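(* Let $\Gamma$ be the free group on a finite set $S$, let $k$ be a positive integer, and for each $n\ge k$ fix $V\in\mathrm{U}(k,n)$. Let $\pi_n$ be a uniformly random $n$-dimensional unitary representation of $\Gamma$ and set $Q^{\pi_n}[F] := [V^\ast\pi_n(g^{-1}h)V]_{g,h\in F}$. Fix a grounded subset $F$ of $\Gamma$ and an element $q\in\mathcal{S}^{\mathrm{u}}_k(F)$. (a) The random matrix $Q^{\pi_n}[F]$ is almost surely nonsingular for all sufficiently large $n$. (b) For every neighbourhood $O$ of $q$ in $\mathcal{S}^{\mathrm{u}}_k(F)$, $\log\mathbf{P}(Q^{\pi_n}[F]\in O)\ge h_F(q)\cdot n - o(n)$ as $n\to\infty$. (c) For every real number $a > h_F(q)$ there is a neighbourhood $O$ of $q$ such that $\log\mathbf{P}(Q^{\pi_n}[F]\in O)\le an + o(n)$ as $n\to\infty$.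
   Context: $\mathrm{U}(k,n)$ is the set of $n\times k$ complex matrices with orthonormal columns. The uniformly random $n$-dimensional representation $\pi_n$ has generators $\pi_n(s)$, $s\in S$, independent and Haar distributed on $\mathrm{U}(n)$. A finite subset $F\subset\Gamma$ is grounded if it contains $e$ and is connected in the left Cayley graph of $\Gamma$ (whose edges are $\{g,sg\}$ for $g\in\Gamma$, $s\in S\cup S^{-1}$). For finite $F\subset\Gamma$, $\mathcal{S}^{\mathrm{u}}_k(F)$ is the (compact) set of positive semidefinite $F$-by-$F$ block matrices $Q$ with blocks in $\mathrm{M}_k$ such that every diagonal block $Q(g,g)$ equals $I_k$ and $Q(g_1,h_1) = Q(g_2,h_2)$ whenever $g_1,h_1,g_2,h_2\in F$ and $g_1^{-1}h_1 = g_2^{-1}h_2$. For $q\in\mathcal{S}^{\mathrm{u}}_k(F)$ and $E\subset F$, $q[E]$ denotes the $E$-by-$E$ submatrix. Define \[h_F(q) := \log\det q - \sum_{s\in S}\log\det q[F\cap sF]\] if $q$ is nonsingular, and $h_F(q) := -\infty$ if $q$ is singular. *)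

theory Defs
  imports "HOL-Probability.Probability" "HOL-Library.Landau_Symbols"
begin

section \<open>Complex matrices of varying size\<close>

text \<open>A matrix is a function nat => nat => complex; an m-by-n matrix is one
  that vanishes outside the index rectangle {0..<m} x {0..<n}.\<close>

type_synonym cmat = "nat \<Rightarrow> nat \<Rightarrow> complex"

definition supp_in :: "nat \<Rightarrow> nat \<Rightarrow> cmat \<Rightarrow> bool" where
  "supp_in m n A \<longleftrightarrow> (\<forall>i j. \<not> (i < m \<and> j < n) \<longrightarrow> A i j = 0)"

definition ident :: "nat \<Rightarrow> cmat" where
  "ident n = (\<lambda>i j. if i < n \<and> j < n \<and> i = j then 1 else 0)"

definition mmul :: "nat \<Rightarrow> cmat \<Rightarrow> cmat \<Rightarrow> cmat" where
  "mmul n A B = (\<lambda>i j. \<Sum>l<n. A i l * B l j)"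

definition adj :: "cmat \<Rightarrow> cmat" where
  "adj A = (\<lambda>i j. cnj (A j i))"

text \<open>The unitary group U(n).\<close>
definition unitary_set :: "nat \<Rightarrow> cmat set" where
  "unitary_set n = {X. supp_in n n X \<and> mmul n (adj X) X = ident n}"

text \<open>U(k,n): n-by-k complex matrices with orthonormal columns.\<close>
definition Ukn :: "nat \<Rightarrow> nat \<Rightarrow> cmat set" where
  "Ukn k n = {V. supp_in n k V \<and>
     (\<forall>i<k. \<forall>j<k. (\<Sum>l<n. cnj (V l i) * V l j) = (if i = j then 1 else 0))}"

text \<open>Haar probability measure on U(n), viewed as a Borel measure on the
  matrix space (product topology); it is the unique left-invariant
  probability measure concentrated on U(n).\<close>
definition is_haar :: "nat \<Rightarrow> cmat measure \<Rightarrow> bool" where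
  "is_haar n \<mu> \<longleftrightarrow> prob_space \<mu> \<and> sets \<mu> = sets borel \<and>
     (AE X in \<mu>. X \<in> unitary_set n) \<and>
     (\<forall>U\<in>unitary_set n. \<forall>A\<in>sets borel.
        emeasure \<mu> ((\<lambda>X. mmul n U X) -` A) = emeasure \<mu> A)"

section \<open>The free group on S\<close>

text \<open>Letters: (s, False) stands for s, (s, True) for s^{-1}.
  Elements of the free group are reduced words.\<close>
type_synonym 's word = "('s \<times> bool) list"

fun red_cons :: "'s \<times> bool \<Rightarrow> 's word \<Rightarrow> 's word" where
  "red_cons x [] = [x]"
| "red_cons x (y # ys) = (if fst x = fst y \<and> snd x \<noteq> snd y then ys else x # y # ys)"

definition reduce :: "'s word \<Rightarrow> 's word" where
  "reduce w = foldr red_cons w []"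

definition reduced :: "'s word \<Rightarrow> bool" where
  "reduced w \<longleftrightarrow> (\<forall>i. Suc i < length w \<longrightarrow>
      \<not> (fst (w ! i) = fst (w ! Suc i) \<and> snd (w ! i) \<noteq> snd (w ! Suc i)))"

definition free_group :: "'s set \<Rightarrow> 's word set" where
  "free_group S = {w. reduced w \<and> fst ` set w \<subseteq> S}"

definition fg_mult :: "'s word \<Rightarrow> 's word \<Rightarrow> 's word" where
  "fg_mult g h = reduce (g @ h)"

definition fg_inv :: "'s word \<Rightarrow> 's word" where
  "fg_inv g = rev (map (\<lambda>(s, b). (s, \<not> b)) g)"

text \<open>Edges of the left Cayley graph restricted to F: {g, s g}, s in S or S^{-1}.\<close>
definition cayley_edges_in :: "'s set \<Rightarrow> 's word set \<Rightarrow> ('s word \<times> 's word) set" where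
  "cayley_edges_in S F = {(g, fg_mult [(s, b)] g) | g s b.
      g \<in> F \<and> s \<in> S \<and> fg_mult [(s, b)] g \<in> F}"

definition grounded :: "'s set \<Rightarrow> 's word set \<Rightarrow> bool" where
  "grounded S F \<longleftrightarrow> finite F \<and> F \<subseteq> free_group S \<and> [] \<in> F \<and>
     (\<forall>g\<in>F. \<forall>h\<in>F. (g, h) \<in> (cayley_edges_in S F)\<^sup>*)"

section \<open>Representations\<close>

text \<open>pi(w) for generator matrices X (a representation of the free group).\<close>
fun rep :: "nat \<Rightarrow> ('s \<Rightarrow> cmat) \<Rightarrow> 's word \<Rightarrow> cmat" where
  "rep n X [] = ident n"
| "rep n X ((s, b) # w) = mmul n (if b then adj (X s) else X s) (rep n X w)"

section \<open>Block matrices indexed by F\<close>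

text \<open>An F-by-F block matrix with k-by-k blocks: Q g h i j is entry (i,j)
  of block (g,h); it vanishes outside F x F x {0..<k} x {0..<k}.\<close>
type_synonym 's bmat = "'s word \<Rightarrow> 's word \<Rightarrow> nat \<Rightarrow> nat \<Rightarrow> complex"

text \<open>Determinant (Leibniz formula) of a matrix indexed by a finite set I.\<close>
definition det_on :: "'a set \<Rightarrow> ('a \<Rightarrow> 'a \<Rightarrow> complex) \<Rightarrow> complex" where
  "det_on I M = (\<Sum>p\<in>{p. p permutes I}. of_int (sign p) * (\<Prod>i\<in>I. M i (p i)))"

text \<open>Determinant of the E-by-E submatrix q[E].\<close>
definition bdet :: "nat \<Rightarrow> 's word set \<Rightarrow> 's bmat \<Rightarrow> complex" where
  "bdet k E Q = det_on (E \<times> {0..<k}) (\<lambda>(g, i) (h, j). Q g h i j)"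

definition psd_block :: "nat \<Rightarrow> 's word set \<Rightarrow> 's bmat \<Rightarrow> bool" where
  "psd_block k F Q \<longleftrightarrow> (\<forall>x :: 's word \<Rightarrow> nat \<Rightarrow> complex.
     let z = (\<Sum>g\<in>F. \<Sum>h\<in>F. \<Sum>i<k. \<Sum>j<k. cnj (x g i) * Q g h i j * x h j)
     in Im z = 0 \<and> Re z \<ge> 0)"

definition Su :: "nat \<Rightarrow> 's word set \<Rightarrow> 's bmat set" where
  "Su k F = {Q. (\<forall>g h i j. \<not> (g \<in> F \<and> h \<in> F \<and> i < k \<and> j < k) \<longrightarrow> Q g h i j = 0)
     \<and> psd_block k F Q
     \<and> (\<forall>g\<in>F. \<forall>i<k. \<forall>j<k. Q g g i j = (if i = j then 1 else 0))
     \<and> (\<forall>g1\<in>F. \<forall>h1\<in>F. \<forall>g2\<in>F. \<forall>h2\<in>F.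
          fg_mult (fg_inv g1) h1 = fg_mult (fg_inv g2) h2 \<longrightarrow> Q g1 h1 = Q g2 h2)}"

text \<open>log with the convention log 0 = -infinity.\<close>
definition elog :: "real \<Rightarrow> ereal" where
  "elog x = (if x > 0 then ereal (ln x) else -\<infinity>)"

text \<open>h_F(q) = log det q - sum_s log det q[F \<inter> sF]  (or -infinity if q is singular).\<close>
definition hF :: "'s set \<Rightarrow> nat \<Rightarrow> 's word set \<Rightarrow> 's bmat \<Rightarrow> ereal" where
  "hF S k F q = (if bdet k F q = 0 then -\<infinity>
     else ereal (ln (Re (bdet k F q))
       - (\<Sum>s\<in>S. ln (Re (bdet k (F \<inter> (\<lambda>g. fg_mult [(s, False)] g) ` F) q)))))"

text \<open>Q^{pi}[F] = [V^* pi(g^{-1} h) V]_{g,h in F}.\<close>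
definition Qpi :: "nat \<Rightarrow> nat \<Rightarrow> cmat \<Rightarrow> 's word set \<Rightarrow> ('s \<Rightarrow> cmat) \<Rightarrow> 's bmat" where
  "Qpi n k V F X = (\<lambda>g h i j. if g \<in> F \<and> h \<in> F \<and> i < k \<and> j < k then
      (\<Sum>a<n. \<Sum>b<n. cnj (V a i) * rep n X (fg_mult (fg_inv g) h) a b * V b j) else 0)"

text \<open>Law of the uniformly random n-dimensional representation: independent
  Haar generators.\<close>
definition rand_rep :: "'s set \<Rightarrow> cmat measure \<Rightarrow> ('s \<Rightarrow> cmat) measure" where
  "rand_rep S \<mu> = PiM S (\<lambda>_. \<mu>)"

end

theory Submission
  imports Defs "HOL-Complex_Analysis.Complex_Analysis"
begin

text \<open>The matrix \<open>Q\<^sup>\<pi>[F]\<close> is the Gram matrix of the orbit vectors \<open>\<pi>(g) v\<^sub>i\<close> with \<open>g \<in> F\<close>, and its law is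
  estimated by double counting. Consider pairs of generators \<open>X\<close> and tuples of vectors, weighted by Haar
  times Lebesgue measure, such that the tuple has Gram matrix close to \<open>q\<close> and is almost an orbit of
  \<open>X\<close>: along every edge of the tree \<open>F\<close> the generator moves one vector close to the other. Fixing \<open>X\<close>
  first, the tuple is an orbit plus noise, which gives the probability in question times a volume of
  balls. Fixing the tuple first, the Gram matrix contributes \<open>(det q)\<^sup>n\<close> to the volume, and the
  generator \<open>s\<close> has to carry one tuple close to another one with the same Gram matrix \<open>q[F \<inter> sF]\<close>; by
  invariance of Haar measure the probability of this is a quotient of volumes, with
  \<open>(det q[F \<inter> sF])\<^sup>n\<close> in the denominator. The volumes of the balls cancel up to subexponential or
  arbitrarily slow exponential factors, so that neither the density of the random Gram matrix nor
  that of Haar measure is needed. Almost sure nonsingularity follows because the determinant is, along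
  rotations of a single generator, the restriction of an entire function that does not vanish
  identically.\<close>

section \<open>Vectors and unitary matrices\<close>

text \<open>A density of the random Gram matrix would have to be carried through changes of
  variables along the tree. Noise of a radius that stays fixed while \<open>n\<close> grows replaces
  densities by volumes of balls. Their unknown volume \<open>vball n\<close> cancels because the
  edges of the tree are counted once by their outer ends, for fixed generators, and once by their
  labels, for a fixed tuple.

  The price is that fixed noise is visible: the volume of a ball sits near its sphere, so noise of
  radius \<open>h\<close> raises squared norms by about \<open>h\<^sup>2\<close>, and a noisy image
  of a tuple has a different Gram matrix. The upper bound does not notice, as it compares volumes of
  full balls, but the lower bound has to shift its target. The upper bound meets another obstacle:
  it needs one estimate for all tuples with Gram matrix near \<open>q\<close>, while volumes are
  bounded below matrix by matrix; a finite net of matrices closes this gap.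

  If \<open>q\<close> is singular, edge determinants may vanish too and the quotient is 0/0. A
  smaller tree is then used, on which only the numerator vanishes.\<close>

type_synonym cvec = "nat \<Rightarrow> complex"

section \<open>Hermitian inner product and norm on the first n coordinates\<close>

text \<open>The dimension is a parameter because it tends to infinity. Only coordinates below
  \<open>n\<close> are read, so on the type \<open>cvec\<close> the form is merely semidefinite, and
  identities between vectors are stated for indices below \<open>n\<close> and transported by
  \<open>cip_cong\<close> and \<open>cnorm_cong\<close>.\<close>

definition cip :: "nat \<Rightarrow> cvec \<Rightarrow> cvec \<Rightarrow> complex" where
  "cip n x y = (\<Sum>l<n. cnj (x l) * y l)"

definition cnorm :: "nat \<Rightarrow> cvec \<Rightarrow> real" where
  "cnorm n x = L2_set (\<lambda>l. cmod (x l)) {..<n}"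

definition mv :: "nat \<Rightarrow> cmat \<Rightarrow> cvec \<Rightarrow> cvec" where
  "mv n U x = (\<lambda>i. \<Sum>l<n. U i l * x l)"

lemma cip_cong: "(\<And>l. l < n \<Longrightarrow> x l = x' l) \<Longrightarrow> (\<And>l. l < n \<Longrightarrow> y l = y' l) \<Longrightarrow> cip n x y = cip n x' y'"
  unfolding cip_def by (intro sum.cong) auto

lemma cnorm_cong: "(\<And>l. l < n \<Longrightarrow> x l = x' l) \<Longrightarrow> cnorm n x = cnorm n x'"
  unfolding cnorm_def by (intro L2_set_cong) auto

lemma cip_add_right: "cip n x (\<lambda>l. y l + z l) = cip n x y + cip n x z"
  by (simp add: cip_def sum.distrib algebra_simps)

lemma cip_add_left: "cip n (\<lambda>l. y l + z l) x = cip n y x + cip n z x"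
  by (simp add: cip_def sum.distrib algebra_simps)

lemma cip_diff_right: "cip n x (\<lambda>l. y l - z l) = cip n x y - cip n x z"
  by (simp add: cip_def sum_subtractf algebra_simps)

lemma cip_diff_left: "cip n (\<lambda>l. y l - z l) x = cip n y x - cip n z x"
  by (simp add: cip_def sum_subtractf algebra_simps)

lemma cip_scale_right: "cip n x (\<lambda>l. c * y l) = c * cip n x y"
  by (simp add: cip_def sum_distrib_left algebra_simps)

lemma cip_scale_left: "cip n (\<lambda>l. c * y l) x = cnj c * cip n y x"
  by (simp add: cip_def sum_distrib_left algebra_simps)

lemma cip_sum_right: "cip n x (\<lambda>l. \<Sum>i\<in>K. f i l) = (\<Sum>i\<in>K. cip n x (f i))"
  unfolding cip_def sum_distrib_left by (rule sum.swap)

lemma cip_sum_left: "cip n (\<lambda>l. \<Sum>i\<in>K. f i l) x = (\<Sum>i\<in>K. cip n (f i) x)"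
  unfolding cip_def cnj_sum sum_distrib_right by (rule sum.swap)

lemma cip_commute: "cip n y x = cnj (cip n x y)"
  by (simp add: cip_def mult.commute)

lemmas cip_linear = cip_add_right cip_add_left cip_diff_right cip_diff_left cip_scale_right cip_scale_left

lemma cnorm_nonneg [simp]: "0 \<le> cnorm n x"
  by (simp add: cnorm_def)

lemma cnorm_power2: "(cnorm n x)\<^sup>2 = (\<Sum>l<n. (cmod (x l))\<^sup>2)"
  by (simp add: cnorm_def L2_set_def sum_nonneg)

lemma cip_self: "cip n x x = complex_of_real ((cnorm n x)\<^sup>2)"
  by (simp add: cnorm_power2 cip_def mult.commute complex_mult_cnj cmod_power2 flip: of_real_power of_real_add)

lemma Re_cip_self: "Re (cip n x x) = (cnorm n x)\<^sup>2"
  by (simp add: cip_self)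

lemma cnorm_triangle: "cnorm n (\<lambda>l. x l + y l) \<le> cnorm n x + cnorm n y"
proof -
  have "cnorm n (\<lambda>l. x l + y l) \<le> L2_set (\<lambda>l. cmod (x l) + cmod (y l)) {..<n}"
    unfolding cnorm_def by (intro L2_set_mono) (auto simp: norm_triangle_ineq)
  also have "\<dots> \<le> cnorm n x + cnorm n y"
    unfolding cnorm_def by (rule L2_set_triangle_ineq)
  finally show ?thesis .
qed

lemma cnorm_scale: "cnorm n (\<lambda>l. c * x l) = cmod c * cnorm n x"
  by (simp add: cnorm_def norm_mult L2_set_right_distrib)

lemma cnorm_minus_commute: "cnorm n (\<lambda>l. x l - y l) = cnorm n (\<lambda>l. y l - x l)"
  by (simp add: cnorm_def norm_minus_commute)

lemma cnorm_diff_triangle: "cnorm n (\<lambda>l. x l - z l) \<le> cnorm n (\<lambda>l. x l - y l) + cnorm n (\<lambda>l. y l - z l)"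
  using cnorm_triangle[of n "\<lambda>l. x l - y l" "\<lambda>l. y l - z l"] by simp

lemma cnorm_triangle_sub: "cnorm n x \<le> cnorm n y + cnorm n (\<lambda>l. x l - y l)"
  using cnorm_triangle[of n y "\<lambda>l. x l - y l"] by simp

lemma cmod_cip_le: "cmod (cip n x y) \<le> cnorm n x * cnorm n y"
proof -
  have "cmod (cip n x y) \<le> (\<Sum>l<n. \<bar>cmod (x l)\<bar> * \<bar>cmod (y l)\<bar>)"
    unfolding cip_def by (rule order_trans[OF norm_sum]) (simp add: norm_mult)
  also have "\<dots> \<le> cnorm n x * cnorm n y"
    unfolding cnorm_def by (rule L2_set_mult_ineq)
  finally show ?thesis .
qed

text \<open>The difference splits as the product of \<open>x' - x\<close> with \<open>y'\<close>
  plus that of \<open>x\<close> with \<open>y' - y\<close>; this is why \<open>x\<close> and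
  \<open>y'\<close> carry the norm bounds.\<close>

lemma cip_perturb:
  assumes "cnorm n x \<le> R" "cnorm n y' \<le> R" "cnorm n (\<lambda>l. x' l - x l) \<le> e" "cnorm n (\<lambda>l. y' l - y l) \<le> e"
  shows "cmod (cip n x' y' - cip n x y) \<le> 2 * R * e"
proof -
  have R: "0 \<le> R" using assms(1) cnorm_nonneg[of n x] by linarith
  have e: "0 \<le> e" using assms(3) cnorm_nonneg[of n "\<lambda>l. x' l - x l"] by linarith
  have "cip n x' y' - cip n x y = cip n (\<lambda>l. x' l - x l) y' + cip n x (\<lambda>l. y' l - y l)"
    by (simp add: cip_linear)
  also have "cmod \<dots> \<le> e * R + R * e"
    using assms R e
    by (intro norm_triangle_mono order_trans[OF cmod_cip_le] mult_mono) auto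
  finally show ?thesis by simp
qed

lemma cnorm_power2_diff:
  "(cnorm n (\<lambda>l. x l - y l))\<^sup>2 = (cnorm n x)\<^sup>2 - 2 * Re (cip n y x) + (cnorm n y)\<^sup>2"
proof -
  have "Re (cip n x y) = Re (cip n y x)" by (subst cip_commute) simp
  thus ?thesis by (simp add: cip_linear flip: Re_cip_self)
qed

section \<open>Matrices acting on vectors; unitary matrices\<close>

lemma mv_mmul: "mv n (mmul n A B) x = mv n A (mv n B x)"
  unfolding mv_def mmul_def sum_distrib_left sum_distrib_right mult.assoc
  by (intro ext) (rule sum.swap)

lemma mv_ident: "i < n \<Longrightarrow> mv n (ident n) x i = x i"
  unfolding mv_def ident_def
  by (subst sum.cong[OF refl, of _ _ "\<lambda>l. if i = l then x l else 0"]) auto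

lemma mv_diff: "mv n U (\<lambda>l. x l - y l) = (\<lambda>l. mv n U x l - mv n U y l)"
  by (simp add: mv_def sum_subtractf algebra_simps)

lemma cip_mv_right: "cip n x (mv n U y) = cip n (mv n (adj U) x) y"
  unfolding cip_def mv_def adj_def sum_distrib_left cnj_sum sum_distrib_right
  by (subst sum.swap) (simp add: algebra_simps)

lemma adj_adj [simp]: "adj (adj U) = U"
  by (simp add: adj_def)

lemma adj_mmul: "adj (mmul n A B) = mmul n (adj B) (adj A)"
  by (simp add: adj_def mmul_def mult.commute)

lemma adj_ident: "adj (ident n) = ident n"
  by (auto simp: adj_def ident_def fun_eq_iff)

lemma mmul_assoc: "mmul n (mmul n A B) C = mmul n A (mmul n B C)"
  unfolding mmul_def sum_distrib_left sum_distrib_right mult.assoc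
  by (intro ext) (rule sum.swap)

lemma supp_in_mmul: "supp_in n n A \<Longrightarrow> supp_in n n B \<Longrightarrow> supp_in n n (mmul n A B)"
  unfolding supp_in_def mmul_def by (auto intro!: sum.neutral)

lemma supp_in_adj: "supp_in n n A \<Longrightarrow> supp_in n n (adj A)"
  unfolding supp_in_def adj_def by auto

lemma supp_in_ident: "supp_in n n (ident n)"
  unfolding supp_in_def ident_def by auto

lemma mmul_ident_left: "supp_in n n A \<Longrightarrow> mmul n (ident n) A = A"
  unfolding mmul_def ident_def supp_in_def
  by (intro ext, subst sum.cong[OF refl, of _ _ "\<lambda>l. if _ = l then A l _ else 0"]) auto

lemma mmul_ident_right: "supp_in n n A \<Longrightarrow> mmul n A (ident n) = A"
  unfolding mmul_def ident_def supp_in_def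
  by (intro ext, subst sum.cong[OF refl, of _ _ "\<lambda>l. if l = _ then A _ l else 0"]) auto

lemma unitary_supp: "U \<in> unitary_set n \<Longrightarrow> supp_in n n U"
  by (simp add: unitary_set_def)

lemma unitary_left: "U \<in> unitary_set n \<Longrightarrow> mmul n (adj U) U = ident n"
  by (simp add: unitary_set_def)

text \<open>The projection \<open>P = U U*\<close> has trace \<open>n\<close>, so \<open>I - P\<close> has Hilbert-Schmidt norm 0.\<close>
lemma unitary_right:
  assumes "U \<in> unitary_set n"
  shows "mmul n U (adj U) = ident n"
proof -
  define P where "P = mmul n U (adj U)"
  have supp: "supp_in n n P"
    unfolding P_def by (intro supp_in_mmul supp_in_adj unitary_supp assms)
  have PP: "mmul n P P = P"
    unfolding P_def mmul_assoc
    by (simp add: mmul_assoc[symmetric, of n "adj U" U] unitary_left[OF assms]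
        mmul_ident_left supp_in_adj unitary_supp[OF assms])
  have cnjP: "cnj (P i j) = P j i" for i j
    by (simp add: P_def mmul_def adj_def mult.commute)
  have "(\<Sum>i<n. P i i) = (\<Sum>l<n. mmul n (adj U) U l l)"
    unfolding P_def mmul_def by (subst sum.swap) (simp add: mult.commute adj_def)
  hence trP: "(\<Sum>i<n. P i i) = of_nat n"
    by (simp add: unitary_left[OF assms] ident_def)
  have sqP: "(\<Sum>i<n. \<Sum>j<n. P i j * cnj (P i j)) = of_nat n"
  proof -
    have "(\<Sum>i<n. \<Sum>j<n. P i j * cnj (P i j)) = (\<Sum>i<n. mmul n P P i i)"
      by (simp add: mmul_def cnjP)
    thus ?thesis by (simp add: PP trP)
  qed
  have D: "(\<Sum>i<n. \<Sum>j<n. (ident n i j - P i j) * cnj (ident n i j - P i j)) = 0"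
  proof -
    have "(ident n i j - P i j) * cnj (ident n i j - P i j)
        = P i j * cnj (P i j) + (if i = j then 1 - P i i - cnj (P i i) else 0)" if "i < n" "j < n" for i j
      using that by (simp add: ident_def algebra_simps)
    hence "(\<Sum>i<n. \<Sum>j<n. (ident n i j - P i j) * cnj (ident n i j - P i j))
        = (\<Sum>i<n. \<Sum>j<n. P i j * cnj (P i j) + (if i = j then 1 - P i i - cnj (P i i) else 0))"
      by (intro sum.cong) auto
    also have "\<dots> = 0"
      using sqP trP by (simp add: sum.distrib cnjP sum_subtractf flip: sum_distrib_left cong: if_cong)
    finally show ?thesis .
  qed
  have "(\<Sum>i<n. \<Sum>j<n. (cmod (ident n i j - P i j))\<^sup>2) = 0"
  proof -
    have "complex_of_real (\<Sum>i<n. \<Sum>j<n. (cmod (ident n i j - P i j))\<^sup>2) = 0"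
      using D by (simp only: complex_norm_square[symmetric] of_real_sum)
    thus ?thesis by (simp only: of_real_eq_0_iff)
  qed
  hence "ident n i j = P i j" if "i < n" "j < n" for i j
    using that by (auto simp: sum_nonneg_eq_0_iff sum_nonneg)
  hence "P i j = ident n i j" for i j
    using supp supp_in_ident[of n] unfolding supp_in_def by metis
  thus ?thesis by (auto simp: P_def fun_eq_iff)
qed

lemma unitary_adj: "U \<in> unitary_set n \<Longrightarrow> adj U \<in> unitary_set n"
  using unitary_right by (auto simp: unitary_set_def supp_in_adj)

lemma unitary_mmul: "U \<in> unitary_set n \<Longrightarrow> W \<in> unitary_set n \<Longrightarrow> mmul n U W \<in> unitary_set n"
  unfolding unitary_set_def
  by (auto simp: supp_in_mmul adj_mmul mmul_assoc)
     (metis mmul_assoc mmul_ident_left)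

lemma unitary_ident: "ident n \<in> unitary_set n"
  by (simp add: unitary_set_def supp_in_ident adj_ident mmul_ident_left)

lemma mv_adj_mv:
  assumes "U \<in> unitary_set n" "i < n"
  shows "mv n (adj U) (mv n U x) i = x i"
  using assms by (simp add: mv_ident unitary_left flip: mv_mmul)

lemma mv_mv_adj:
  assumes "U \<in> unitary_set n" "i < n"
  shows "mv n U (mv n (adj U) x) i = x i"
  using mv_adj_mv[OF unitary_adj[OF assms(1)] assms(2)] by simp

lemma cip_mv_unitary:
  assumes "U \<in> unitary_set n"
  shows "cip n (mv n U x) (mv n U y) = cip n x y"
  unfolding cip_mv_right by (intro cip_cong mv_adj_mv assms refl)

lemma cnorm_mv_unitary:
  assumes "U \<in> unitary_set n"
  shows "cnorm n (mv n U x) = cnorm n x"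
proof -
  have "(cnorm n (mv n U x))\<^sup>2 = (cnorm n x)\<^sup>2"
    unfolding Re_cip_self[symmetric] cip_mv_unitary[OF assms] ..
  thus ?thesis by (simp add: power2_eq_iff_nonneg)
qed

lemma cnorm_mv_diff_unitary:
  assumes "U \<in> unitary_set n"
  shows "cnorm n (\<lambda>l. mv n U x l - mv n U y l) = cnorm n (\<lambda>l. x l - y l)"
  unfolding mv_diff[symmetric] by (rule cnorm_mv_unitary[OF assms])

text \<open>Turns the error of an inverse generator carrying \<open>x\<close> to \<open>y\<close>
  into that of the generator carrying \<open>y\<close> to \<open>x\<close>, so that constraints
  along edges can always be phrased with the generator itself.\<close>

lemma cnorm_mv_adj_swap:
  assumes "U \<in> unitary_set n"
  shows "cnorm n (\<lambda>l. mv n (adj U) x l - y l) = cnorm n (\<lambda>l. mv n U y l - x l)"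
proof -
  have "cnorm n (\<lambda>l. mv n (adj U) x l - y l) = cnorm n (\<lambda>l. mv n U (mv n (adj U) x) l - mv n U y l)"
    by (rule cnorm_mv_diff_unitary[OF assms, symmetric])
  also have "\<dots> = cnorm n (\<lambda>l. x l - mv n U y l)"
    by (intro cnorm_cong) (simp add: mv_mv_adj[OF assms])
  finally show ?thesis by (simp add: cnorm_minus_commute)
qed

section \<open>Lebesgue measure on complex vectors\<close>

text \<open>Lebesgue measure on the first \<open>n\<close> coordinates, pushed to sequences that
  vanish from \<open>n\<close> on. All dimensions thus share one type and one Borel
  sigma-algebra.\<close>

definition cvol :: "nat \<Rightarrow> cvec measure" where
  "cvol n = distr (PiM {..<n} (\<lambda>_. lborel)) borel (\<lambda>x i. if i < n then x i else 0)"

text \<open>This volume is never computed: finiteness, positivity and scaling suffice, since its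
  powers cancel in the end.\<close>

definition vball :: "nat \<Rightarrow> real" where
  "vball n = measure (cvol n) {x. cnorm n x \<le> 1}"

lemma sets_cvol [simp, measurable_cong]: "sets (cvol n) = sets borel"
  by (simp add: cvol_def)

lemma space_cvol [simp]: "space (cvol n) = UNIV"
  by (simp add: cvol_def)

lemma measurable_entry:
  fixes f :: "'a \<Rightarrow> 'i::countable \<Rightarrow> 'b::second_countable_topology"
  shows "f \<in> borel_measurable M \<Longrightarrow> (\<lambda>x. f x l) \<in> borel_measurable M"
  by (rule measurable_compose[OF _ measurable_product_coordinates])

lemma measurable_cip [measurable]:
  assumes "f \<in> borel_measurable M" "g \<in> borel_measurable M"
  shows "(\<lambda>x. cip n (f x) (g x)) \<in> borel_measurable M"
proof -
  have c: "cnj \<in> borel_measurable borel"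
    by (intro borel_measurable_continuous_onI continuous_intros)
  show ?thesis
    unfolding cip_def
    by (rule borel_measurable_sum, rule borel_measurable_times)
       (rule measurable_compose[OF measurable_entry[OF assms(1)] c], rule measurable_entry[OF assms(2)])
qed

lemma measurable_cnorm [measurable]:
  assumes "f \<in> borel_measurable M"
  shows "(\<lambda>x. cnorm n (f x)) \<in> borel_measurable M"
proof -
  have [measurable]: "\<And>l. (\<lambda>x. f x l) \<in> borel_measurable M" by (rule measurable_entry[OF assms])
  show ?thesis unfolding cnorm_def L2_set_def by measurable
qed

lemma measurable_mv [measurable]:
  assumes "U \<in> borel_measurable M" "f \<in> borel_measurable M"
  shows "(\<lambda>x. mv n (U x) (f x)) \<in> borel_measurable M"
  unfolding mv_def
  by (rule measurable_coordinatewise_then_product, rule borel_measurable_sum, rule borel_measurable_times)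
     (rule measurable_entry[OF measurable_entry[OF assms(1)]], rule measurable_entry[OF assms(2)])

lemma measurable_vec_diff [measurable]:
  fixes f g :: "'a \<Rightarrow> cvec"
  assumes "f \<in> borel_measurable M" "g \<in> borel_measurable M"
  shows "(\<lambda>x l. f x l - g x l) \<in> borel_measurable M"
  by (rule measurable_coordinatewise_then_product, rule borel_measurable_diff)
     (rule measurable_entry[OF assms(1)], rule measurable_entry[OF assms(2)])

lemma measurable_zero_extend [measurable]:
  "(\<lambda>x i. if i < n then x i else 0) \<in> measurable (PiM {..<n} (\<lambda>_. lborel)) (borel :: cvec measure)"
proof (intro measurable_coordinatewise_then_product)
  fix i show "(\<lambda>x. if i < n then x i else 0) \<in> borel_measurable (PiM {..<n} (\<lambda>_. lborel :: complex measure))"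
    by (cases "i < n") (auto intro: measurable_component_singleton)
qed

interpretation lebc: product_sigma_finite "\<lambda>_::nat. lborel :: complex measure"
  by standard

lemma cball_borel [measurable]: "{x. cnorm n (\<lambda>l. x l - a l) \<le> r} \<in> sets borel"
proof -
  have "{x \<in> space borel. cnorm n (\<lambda>l. x l - a l) \<le> r} \<in> sets borel" by measurable
  thus ?thesis by simp
qed

lemma emeasure_lborel_complex_affine:
  fixes t :: complex
  assumes r: "0 < r" and A: "A \<in> sets borel"
  shows "emeasure lborel A = ennreal (r ^ 2) * emeasure lborel ((\<lambda>x. t + r *\<^sub>R x) -` A)"
proof -
  have "emeasure lborel A
      = emeasure (density (distr lborel borel (\<lambda>x. t + r *\<^sub>R x)) (\<lambda>_. ennreal (\<bar>r\<bar> ^ DIM(complex)))) A"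
    using lborel_affine[of r t] r by simp
  also have "\<dots> = ennreal (r ^ 2) * emeasure lborel ((\<lambda>x. t + r *\<^sub>R x) -` A)"
    using A r by (subst emeasure_density_const) (auto simp: emeasure_distr)
  finally show ?thesis .
qed

lemma PiM_lborel_affine:
  fixes a :: cvec
  assumes r: "0 < r"
  shows "scale_measure (ennreal (r ^ (2 * n)))
      (distr (PiM {..<n} (\<lambda>_. lborel)) (PiM {..<n} (\<lambda>_. lborel)) (\<lambda>x. \<lambda>l\<in>{..<n}. a l + r *\<^sub>R x l))
    = PiM {..<n} (\<lambda>_. lborel)" (is "scale_measure ?c (distr ?L ?L ?T) = ?L")
proof (rule lebc.PiM_eqI)
  fix A :: "nat \<Rightarrow> complex set" assume A: "\<And>i. i \<in> {..<n} \<Longrightarrow> A i \<in> sets lborel"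
  have T: "?T \<in> measurable ?L ?L"
    by (intro measurable_restrict) measurable
  have eq: "?T -` PiE {..<n} A \<inter> space ?L = PiE {..<n} (\<lambda>l. (\<lambda>x. a l + r *\<^sub>R x) -` A l)"
    by (auto simp: space_PiM PiE_iff)
  have m: "(\<lambda>x. a l + r *\<^sub>R x) -` A l \<in> sets lborel" if "l < n" for l
  proof -
    have "(\<lambda>x. a l + r *\<^sub>R x) -` A l \<inter> space borel \<in> sets borel"
      by (rule measurable_sets[of _ borel borel]) (use A[of l] that in auto)
    thus ?thesis by simp
  qed
  have "emeasure (scale_measure ?c (distr ?L ?L ?T)) (PiE {..<n} A)
      = ?c * emeasure ?L (PiE {..<n} (\<lambda>l. (\<lambda>x. a l + r *\<^sub>R x) -` A l))"
    using A T by (subst emeasure_scale_measure, subst emeasure_distr) (auto simp: eq intro!: sets_PiM_I_finite)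
  also have "\<dots> = ?c * (\<Prod>l<n. emeasure lborel ((\<lambda>x. a l + r *\<^sub>R x) -` A l))"
    by (subst lebc.emeasure_PiM) (use m in auto)
  also have "?c * (\<Prod>l<n. emeasure lborel ((\<lambda>x. a l + r *\<^sub>R x) -` A l))
     = (\<Prod>l<n. ennreal (r ^ 2)) * (\<Prod>l<n. emeasure lborel ((\<lambda>x. a l + r *\<^sub>R x) -` A l))"
    using r by (simp add: ennreal_power power_mult)
  also have "(\<Prod>l<n. ennreal (r ^ 2)) * (\<Prod>l<n. emeasure lborel ((\<lambda>x. a l + r *\<^sub>R x) -` A l))
      = (\<Prod>l<n. emeasure lborel (A l))"
    unfolding prod.distrib[symmetric]
    by (intro prod.cong refl emeasure_lborel_complex_affine[symmetric] r) (use A in auto)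
  finally show "emeasure (scale_measure ?c (distr ?L ?L ?T)) (PiE {..<n} A)
      = (\<Prod>l\<in>{..<n}. emeasure lborel (A l))" .
qed auto

lemma emeasure_cvol_cball':
  assumes r: "0 < r"
  shows "emeasure (cvol n) {x. cnorm n (\<lambda>l. x l - a l) \<le> r}
    = ennreal (r ^ (2 * n)) * emeasure (cvol n) {x. cnorm n x \<le> 1}"
proof -
  let ?L = "PiM {..<n} (\<lambda>_. lborel :: complex measure)"
  let ?T = "\<lambda>x. \<lambda>l\<in>{..<n}. a l + r *\<^sub>R x l"
  let ?Z = "\<lambda>x i. if i < n then x i else (0::complex)"
  let ?B = "{x \<in> space ?L. cnorm n (\<lambda>l. ?Z x l - a l) \<le> r}"
  have T: "?T \<in> measurable ?L ?L"
    by (intro measurable_restrict) measurable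
  have Bm: "?B \<in> sets ?L" by measurable
  have b0: "{x. cnorm n x \<le> 1} \<in> sets borel" using cball_borel[of n "\<lambda>_. 0" 1] by simp
  have "emeasure (cvol n) {x. cnorm n (\<lambda>l. x l - a l) \<le> r} = emeasure ?L ?B"
    unfolding cvol_def by (subst emeasure_distr) (auto intro!: arg_cong[of _ _ "emeasure ?L"])
  also have "\<dots> = emeasure (scale_measure (ennreal (r ^ (2 * n))) (distr ?L ?L ?T)) ?B"
    by (simp only: PiM_lborel_affine[OF r])
  also have "\<dots> = ennreal (r ^ (2 * n)) * emeasure ?L (?T -` ?B \<inter> space ?L)"
    using T Bm by (subst emeasure_scale_measure, subst emeasure_distr) auto
  also have "?T -` ?B \<inter> space ?L = {x \<in> space ?L. cnorm n (?Z x) \<le> 1}"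
  proof -
    have "cnorm n (\<lambda>l. ?Z (?T x) l - a l) = r * cnorm n (?Z x)" for x
    proof -
      have "cnorm n (\<lambda>l. ?Z (?T x) l - a l) = cnorm n (\<lambda>l. complex_of_real r * ?Z x l)"
        by (rule cnorm_cong) (simp add: scaleR_conv_of_real)
      thus ?thesis using r by (simp add: cnorm_scale)
    qed
    moreover have "?T x \<in> space ?L" for x by (auto simp: space_PiM)
    ultimately show ?thesis using r by (auto simp: space_PiM)
  qed
  also have "emeasure ?L {x \<in> space ?L. cnorm n (?Z x) \<le> 1} = emeasure (cvol n) {x. cnorm n x \<le> 1}"
    unfolding cvol_def using b0 by (subst emeasure_distr) (auto intro!: arg_cong[of _ _ "emeasure ?L"])
  finally show ?thesis .
qed

lemma cvol_unit_ball_finite: "emeasure (cvol n) {x. cnorm n x \<le> 1} < \<infinity>"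
proof -
  let ?L = "PiM {..<n} (\<lambda>_. lborel :: complex measure)"
  let ?Z = "\<lambda>x i. if i < n then x i else (0::complex)"
  have b0: "{x. cnorm n x \<le> 1} \<in> sets borel" using cball_borel[of n "\<lambda>_. 0" 1] by simp
  have sub: "x \<in> PiE {..<n} (\<lambda>_. cball 0 1)" if x: "x \<in> space ?L" and c: "cnorm n (?Z x) \<le> 1" for x
  proof -
    have "cmod (x l) \<le> 1" if "l < n" for l
    proof -
      have "cmod (?Z x l) \<le> cnorm n (?Z x)"
        unfolding cnorm_def by (rule member_le_L2_set) (use that in auto)
      thus ?thesis using c that by simp
    qed
    thus ?thesis using x by (auto simp: space_PiM PiE_iff)
  qed
  have "emeasure (cvol n) {x. cnorm n x \<le> 1} = emeasure ?L {x \<in> space ?L. cnorm n (?Z x) \<le> 1}"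
    unfolding cvol_def using b0 by (subst emeasure_distr) (auto intro!: arg_cong[of _ _ "emeasure ?L"])
  also have "\<dots> \<le> emeasure ?L (PiE {..<n} (\<lambda>_. cball 0 1))"
    using sub by (intro emeasure_mono sets_PiM_I_finite) auto
  also have "\<dots> = (\<Prod>l<n. emeasure lborel (cball (0::complex) 1))"
    by (subst lebc.emeasure_PiM) auto
  also have "\<dots> < \<infinity>"
    using emeasure_lborel_cball_finite[of "0::complex" 1] by (simp add: power_less_top_ennreal)
  finally show ?thesis .
qed

lemma emeasure_cvol_unit: "emeasure (cvol n) {x. cnorm n x \<le> 1} = ennreal (vball n)"
  unfolding vball_def using cvol_unit_ball_finite[of n] by (intro emeasure_eq_ennreal_measure) auto

lemma emeasure_cvol_cball:
  assumes r: "0 < r"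
  shows "emeasure (cvol n) {x. cnorm n (\<lambda>l. x l - a l) \<le> r} = ennreal (r ^ (2 * n) * vball n)"
  unfolding emeasure_cvol_cball'[OF r] emeasure_cvol_unit using r by (simp add: ennreal_mult' vball_def)

lemma vball_nonneg [simp]: "0 \<le> vball n"
  by (simp add: vball_def)

lemma UNIV_Union_cballs: "(\<Union>m::nat. {x. cnorm n (\<lambda>l. x l - 0) \<le> real (Suc m)}) = UNIV"
proof -
  have "\<exists>m. cnorm n x \<le> real (Suc m)" for x
    using real_arch_simple[of "cnorm n x"] by (meson le_Suc_eq of_nat_mono order_trans le_SucI order_refl)
  thus ?thesis by auto
qed

text \<open>By scaling, a null unit ball would make every centred ball and hence the whole space
  null, whereas the space has measure \<infinity>, or 1 if \<open>n = 0\<close>.\<close>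

lemma vball_pos: "0 < vball n"
proof (rule ccontr)
  assume "\<not> 0 < vball n"
  hence 0: "vball n = 0" by (simp add: order.antisym not_less)
  have "emeasure (cvol n) (\<Union>m::nat. {x. cnorm n (\<lambda>l. x l - 0) \<le> real (Suc m)}) = 0"
    using emeasure_cvol_cball[of _ n "\<lambda>_. 0"] 0
    by (intro emeasure_UN_eq_0) (auto simp: cball_borel[of n "\<lambda>_. 0", simplified])
  hence "emeasure (cvol n) UNIV = 0" unfolding UNIV_Union_cballs .
  moreover have "emeasure (cvol n) UNIV = emeasure (PiM {..<n} (\<lambda>_. lborel :: complex measure)) (PiE {..<n} (\<lambda>_. UNIV))"
    unfolding cvol_def by (subst emeasure_distr) (auto simp: space_PiM)
  moreover have "\<dots> = (\<Prod>l<n. emeasure lborel (UNIV :: complex set))"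
    by (subst lebc.emeasure_PiM) auto
  ultimately show False by simp
qed

lemma sigma_finite_cvol: "sigma_finite_measure (cvol n)"
proof
  show "\<exists>A. countable A \<and> A \<subseteq> sets (cvol n) \<and> \<Union> A = space (cvol n) \<and> (\<forall>a\<in>A. emeasure (cvol n) a \<noteq> \<infinity>)"
  proof (intro exI conjI)
    show "countable (range (\<lambda>m::nat. {x. cnorm n (\<lambda>l. x l - 0) \<le> real (Suc m)}))" by simp
    show "range (\<lambda>m::nat. {x. cnorm n (\<lambda>l. x l - 0) \<le> real (Suc m)}) \<subseteq> sets (cvol n)"
      using cball_borel[of n "\<lambda>_. 0"] by auto
    show "\<Union> (range (\<lambda>m::nat. {x. cnorm n (\<lambda>l. x l - 0) \<le> real (Suc m)})) = space (cvol n)"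
      using UNIV_Union_cballs[of n] by simp
    show "\<forall>a\<in>range (\<lambda>m::nat. {x. cnorm n (\<lambda>l. x l - 0) \<le> real (Suc m)}). emeasure (cvol n) a \<noteq> \<infinity>"
      using emeasure_cvol_cball[of _ n "\<lambda>_. 0"] by auto
  qed
qed

lemma product_sigma_finite_cvol: "product_sigma_finite (\<lambda>_. cvol n)"
  by (simp add: product_sigma_finite_def sigma_finite_cvol)

section \<open>Concentration of volume in balls of high dimension\<close>

lemma ennreal_lower_from_cover:
  assumes "ennreal a \<le> E + ennreal b" "0 \<le> b" "c \<le> a - b"
  shows "ennreal c \<le> E"
proof -
  have "ennreal (a - b) \<le> E"
    using assms(1,2) by (simp add: ennreal_minus_le_iff add.commute flip: ennreal_minus)
  thus ?thesis using ennreal_leI[OF assms(3)] by (rule order_trans[rotated])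
qed

text \<open>The real or the imaginary part of \<open>w\<close>, up to sign, is at least half the
  modulus. A lower bound on the modulus of an inner product is thus covered by four
  half-spaces.\<close>

lemma unit_direction:
  fixes w :: complex
  obtains u where "u \<in> {1, -1, \<i>, -\<i>}" "cmod w / 2 \<le> Re (cnj u * w)"
proof -
  have "cmod w \<le> \<bar>Re w\<bar> + \<bar>Im w\<bar>" by (rule cmod_le)
  hence "cmod w / 2 \<le> Re w \<or> cmod w / 2 \<le> - Re w \<or> cmod w / 2 \<le> Im w \<or> cmod w / 2 \<le> - Im w"
    by linarith
  thus ?thesis using that[of 1] that[of "-1"] that[of \<i>] that[of "-\<i>"] by auto
qed

text \<open>A cap \<open>{x. |x| \<le> r, Re \<langle>y,x\<rangle> \<ge> d/2}\<close> lies in a smaller ball centred at a small multiple of \<open>y\<close>;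
  hence in high dimension most of a ball is nearly orthogonal to finitely many given vectors
  and close to the bounding sphere.\<close>
lemma cap_in_smaller_ball:
  assumes R: "0 < R" and d: "0 < d" and y: "cnorm n y \<le> R" and x: "cnorm n x \<le> r"
    and big: "d \<le> cmod (cip n y x)"
  obtains u where "u \<in> {1, -1, \<i>, -\<i>}"
    "(cnorm n (\<lambda>l. x l - complex_of_real (d / (2 * R\<^sup>2)) * (u * y l)))\<^sup>2 \<le> r\<^sup>2 - d\<^sup>2 / (4 * R\<^sup>2)"
proof -
  obtain u where u: "u \<in> {1, -1, \<i>, -\<i>}" "cmod (cip n y x) / 2 \<le> Re (cnj u * cip n y x)"
    by (rule unit_direction)
  define t where "t = d / (2 * R\<^sup>2)"
  have t: "0 < t" using R d by (simp add: t_def)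
  have nu: "cmod u = 1" using u by auto
  have x2: "(cnorm n x)\<^sup>2 \<le> r\<^sup>2" using x by (intro power_mono) auto
  have y2: "(cnorm n y)\<^sup>2 \<le> R\<^sup>2" using y by (intro power_mono) auto
  have R2: "0 < R\<^sup>2" using R by simp
  have "(cnorm n (\<lambda>l. x l - complex_of_real t * (u * y l)))\<^sup>2
      = (cnorm n x)\<^sup>2 - 2 * (t * Re (cnj u * cip n y x)) + (t * cnorm n y)\<^sup>2"
    using t nu unfolding cnorm_power2_diff cip_scale_left cnorm_scale by (simp add: norm_mult)
  also have "\<dots> \<le> r\<^sup>2 - 2 * (t * (d / 2)) + t\<^sup>2 * R\<^sup>2"
  proof -
    have "t * (d / 2) \<le> t * Re (cnj u * cip n y x)"
      using t u big by (intro mult_left_mono) auto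
    moreover have "(t * cnorm n y)\<^sup>2 \<le> t\<^sup>2 * R\<^sup>2"
      using y2 by (simp add: power_mult_distrib mult_left_mono)
    ultimately show ?thesis using x2 by linarith
  qed
  also have "\<dots> = r\<^sup>2 - d\<^sup>2 / (4 * R\<^sup>2)"
    using R2 by (simp add: t_def field_simps power2_eq_square)
  finally show ?thesis using u that by (auto simp: t_def)
qed

text \<open>The bad part of the ball is covered by one concentric ball and four translated balls for
  each \<open>y\<close> in \<open>K\<close>, all of a radius \<open>\<rho> < r\<close>. Their share
  of the volume is at most \<open>(1 + 4 * m) * (\<rho> / r) ^ (2 * n)\<close>, which tends to 0.
  The threshold for \<open>n\<close> depends on \<open>K\<close> only through \<open>m\<close> and
  \<open>R\<close>, and not on the centre: later inductions choose both after
  \<open>n\<close>.\<close>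

lemma ball_mostly_orthogonal_shell:
  fixes r R d :: real and m :: nat
  assumes r: "0 < r" and d: "0 < d"
  shows "\<exists>n0. \<forall>n\<ge>n0. \<forall>K a. finite K \<and> card K \<le> m \<and> (\<forall>y\<in>K. cnorm n y \<le> R) \<longrightarrow>
    ennreal (1/2 * (r ^ (2 * n) * vball n)) \<le>
    emeasure (cvol n) {x. cnorm n (\<lambda>l. x l - a l) \<le> r \<and> r\<^sup>2 - d \<le> (cnorm n (\<lambda>l. x l - a l))\<^sup>2 \<and>
      (\<forall>y\<in>K. cmod (cip n y (\<lambda>l. x l - a l)) < d)}"
proof -
  define R' where "R' = max R 1"
  have R': "0 < R'" "R \<le> R'" by (auto simp: R'_def)
  define k where "k = min d (d\<^sup>2 / (4 * R'\<^sup>2))"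
  have k: "0 < k" using d R' by (simp add: k_def)
  \<comment> \<open>The maximum with \<open>r\<^sup>2 / 2\<close> keeps the radius positive when
    \<open>k\<close> is large compared with \<open>r\<^sup>2\<close>. Both the inner ball cut off by
    the shell and the balls of \<open>cap_in_smaller_ball\<close> have at most this radius.\<close>
  define \<rho> where "\<rho> = sqrt (max (r\<^sup>2 - k) (r\<^sup>2 / 2))"
  have \<rho>2: "\<rho>\<^sup>2 = max (r\<^sup>2 - k) (r\<^sup>2 / 2)" unfolding \<rho>_def by (rule real_sqrt_pow2) (auto simp: le_max_iff_disj)
  have \<rho>k: "r\<^sup>2 - k \<le> \<rho>\<^sup>2" unfolding \<rho>2 by simp
  have kd: "k \<le> d" "k \<le> d\<^sup>2 / (4 * R'\<^sup>2)" by (simp_all add: k_def)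
  have \<rho>0: "0 < \<rho>" unfolding \<rho>_def using r by (auto simp: less_max_iff_disj)
  have "\<rho>\<^sup>2 < r\<^sup>2" unfolding \<rho>2 using k r by simp
  hence \<rho>r: "\<rho> < r" using power2_less_imp_less[of \<rho> r] r by linarith
  define U where "U = {1, -1, \<i>, -\<i>}"
  have U: "finite U" "card U \<le> 4" unfolding U_def by (auto intro!: card_insert_le_m1)
  have "(\<lambda>n. (1 + 4 * real m) * ((\<rho> / r)\<^sup>2) ^ n) \<longlonglongrightarrow> (1 + 4 * real m) * 0"
    using \<rho>0 \<rho>r r by (intro tendsto_mult tendsto_const LIMSEQ_realpow_zero) (auto simp: power_less_one_iff)
  hence "\<forall>\<^sub>F n in sequentially. (1 + 4 * real m) * ((\<rho> / r)\<^sup>2) ^ n < 1/2"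
    by (rule order_tendstoD) simp
  then obtain n0 where n0: "\<And>n. n \<ge> n0 \<Longrightarrow> (1 + 4 * real m) * ((\<rho> / r)\<^sup>2) ^ n < 1/2"
    by (auto simp: eventually_sequentially)
  show ?thesis
  proof (intro exI[of _ n0] allI impI, elim conjE)
    fix n and K :: "cvec set" and a
    assume n: "n0 \<le> n" and K: "finite K" "card K \<le> m" "\<forall>y\<in>K. cnorm n y \<le> R"
    define t where "t = complex_of_real (d / (2 * R'\<^sup>2))"
    let ?B = "\<lambda>c \<rho>. {x. cnorm n (\<lambda>l. x l - c l) \<le> \<rho>}"
    let ?G = "{x. cnorm n (\<lambda>l. x l - a l) \<le> r \<and> r\<^sup>2 - d \<le> (cnorm n (\<lambda>l. x l - a l))\<^sup>2 \<and>
      (\<forall>y\<in>K. cmod (cip n y (\<lambda>l. x l - a l)) < d)}"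
    let ?C = "\<lambda>p l. a l + t * (snd p * fst p l)"
    have Gm: "?G \<in> sets borel"
    proof -
      have "{x \<in> space borel. cnorm n (\<lambda>l. x l - a l) \<le> r \<and> r\<^sup>2 - d \<le> (cnorm n (\<lambda>l. x l - a l))\<^sup>2 \<and>
        (\<forall>y\<in>K. cmod (cip n y (\<lambda>l. x l - a l)) < d)} \<in> sets borel"
        using K(1) by measurable
      thus ?thesis by simp
    qed
    have cover: "?B a r \<subseteq> (?G \<union> ?B a \<rho>) \<union> (\<Union>p\<in>K \<times> U. ?B (?C p) \<rho>)"
    proof
      fix x assume x: "x \<in> ?B a r"
      have "x \<in> ?B a \<rho>" if "(cnorm n (\<lambda>l. x l - a l))\<^sup>2 < r\<^sup>2 - d"
      proof -
        have "(cnorm n (\<lambda>l. x l - a l))\<^sup>2 \<le> \<rho>\<^sup>2" using that kd \<rho>k by linarith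
        thus ?thesis using power2_le_imp_le[OF _ less_imp_le[OF \<rho>0]] by simp
      qed
      moreover have "\<exists>p\<in>K\<times>U. x \<in> ?B (?C p) \<rho>" if y: "y \<in> K" "d \<le> cmod (cip n y (\<lambda>l. x l - a l))" for y
      proof -
        obtain u where u: "u \<in> {1, -1, \<i>, -\<i>}"
          "(cnorm n (\<lambda>l. (x l - a l) - complex_of_real (d / (2 * R'\<^sup>2)) * (u * y l)))\<^sup>2 \<le> r\<^sup>2 - d\<^sup>2 / (4 * R'\<^sup>2)"
          by (rule cap_in_smaller_ball[of R' d n y "\<lambda>l. x l - a l" r]) (use R' d y K(3) x in auto)
        have "r\<^sup>2 - d\<^sup>2 / (4 * R'\<^sup>2) \<le> \<rho>\<^sup>2" using kd \<rho>k by linarith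
        hence "(cnorm n (\<lambda>l. x l - ?C (y, u) l))\<^sup>2 \<le> \<rho>\<^sup>2"
          using u(2) by (simp add: t_def algebra_simps)
        hence "x \<in> ?B (?C (y, u)) \<rho>" using power2_le_imp_le[OF _ less_imp_le[OF \<rho>0]] by simp
        thus ?thesis using u(1) y(1) unfolding U_def by (intro bexI[of _ "(y, u)"]) auto
      qed
      ultimately show "x \<in> (?G \<union> ?B a \<rho>) \<union> (\<Union>p\<in>K \<times> U. ?B (?C p) \<rho>)"
        using x by (cases "(cnorm n (\<lambda>l. x l - a l))\<^sup>2 < r\<^sup>2 - d"; cases "\<exists>y\<in>K. d \<le> cmod (cip n y (\<lambda>l. x l - a l))")
          (auto simp: not_less not_le)
    qed
    let ?v = "\<rho> ^ (2 * n) * vball n"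
    have GS: "?G \<in> sets (cvol n)" using Gm by (simp only: sets_cvol)
    have BS: "?B c s \<in> sets (cvol n)" for c s by (simp only: sets_cvol cball_borel)
    have fin: "finite (K \<times> U)" using K(1) U(1) by (rule finite_cartesian_product)
    have US: "(\<Union>p\<in>K \<times> U. ?B (?C p) \<rho>) \<in> sets (cvol n)"
      by (rule sets.finite_UN[OF fin BS])
    have "ennreal (r ^ (2 * n) * vball n) = emeasure (cvol n) (?B a r)"
      by (rule emeasure_cvol_cball[OF r, symmetric])
    also have "\<dots> \<le> emeasure (cvol n) ((?G \<union> ?B a \<rho>) \<union> (\<Union>p\<in>K \<times> U. ?B (?C p) \<rho>))"
      by (rule emeasure_mono[OF cover sets.Un[OF sets.Un[OF GS BS] US]])
    also have "\<dots> \<le> (emeasure (cvol n) ?G + emeasure (cvol n) (?B a \<rho>)) + (\<Sum>p\<in>K \<times> U. emeasure (cvol n) (?B (?C p) \<rho>))"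
      by (rule order_trans[OF emeasure_subadditive[OF sets.Un[OF GS BS] US]
            add_mono[OF emeasure_subadditive[OF GS BS] emeasure_subadditive_finite[OF fin]]]) (rule image_subsetI, rule BS)
    also have "\<dots> = emeasure (cvol n) ?G + (ennreal ?v + ennreal (real (card (K \<times> U)) * ?v))"
      unfolding emeasure_cvol_cball[OF \<rho>0] by (simp add: ennreal_mult' ennreal_of_nat_eq_real_of_nat add.assoc)
    also have "ennreal ?v + ennreal (real (card (K \<times> U)) * ?v) = ennreal ((1 + real (card (K \<times> U))) * ?v)"
      using \<rho>0 by (subst ennreal_plus[symmetric]) (auto simp: algebra_simps)
    finally have main: "ennreal (r ^ (2 * n) * vball n) \<le> emeasure (cvol n) ?G + ennreal ((1 + real (card (K \<times> U))) * ?v)" .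
    show "ennreal (1/2 * (r ^ (2 * n) * vball n)) \<le> emeasure (cvol n) ?G"
    proof (rule ennreal_lower_from_cover[OF main])
      have "card (K \<times> U) \<le> m * 4"
        unfolding card_cartesian_product using K U by (intro mult_le_mono) auto
      hence "1 + real (card (K \<times> U)) \<le> 1 + 4 * real m" by linarith
      hence "(1 + real (card (K \<times> U))) * ?v \<le> (1 + 4 * real m) * ?v"
        using \<rho>0 by (intro mult_right_mono) auto
      also have "\<dots> = ((1 + 4 * real m) * ((\<rho> / r)\<^sup>2) ^ n) * (r ^ (2 * n) * vball n)"
        using r by (simp add: power_mult power_divide)
      also have "\<dots> \<le> 1/2 * (r ^ (2 * n) * vball n)"
        using n0[OF n] r by (intro mult_right_mono) auto
      finally show "1/2 * (r ^ (2 * n) * vball n) \<le> r ^ (2 * n) * vball n - (1 + real (card (K \<times> U))) * ?v"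
        by linarith
      show "0 \<le> (1 + real (card (K \<times> U))) * ?v" using \<rho>0 by auto
    qed
  qed
qed

section \<open>Determinants of positive semidefinite matrices\<close>

lemma det_on_cong: "(\<And>i j. i \<in> I \<Longrightarrow> j \<in> I \<Longrightarrow> M i j = N i j) \<Longrightarrow> det_on I M = det_on I N"
  unfolding det_on_def
  by (intro sum.cong refl arg_cong2[of _ _ _ _ "(*)"] prod.cong) (auto dest: permutes_in_image)

text \<open>The row that meets column \<open>j\<close> under a permutation \<open>p\<close> is
  \<open>inv p j\<close>. Isolating its factor makes linearity in the column visible.\<close>

lemma det_on_column:
  assumes "finite I" "j \<in> I"
  shows "det_on I (\<lambda>a b. if b = j then f a else M a b) =
    (\<Sum>p\<in>{p. p permutes I}. of_int (sign p) * (\<Prod>i\<in>I - {inv p j}. M i (p i)) * f (inv p j))"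
  unfolding det_on_def
proof (rule sum.cong[OF refl])
  fix p assume "p \<in> {p. p permutes I}"
  hence p: "p permutes I" by simp
  have pj: "p (inv p j) = j" using p by (simp add: permutes_inverses)
  have ij: "inv p j \<in> I" using permutes_inv[OF p] assms(2) by (simp add: permutes_in_image)
  have "(\<Prod>i\<in>I. if p i = j then f i else M i (p i)) = f (inv p j) * (\<Prod>i\<in>I - {inv p j}. if p i = j then f i else M i (p i))"
    by (subst prod.remove[OF assms(1) ij]) (simp add: pj)
  also have "(\<Prod>i\<in>I - {inv p j}. if p i = j then f i else M i (p i)) = (\<Prod>i\<in>I - {inv p j}. M i (p i))"
    by (intro prod.cong) (use p in \<open>auto simp: permutes_inverses\<close>)
  finally show "of_int (sign p) * (\<Prod>i\<in>I. if p i = j then f i else M i (p i)) =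
    of_int (sign p) * (\<Prod>i\<in>I - {inv p j}. M i (p i)) * f (inv p j)" by simp
qed

text \<open>Composition with the transposition of the two columns is a sign-reversing involution of
  the sum, so the determinant equals its own negative.\<close>

lemma det_on_equal_columns:
  assumes "finite I" "j \<in> I" "l \<in> I" "j \<noteq> l" "\<And>a. a \<in> I \<Longrightarrow> M a j = M a l"
  shows "det_on I M = 0"
proof -
  let ?t = "Transposition.transpose j l"
  have t: "?t permutes I" using assms by (intro permutes_swap_id)
  have fin: "finite {p. p permutes I}" using assms(1) by (rule finite_permutations)
  have "det_on I M = (\<Sum>p\<in>{p. p permutes I}. of_int (sign (?t \<circ> p)) * (\<Prod>i\<in>I. M i ((?t \<circ> p) i)))"
    unfolding det_on_def
    by (rule sum.reindex_bij_witness[of _ "\<lambda>p. ?t \<circ> p" "\<lambda>p. ?t \<circ> p"])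
       (auto simp: permutes_compose[OF _ t] comp_assoc[symmetric])
  also have "\<dots> = (\<Sum>p\<in>{p. p permutes I}. - (of_int (sign p) * (\<Prod>i\<in>I. M i (p i))))"
  proof (rule sum.cong[OF refl])
    fix p assume "p \<in> {p. p permutes I}"
    hence p: "p permutes I" by simp
    have "sign (?t \<circ> p) = - sign p"
      using assms p permutation_permutes[of p] permutation_permutes[of ?t] t
      by (subst sign_compose) (auto simp: sign_swap_id)
    moreover have "(\<Prod>i\<in>I. M i ((?t \<circ> p) i)) = (\<Prod>i\<in>I. M i (p i))"
      by (intro prod.cong) (auto simp: Transposition.transpose_def assms(5))
    ultimately show "of_int (sign (?t \<circ> p)) * (\<Prod>i\<in>I. M i ((?t \<circ> p) i)) = - (of_int (sign p) * (\<Prod>i\<in>I. M i (p i)))"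
      by simp
  qed
  also have "\<dots> = - det_on I M" by (simp add: det_on_def sum_negf)
  finally show ?thesis by simp
qed

lemma det_on_pivot_column:
  assumes "finite J" "j \<notin> J"
  shows "det_on (insert j J) (\<lambda>a b. if b = j then (if a = j then d else 0) else M a b) = d * det_on J M"
proof -
  let ?I = "insert j J"
  have sub: "{p. p permutes J} \<subseteq> {p. p permutes ?I}" by (auto intro: permutes_subset)
  have "det_on ?I (\<lambda>a b. if b = j then (if a = j then d else 0) else M a b)
    = (\<Sum>p\<in>{p. p permutes ?I}. of_int (sign p) * (\<Prod>i\<in>?I - {inv p j}. M i (p i)) * (if inv p j = j then d else 0))"
    using assms by (intro det_on_column) auto
  also have "\<dots> = (\<Sum>p\<in>{p. p permutes J}. of_int (sign p) * (\<Prod>i\<in>?I - {inv p j}. M i (p i)) * (if inv p j = j then d else 0))"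
  proof (rule sum.mono_neutral_right)
    show "finite {p. p permutes ?I}" using assms by (simp add: finite_permutations)
    show "\<forall>p\<in>{p. p permutes ?I} - {p. p permutes J}.
        of_int (sign p) * (\<Prod>i\<in>?I - {inv p j}. M i (p i)) * (if inv p j = j then d else 0) = 0"
    proof
      fix p assume p: "p \<in> {p. p permutes ?I} - {p. p permutes J}"
      have "inv p j \<noteq> j"
      proof
        assume "inv p j = j"
        hence "p j = j" using p by (auto simp: permutes_inverses dest: permutes_inv_eq)
        hence "p permutes J" using p permutes_superset[of p ?I J] by blast
        thus False using p by simp
      qed
      thus "of_int (sign p) * (\<Prod>i\<in>?I - {inv p j}. M i (p i)) * (if inv p j = j then d else 0) = 0" by simp
    qed
  qed (rule sub)
  also have "\<dots> = (\<Sum>p\<in>{p. p permutes J}. d * (of_int (sign p) * (\<Prod>i\<in>J. M i (p i))))"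
  proof (rule sum.cong[OF refl])
    fix p assume "p \<in> {p. p permutes J}"
    hence "inv p permutes J" by (simp add: permutes_inv)
    hence "inv p j = j" using assms(2) by (rule permutes_not_in)
    moreover have "?I - {j} = J" using assms(2) by auto
    ultimately show "of_int (sign p) * (\<Prod>i\<in>?I - {inv p j}. M i (p i)) * (if inv p j = j then d else 0) =
        d * (of_int (sign p) * (\<Prod>i\<in>J. M i (p i)))" by simp
  qed
  also have "\<dots> = d * det_on J M" by (simp add: det_on_def sum_distrib_left)
  finally show ?thesis .
qed

text \<open>Column \<open>j\<close> is the combination \<open>c\<close> of the other columns plus a
  column whose only nonzero entry is the pivot. Taking for \<open>c\<close> any solution of the
  linear system avoids inverse matrices.\<close>

lemma det_on_schur:
  assumes J: "finite J" "j \<notin> J" and c: "\<And>i. i \<in> J \<Longrightarrow> M i j = (\<Sum>l\<in>J. M i l * c l)"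
  shows "det_on (insert j J) M = det_on J M * (M j j - (\<Sum>l\<in>J. M j l * c l))"
proof -
  let ?I = "insert j J"
  let ?d = "M j j - (\<Sum>l\<in>J. M j l * c l)"
  let ?W = "\<lambda>p. of_int (sign p) * (\<Prod>i\<in>?I - {inv p j}. M i (p i)) :: complex"
  let ?P = "{p. p permutes ?I}"
  have col: "det_on ?I (\<lambda>a b. if b = j then f a else M a b) = (\<Sum>p\<in>?P. ?W p * f (inv p j))" for f
    using J by (intro det_on_column) auto
  have inI: "inv p j \<in> ?I" if "p \<in> ?P" for p
    using that permutes_inv[of p ?I] permutes_in_image[of "inv p" ?I j] by auto
  have split: "M a j = (\<Sum>l\<in>J. M a l * c l) + (if a = j then ?d else 0)" if "a \<in> ?I" for a
    using that c by auto
  have "det_on ?I M = det_on ?I (\<lambda>a b. if b = j then M a j else M a b)"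
    by (intro det_on_cong) auto
  also have "\<dots> = (\<Sum>p\<in>?P. ?W p * M (inv p j) j)" by (rule col)
  also have "\<dots> = (\<Sum>p\<in>?P. (\<Sum>l\<in>J. c l * (?W p * M (inv p j) l)) + ?W p * (if inv p j = j then ?d else 0))"
    by (intro sum.cong refl, subst split[OF inI]) (auto simp: distrib_left sum_distrib_left sum_distrib_right mult_ac)
  also have "\<dots> = (\<Sum>l\<in>J. c l * (\<Sum>p\<in>?P. ?W p * M (inv p j) l)) + (\<Sum>p\<in>?P. ?W p * (if inv p j = j then ?d else 0))"
    unfolding sum.distrib by (subst sum.swap) (simp add: sum_distrib_left)
  also have "\<dots> = (\<Sum>l\<in>J. c l * det_on ?I (\<lambda>a b. if b = j then M a l else M a b))
      + det_on ?I (\<lambda>a b. if b = j then (if a = j then ?d else 0) else M a b)"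
    unfolding col ..
  also have "(\<Sum>l\<in>J. c l * det_on ?I (\<lambda>a b. if b = j then M a l else M a b)) = 0"
  proof (intro sum.neutral ballI)
    fix l assume l: "l \<in> J"
    hence "det_on ?I (\<lambda>a b. if b = j then M a l else M a b) = 0"
      using J by (intro det_on_equal_columns[of _ j l]) auto
    thus "c l * det_on ?I (\<lambda>a b. if b = j then M a l else M a b) = 0" by simp
  qed
  finally show ?thesis using J by (simp add: det_on_pivot_column mult.commute)
qed

section \<open>Positive semidefinite and positive definite forms\<close>

definition bform :: "'a set \<Rightarrow> ('a \<Rightarrow> 'a \<Rightarrow> complex) \<Rightarrow> ('a \<Rightarrow> complex) \<Rightarrow> ('a \<Rightarrow> complex) \<Rightarrow> complex" where
  "bform J q x y = (\<Sum>i\<in>J. \<Sum>j\<in>J. cnj (x i) * q i j * y j)"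

text \<open>The vanishing imaginary part is what forces the matrix to be hermitian
  (\<open>psd_hermitian\<close>); \<open>pd\<close> records strictness alone.\<close>

definition psd :: "'a set \<Rightarrow> ('a \<Rightarrow> 'a \<Rightarrow> complex) \<Rightarrow> bool" where
  "psd J q \<longleftrightarrow> (\<forall>x. Im (bform J q x x) = 0 \<and> 0 \<le> Re (bform J q x x))"

definition pd :: "'a set \<Rightarrow> ('a \<Rightarrow> 'a \<Rightarrow> complex) \<Rightarrow> bool" where
  "pd J q \<longleftrightarrow> (\<forall>x. (\<exists>i\<in>J. x i \<noteq> 0) \<longrightarrow> 0 < Re (bform J q x x))"

lemma bform_rows: "bform J q x y = (\<Sum>i\<in>J. cnj (x i) * (\<Sum>j\<in>J. q i j * y j))"
  by (simp add: bform_def sum_distrib_left mult.assoc)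

lemma bform_diff_left: "bform J q (\<lambda>i. x i - s * w i) y = bform J q x y - cnj s * bform J q w y"
  by (simp add: bform_def sum_subtractf sum_distrib_left algebra_simps)

lemma bform_diff_right: "bform J q y (\<lambda>i. x i - s * w i) = bform J q y x - s * bform J q y w"
  by (simp add: bform_def sum_subtractf sum_distrib_left algebra_simps)

text \<open>The vector \<open>x\<close> is carried along \<open>f\<close> and extended by zero.
  Arbitrary injections are allowed because besides submatrices also translates by a generator are
  compared with \<open>q\<close>.\<close>

lemma bform_reindex:
  assumes "inj_on f J" "f ` J \<subseteq> K" "finite K"
  shows "\<exists>y. (\<forall>i\<in>J. y (f i) = x i) \<and> bform J (\<lambda>a b. q (f a) (f b)) x x = bform K q y y"
proof -
  define y where "y i = (if i \<in> f ` J then x (the_inv_into J f i) else 0)" for i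
  have y: "y (f i) = x i" if "i \<in> J" for i
    using that assms(1) by (simp add: y_def the_inv_into_f_f)
  have "bform K q y y = (\<Sum>i\<in>f ` J. \<Sum>j\<in>K. cnj (y i) * q i j * y j)"
    unfolding bform_def using assms by (intro sum.mono_neutral_right) (auto simp: y_def)
  also have "\<dots> = (\<Sum>i\<in>f ` J. \<Sum>j\<in>f ` J. cnj (y i) * q i j * y j)"
    using assms by (intro sum.cong refl sum.mono_neutral_right) (auto simp: y_def)
  also have "\<dots> = bform J (\<lambda>a b. q (f a) (f b)) x x"
    unfolding bform_def using assms(1) by (simp add: sum.reindex y)
  finally show ?thesis using y by metis
qed

lemma psd_reindex:
  assumes "psd K q" "inj_on f J" "f ` J \<subseteq> K" "finite K"
  shows "psd J (\<lambda>a b. q (f a) (f b))"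
  unfolding psd_def
proof
  fix x
  show "Im (bform J (\<lambda>a b. q (f a) (f b)) x x) = 0 \<and> 0 \<le> Re (bform J (\<lambda>a b. q (f a) (f b)) x x)"
    using bform_reindex[OF assms(2-4), of x q] assms(1) unfolding psd_def by metis
qed

lemma pd_reindex:
  assumes "pd K q" "inj_on f J" "f ` J \<subseteq> K" "finite K"
  shows "pd J (\<lambda>a b. q (f a) (f b))"
  unfolding pd_def
proof (intro allI impI)
  fix x :: "_ \<Rightarrow> complex" assume "\<exists>i\<in>J. x i \<noteq> 0"
  moreover obtain y where "\<forall>i\<in>J. y (f i) = x i" "bform J (\<lambda>a b. q (f a) (f b)) x x = bform K q y y"
    using bform_reindex[OF assms(2-4), of x q] by blast
  ultimately show "0 < Re (bform J (\<lambda>a b. q (f a) (f b)) x x)"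
    using assms(1,3) unfolding pd_def by (metis image_subset_iff)
qed

lemma psd_subset: "psd K q \<Longrightarrow> J \<subseteq> K \<Longrightarrow> finite K \<Longrightarrow> psd J q"
  using psd_reindex[of K q "\<lambda>x. x" J] by simp

lemma pd_subset: "pd K q \<Longrightarrow> J \<subseteq> K \<Longrightarrow> finite K \<Longrightarrow> pd J q"
  using pd_reindex[of K q "\<lambda>x. x" J] by simp

lemma psd_cong: "(\<And>i j. i \<in> J \<Longrightarrow> j \<in> J \<Longrightarrow> q i j = r i j) \<Longrightarrow> psd J q \<longleftrightarrow> psd J r"
  unfolding psd_def bform_def by (simp cong: sum.cong)

lemma pd_cong: "(\<And>i j. i \<in> J \<Longrightarrow> j \<in> J \<Longrightarrow> q i j = r i j) \<Longrightarrow> pd J q \<longleftrightarrow> pd J r"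
  unfolding pd_def bform_def by (simp cong: sum.cong)

text \<open>Polarization: on the span of two coordinate vectors the form is real at
  \<open>(1, t)\<close> for \<open>t\<close> equal to 0, 1, -1, i and -i, which ties the two
  off-diagonal entries to each other.\<close>

lemma psd_hermitian:
  assumes q: "psd K q" "finite K" and ij: "i \<in> K" "j \<in> K"
  shows "q j i = cnj (q i j)"
proof (cases "i = j")
  case True
  have "psd {i} q" by (rule psd_subset[OF q(1) _ q(2)]) (use ij in auto)
  hence "Im (bform {i} q (\<lambda>_. 1) (\<lambda>_. 1)) = 0" unfolding psd_def by blast
  thus ?thesis using True by (simp add: bform_def complex_eq_iff)
next
  case False
  have P: "psd {i, j} q" by (rule psd_subset[OF q(1) _ q(2)]) (use ij in auto)
  have *: "Im (q i i + cnj t * q j i + q i j * t + cnj t * q j j * t) = 0" for t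
    using P[unfolded psd_def, rule_format, of "\<lambda>a. if a = i then 1 else t"] False
    by (simp add: bform_def algebra_simps)
  show ?thesis using *[of 0] *[of 1] *[of "-1"] *[of \<i>] *[of "-\<i>"]
    by (simp add: complex_eq_iff algebra_simps)
qed

text \<open>If \<open>w = q x\<close> were nonzero, moving from the isotropic vector
  \<open>x\<close> a little in the direction of \<open>- w\<close> would make the form
  negative.\<close>

lemma psd_kernel:
  assumes q: "psd J q" "finite J" and x: "Re (bform J q x x) = 0" and i: "i \<in> J"
  shows "(\<Sum>j\<in>J. q i j * x j) = 0"
proof -
  define w where "w i = (\<Sum>j\<in>J. q i j * x j)" for i
  define N where "N = (\<Sum>i\<in>J. (cmod (w i))\<^sup>2)"
  define K where "K = Re (bform J q w w)"
  have K: "0 \<le> K" using q(1) by (simp add: K_def psd_def)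
  have wx: "bform J q w x = of_real N"
  proof -
    have "cnj (w i) * w i = complex_of_real ((cmod (w i))\<^sup>2)" for i
      by (simp only: complex_norm_square mult.commute)
    thus ?thesis unfolding bform_rows N_def w_def[symmetric] of_real_sum by simp
  qed
  have xw: "bform J q x w = of_real N"
  proof -
    have "bform J q x w = cnj (bform J q w x)"
      unfolding bform_def cnj_sum
    proof (subst sum.swap, intro sum.cong refl)
      fix a b assume "a \<in> J" "b \<in> J"
      hence "q b a = cnj (q a b)" by (rule psd_hermitian[OF q])
      thus "cnj (x b) * q b a * w a = cnj (cnj (w a) * q a b * x b)" by simp
    qed
    thus ?thesis by (simp add: wx)
  qed
  have N0: "0 \<le> N" by (simp add: N_def sum_nonneg)
  have "N = 0"
  proof (rule ccontr)
    assume "N \<noteq> 0"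
    hence N: "0 < N" using N0 by simp
    \<comment> \<open>Small enough for the second-order term \<open>s * K\<close> to stay below
      \<open>N\<close>; the added 1 takes care of \<open>K = 0\<close>.\<close>
    define s where "s = N / (K + 1)"
    have s: "0 < s" using N K by (simp add: s_def)
    have "s * K < N" using N K by (simp add: s_def field_simps)
    have "Re (bform J q (\<lambda>i. x i - complex_of_real s * w i) (\<lambda>i. x i - complex_of_real s * w i)) = s * (s * K - 2 * N)"
      unfolding bform_diff_left bform_diff_right xw wx using x by (simp add: K_def algebra_simps)
    also have "\<dots> < 0" using s \<open>s * K < N\<close> N by (intro mult_pos_neg) auto
    finally show False using q(1) unfolding psd_def by (metis not_less)
  qed
  hence "w i = 0" using i q(2) by (auto simp: N_def sum_nonneg_eq_0_iff)
  thus ?thesis by (simp add: w_def)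
qed

text \<open>The Schur complement is the value of the form at a vector with \<open>j\<close>-th
  coordinate 1 and so inherits its sign from the form.\<close>

lemma schur_form:
  assumes J: "finite J" "j \<notin> J" and c: "\<And>i. i \<in> J \<Longrightarrow> q i j = (\<Sum>l\<in>J. q i l * c l)"
  defines "x \<equiv> \<lambda>l. if l = j then 1 else - c l"
  shows "bform (insert j J) q x x = q j j - (\<Sum>l\<in>J. q j l * c l)"
proof -
  have row: "(\<Sum>l\<in>insert j J. q i l * x l) = q i j - (\<Sum>l\<in>J. q i l * c l)" for i
  proof -
    have "(\<Sum>l\<in>J. q i l * x l) = - (\<Sum>l\<in>J. q i l * c l)"
      unfolding sum_negf[symmetric] by (intro sum.cong) (use J in \<open>auto simp: x_def\<close>)
    thus ?thesis using J by (simp add: x_def)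
  qed
  show ?thesis unfolding bform_rows row
    using J by (subst sum.insert) (auto simp: x_def c)
qed

text \<open>Elimination of one index at a time: the system on \<open>J\<close> is solved for column
  \<open>j\<close> and for the right-hand side, and then coordinate \<open>j\<close> is adjusted.
  The pivot is nonzero by \<open>schur_form\<close>.\<close>

lemma pd_solvable:
  assumes "finite J" "psd J q" "pd J q"
  shows "\<exists>c. \<forall>i\<in>J. b i = (\<Sum>l\<in>J. q i l * c l)"
  using assms
proof (induction J arbitrary: b rule: finite_induct)
  case (insert j J)
  have P: "psd J q" "pd J q"
    using insert.prems insert.hyps by (auto intro: psd_subset pd_subset)
  obtain u where u: "\<And>i. i \<in> J \<Longrightarrow> q i j = (\<Sum>l\<in>J. q i l * u l)"
    using insert.IH[OF P, of "\<lambda>i. q i j"] by auto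
  obtain w where w: "\<And>i. i \<in> J \<Longrightarrow> b i = (\<Sum>l\<in>J. q i l * w l)"
    using insert.IH[OF P, of b] by auto
  define d where "d = q j j - (\<Sum>l\<in>J. q j l * u l)"
  have "d = bform (insert j J) q (\<lambda>l. if l = j then 1 else - u l) (\<lambda>l. if l = j then 1 else - u l)"
    unfolding d_def using schur_form[OF insert.hyps u] by simp
  moreover have "0 < Re (bform (insert j J) q (\<lambda>l. if l = j then 1 else - u l) (\<lambda>l. if l = j then 1 else - u l))"
    using insert.prems(2) unfolding pd_def by (intro insert.prems(2)[unfolded pd_def, rule_format]) auto
  ultimately have d: "d \<noteq> 0" by auto
  define t where "t = (b j - (\<Sum>l\<in>J. q j l * w l)) / d"
  define c where "c l = (if l = j then t else w l - t * u l)" for l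
  have sumc: "(\<Sum>l\<in>insert j J. q i l * c l) = q i j * t + (\<Sum>l\<in>J. q i l * w l) - t * (\<Sum>l\<in>J. q i l * u l)" for i
  proof -
    have "(\<Sum>l\<in>J. q i l * c l) = (\<Sum>l\<in>J. q i l * w l - t * (q i l * u l))"
      by (intro sum.cong) (use insert.hyps in \<open>auto simp: c_def algebra_simps\<close>)
    thus ?thesis using insert.hyps by (simp add: c_def sum_subtractf sum_distrib_left)
  qed
  have "b i = (\<Sum>l\<in>insert j J. q i l * c l)" if "i \<in> insert j J" for i
  proof (cases "i = j")
    case True
    have "t * d = b j - (\<Sum>l\<in>J. q j l * w l)" using d by (simp add: t_def)
    thus ?thesis unfolding sumc True d_def by (simp add: algebra_simps)
  next
    case False
    thus ?thesis unfolding sumc using that u[of i] w[of i] by simp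
  qed
  thus ?case by blast
qed auto

text \<open>An isotropic vector lies in the kernel (\<open>psd_kernel\<close>), so one column is a
  combination of the others and its Schur complement vanishes.\<close>

lemma not_pd_det_zero:
  assumes J: "finite J" and q: "psd J q" and np: "\<not> pd J q"
  shows "det_on J q = 0"
proof -
  obtain x k where x: "k \<in> J" "x k \<noteq> 0" "\<not> 0 < Re (bform J q x x)"
    using np unfolding pd_def by auto
  hence 0: "Re (bform J q x x) = 0" using q unfolding psd_def by (metis order_le_less)
  have ker: "(\<Sum>l\<in>J. q i l * x l) = 0" if "i \<in> J" for i
    by (rule psd_kernel[OF q J 0 that])
  let ?J = "J - {k}"
  have Jk: "J = insert k ?J" using x(1) by auto
  have col: "q i k = (\<Sum>l\<in>?J. q i l * (- x l / x k))" if "i \<in> J" for i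
  proof -
    have "0 = q i k * x k + (\<Sum>l\<in>?J. q i l * x l)"
      using ker[OF that] J x(1) by (simp add: sum.remove)
    hence "q i k * x k = (\<Sum>l\<in>?J. q i l * (- x l))"
      by (simp add: sum_negf eq_neg_iff_add_eq_0)
    hence "q i k = (\<Sum>l\<in>?J. q i l * (- x l)) / x k" using x(2) by (simp add: field_simps)
    thus ?thesis by (simp add: sum_divide_distrib)
  qed
  have "det_on (insert k ?J) q = det_on ?J q * (q k k - (\<Sum>l\<in>?J. q k l * (- x l / x k)))"
    by (rule det_on_schur) (use J col in auto)
  thus ?thesis using col[OF x(1)] Jk by simp
qed

text \<open>The common induction step of the determinant and volume estimates: each new index
  multiplies the determinant by a real pivot, which will be the squared distance of the new vector
  from the span of the old ones.\<close>

lemma schur_step: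
  assumes J: "finite J" "j \<notin> J" and q: "psd (insert j J) q" "pd J q"
  obtains c d where "\<And>i. i \<in> J \<Longrightarrow> q i j = (\<Sum>l\<in>J. q i l * c l)"
    "0 \<le> d" "q j j - (\<Sum>l\<in>J. q j l * c l) = complex_of_real d"
    "det_on (insert j J) q = det_on J q * complex_of_real d"
    "pd (insert j J) q \<Longrightarrow> 0 < d"
proof -
  have P: "psd J q" using q(1) J by (auto intro: psd_subset)
  obtain c where c: "\<And>i. i \<in> J \<Longrightarrow> q i j = (\<Sum>l\<in>J. q i l * c l)"
    using pd_solvable[OF J(1) P q(2), of "\<lambda>i. q i j"] by auto
  let ?x = "\<lambda>l. if l = j then 1 else - c l"
  define d where "d = Re (bform (insert j J) q ?x ?x)"
  have im: "Im (bform (insert j J) q ?x ?x) = 0" "0 \<le> d"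
    unfolding d_def using q(1) unfolding psd_def by blast+
  have dd: "q j j - (\<Sum>l\<in>J. q j l * c l) = complex_of_real d"
    using schur_form[OF J c] im(1) by (simp add: d_def complex_eq_iff)
  have "0 < d" if "pd (insert j J) q"
    unfolding d_def by (rule that[unfolded pd_def, rule_format]) auto
  thus ?thesis using that[OF c im(2) dd] det_on_schur[OF J c] dd by simp
qed

lemma psd_det:
  assumes "finite J" "psd J q"
  shows "Im (det_on J q) = 0 \<and> 0 \<le> Re (det_on J q) \<and> (pd J q \<longrightarrow> 0 < Re (det_on J q))"
  using assms
proof (induction J rule: finite_induct)
  case empty
  have "{p. p permutes ({} :: 'a set)} = {id}" by auto
  thus ?case by (simp add: det_on_def)
next
  case (insert j J)
  show ?case
  proof (cases "pd (insert j J) q")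
    case False
    thus ?thesis using not_pd_det_zero[OF _ insert.prems False] insert.hyps by simp
  next
    case True
    have P: "psd J q" "pd J q"
      using insert.prems insert.hyps True by (auto intro: psd_subset pd_subset)
    obtain d where "det_on (insert j J) q = det_on J q * complex_of_real d" "0 < d"
      using schur_step[OF insert.hyps insert.prems P(2)] True by metis
    thus ?thesis using insert.IH[OF P(1)] P(2) by simp
  qed
qed

lemma det_on_pos: "finite J \<Longrightarrow> psd J q \<Longrightarrow> pd J q \<Longrightarrow> 0 < Re (det_on J q)"
  using psd_det by blast

lemma det_on_nonneg: "finite J \<Longrightarrow> psd J q \<Longrightarrow> 0 \<le> Re (det_on J q)"
  using psd_det by blast

lemma pd_iff_det: "finite J \<Longrightarrow> psd J q \<Longrightarrow> pd J q \<longleftrightarrow> det_on J q \<noteq> 0"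
  using psd_det[of J q] not_pd_det_zero[of J q] by auto

lemma det_on_tendsto:
  assumes "\<And>i j. i \<in> J \<Longrightarrow> j \<in> J \<Longrightarrow> ((\<lambda>t. q t i j) \<longlongrightarrow> r i j) G"
  shows "((\<lambda>t. det_on J (q t)) \<longlongrightarrow> det_on J r) G"
  unfolding det_on_def
  by (intro tendsto_sum tendsto_mult tendsto_const tendsto_prod assms) (auto dest: permutes_in_image)

section \<open>Volumes of sets of tuples with prescribed Gram matrix\<close>

abbreviation tvol :: "nat \<Rightarrow> 'a set \<Rightarrow> ('a \<Rightarrow> cvec) measure" where
  "tvol n J \<equiv> PiM J (\<lambda>_. cvol n)"

definition gset :: "nat \<Rightarrow> 'a set \<Rightarrow> ('a \<Rightarrow> 'a \<Rightarrow> complex) \<Rightarrow> real \<Rightarrow> ('a \<Rightarrow> cvec) set" where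
  "gset n J q d = {Y \<in> space (tvol n J). \<forall>i\<in>J. \<forall>j\<in>J. cmod (cip n (Y i) (Y j) - q i j) < d}"

lemma measurable_tvol_component [measurable (raw)]:
  "j \<in> J \<Longrightarrow> (\<lambda>Y. Y j) \<in> measurable (tvol n J) borel"
  by (rule measurable_component_singleton[of j J "\<lambda>_. cvol n", unfolded measurable_cong_sets[OF refl sets_cvol]])

lemma sets_gset [measurable]: "finite J \<Longrightarrow> gset n J q d \<in> sets (tvol n J)"
  unfolding gset_def by measurable

lemma gset_mono: "d \<le> d' \<Longrightarrow> gset n J q d \<subseteq> gset n J q d'"
  unfolding gset_def by fastforce

lemma gset_norm:
  assumes "Y \<in> gset n J q d" "d \<le> 1" "j \<in> J" "finite J"
  shows "cnorm n (Y j) \<le> 1 + (\<Sum>i\<in>J. cmod (q i i))"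
proof -
  let ?R = "1 + (\<Sum>i\<in>J. cmod (q i i))"
  have "cmod (cip n (Y j) (Y j) - q j j) < d" using assms(1,3) by (auto simp: gset_def)
  hence "cmod (cip n (Y j) (Y j)) \<le> cmod (q j j) + 1"
    using assms(2) norm_triangle_sub[of "cip n (Y j) (Y j)" "q j j"] by linarith
  moreover have "cmod (q j j) \<le> (\<Sum>i\<in>J. cmod (q i i))" using assms by (intro member_le_sum) auto
  moreover have "cmod (cip n (Y j) (Y j)) = (cnorm n (Y j))\<^sup>2"
    unfolding cip_self norm_of_real by simp
  ultimately have "(cnorm n (Y j))\<^sup>2 \<le> ?R" by linarith
  also have "?R \<le> ?R\<^sup>2" by (rule self_le_power) (simp_all add: sum_nonneg)
  finally show ?thesis by (rule power2_le_imp_le) (simp add: sum_nonneg add_nonneg_nonneg)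
qed

lemma emeasure_tvol_insert:
  assumes J: "finite J" "j \<notin> J" and A: "A \<in> sets (tvol n (insert j J))"
  shows "emeasure (tvol n (insert j J)) A = (\<integral>\<^sup>+Y. emeasure (cvol n) {y. Y(j := y) \<in> A} \<partial>tvol n J)"
proof -
  interpret product_sigma_finite "\<lambda>_. cvol n" by (rule product_sigma_finite_cvol)
  have "emeasure (tvol n (insert j J)) A = (\<integral>\<^sup>+Y. indicator A Y \<partial>tvol n (insert j J))"
    using A by simp
  also have "\<dots> = (\<integral>\<^sup>+Y. (\<integral>\<^sup>+y. indicator A (Y(j := y)) \<partial>cvol n) \<partial>tvol n J)"
    using A by (intro product_nn_integral_insert J) auto
  also have "\<dots> = (\<integral>\<^sup>+Y. emeasure (cvol n) {y. Y(j := y) \<in> A} \<partial>tvol n J)"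
  proof (rule nn_integral_cong)
    fix Y assume Y: "Y \<in> space (tvol n J)"
    have "(\<lambda>y. Y(j := y)) \<in> measurable (cvol n) (tvol n (insert j J))"
      using measurable_fun_upd[of "insert j J" J j "\<lambda>_. Y" "cvol n" "\<lambda>_. cvol n" "\<lambda>y. y"] Y by auto
    from measurable_sets[OF this A] have m: "{y. Y(j := y) \<in> A} \<in> sets (cvol n)"
      by (simp add: vimage_def)
    have "(\<integral>\<^sup>+y. indicator A (Y(j := y)) \<partial>cvol n) = (\<integral>\<^sup>+y. indicator {y. Y(j := y) \<in> A} y \<partial>cvol n)"
      by (intro nn_integral_cong) (auto simp: indicator_def)
    thus "(\<integral>\<^sup>+y. indicator A (Y(j := y)) \<partial>cvol n) = emeasure (cvol n) {y. Y(j := y) \<in> A}"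
      using m by simp
  qed
  finally show ?thesis .
qed

text \<open>Fubini with the last vector innermost: the fibre over a tuple outside \<open>B\<close>
  is empty and every other fibre has volume at most \<open>c\<close>.\<close>

lemma tvol_insert_upper:
  assumes J: "finite J" "j \<notin> J" and A: "A \<in> sets (tvol n (insert j J))" and B: "B \<in> sets (tvol n J)"
    and sub: "\<And>Y y. Y \<in> space (tvol n J) \<Longrightarrow> Y(j := y) \<in> A \<Longrightarrow> Y \<in> B"
    and le: "\<And>Y. Y \<in> B \<Longrightarrow> emeasure (cvol n) {y. Y(j := y) \<in> A} \<le> c"
  shows "emeasure (tvol n (insert j J)) A \<le> c * emeasure (tvol n J) B"
proof -
  have "emeasure (tvol n (insert j J)) A \<le> (\<integral>\<^sup>+Y. c * indicator B Y \<partial>tvol n J)"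
    unfolding emeasure_tvol_insert[OF J A]
  proof (rule nn_integral_mono)
    fix Y assume Y: "Y \<in> space (tvol n J)"
    show "emeasure (cvol n) {y. Y(j := y) \<in> A} \<le> c * indicator B Y"
    proof (cases "Y \<in> B")
      case False
      hence "{y. Y(j := y) \<in> A} = {}" using sub[OF Y] by auto
      thus ?thesis by (simp only: emeasure_empty zero_le)
    qed (use le in auto)
  qed
  thus ?thesis using B by (simp add: nn_integral_cmult_indicator)
qed

lemma tvol_insert_lower:
  assumes J: "finite J" "j \<notin> J" and A: "A \<in> sets (tvol n (insert j J))" and B: "B \<in> sets (tvol n J)"
    and ge: "\<And>Y. Y \<in> B \<Longrightarrow> c \<le> emeasure (cvol n) {y. Y(j := y) \<in> A}"
  shows "c * emeasure (tvol n J) B \<le> emeasure (tvol n (insert j J)) A"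
proof -
  have "(\<integral>\<^sup>+Y. c * indicator B Y \<partial>tvol n J) \<le> emeasure (tvol n (insert j J)) A"
    unfolding emeasure_tvol_insert[OF J A]
    by (rule nn_integral_mono) (use ge in \<open>auto simp: indicator_def\<close>)
  thus ?thesis using B by (simp add: nn_integral_cmult_indicator)
qed

lemma emeasure_tvol_empty:
  assumes "(\<lambda>_. undefined) \<in> A" "A \<subseteq> space (tvol n {})"
  shows "emeasure (tvol n ({} :: 'a set)) A = 1"
proof -
  interpret product_sigma_finite "\<lambda>_. cvol n" by (rule product_sigma_finite_cvol)
  have "A = PiE {} (\<lambda>_. UNIV)" using assms by (auto simp: space_PiM)
  thus ?thesis using emeasure_PiM[of "{} :: 'a set" "\<lambda>_. UNIV"] by simp
qed

text \<open>The Gram form at \<open>x\<close> is a squared norm. This converts Schur complements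
  into squared distances.\<close>

lemma cip_combination:
  "cip n (\<lambda>l. \<Sum>i\<in>J. x i * Y i l) (\<lambda>l. \<Sum>i\<in>J. x i * Y i l) = bform J (\<lambda>i j. cip n (Y i) (Y j)) x x"
  unfolding cip_sum_left cip_sum_right cip_scale_left cip_scale_right bform_def
  by (simp add: sum_distrib_left mult_ac)

lemma bform_close:
  assumes "\<And>i j. i \<in> J \<Longrightarrow> j \<in> J \<Longrightarrow> cmod (G i j - q i j) \<le> d"
  shows "cmod (bform J G x x - bform J q x x) \<le> d * (\<Sum>i\<in>J. cmod (x i))\<^sup>2"
proof -
  have "cmod (bform J G x x - bform J q x x) = cmod (\<Sum>i\<in>J. \<Sum>j\<in>J. cnj (x i) * (G i j - q i j) * x j)"
    by (simp add: bform_def sum_subtractf algebra_simps)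
  also have "\<dots> \<le> (\<Sum>i\<in>J. \<Sum>j\<in>J. d * (cmod (x i) * cmod (x j)))"
  proof (intro sum_norm_le)
    fix i j assume "i \<in> J" "j \<in> J"
    hence "cmod (G i j - q i j) * (cmod (x i) * cmod (x j)) \<le> d * (cmod (x i) * cmod (x j))"
      by (intro mult_right_mono assms) auto
    thus "cmod (cnj (x i) * (G i j - q i j) * x j) \<le> d * (cmod (x i) * cmod (x j))"
      by (simp add: norm_mult mult_ac)
  qed
  also have "\<dots> = d * (\<Sum>i\<in>J. cmod (x i))\<^sup>2"
    by (simp add: power2_eq_square sum_product flip: sum_distrib_left)
  finally show ?thesis .
qed

lemma det_on_empty [simp]: "det_on {} q = 1"
proof -
  have "{p. p permutes ({} :: 'a set)} = {id}" by auto
  thus ?thesis by (simp add: det_on_def)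
qed

text \<open>In the nonsingular case this is the vector of \<open>schur_form\<close>. If
  \<open>q\<close> is already singular on \<open>J\<close>, both determinants vanish and the
  coordinate vector at \<open>j\<close> serves, so that the volume bound below covers singular
  matrices too.\<close>

lemma schur_vector:
  assumes J: "finite J" "j \<notin> J" and q: "psd (insert j J) q"
  obtains x d where "x j = 1" "bform (insert j J) q x x = complex_of_real d" "0 \<le> d"
    "Re (det_on (insert j J) q) = Re (det_on J q) * d"
proof (cases "pd J q")
  case True
  show ?thesis
  proof (rule schur_step[OF J q True])
    fix c d
    assume c: "\<And>i. i \<in> J \<Longrightarrow> q i j = (\<Sum>l\<in>J. q i l * c l)" "0 \<le> d"
      "q j j - (\<Sum>l\<in>J. q j l * c l) = complex_of_real d"
      "det_on (insert j J) q = det_on J q * complex_of_real d"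
    show thesis
      using schur_form[OF J c(1)] that[of "\<lambda>l. if l = j then 1 else - c l" d] c(2-4) by simp
  qed
next
  case False
  hence np: "\<not> pd (insert j J) q" using J by (auto intro: pd_subset)
  have "det_on (insert j J) q = 0" "det_on J q = 0"
    using not_pd_det_zero[OF _ q np] not_pd_det_zero[OF J(1) psd_subset[OF q] False] J by auto
  moreover have "Im (bform (insert j J) q (\<lambda>l. if l = j then 1 else 0) (\<lambda>l. if l = j then 1 else 0)) = 0"
    "0 \<le> Re (bform (insert j J) q (\<lambda>l. if l = j then 1 else 0) (\<lambda>l. if l = j then 1 else 0))"
    using q unfolding psd_def by blast+
  ultimately show ?thesis
    using that[of "\<lambda>l. if l = j then 1 else 0"
        "Re (bform (insert j J) q (\<lambda>l. if l = j then 1 else 0) (\<lambda>l. if l = j then 1 else 0))"]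
    by (simp add: complex_eq_iff)
qed

text \<open>Once the other vectors are chosen, the last one is confined to a ball: its sum with the
  combination prescribed by \<open>schur_vector\<close> has squared norm close to the Schur
  complement \<open>b\<close>. The ball has volume about \<open>b ^ n * vball n\<close>, and the
  determinant acquires the factor \<open>b\<close>.\<close>

lemma gram_volume_upper:
  assumes "finite J" "psd J q" "0 < e"
  shows "\<exists>d>0. \<forall>n. emeasure (tvol n J) (gset n J q d) \<le> ennreal ((Re (det_on J q) + e) ^ n * vball n ^ card J)"
  using assms
proof (induction J arbitrary: e rule: finite_induct)
  case empty
  have "emeasure (tvol n {}) (gset n {} q 1) = 1" for n
    by (rule emeasure_tvol_empty) (auto simp: gset_def space_PiM)
  moreover have "1 \<le> (1 + e) ^ n" for n using \<open>0 < e\<close> by (simp add: one_le_power)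
  ultimately show ?case by (intro exI[of _ 1]) (auto simp: ennreal_1[symmetric] simp del: ennreal_1 intro!: ennreal_leI)
next
  case (insert j J)
  have P: "psd J q" using insert.prems insert.hyps by (auto intro: psd_subset)
  obtain x b where x: "x j = 1" "bform (insert j J) q x x = complex_of_real b" "0 \<le> b"
    "Re (det_on (insert j J) q) = Re (det_on J q) * b"
    by (rule schur_vector[OF insert.hyps insert.prems(1)])
  define D where "D = Re (det_on J q)"
  have D: "0 \<le> D" unfolding D_def using insert.hyps P by (intro det_on_nonneg)
  \<comment> \<open>Splits the error so that \<open>(D + s) * (b + s)\<close> exceeds
    \<open>D * b\<close> by at most \<open>e\<close>; the bound \<open>s \<le> 1\<close> tames the
    quadratic term.\<close>
  define s where "s = min 1 (e / (D + b + 1))"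
  have s: "0 < s" "s \<le> 1" using D x(3) insert.prems(2) by (auto simp: s_def)
  have "s \<le> e / (D + b + 1)" by (simp add: s_def)
  hence "s * (D + b + 1) \<le> e" using D x(3) by (simp add: field_simps)
  moreover have "s * s \<le> s * 1" using s by (intro mult_left_mono) auto
  ultimately have se: "(D + s) * (b + s) \<le> D * b + e" by (simp add: algebra_simps)
  define X where "X = (\<Sum>i\<in>insert j J. cmod (x i))\<^sup>2"
  have X: "0 \<le> X" by (simp add: X_def)
  obtain d1 where d1: "0 < d1" "\<And>n. emeasure (tvol n J) (gset n J q d1) \<le> ennreal ((D + s) ^ n * vball n ^ card J)"
    using insert.IH[OF P s(1)] by (auto simp: D_def)
  define d where "d = min d1 (s / (X + 1))"
  have d: "0 < d" "d \<le> d1" using d1 s X by (auto simp: d_def)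
  have dX: "d * X \<le> s"
  proof -
    have "d * X \<le> s / (X + 1) * (X + 1)" using d s X by (intro mult_mono) (auto simp: d_def)
    thus ?thesis using X by simp
  qed
  show ?case
  proof (intro exI[of _ d] conjI allI d)
    fix n
    have bs: "0 < b + s" using s x(3) by simp
    have "emeasure (tvol n (insert j J)) (gset n (insert j J) q d)
        \<le> ennreal ((b + s) ^ n * vball n) * emeasure (tvol n J) (gset n J q d1)"
    proof (rule tvol_insert_upper[OF insert.hyps])
      fix Y y assume Y: "Y \<in> space (tvol n J)" "Y(j := y) \<in> gset n (insert j J) q d"
      show "Y \<in> gset n J q d1"
        unfolding gset_def
      proof (intro CollectI conjI ballI Y(1))
        fix i l assume il: "i \<in> J" "l \<in> J"
        hence "cmod (cip n ((Y(j := y)) i) ((Y(j := y)) l) - q i l) < d"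
          using Y(2) unfolding gset_def by blast
        thus "cmod (cip n (Y i) (Y l) - q i l) < d1" using il insert.hyps d(2) by (auto split: if_splits)
      qed
    next
      fix Y assume "Y \<in> gset n J q d1"
      let ?a = "\<lambda>l. - (\<Sum>i\<in>J. x i * Y i l)"
      have "{y. Y(j := y) \<in> gset n (insert j J) q d} \<subseteq> {y. cnorm n (\<lambda>l. y l - ?a l) \<le> sqrt (b + s)}"
      proof (intro subsetI CollectI)
        fix y assume "y \<in> {y. Y(j := y) \<in> gset n (insert j J) q d}"
        hence y: "Y(j := y) \<in> gset n (insert j J) q d" by simp
        define Z where "Z = Y(j := y)"
        have "(\<Sum>i\<in>J. x i * Z i l) = (\<Sum>i\<in>J. x i * Y i l)" for l
          by (intro sum.cong) (use insert.hyps in \<open>auto simp: Z_def\<close>)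
        hence comb: "(\<lambda>l. \<Sum>i\<in>insert j J. x i * Z i l) = (\<lambda>l. y l - ?a l)"
          using insert.hyps x(1) by (simp add: Z_def)
        have "cmod (cip n (Z i) (Z k) - q i k) \<le> d" if "i \<in> insert j J" "k \<in> insert j J" for i k
        proof -
          have "cmod (cip n (Z i) (Z k) - q i k) < d"
            using y that unfolding gset_def Z_def by blast
          thus ?thesis by simp
        qed
        hence "cmod (bform (insert j J) (\<lambda>i j. cip n (Z i) (Z j)) x x - bform (insert j J) q x x) \<le> d * X"
          unfolding X_def by (rule bform_close)
        hence "\<bar>Re (bform (insert j J) (\<lambda>i j. cip n (Z i) (Z j)) x x - bform (insert j J) q x x)\<bar> \<le> s"
          by (rule order_trans[OF abs_Re_le_cmod order_trans[OF _ dX]])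
        hence "Re (cip n (\<lambda>l. y l - ?a l) (\<lambda>l. y l - ?a l)) \<le> b + s"
          unfolding comb[symmetric] cip_combination x(2) by (auto simp: abs_le_iff)
        hence "(cnorm n (\<lambda>l. y l - ?a l))\<^sup>2 \<le> b + s" unfolding Re_cip_self .
        thus "cnorm n (\<lambda>l. y l - ?a l) \<le> sqrt (b + s)" by (rule real_le_rsqrt)
      qed
      hence "emeasure (cvol n) {y. Y(j := y) \<in> gset n (insert j J) q d}
          \<le> emeasure (cvol n) {y. cnorm n (\<lambda>l. y l - ?a l) \<le> sqrt (b + s)}"
        by (rule emeasure_mono) (simp only: sets_cvol cball_borel)
      also have "\<dots> = ennreal (sqrt (b + s) ^ (2 * n) * vball n)"
        by (rule emeasure_cvol_cball) (use bs in simp)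
      also have "sqrt (b + s) ^ (2 * n) = (b + s) ^ n"
        using bs by (simp add: power_mult)
      finally show "emeasure (cvol n) {y. Y(j := y) \<in> gset n (insert j J) q d} \<le> ennreal ((b + s) ^ n * vball n)" .
    qed (use insert.hyps in \<open>auto intro: sets_gset\<close>)
    also have "\<dots> \<le> ennreal ((b + s) ^ n * vball n) * ennreal ((D + s) ^ n * vball n ^ card J)"
      by (intro mult_left_mono d1) auto
    also have "\<dots> = ennreal (((D + s) * (b + s)) ^ n * vball n ^ card (insert j J))"
      using bs insert.hyps D s by (subst ennreal_mult[symmetric]) (auto simp: power_mult_distrib mult_ac)
    also have "\<dots> \<le> ennreal ((Re (det_on (insert j J) q) + e) ^ n * vball n ^ card (insert j J))"
      using se D s x(3) by (intro ennreal_leI mult_right_mono power_mono) (auto simp: x(4) D_def)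
    finally show "emeasure (tvol n (insert j J)) (gset n (insert j J) q d)
      \<le> ennreal ((Re (det_on (insert j J) q) + e) ^ n * vball n ^ card (insert j J))" .
  qed
qed

lemma cmod_norm_square_cross:
  assumes "\<And>l. y l = a l + z l"
  shows "cip n y y = cip n a a + cip n a z + cnj (cip n a z) + cip n z z"
proof -
  have "y = (\<lambda>l. a l + z l)" using assms by auto
  thus ?thesis by (simp add: cip_linear cip_commute[of n z a])
qed

text \<open>The last vector is the combination \<open>c\<close> of the others plus a vector
  \<open>z\<close> near the sphere of radius \<open>sqrt b\<close> and nearly orthogonal to them. At
  least half of the ball consists of such \<open>z\<close>, and the halves cost only the constant
  factor \<open>(1/2) ^ card J\<close>.\<close>

lemma gram_volume_lower:
  assumes "finite J" "psd J q" "pd J q" "0 < d"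
  shows "\<exists>n0. \<forall>n\<ge>n0. ennreal ((1/2) ^ card J * Re (det_on J q) ^ n * vball n ^ card J)
    \<le> emeasure (tvol n J) (gset n J q d)"
  using assms
proof (induction J arbitrary: d rule: finite_induct)
  case empty
  have "emeasure (tvol n {}) (gset n {} q d) = 1" for n
    by (rule emeasure_tvol_empty) (auto simp: gset_def space_PiM)
  thus ?case by simp
next
  case (insert j J)
  have P: "psd J q" "pd J q"
    using insert.prems insert.hyps by (auto intro: psd_subset pd_subset)
  have herm: "q i k = cnj (q k i)" if "i \<in> insert j J" "k \<in> insert j J" for i k
    by (rule psd_hermitian[OF insert.prems(1)]) (use that insert.hyps in auto)
  obtain c b where c: "\<And>i. i \<in> J \<Longrightarrow> q i j = (\<Sum>l\<in>J. q i l * c l)"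
    and qjj: "q j j - (\<Sum>l\<in>J. q j l * c l) = complex_of_real b"
    and det: "det_on (insert j J) q = det_on J q * complex_of_real b" and b: "0 < b"
  proof (rule schur_step[OF insert.hyps insert.prems(1) P(2)])
    fix c d
    assume "\<And>i. i \<in> J \<Longrightarrow> q i j = (\<Sum>l\<in>J. q i l * c l)"
      "q j j - (\<Sum>l\<in>J. q j l * c l) = complex_of_real d"
      "det_on (insert j J) q = det_on J q * complex_of_real d" "pd (insert j J) q \<Longrightarrow> 0 < d"
    thus thesis using that[of c d] insert.prems(2) by blast
  qed
  have qcc: "bform J q c c = (\<Sum>l\<in>J. q j l * c l)"
  proof -
    have "bform J q c c = (\<Sum>i\<in>J. cnj (c i) * q i j)"
      unfolding bform_rows by (intro sum.cong refl) (simp add: c)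
    also have "\<dots> = cnj (\<Sum>l\<in>J. q j l * c l)"
      unfolding cnj_sum by (intro sum.cong refl) (subst herm, auto simp: mult.commute)
    finally have "cnj (bform J q c c) = (\<Sum>l\<in>J. q j l * c l)" by simp
    moreover have "cnj (bform J q c c) = bform J q c c"
      using P(1) unfolding psd_def by (simp add: complex_eq_iff)
    ultimately show ?thesis by simp
  qed
  define C where "C = (\<Sum>i\<in>J. cmod (c i))"
  have C: "0 \<le> C" by (simp add: C_def sum_nonneg)
  \<comment> \<open>The new diagonal entry has error at most \<open>(1 + C)\<^sup>2 * e\<close>,
    with \<open>C\<close> the sum of the moduli of the coefficients; the off-diagonal entries have
    error at most \<open>(1 + C) * e\<close>.\<close>
  define e where "e = min 1 (d / (2 * (1 + C)\<^sup>2))"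
  have e: "0 < e" "e \<le> 1" using C insert.prems(3) by (auto simp: e_def)
  have e2: "(1 + C)\<^sup>2 * e < d"
  proof -
    have "(1 + C)\<^sup>2 * e \<le> (1 + C)\<^sup>2 * (d / (2 * (1 + C)\<^sup>2))" by (intro mult_left_mono) (auto simp: e_def)
    also have "\<dots> = d / 2" using C by simp
    finally show ?thesis using insert.prems(3) by simp
  qed
  have e1: "(1 + C) * e < d"
  proof -
    have "(1 + C) * e \<le> (1 + C)\<^sup>2 * e"
      using C e by (intro mult_right_mono self_le_power) auto
    thus ?thesis using e2 by simp
  qed
  have e0: "e < d"
  proof -
    have "1 * e \<le> (1 + C) * e" using C e by (intro mult_right_mono) auto
    thus ?thesis using e1 by simp
  qed
  define R where "R = 1 + (\<Sum>i\<in>J. cmod (q i i))"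
  obtain n1 where n1: "\<And>n. n \<ge> n1 \<Longrightarrow> ennreal ((1/2) ^ card J * Re (det_on J q) ^ n * vball n ^ card J)
    \<le> emeasure (tvol n J) (gset n J q e)"
    using insert.IH[OF P e(1)] by auto
  have sb: "0 < sqrt b" using b by simp
  obtain n2 where n2: "\<And>n K a. n \<ge> n2 \<Longrightarrow> finite K \<Longrightarrow> card K \<le> card J \<Longrightarrow> (\<forall>y\<in>K. cnorm n y \<le> R) \<Longrightarrow>
    ennreal (1/2 * (sqrt b ^ (2 * n) * vball n)) \<le>
    emeasure (cvol n) {x. cnorm n (\<lambda>l. x l - a l) \<le> sqrt b \<and> (sqrt b)\<^sup>2 - e \<le> (cnorm n (\<lambda>l. x l - a l))\<^sup>2 \<and>
      (\<forall>y\<in>K. cmod (cip n y (\<lambda>l. x l - a l)) < e)}"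
    using ball_mostly_orthogonal_shell[OF sb e(1), of "card J" R] by blast
  have sq: "sqrt b ^ (2 * n) = b ^ n" "(sqrt b)\<^sup>2 = b" for n using b by (simp_all add: power_mult)
  show ?case
  proof (intro exI[of _ "max n1 n2"] allI impI)
    fix n assume n: "max n1 n2 \<le> n"
    have D0: "0 \<le> Re (det_on J q)" using insert.hyps P by (intro det_on_nonneg)
    have "ennreal ((1/2) ^ card (insert j J) * Re (det_on (insert j J) q) ^ n * vball n ^ card (insert j J))
      = ennreal (1/2 * (b ^ n * vball n)) * ennreal ((1/2) ^ card J * Re (det_on J q) ^ n * vball n ^ card J)"
      using insert.hyps b D0 by (subst ennreal_mult[symmetric]) (auto simp: det power_mult_distrib mult_ac)
    also have "\<dots> \<le> ennreal (1/2 * (b ^ n * vball n)) * emeasure (tvol n J) (gset n J q e)"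
      using n by (intro mult_left_mono n1) auto
    also have "\<dots> \<le> emeasure (tvol n (insert j J)) (gset n (insert j J) q d)"
    proof (rule tvol_insert_lower[OF insert.hyps])
      fix Y assume Y: "Y \<in> gset n J q e"
      let ?a = "\<lambda>l. \<Sum>i\<in>J. c i * Y i l"
      let ?S = "{x. cnorm n (\<lambda>l. x l - ?a l) \<le> sqrt b \<and> (sqrt b)\<^sup>2 - e \<le> (cnorm n (\<lambda>l. x l - ?a l))\<^sup>2 \<and>
        (\<forall>y\<in>Y ` J. cmod (cip n y (\<lambda>l. x l - ?a l)) < e)}"
      have YJ: "cmod (cip n (Y i) (Y k) - q i k) < e" if "i \<in> J" "k \<in> J" for i k
        using Y that by (auto simp: gset_def)
      have "?S \<subseteq> {y. Y(j := y) \<in> gset n (insert j J) q d}"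
      proof (intro subsetI CollectI)
        fix y assume y: "y \<in> ?S"
        define z where "z = (\<lambda>l. y l - ?a l)"
        have z: "cnorm n z \<le> sqrt b" "b - e \<le> (cnorm n z)\<^sup>2" "\<And>i. i \<in> J \<Longrightarrow> cmod (cip n (Y i) z) < e"
          using y by (auto simp: z_def sq)
        have yz: "y = (\<lambda>l. ?a l + z l)" by (simp add: z_def)
        have cross: "cmod (cip n (Y i) y - q i j) < d" if i: "i \<in> J" for i
        proof -
          have "cip n (Y i) y - q i j = (\<Sum>l\<in>J. c l * (cip n (Y i) (Y l) - q i l)) + cip n (Y i) z"
            unfolding yz cip_add_right cip_sum_right cip_scale_right c[OF i]
            by (simp add: sum_subtractf algebra_simps)
          also have "cmod \<dots> \<le> (\<Sum>l\<in>J. cmod (c l) * e) + e"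
          proof (intro norm_triangle_mono sum_norm_le)
            show "cmod (c l * (cip n (Y i) (Y l) - q i l)) \<le> cmod (c l) * e" if "l \<in> J" for l
              using YJ[OF i that] by (simp add: norm_mult mult_left_mono)
            show "cmod (cip n (Y i) z) \<le> e" using z(3)[OF i] by simp
          qed
          also have "\<dots> = (1 + C) * e" by (simp add: C_def distrib_right sum_distrib_right)
          finally show ?thesis using e1 by simp
        qed
        have cross': "cmod (cip n y (Y i) - q j i) < d" if i: "i \<in> J" for i
        proof -
          have "cip n y (Y i) - q j i = cnj (cip n (Y i) y - q i j)"
            using i by (subst cip_commute, subst herm) auto
          thus ?thesis using cross[OF i] by (simp only: complex_mod_cnj)
        qed
        have self: "cmod (cip n y y - q j j) < d"
        proof -
          have az: "cmod (cip n ?a z) \<le> C * e"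
          proof -
            have "cip n ?a z = (\<Sum>i\<in>J. cnj (c i) * cip n (Y i) z)"
              unfolding cip_sum_left cip_scale_left ..
            also have "cmod \<dots> \<le> (\<Sum>i\<in>J. cmod (c i) * e)"
            proof (rule sum_norm_le)
              show "cmod (cnj (c i) * cip n (Y i) z) \<le> cmod (c i) * e" if "i \<in> J" for i
                using z(3)[OF that] by (simp add: norm_mult mult_left_mono)
            qed
            finally show ?thesis by (simp add: C_def sum_distrib_right)
          qed
          have aa: "cmod (cip n ?a ?a - bform J q c c) \<le> e * C\<^sup>2"
            unfolding cip_combination C_def by (rule bform_close) (use YJ in \<open>auto intro: less_imp_le\<close>)
          have zz: "cmod (cip n z z - of_real b) \<le> e"
          proof -
            have "(cnorm n z)\<^sup>2 \<le> (sqrt b)\<^sup>2" using z(1) by (intro power_mono) auto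
            hence "\<bar>(cnorm n z)\<^sup>2 - b\<bar> \<le> e" using z(2) e by (auto simp: sq)
            thus ?thesis unfolding cip_self of_real_diff[symmetric] norm_of_real .
          qed
          have "cip n y y - q j j = (cip n ?a ?a - bform J q c c) + (cip n ?a z + cnj (cip n ?a z)) + (cip n z z - of_real b)"
            using qjj cmod_norm_square_cross[of y ?a z n] qcc by (simp add: z_def algebra_simps)
          also have "cmod \<dots> \<le> e * C\<^sup>2 + (C * e + C * e) + e"
            by (intro norm_triangle_mono aa zz) (simp_all only: az complex_mod_cnj)
          also have "\<dots> = (1 + C)\<^sup>2 * e" by (simp add: power2_eq_square algebra_simps)
          finally show ?thesis using e2 by simp
        qed
        have "Y \<in> space (tvol n J)" using Y by (simp add: gset_def)
        hence "Y(j := y) \<in> space (tvol n (insert j J))" by (auto simp: space_PiM intro!: PiE_fun_upd)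
        moreover have "cmod (cip n ((Y(j := y)) i) ((Y(j := y)) k) - q i k) < d"
          if "i \<in> insert j J" "k \<in> insert j J" for i k
          using that cross[of i] cross'[of k] self YJ[of i k] e0 insert.hyps
          by (cases "i = j"; cases "k = j") auto
        ultimately show "Y(j := y) \<in> gset n (insert j J) q d" unfolding gset_def by blast
      qed
      moreover have "{y. Y(j := y) \<in> gset n (insert j J) q d} \<in> sets (cvol n)"
      proof -
        have "(\<lambda>y. Y(j := y)) \<in> measurable (cvol n) (tvol n (insert j J))"
          using measurable_fun_upd[of "insert j J" J j "\<lambda>_. Y" "cvol n" "\<lambda>_. cvol n" "\<lambda>y. y"] Y
          by (auto simp: gset_def)
        from measurable_sets[OF this sets_gset] insert.hyps show ?thesis
          by (simp add: vimage_def)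
      qed
      ultimately have "emeasure (cvol n) ?S \<le> emeasure (cvol n) {y. Y(j := y) \<in> gset n (insert j J) q d}"
        by (rule emeasure_mono)
      moreover have "ennreal (1/2 * (sqrt b ^ (2 * n) * vball n)) \<le> emeasure (cvol n) ?S"
        using n gset_norm[OF Y e(2) _ insert.hyps(1)] insert.hyps(1)
        by (intro n2) (auto simp: R_def card_image_le)
      ultimately show "ennreal (1/2 * (b ^ n * vball n)) \<le> emeasure (cvol n) {y. Y(j := y) \<in> gset n (insert j J) q d}"
        unfolding sq by (rule order_trans[rotated])
    qed (use insert.hyps in \<open>auto intro: sets_gset\<close>)
    finally show "ennreal ((1/2) ^ card (insert j J) * Re (det_on (insert j J) q) ^ n * vball n ^ card (insert j J))
      \<le> emeasure (tvol n (insert j J)) (gset n (insert j J) q d)" .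
  qed
qed

text \<open>For a constant proportion of the noise of radius \<open>h\<close>, the noise vectors are
  nearly orthogonal to the centres and to one another and have norm nearly \<open>h\<close>, so the
  Gram matrix grows by \<open>h\<^sup>2\<close> times the identity. The threshold for
  \<open>n\<close> is uniform in the centres, which in the application are rotated by a random
  unitary.\<close>

lemma noisy_gram_volume:
  fixes J :: "'a set"
  assumes J: "finite J" and h: "0 < h" and d: "0 < d"
  shows "\<exists>n0. \<forall>n\<ge>n0. \<forall>A. (\<forall>j\<in>J. cnorm n (A j) \<le> R) \<longrightarrow>
    ennreal ((1/2 * (h ^ (2 * n) * vball n)) ^ card J) \<le>
    emeasure (tvol n J) {B \<in> space (tvol n J). (\<forall>j\<in>J. cnorm n (\<lambda>l. B j l - A j l) \<le> h) \<and>
      (\<forall>i\<in>J. \<forall>j\<in>J. cmod (cip n (B i) (B j) - (cip n (A i) (A j) + (if i = j then of_real (h\<^sup>2) else 0))) < d)}"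
proof -
  define e where "e = d / 3"
  have e: "0 < e" "3 * e = d" using d by (auto simp: e_def)
  obtain n0 where n0: "\<And>n K a. n \<ge> n0 \<Longrightarrow> finite K \<Longrightarrow> card K \<le> 2 * card J \<Longrightarrow> (\<forall>y\<in>K. cnorm n y \<le> max R h) \<Longrightarrow>
    ennreal (1/2 * (h ^ (2 * n) * vball n)) \<le>
    emeasure (cvol n) {x. cnorm n (\<lambda>l. x l - a l) \<le> h \<and> h\<^sup>2 - e \<le> (cnorm n (\<lambda>l. x l - a l))\<^sup>2 \<and>
      (\<forall>y\<in>K. cmod (cip n y (\<lambda>l. x l - a l)) < e)}"
    using ball_mostly_orthogonal_shell[OF h e(1), of "2 * card J" "max R h"] by blast
  show ?thesis
  proof (intro exI[of _ n0] allI impI)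
    fix n and A :: "'a \<Rightarrow> cvec" assume n: "n0 \<le> n" and A: "\<forall>j\<in>J. cnorm n (A j) \<le> R"
    define xi where "xi B j = (\<lambda>l. B j l - A j l)" for B :: "'a \<Rightarrow> cvec" and j
    \<comment> \<open>Only vectors indexed by \<open>I\<close> have been chosen, yet orthogonality
      is demanded against the centres for all of \<open>J\<close>. The next vector is thus tested
      against at most \<open>2 * card J\<close> vectors of norm at most
      \<open>max R h\<close>.\<close>
    define N where "N I = {B \<in> space (tvol n I). (\<forall>j\<in>I. cnorm n (xi B j) \<le> h \<and> h\<^sup>2 - e \<le> (cnorm n (xi B j))\<^sup>2 \<and>
      (\<forall>i\<in>J. cmod (cip n (A i) (xi B j)) < e) \<and> (\<forall>i\<in>I. i \<noteq> j \<longrightarrow> cmod (cip n (xi B i) (xi B j)) < e))}" for I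
    have Nm: "N I \<in> sets (tvol n I)" if "finite I" for I
      unfolding N_def xi_def using that J by measurable
    have sym: "cmod (cip n x y) = cmod (cip n y x)" for x y
      by (subst cip_commute) (simp only: complex_mod_cnj)
    have "ennreal ((1/2 * (h ^ (2 * n) * vball n)) ^ card I) \<le> emeasure (tvol n I) (N I)"
      if "finite I" "I \<subseteq> J" for I
      using that
    proof (induction I rule: finite_induct)
      case empty
      have "emeasure (tvol n {}) (N {}) = 1"
        by (rule emeasure_tvol_empty) (auto simp: N_def space_PiM)
      thus ?case by simp
    next
      case (insert j I)
      have "ennreal ((1/2 * (h ^ (2 * n) * vball n)) ^ card (insert j I))
        = ennreal (1/2 * (h ^ (2 * n) * vball n)) * ennreal ((1/2 * (h ^ (2 * n) * vball n)) ^ card I)"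
        using insert.hyps h by (subst ennreal_mult[symmetric]) auto
      also have "\<dots> \<le> ennreal (1/2 * (h ^ (2 * n) * vball n)) * emeasure (tvol n I) (N I)"
        using insert by (intro mult_left_mono) auto
      also have "\<dots> \<le> emeasure (tvol n (insert j I)) (N (insert j I))"
      proof (rule tvol_insert_lower[OF insert.hyps])
        fix B assume B: "B \<in> N I"
        let ?K = "A ` J \<union> xi B ` I"
        let ?S = "{x. cnorm n (\<lambda>l. x l - A j l) \<le> h \<and> h\<^sup>2 - e \<le> (cnorm n (\<lambda>l. x l - A j l))\<^sup>2 \<and>
          (\<forall>y\<in>?K. cmod (cip n y (\<lambda>l. x l - A j l)) < e)}"
        have cardK: "card ?K \<le> 2 * card J"
        proof -
          have "card ?K \<le> card (A ` J) + card (xi B ` I)" by (rule card_Un_le)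
          also have "\<dots> \<le> card J + card I"
            using J insert.hyps by (intro add_mono card_image_le)
          also have "card I \<le> card J" using insert.prems J by (intro card_mono) auto
          finally show ?thesis by simp
        qed
        have "?S \<subseteq> {y. B(j := y) \<in> N (insert j I)}"
        proof (intro subsetI CollectI)
          fix y assume y: "y \<in> ?S"
          have x1: "xi (B(j := y)) j = (\<lambda>l. y l - A j l)" by (simp add: xi_def)
          have x2: "xi (B(j := y)) i = xi B i" if "i \<in> I" for i
            using that insert.hyps by (auto simp: xi_def)
          have sp: "B(j := y) \<in> space (tvol n (insert j I))"
            using B by (auto simp: N_def space_PiM intro!: PiE_fun_upd)
          have new: "cmod (cip n (xi B i) (\<lambda>l. y l - A j l)) < e" if "i \<in> I" for i
            using y that by auto
          have old: "cnorm n (xi B i) \<le> h" "h\<^sup>2 - e \<le> (cnorm n (xi B i))\<^sup>2" if "i \<in> I" for i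
            using B that by (auto simp: N_def)
          have oldA: "cmod (cip n (A k) (xi B i)) < e" if "i \<in> I" "k \<in> J" for i k
            using B that by (auto simp: N_def)
          have oldI: "cmod (cip n (xi B k) (xi B i)) < e" if "i \<in> I" "k \<in> I" "k \<noteq> i" for i k
            using B that by (auto simp: N_def)
          show "B(j := y) \<in> N (insert j I)"
            unfolding N_def
          proof (intro CollectI conjI ballI sp impI)
            fix i assume i: "i \<in> insert j I"
            show "cnorm n (xi (B(j := y)) i) \<le> h" "h\<^sup>2 - e \<le> (cnorm n (xi (B(j := y)) i))\<^sup>2"
              using i y old by (auto simp: x1 x2)
            show "cmod (cip n (A k) (xi (B(j := y)) i)) < e" if "k \<in> J" for k
              using i y oldA that by (auto simp: x1 x2)
            show "cmod (cip n (xi (B(j := y)) k) (xi (B(j := y)) i)) < e" if k: "k \<in> insert j I" "k \<noteq> i" for k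
            proof (cases "i = j")
              case True
              thus ?thesis using k new by (auto simp: x1 x2)
            next
              case False
              hence iI: "i \<in> I" using i by simp
              show ?thesis
              proof (cases "k = j")
                case True
                show ?thesis unfolding True x1 x2[OF iI] by (subst sym) (rule new[OF iI])
              next
                case False
                thus ?thesis using k iI oldI[of i k] by (simp add: x2)
              qed
            qed
          qed
        qed
        moreover have "{y. B(j := y) \<in> N (insert j I)} \<in> sets (cvol n)"
        proof -
          have "(\<lambda>y. B(j := y)) \<in> measurable (cvol n) (tvol n (insert j I))"
            using measurable_fun_upd[of "insert j I" I j "\<lambda>_. B" "cvol n" "\<lambda>_. cvol n" "\<lambda>y. y"] B
            by (auto simp: N_def)
          from measurable_sets[OF this Nm] insert.hyps show ?thesis
            by (simp add: vimage_def)
        qed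
        ultimately have "emeasure (cvol n) ?S \<le> emeasure (cvol n) {y. B(j := y) \<in> N (insert j I)}"
          by (rule emeasure_mono)
        moreover have "ennreal (1/2 * (h ^ (2 * n) * vball n)) \<le> emeasure (cvol n) ?S"
        proof (rule n0[OF n _ cardK])
          show "\<forall>y\<in>?K. cnorm n y \<le> max R h" using A B by (auto simp: N_def le_max_iff_disj)
        qed (use J insert.hyps in auto)
        ultimately show "ennreal (1/2 * (h ^ (2 * n) * vball n)) \<le> emeasure (cvol n) {y. B(j := y) \<in> N (insert j I)}"
          by (rule order_trans[rotated])
      qed (use insert.hyps in \<open>auto intro: Nm\<close>)
      finally show ?case .
    qed
    hence "ennreal ((1/2 * (h ^ (2 * n) * vball n)) ^ card J) \<le> emeasure (tvol n J) (N J)" using J by blast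
    also have "\<dots> \<le> emeasure (tvol n J) {B \<in> space (tvol n J). (\<forall>j\<in>J. cnorm n (\<lambda>l. B j l - A j l) \<le> h) \<and>
      (\<forall>i\<in>J. \<forall>j\<in>J. cmod (cip n (B i) (B j) - (cip n (A i) (A j) + (if i = j then of_real (h\<^sup>2) else 0))) < d)}"
    proof (rule emeasure_mono)
      show "N J \<subseteq> {B \<in> space (tvol n J). (\<forall>j\<in>J. cnorm n (\<lambda>l. B j l - A j l) \<le> h) \<and>
        (\<forall>i\<in>J. \<forall>j\<in>J. cmod (cip n (B i) (B j) - (cip n (A i) (A j) + (if i = j then of_real (h\<^sup>2) else 0))) < d)}"
      proof (intro subsetI CollectI conjI ballI)
        fix B assume B: "B \<in> N J"
        show "B \<in> space (tvol n J)" using B by (simp add: N_def)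
        show "cnorm n (\<lambda>l. B j l - A j l) \<le> h" if "j \<in> J" for j
          using B that by (auto simp: N_def xi_def)
        fix i j assume ij: "i \<in> J" "j \<in> J"
        have Bi: "B k = (\<lambda>l. A k l + xi B k l)" for k by (simp add: xi_def)
        define w where "w = cip n (xi B i) (xi B j) - (if i = j then complex_of_real (h\<^sup>2) else 0)"
        have w: "cmod w \<le> e"
        proof (cases "i = j")
          case True
          have b: "h\<^sup>2 - e \<le> (cnorm n (xi B j))\<^sup>2" "cnorm n (xi B j) \<le> h"
            using B ij by (auto simp: N_def)
          have "(cnorm n (xi B j))\<^sup>2 \<le> h\<^sup>2" using b(2) by (intro power_mono) auto
          hence "\<bar>(cnorm n (xi B j))\<^sup>2 - h\<^sup>2\<bar> \<le> e" using b(1) e by auto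
          moreover have "w = of_real ((cnorm n (xi B j))\<^sup>2 - h\<^sup>2)" using True by (simp add: w_def cip_self)
          ultimately show ?thesis by (simp only: norm_of_real)
        next
          case False
          have "cmod (cip n (xi B i) (xi B j)) < e" using B ij False unfolding N_def by blast
          thus ?thesis using False by (simp add: w_def)
        qed
        have a1: "cmod (cip n (A i) (xi B j)) < e" using B ij unfolding N_def by blast
        have "cmod (cip n (A j) (xi B i)) < e" using B ij unfolding N_def by blast
        hence a2: "cmod (cip n (xi B i) (A j)) < e" by (subst sym)
        have "cip n (B i) (B j) - (cip n (A i) (A j) + (if i = j then of_real (h\<^sup>2) else 0))
          = cip n (A i) (xi B j) + cip n (xi B i) (A j) + w"
          by (subst (1 2) Bi) (simp add: cip_linear w_def)
        moreover have "cmod (cip n (A i) (xi B j) + cip n (xi B i) (A j) + w) < 3 * e"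
          using a1 a2 w norm_triangle_ineq[of "cip n (A i) (xi B j) + cip n (xi B i) (A j)" w]
            norm_triangle_ineq[of "cip n (A i) (xi B j)" "cip n (xi B i) (A j)"] by linarith
        ultimately show "cmod (cip n (B i) (B j) - (cip n (A i) (A j) + (if i = j then of_real (h\<^sup>2) else 0))) < d"
          unfolding e(2) by simp
      qed
    qed (use J in measurable)
    finally show "ennreal ((1/2 * (h ^ (2 * n) * vball n)) ^ card J) \<le>
      emeasure (tvol n J) {B \<in> space (tvol n J). (\<forall>j\<in>J. cnorm n (\<lambda>l. B j l - A j l) \<le> h) \<and>
      (\<forall>i\<in>J. \<forall>j\<in>J. cmod (cip n (B i) (B j) - (cip n (A i) (A j) + (if i = j then of_real (h\<^sup>2) else 0))) < d)}" .
  qed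
qed

section \<open>Complex reflections and alignment of tuples\<close>

text \<open>For a unit vector \<open>v\<close> this multiplies \<open>v\<close> by \<open>z\<close>
  and fixes its orthogonal complement. The entries are affine in \<open>z\<close>, which makes
  rotations analytic later on.\<close>

definition creflect :: "nat \<Rightarrow> cvec \<Rightarrow> complex \<Rightarrow> cmat" where
  "creflect n v z = (\<lambda>i j. if i < n \<and> j < n then (if i = j then 1 else 0) + (z - 1) * v i * cnj (v j) else 0)"

lemma creflect_mmul:
  assumes "cnorm n v = 1"
  shows "mmul n (creflect n v z) (creflect n v w) = creflect n v (z * w)"
proof (intro ext)
  fix i j
  have vv: "(\<Sum>l<n. cnj (v l) * v l) = 1" using cip_self[of n v] assms by (simp add: cip_def)
  show "mmul n (creflect n v z) (creflect n v w) i j = creflect n v (z * w) i j"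
  proof (cases "i < n \<and> j < n")
    case True
    have "mmul n (creflect n v z) (creflect n v w) i j
      = (\<Sum>l<n. (if i = l then (if l = j then 1 else 0) else 0) + (if i = l then (w - 1) * v l * cnj (v j) else 0)
          + (if l = j then (z - 1) * v i * cnj (v l) else 0)
          + (z - 1) * (w - 1) * v i * cnj (v j) * (cnj (v l) * v l))"
      unfolding mmul_def by (intro sum.cong refl) (use True in \<open>auto simp: creflect_def algebra_simps\<close>)
    also have "\<dots> = (if i = j then 1 else 0) + (w - 1) * v i * cnj (v j) + (z - 1) * v i * cnj (v j)
        + (z - 1) * (w - 1) * v i * cnj (v j)"
      unfolding sum.distrib sum_distrib_left[symmetric] vv using True by simp
    finally show ?thesis using True by (simp add: creflect_def algebra_simps)
  qed (auto simp: mmul_def creflect_def intro!: sum.neutral)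
qed

lemma creflect_one: "creflect n v 1 = ident n"
  by (auto simp: creflect_def ident_def fun_eq_iff)

lemma adj_creflect: "adj (creflect n v z) = creflect n v (cnj z)"
  by (auto simp: creflect_def adj_def fun_eq_iff)

lemma supp_in_creflect: "supp_in n n (creflect n v z)"
  by (auto simp: supp_in_def creflect_def)

lemma unitary_creflect:
  assumes "cnorm n v = 1" "cmod z = 1"
  shows "creflect n v z \<in> unitary_set n"
proof -
  have "cnj z * z = 1" using assms(2) by (simp add: complex_norm_square[symmetric] mult.commute)
  thus ?thesis by (simp add: unitary_set_def supp_in_creflect adj_creflect creflect_mmul[OF assms(1)] creflect_one)
qed

lemma mv_creflect: "i < n \<Longrightarrow> mv n (creflect n v z) x i = x i + (z - 1) * cip n v x * v i"
proof -
  assume i: "i < n"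
  have "mv n (creflect n v z) x i = (\<Sum>l<n. (if i = l then x l else 0) + (z - 1) * v i * (cnj (v l) * x l))"
    unfolding mv_def by (intro sum.cong refl) (use i in \<open>auto simp: creflect_def algebra_simps\<close>)
  thus ?thesis using i by (simp add: sum.distrib cip_def sum_distrib_left sum_distrib_right mult_ac)
qed

text \<open>Recording a unitary as a product of one-parameter reflections allows it to be undone one
  rotation at a time in the argument on zero sets. Up to closure nothing is lost, see
  \<open>reflgrp_dense\<close>.\<close>

inductive_set reflgrp :: "nat \<Rightarrow> cmat set" for n where
  ident: "ident n \<in> reflgrp n"
| step: "W \<in> reflgrp n \<Longrightarrow> cnorm n v = 1 \<Longrightarrow> mmul n (creflect n v (cis t)) W \<in> reflgrp n"

lemma reflgrp_unitary: "W \<in> reflgrp n \<Longrightarrow> W \<in> unitary_set n"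
proof (induction rule: reflgrp.induct)
  case (step W v t)
  show ?case by (intro unitary_mmul unitary_creflect step) simp
qed (rule unitary_ident)

text \<open>Vectors of nearly equal norm are nearly exchanged by a reflection in the direction of
  their difference; it hardly moves vectors nearly orthogonal to that difference.\<close>
lemma reflection_step:
  fixes x y :: cvec and e d :: real
  assumes e: "0 < e" and u: "e < cnorm n (\<lambda>l. y l - x l)" and d: "d < e\<^sup>2"
    and close: "\<bar>(cnorm n y)\<^sup>2 - (cnorm n x)\<^sup>2\<bar> \<le> d"
  obtains v t where "cnorm n v = 1" "cnorm n (\<lambda>l. mv n (creflect n v (cis t)) x l - y l) \<le> d / e"
    "\<forall>a. cnorm n (\<lambda>l. mv n (creflect n v (cis t)) a l - a l) \<le> 2 * cmod (cip n (\<lambda>l. y l - x l) a) / e"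
proof -
  define u where "u = (\<lambda>l. y l - x l)"
  define s where "s = cnorm n u"
  have s: "e < s" using u by (simp add: s_def u_def)
  have s0: "0 < s" using s e by simp
  define c where "c = cip n u x"
  define d' where "d' = (cnorm n y)\<^sup>2 - (cnorm n x)\<^sup>2"
  have d': "\<bar>d'\<bar> \<le> d" using close by (simp add: d'_def)
  have yu: "y = (\<lambda>l. u l + x l)" by (simp add: u_def)
  have rel: "s\<^sup>2 + 2 * Re c = d'"
  proof -
    have "Re (cip n y y) = Re (cip n u u) + 2 * Re (cip n u x) + Re (cip n x x)"
      unfolding yu by (simp add: cip_linear cip_commute[of n x u])
    thus ?thesis unfolding Re_cip_self by (simp add: s_def c_def d'_def)
  qed
  have "d' < s\<^sup>2"
  proof -
    have "e\<^sup>2 < s\<^sup>2" using s e by (intro power_strict_mono) auto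
    thus ?thesis using d' d by linarith
  qed
  hence c0: "c \<noteq> 0" using rel by auto
  \<comment> \<open>The phase for which \<open>(z - 1) * c\<close> becomes the real number
    \<open>- 2 * Re c\<close>, that is \<open>s\<^sup>2 - d'\<close>. The reflection then moves
    \<open>x\<close> by almost exactly \<open>u\<close>.\<close>
  define z where "z = - cnj c / c"
  have nz: "cmod z = 1" using c0 by (simp add: z_def norm_divide)
  have "z = cis (Arg z)" using cis_Arg[of z] nz by (metis complex_sgn_def norm_zero one_neq_zero scaleR_one inverse_1 sgn_eq div_by_1 of_real_1)
  then obtain t where t: "z = cis t" by blast
  have zc: "(z - 1) * c = of_real (s\<^sup>2 - d')"
  proof -
    have "(z - 1) * c = - (cnj c + c)" using c0 by (simp add: z_def field_simps)
    also have "\<dots> = of_real (- 2 * Re c)" by (simp add: complex_eq_iff)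
    also have "- 2 * Re c = s\<^sup>2 - d'" using rel by simp
    finally show ?thesis .
  qed
  define v where "v = (\<lambda>l. complex_of_real (1 / s) * u l)"
  have v: "cnorm n v = 1" unfolding v_def cnorm_scale norm_of_real s_def[symmetric] using s0 by simp
  have z1: "cmod (z - 1) \<le> 2" using norm_triangle_ineq4[of z 1] nz by simp
  have act: "mv n (creflect n v z) a l = a l + (z - 1) * (cip n u a / s\<^sup>2) * u l" if "l < n" for a l
    unfolding mv_creflect[OF that] unfolding v_def cip_scale_left by (simp add: power2_eq_square divide_inverse mult_ac)
  have 1: "cnorm n (\<lambda>l. mv n (creflect n v z) x l - y l) \<le> d / e"
  proof -
    have "cnorm n (\<lambda>l. mv n (creflect n v z) x l - y l) = cnorm n (\<lambda>l. complex_of_real (- d' / s\<^sup>2) * u l)"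
    proof (rule cnorm_cong)
      fix l assume l: "l < n"
      have "(z - 1) * (cip n u x / s\<^sup>2) = of_real ((s\<^sup>2 - d') / s\<^sup>2)"
        using zc by (simp add: c_def)
      also have "\<dots> = 1 + of_real (- d' / s\<^sup>2)" using s0 by (simp add: diff_divide_distrib)
      finally have k: "(z - 1) * (cip n u x / s\<^sup>2) = 1 + of_real (- d' / s\<^sup>2)" .
      show "mv n (creflect n v z) x l - y l = complex_of_real (- d' / s\<^sup>2) * u l"
        unfolding act[OF l] k by (simp add: u_def algebra_simps)
    qed
    also have "\<dots> = \<bar>d'\<bar> / s"
      unfolding cnorm_scale norm_of_real s_def[symmetric] using s0 by (simp add: power2_eq_square)
    also have "\<dots> \<le> d / e" using d' s e by (intro frac_le) auto
    finally show ?thesis .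
  qed
  have 2: "cnorm n (\<lambda>l. mv n (creflect n v z) a l - a l) \<le> 2 * cmod (cip n u a) / e" for a
  proof -
    have "cnorm n (\<lambda>l. mv n (creflect n v z) a l - a l) = cnorm n (\<lambda>l. ((z - 1) * (cip n u a / s\<^sup>2)) * u l)"
      by (rule cnorm_cong) (simp add: act)
    also have "\<dots> = cmod (z - 1) * cmod (cip n u a) / s"
      unfolding cnorm_scale s_def[symmetric] using s0 by (simp add: norm_mult norm_divide norm_power power2_eq_square)
    also have "\<dots> \<le> 2 * cmod (cip n u a) / e"
      using z1 s e by (intro frac_le mult_right_mono) auto
    finally show ?thesis .
  qed
  show ?thesis using that[OF v] 1 2 unfolding t u_def by blast
qed

text \<open>Tuples with equal Gram matrices are unitarily equivalent; this is the approximate form,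
  with \<open>d\<close> independent of the dimension. After alignment of the vectors in
  \<open>J\<close>, the last one is corrected by a reflection in the direction of its defect. As the
  Gram matrices nearly agree, the defect is nearly orthogonal to the aligned vectors, and these
  hardly move.\<close>

lemma gram_alignment:
  fixes J :: "'a set"
  assumes "finite J" "0 < e"
  shows "\<exists>d>0. \<forall>n. \<forall>A B :: 'a \<Rightarrow> cvec. (\<forall>j\<in>J. cnorm n (A j) \<le> R \<and> cnorm n (B j) \<le> R) \<and>
      (\<forall>i\<in>J. \<forall>j\<in>J. cmod (cip n (A i) (A j) - cip n (B i) (B j)) \<le> d) \<longrightarrow>
      (\<exists>W\<in>reflgrp n. \<forall>j\<in>J. cnorm n (\<lambda>l. mv n W (A j) l - B j l) \<le> e)"
  using assms
proof (induction J arbitrary: e rule: finite_induct)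
  case empty
  thus ?case by (intro exI[of _ 1]) (auto intro: reflgrp.ident)
next
  case (insert j J)
  define R' where "R' = max R 1"
  have R': "1 \<le> R'" "R \<le> R'" by (auto simp: R'_def)
  \<comment> \<open>The reflection displaces the earlier vectors by inner products divided by
    \<open>e\<close>, so they must be aligned to order \<open>e\<^sup>2\<close> beforehand.\<close>
  define e1 where "e1 = min (e / 2) (e\<^sup>2 / (8 * R'))"
  have e1: "0 < e1" "e1 \<le> e / 2" "R' * e1 \<le> e\<^sup>2 / 8"
  proof -
    show "0 < e1" using insert.prems R' by (auto simp: e1_def)
    show "e1 \<le> e / 2" by (simp add: e1_def)
    have "R' * e1 \<le> R' * (e\<^sup>2 / (8 * R'))" using R' by (intro mult_left_mono) (auto simp: e1_def)
    thus "R' * e1 \<le> e\<^sup>2 / 8" using R' by simp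
  qed
  obtain d1 where d1: "0 < d1" and IH: "\<And>n. \<And>A B :: 'a \<Rightarrow> cvec. (\<forall>j\<in>J. cnorm n (A j) \<le> R \<and> cnorm n (B j) \<le> R) \<Longrightarrow>
      (\<forall>i\<in>J. \<forall>j\<in>J. cmod (cip n (A i) (A j) - cip n (B i) (B j)) \<le> d1) \<Longrightarrow>
      (\<exists>W\<in>reflgrp n. \<forall>j\<in>J. cnorm n (\<lambda>l. mv n W (A j) l - B j l) \<le> e1)"
    using insert.IH[OF e1(1)] by blast
  define d where "d = min d1 (e\<^sup>2 / 8)"
  have d: "0 < d" "d \<le> d1" "d \<le> e\<^sup>2 / 8" using d1 insert.prems by (auto simp: d_def)
  have de: "d < e\<^sup>2" using d(3) zero_less_power[OF insert.prems, of 2] by linarith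
  show ?case
  proof (intro exI[of _ d] conjI allI impI, rule d, elim conjE)
    fix n and A B :: "'a \<Rightarrow> cvec"
    assume nrm: "\<forall>j\<in>insert j J. cnorm n (A j) \<le> R \<and> cnorm n (B j) \<le> R"
      and gram: "\<forall>i\<in>insert j J. \<forall>k\<in>insert j J. cmod (cip n (A i) (A k) - cip n (B i) (B k)) \<le> d"
    obtain W where W: "W \<in> reflgrp n" "\<And>i. i \<in> J \<Longrightarrow> cnorm n (\<lambda>l. mv n W (A i) l - B i l) \<le> e1"
    proof -
      have "cmod (cip n (A i) (A k) - cip n (B i) (B k)) \<le> d1" if "i \<in> J" "k \<in> J" for i k
        using gram that d(2) by (meson insertI2 order_trans)
      hence "\<exists>W\<in>reflgrp n. \<forall>j\<in>J. cnorm n (\<lambda>l. mv n W (A j) l - B j l) \<le> e1"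
        using nrm by (intro IH) auto
      thus ?thesis using that by blast
    qed
    have WU: "W \<in> unitary_set n" by (rule reflgrp_unitary[OF W(1)])
    define x where "x = mv n W (A j)"
    define y where "y = B j"
    show "\<exists>W\<in>reflgrp n. \<forall>j\<in>insert j J. cnorm n (\<lambda>l. mv n W (A j) l - B j l) \<le> e"
    \<comment> \<open>A defect of norm at most \<open>e\<close> is left alone, because the estimates
      for the reflection divide by a lower bound for that norm.\<close>
    proof (cases "cnorm n (\<lambda>l. y l - x l) \<le> e")
      case True
      have "cnorm n (\<lambda>l. mv n W (A i) l - B i l) \<le> e" if "i \<in> insert j J" for i
      proof (cases "i = j")
        case j: True
        show ?thesis using True unfolding j x_def y_def by (subst cnorm_minus_commute)
      next
        case False
        thus ?thesis using W(2)[of i] that e1(2) insert.prems by auto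
      qed
      thus ?thesis using W(1) by blast
    next
      case False
      hence far: "e < cnorm n (\<lambda>l. y l - x l)" by simp
      have cl: "\<bar>(cnorm n y)\<^sup>2 - (cnorm n x)\<^sup>2\<bar> \<le> d"
      proof -
        have "cmod (cip n (A j) (A j) - cip n (B j) (B j)) \<le> d" using gram by blast
        hence "\<bar>(cnorm n (A j))\<^sup>2 - (cnorm n (B j))\<^sup>2\<bar> \<le> d"
          unfolding cip_self of_real_diff[symmetric] norm_of_real .
        thus ?thesis by (simp add: x_def y_def cnorm_mv_unitary[OF WU] abs_minus_commute)
      qed
      obtain v t where v: "cnorm n v = 1"
        "cnorm n (\<lambda>l. mv n (creflect n v (cis t)) x l - y l) \<le> d / e"
        "\<forall>a. cnorm n (\<lambda>l. mv n (creflect n v (cis t)) a l - a l) \<le> 2 * cmod (cip n (\<lambda>l. y l - x l) a) / e"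
        by (rule reflection_step[OF insert.prems far de cl])
      let ?T = "mmul n (creflect n v (cis t)) W"
      have "cnorm n (\<lambda>l. mv n ?T (A i) l - B i l) \<le> e" if i: "i \<in> insert j J" for i
      proof (cases "i = j")
        case True
        have "d / e \<le> e" using de insert.prems by (simp add: divide_le_eq power2_eq_square)
        thus ?thesis using v(2) unfolding True mv_mmul x_def y_def by linarith
      next
        case False
        hence iJ: "i \<in> J" using i by simp
        define a where "a = mv n W (A i)"
        have "cip n (\<lambda>l. y l - x l) a = (cip n (B j) (B i) - cip n (A j) (A i)) + cip n (B j) (\<lambda>l. a l - B i l)"
          unfolding y_def x_def a_def by (simp add: cip_linear cip_mv_unitary[OF WU])
        also have "cmod \<dots> \<le> d + R' * e1"
        proof (intro norm_triangle_mono)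
          have "cmod (cip n (A j) (A i) - cip n (B j) (B i)) \<le> d" using gram i by blast
          thus "cmod (cip n (B j) (B i) - cip n (A j) (A i)) \<le> d" by (simp add: norm_minus_commute)
          have "cnorm n (B j) * cnorm n (\<lambda>l. a l - B i l) \<le> R' * e1"
            using nrm R' W(2)[OF iJ] by (intro mult_mono) (auto simp: a_def)
          thus "cmod (cip n (B j) (\<lambda>l. a l - B i l)) \<le> R' * e1" by (rule order_trans[OF cmod_cip_le])
        qed
        also have "\<dots> \<le> e\<^sup>2 / 4" using d(3) e1(3) by simp
        finally have "2 * cmod (cip n (\<lambda>l. y l - x l) a) / e \<le> 2 * (e\<^sup>2 / 4) / e"
          using insert.prems by (intro divide_right_mono mult_left_mono) auto
        also have "\<dots> = e / 2" using insert.prems by (simp add: power2_eq_square)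
        finally have "cnorm n (\<lambda>l. mv n (creflect n v (cis t)) a l - a l) \<le> e / 2"
          using v(3)[rule_format, of a] by linarith
        moreover have "cnorm n (\<lambda>l. a l - B i l) \<le> e / 2" using W(2)[OF iJ] e1(2) unfolding a_def by linarith
        ultimately show ?thesis
          using cnorm_diff_triangle[of n "mv n (creflect n v (cis t)) a" "B i" a]
          unfolding mv_mmul a_def by linarith
      qed
      moreover have "?T \<in> reflgrp n" by (rule reflgrp.step[OF W(1) v(1)])
      ultimately show ?thesis by blast
    qed
  qed
qed

section \<open>Haar measure\<close>

lemma measurable_mmul [measurable]:
  assumes "f \<in> borel_measurable M" "g \<in> borel_measurable M"
  shows "(\<lambda>x. mmul n (f x) (g x)) \<in> borel_measurable M"
  unfolding mmul_def
  by (rule measurable_coordinatewise_then_product, rule measurable_coordinatewise_then_product,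
      rule borel_measurable_sum, rule borel_measurable_times)
     (rule measurable_entry[OF measurable_entry[OF assms(1)]], rule measurable_entry[OF measurable_entry[OF assms(2)]])

lemma measurable_adj [measurable]:
  assumes "f \<in> borel_measurable M"
  shows "(\<lambda>x. adj (f x)) \<in> borel_measurable M"
proof -
  have c: "cnj \<in> borel_measurable borel"
    by (intro borel_measurable_continuous_onI continuous_intros)
  show ?thesis
    unfolding adj_def
    by (rule measurable_coordinatewise_then_product, rule measurable_coordinatewise_then_product)
       (rule measurable_compose[OF measurable_entry[OF measurable_entry[OF assms]] c])
qed

locale haar =
  fixes n :: nat and \<mu> :: "cmat measure"
  assumes haar: "is_haar n \<mu>"
begin

sublocale prob_space \<mu>
  using haar by (simp add: is_haar_def)

lemma sets_haar [simp, measurable_cong]: "sets \<mu> = sets borel"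
  using haar by (simp add: is_haar_def)

lemma space_haar [simp]: "space \<mu> = UNIV"
  using sets_eq_imp_space_eq[OF sets_haar] by simp

lemma emeasure_UNIV [simp]: "emeasure \<mu> UNIV = 1"
  using emeasure_space_1 by simp

lemma AE_unitary: "AE X in \<mu>. X \<in> unitary_set n"
  using haar by (simp add: is_haar_def)

lemma emeasure_left:
  assumes "U \<in> unitary_set n" "A \<in> sets borel"
  shows "emeasure \<mu> {X. mmul n U X \<in> A} = emeasure \<mu> A"
  using haar assms by (auto simp: is_haar_def vimage_def)

lemma adj_right_invariant:
  assumes "W \<in> unitary_set n" "A \<in> sets borel"
  shows "emeasure \<mu> {X. mmul n (adj X) W \<in> A} = emeasure \<mu> {X. adj X \<in> A}"
proof -
  have "{X. adj X \<in> A} \<in> sets borel"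
    using measurable_sets[of adj borel borel A] assms(2) by (simp add: vimage_def)
  from emeasure_left[OF unitary_adj[OF assms(1)] this] show ?thesis
    by (simp add: adj_mmul)
qed

text \<open>Only left invariance is given. The law of \<open>mmul n (adj Y) X\<close> for
  independent \<open>X\<close> and \<open>Y\<close> is computed twice: for fixed \<open>Y\<close> it
  is the law of \<open>X\<close>, for fixed \<open>X\<close> it is that of
  \<open>adj Y\<close>.\<close>

lemma inverse_invariant:
  assumes A: "A \<in> sets borel"
  shows "emeasure \<mu> {X. adj X \<in> A} = emeasure \<mu> A"
proof -
  interpret P: pair_sigma_finite \<mu> \<mu> by standard
  let ?f = "\<lambda>p. indicator A (mmul n (adj (fst p)) (snd p)) :: ennreal"
  have f: "?f \<in> borel_measurable (\<mu> \<Otimes>\<^sub>M \<mu>)" using A by measurable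
  have "emeasure \<mu> A = (\<integral>\<^sup>+Y. emeasure \<mu> A \<partial>\<mu>)" by simp
  also have "\<dots> = (\<integral>\<^sup>+Y. (\<integral>\<^sup>+X. ?f (Y, X) \<partial>\<mu>) \<partial>\<mu>)"
  proof (rule nn_integral_cong_AE)
    show "AE Y in \<mu>. emeasure \<mu> A = (\<integral>\<^sup>+X. ?f (Y, X) \<partial>\<mu>)"
      using AE_unitary
    proof eventually_elim
      case (elim Y)
      have "{X. mmul n (adj Y) X \<in> A} \<in> sets borel"
        using measurable_sets[of "\<lambda>X. mmul n (adj Y) X" borel borel A] A by (simp add: vimage_def)
      moreover have "(\<lambda>X. ?f (Y, X)) = indicator {X. mmul n (adj Y) X \<in> A}"
        by (auto simp: indicator_def)
      ultimately show ?case using emeasure_left[OF unitary_adj[OF elim] A] by simp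
    qed
  qed
  also have "\<dots> = (\<integral>\<^sup>+X. (\<integral>\<^sup>+Y. ?f (Y, X) \<partial>\<mu>) \<partial>\<mu>)" by (rule P.Fubini[OF f, symmetric])
  also have "\<dots> = (\<integral>\<^sup>+X. emeasure \<mu> {X. adj X \<in> A} \<partial>\<mu>)"
  proof (rule nn_integral_cong_AE)
    show "AE X in \<mu>. (\<integral>\<^sup>+Y. ?f (Y, X) \<partial>\<mu>) = emeasure \<mu> {X. adj X \<in> A}"
      using AE_unitary
    proof eventually_elim
      case (elim X)
      have "{Y. mmul n (adj Y) X \<in> A} \<in> sets borel"
        using measurable_sets[of "\<lambda>Y. mmul n (adj Y) X" borel borel A] A by (simp add: vimage_def)
      moreover have "(\<lambda>Y. ?f (Y, X)) = indicator {Y. mmul n (adj Y) X \<in> A}"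
        by (auto simp: indicator_def)
      ultimately show ?case using adj_right_invariant[OF elim A] by simp
    qed
  qed
  also have "\<dots> = emeasure \<mu> {X. adj X \<in> A}" by simp
  finally show ?thesis ..
qed

text \<open>Right invariance comes from left invariance by passing through inverses twice.
  Conjugation will make the law of the Gram matrix independent of the frame
  \<open>V\<close>.\<close>

lemma conj_invariant:
  assumes W: "W \<in> unitary_set n"
  shows "distr \<mu> \<mu> (\<lambda>X. mmul n (adj W) (mmul n X W)) = \<mu>"
proof (rule measure_eqI)
  fix A assume "A \<in> sets (distr \<mu> \<mu> (\<lambda>X. mmul n (adj W) (mmul n X W)))"
  hence A: "A \<in> sets borel" by simp
  have S: "{X. mmul n X W \<in> A} \<in> sets borel"
    using measurable_sets[of "\<lambda>X. mmul n X W" borel borel A] A by (simp add: vimage_def)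
  have S': "{X. mmul n (adj X) W \<in> A} \<in> sets borel"
    using measurable_sets[of "\<lambda>X. mmul n (adj X) W" borel borel A] A by (simp add: vimage_def)
  have "emeasure (distr \<mu> \<mu> (\<lambda>X. mmul n (adj W) (mmul n X W))) A = emeasure \<mu> {X. mmul n (mmul n (adj W) X) W \<in> A}"
    using A by (subst emeasure_distr) (auto simp: vimage_def mmul_assoc)
  also have "\<dots> = emeasure \<mu> {X. mmul n X W \<in> A}"
    using emeasure_left[OF unitary_adj[OF W] S] by simp
  also have "\<dots> = emeasure \<mu> {X. mmul n (adj X) W \<in> A}"
    using inverse_invariant[OF S] by simp
  also have "\<dots> = emeasure \<mu> A"
    using adj_right_invariant[OF W A] inverse_invariant[OF A] by simp
  finally show "emeasure (distr \<mu> \<mu> (\<lambda>X. mmul n (adj W) (mmul n X W))) A = emeasure \<mu> A" .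
qed simp

section \<open>Probability that a Haar unitary carries one tuple near another\<close>

definition hprob :: "'a set \<Rightarrow> real \<Rightarrow> ('a \<Rightarrow> cvec) \<Rightarrow> ('a \<Rightarrow> cvec) \<Rightarrow> ennreal" where
  "hprob J h A B = emeasure \<mu> {U. \<forall>j\<in>J. cnorm n (\<lambda>l. mv n U (A j) l - B j l) \<le> h}"

lemma hprob_sets:
  assumes "finite J"
  shows "{U. \<forall>j\<in>J. cnorm n (\<lambda>l. mv n U (A j) l - B j l) \<le> h} \<in> sets borel"
proof -
  have "{U \<in> space borel. \<forall>j\<in>J. cnorm n (\<lambda>l. mv n U (A j) l - B j l) \<le> h} \<in> sets borel"
    using assms by measurable
  thus ?thesis by simp
qed

lemma hprob_align:
  assumes J: "finite J" and W: "W \<in> unitary_set n"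
    and le: "\<And>j. j \<in> J \<Longrightarrow> cnorm n (\<lambda>l. mv n W (B j) l - B' j l) \<le> e"
  shows "hprob J h A B \<le> hprob J (h + e) A B'"
proof -
  let ?S = "{U. \<forall>j\<in>J. cnorm n (\<lambda>l. mv n U (A j) l - B j l) \<le> h}"
  let ?T = "{U. \<forall>j\<in>J. cnorm n (\<lambda>l. mv n U (A j) l - B' j l) \<le> h + e}"
  have "hprob J h A B = emeasure \<mu> {U. mmul n (adj W) U \<in> ?S}"
    unfolding hprob_def by (rule emeasure_left[OF unitary_adj[OF W] hprob_sets[OF J], symmetric])
  also have "\<dots> \<le> emeasure \<mu> ?T"
  proof (rule emeasure_mono)
    show "{U. mmul n (adj W) U \<in> ?S} \<subseteq> ?T"
    proof (intro subsetI CollectI ballI)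
      fix U j assume "U \<in> {U. mmul n (adj W) U \<in> ?S}" and j: "j \<in> J"
      hence "cnorm n (\<lambda>l. mv n (adj W) (mv n U (A j)) l - B j l) \<le> h" by (simp add: mv_mmul)
      hence "cnorm n (\<lambda>l. mv n U (A j) l - mv n W (B j) l) \<le> h"
        by (subst cnorm_minus_commute) (simp add: cnorm_mv_adj_swap[OF W])
      thus "cnorm n (\<lambda>l. mv n U (A j) l - B' j l) \<le> h + e"
        using le[OF j] cnorm_diff_triangle[of n "mv n U (A j)" "B' j" "mv n W (B j)"] by linarith
    qed
    show "?T \<in> sets \<mu>" using hprob_sets[OF J] by simp
  qed
  finally show ?thesis by (simp add: hprob_def)
qed

text \<open>Fubini for pairs of a tuple \<open>B\<close> and a unitary \<open>U\<close> carrying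
  \<open>A\<close> to within \<open>h\<close> of \<open>B\<close>: for fixed \<open>U\<close> the
  tuples fill a product of balls.\<close>

lemma hprob_integral:
  assumes J: "finite J" and G: "G \<in> sets (tvol n J)"
  shows "(\<integral>\<^sup>+B. hprob J h A B * indicator G B \<partial>tvol n J)
    = (\<integral>\<^sup>+U. emeasure (tvol n J) {B \<in> G. \<forall>j\<in>J. cnorm n (\<lambda>l. B j l - mv n U (A j) l) \<le> h} \<partial>\<mu>)"
    (is "?L = ?R")
    and "hprob J h A \<in> borel_measurable (tvol n J)"
proof -
  interpret product_sigma_finite "\<lambda>_. cvol n" by (rule product_sigma_finite_cvol)
  interpret T: sigma_finite_measure "tvol n J" by (rule sigma_finite[OF J])
  interpret P: pair_sigma_finite "tvol n J" \<mu> by standard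
  define Q where "Q = {p \<in> space (tvol n J \<Otimes>\<^sub>M \<mu>). \<forall>j\<in>J. cnorm n (\<lambda>l. fst p j l - mv n (snd p) (A j) l) \<le> h}"
  have Q: "Q \<in> sets (tvol n J \<Otimes>\<^sub>M \<mu>)"
    unfolding Q_def using J by measurable
  have hp: "hprob J h A B = (\<integral>\<^sup>+U. indicator Q (B, U) \<partial>\<mu>)" if "B \<in> space (tvol n J)" for B
  proof -
    have "(\<integral>\<^sup>+U. indicator Q (B, U) \<partial>\<mu>) = (\<integral>\<^sup>+U. indicator {U. \<forall>j\<in>J. cnorm n (\<lambda>l. mv n U (A j) l - B j l) \<le> h} U \<partial>\<mu>)"
      by (intro nn_integral_cong)
         (use that in \<open>auto simp: Q_def indicator_def space_pair_measure cnorm_minus_commute[of n "B _"]\<close>)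
    thus ?thesis using hprob_sets[OF J] by (simp add: hprob_def)
  qed
  have "(\<lambda>B. \<integral>\<^sup>+U. indicator Q (B, U) \<partial>\<mu>) \<in> borel_measurable (tvol n J)"
    using Q by measurable
  thus m: "hprob J h A \<in> borel_measurable (tvol n J)"
    by (subst measurable_cong[OF hp])
  have "?L = (\<integral>\<^sup>+B. (\<integral>\<^sup>+U. indicator Q (B, U) * indicator G B \<partial>\<mu>) \<partial>tvol n J)"
    using Q by (intro nn_integral_cong) (simp add: hp nn_integral_multc)
  also have "\<dots> = (\<integral>\<^sup>+U. (\<integral>\<^sup>+B. indicator Q (B, U) * indicator G B \<partial>tvol n J) \<partial>\<mu>)"
    by (rule P.Fubini'[symmetric]) (use Q G in measurable)
  also have "\<dots> = ?R"
  proof (rule nn_integral_cong)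
    fix U
    let ?S = "{B \<in> G. \<forall>j\<in>J. cnorm n (\<lambda>l. B j l - mv n U (A j) l) \<le> h}"
    have "?S = G \<inter> {B \<in> space (tvol n J). \<forall>j\<in>J. cnorm n (\<lambda>l. B j l - mv n U (A j) l) \<le> h}"
      using sets.sets_into_space[OF G] by auto
    also have "\<dots> \<in> sets (tvol n J)"
      by (rule sets.Int[OF G]) (use J in measurable)
    finally have S: "?S \<in> sets (tvol n J)" .
    have "(\<integral>\<^sup>+B. indicator Q (B, U) * indicator G B \<partial>tvol n J) = (\<integral>\<^sup>+B. indicator ?S B \<partial>tvol n J)"
      by (intro nn_integral_cong) (auto simp: Q_def indicator_def space_pair_measure)
    thus "(\<integral>\<^sup>+B. indicator Q (B, U) * indicator G B \<partial>tvol n J) = emeasure (tvol n J) ?S" using S by simp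
  qed
  finally show "?L = ?R" .
qed

lemma emeasure_tvol_box:
  assumes J: "finite J" and h: "0 < h"
  shows "emeasure (tvol n J) {B \<in> space (tvol n J). \<forall>j\<in>J. cnorm n (\<lambda>l. B j l - a j l) \<le> h}
    = ennreal ((h ^ (2 * n) * vball n) ^ card J)"
proof -
  interpret product_sigma_finite "\<lambda>_. cvol n" by (rule product_sigma_finite_cvol)
  have "{B \<in> space (tvol n J). \<forall>j\<in>J. cnorm n (\<lambda>l. B j l - a j l) \<le> h}
      = PiE J (\<lambda>j. {x. cnorm n (\<lambda>l. x l - a j l) \<le> h})"
    by (auto simp: space_PiM PiE_iff extensional_def)
  thus ?thesis using J h
    by (simp add: emeasure_PiM emeasure_cvol_cball prod_constant ennreal_power)
qed

text \<open>All tuples in \<open>G\<close> are nearly rotations of \<open>B\<close>, so by left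
  invariance each is hit with at least the probability for \<open>B\<close> once \<open>h\<close> is
  enlarged by \<open>e\<close>. The integral over all tuples is the volume of a product of balls,
  whatever \<open>A\<close> is; this gives a quotient of volumes.\<close>

lemma hprob_upper:
  assumes J: "finite J" and h: "0 < h" "0 \<le> e"
    and al: "\<And>B'. B' \<in> G \<Longrightarrow> \<exists>W\<in>unitary_set n. \<forall>j\<in>J. cnorm n (\<lambda>l. mv n W (B j) l - B' j l) \<le> e"
    and G: "G \<in> sets (tvol n J)"
  shows "hprob J h A B * emeasure (tvol n J) G \<le> ennreal (((h + e) ^ (2 * n) * vball n) ^ card J)"
proof -
  have "hprob J h A B * emeasure (tvol n J) G = (\<integral>\<^sup>+B'. hprob J h A B * indicator G B' \<partial>tvol n J)"
    using G by (simp add: nn_integral_cmult_indicator)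
  also have "\<dots> \<le> (\<integral>\<^sup>+B'. hprob J (h + e) A B' * indicator (space (tvol n J)) B' \<partial>tvol n J)"
  proof (rule nn_integral_mono)
    fix B' assume "B' \<in> space (tvol n J)"
    moreover have "hprob J h A B \<le> hprob J (h + e) A B'" if "B' \<in> G"
      using al[OF that] hprob_align[OF J] by blast
    ultimately show "hprob J h A B * indicator G B' \<le> hprob J (h + e) A B' * indicator (space (tvol n J)) B'"
      by (auto simp: indicator_def)
  qed
  also have "\<dots> = (\<integral>\<^sup>+U. ennreal (((h + e) ^ (2 * n) * vball n) ^ card J) \<partial>\<mu>)"
    using h by (subst hprob_integral[OF J]) (auto simp: emeasure_tvol_box[OF J])
  finally show ?thesis by simp
qed

text \<open>The same comparison in reverse: every tuple in \<open>G\<close> is hit with at most the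
  probability for \<open>B\<close> at the enlarged radius, and the integral over \<open>G\<close> is
  large as soon as each rotation of \<open>A\<close> has enough noisy copies in
  \<open>G\<close>.\<close>

lemma hprob_lower:
  assumes J: "finite J" and G: "G \<in> sets (tvol n J)"
    and al: "\<And>B'. B' \<in> G \<Longrightarrow> \<exists>W\<in>unitary_set n. \<forall>j\<in>J. cnorm n (\<lambda>l. mv n W (B' j) l - B j l) \<le> e"
    and vol: "\<And>U. U \<in> unitary_set n \<Longrightarrow>
      c \<le> emeasure (tvol n J) {B \<in> G. \<forall>j\<in>J. cnorm n (\<lambda>l. B j l - mv n U (A j) l) \<le> h}"
  shows "c \<le> hprob J (h + e) A B * emeasure (tvol n J) G"
proof -
  have "c = (\<integral>\<^sup>+U. c \<partial>\<mu>)" by simp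
  also have "\<dots> \<le> (\<integral>\<^sup>+U. emeasure (tvol n J) {B \<in> G. \<forall>j\<in>J. cnorm n (\<lambda>l. B j l - mv n U (A j) l) \<le> h} \<partial>\<mu>)"
    by (rule nn_integral_mono_AE, rule AE_mp[OF AE_unitary]) (use vol in auto)
  also have "\<dots> = (\<integral>\<^sup>+B'. hprob J h A B' * indicator G B' \<partial>tvol n J)"
    by (rule hprob_integral(1)[OF J G, symmetric])
  also have "\<dots> \<le> (\<integral>\<^sup>+B'. hprob J (h + e) A B * indicator G B' \<partial>tvol n J)"
  proof (rule nn_integral_mono)
    fix B' 
    have "hprob J h A B' \<le> hprob J (h + e) A B" if "B' \<in> G"
      using al[OF that] hprob_align[OF J] by blast
    thus "hprob J h A B' * indicator G B' \<le> hprob J (h + e) A B * indicator G B'"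
      by (auto simp: indicator_def)
  qed
  also have "\<dots> = hprob J (h + e) A B * emeasure (tvol n J) G"
    using G by (simp add: nn_integral_cmult_indicator)
  finally show ?thesis .
qed

end

section \<open>Reduced words and representations\<close>

lemma reduced_Cons2: "reduced (x # y # w) \<longleftrightarrow> \<not> (fst x = fst y \<and> snd x \<noteq> snd y) \<and> reduced (y # w)"
proof -
  have *: "(\<forall>i. P i) \<longleftrightarrow> P 0 \<and> (\<forall>i. P (Suc i))" for P :: "nat \<Rightarrow> bool"
    by (metis not0_implies_Suc)
  show ?thesis unfolding reduced_def by (subst *) simp
qed

lemma reduced_Nil [simp]: "reduced []" by (simp add: reduced_def)

lemma reduced_tl: "reduced (x # w) \<Longrightarrow> reduced w"
  by (cases w) (auto simp: reduced_Cons2)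

lemma reduced_red_cons: "reduced w \<Longrightarrow> reduced (red_cons x w)"
  by (cases w) (auto simp: reduced_Cons2 reduced_def[of "[x]"] dest: reduced_tl)

lemma red_cons_reduced: "reduced (x # w) \<Longrightarrow> red_cons x w = x # w"
  by (cases w) (auto simp: reduced_Cons2)

lemma red_cons_inverse: "reduced w \<Longrightarrow> red_cons (s, b) (red_cons (s, \<not> b) w) = w"
  by (cases w; cases "tl w") (auto simp: reduced_Cons2 prod_eq_iff)

lemma reduce_Cons: "reduce (x # w) = red_cons x (reduce w)"
  by (simp add: reduce_def)

lemma reduce_append: "reduce (u @ v) = foldr red_cons u (reduce v)"
  by (simp add: reduce_def)

lemma reduced_reduce: "reduced (reduce w)"
  by (induction w) (auto simp: reduce_Cons reduced_red_cons, simp add: reduce_def)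

lemma reduce_reduced: "reduced w \<Longrightarrow> reduce w = w"
proof (induction w)
  case (Cons x w)
  thus ?case using red_cons_reduced reduced_tl by (metis reduce_Cons)
qed (simp add: reduce_def)

lemma reduce_cancel: "reduce (u @ (s, b) # (s, \<not> b) # v) = reduce (u @ v)"
  by (simp add: reduce_append reduce_Cons red_cons_inverse reduced_reduce)

lemma fg_mult_single: "reduced g \<Longrightarrow> fg_mult [x] g = red_cons x g"
  by (simp add: fg_mult_def reduce_Cons reduce_reduced)

text \<open>A letter either cancels the head or is put in front. In the tree this tells a step
  towards the root from a step away from it.\<close>

lemma red_cons_cases:
  assumes "reduced g"
  shows "g = (s, \<not> b) # red_cons (s, b) g \<or> red_cons (s, b) g = (s, b) # g"
proof (cases g)
  case (Cons y ys)
  thus ?thesis by (cases y) auto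
qed simp

lemma fg_inv_Cons: "fg_inv ((s, b) # w) = fg_inv w @ [(s, \<not> b)]"
  by (simp add: fg_inv_def)

text \<open>The four cases are whether the letter cancels in \<open>g\<close> and in
  \<open>h\<close>: either two inverse letters meet in the middle, or both sides reduce the same
  concatenation. For a matrix in \<open>Su k F\<close> it follows that sources and targets of the
  edges labelled \<open>s\<close> have the same submatrix.\<close>

lemma left_translation_invariant:
  assumes g: "reduced g" and h: "reduced h"
  shows "fg_mult (fg_inv (red_cons (s, b) g)) (red_cons (s, b) h) = fg_mult (fg_inv g) h"
  using red_cons_cases[OF g, of s b] red_cons_cases[OF h, of s b]
proof (elim disjE)
  assume 1: "g = (s, \<not> b) # red_cons (s, b) g" "h = (s, \<not> b) # red_cons (s, b) h"
  have "fg_mult (fg_inv g) h = reduce (fg_inv (red_cons (s, b) g) @ (s, b) # (s, \<not> b) # red_cons (s, b) h)"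
    unfolding fg_mult_def by (subst 1(1), subst 1(2)) (simp add: fg_inv_Cons)
  thus ?thesis by (simp add: reduce_cancel fg_mult_def)
next
  assume 1: "g = (s, \<not> b) # red_cons (s, b) g" "red_cons (s, b) h = (s, b) # h"
  have "fg_mult (fg_inv g') ((s, b) # h) = fg_mult (fg_inv ((s, \<not> b) # g')) h" for g'
    by (simp add: fg_mult_def fg_inv_Cons)
  thus ?thesis by (metis 1)
next
  assume 1: "red_cons (s, b) g = (s, b) # g" "h = (s, \<not> b) # red_cons (s, b) h"
  have "fg_mult (fg_inv ((s, b) # g)) h' = fg_mult (fg_inv g) ((s, \<not> b) # h')" for h'
    by (simp add: fg_mult_def fg_inv_Cons)
  thus ?thesis by (metis 1)
next
  assume 1: "red_cons (s, b) g = (s, b) # g" "red_cons (s, b) h = (s, b) # h"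
  show ?thesis unfolding fg_mult_def 1 fg_inv_Cons
    using reduce_cancel[of "fg_inv g" s "\<not> b" h] by simp
qed

section \<open>Finite subtrees of the Cayley graph\<close>

text \<open>Generators act at the head of a word, so the parent of a word is its tail; closure under
  tails says that \<open>F\<close> is a subtree containing the root.\<close>

definition suffix_closed :: "'s set \<Rightarrow> 's word set \<Rightarrow> bool" where
  "suffix_closed S F \<longleftrightarrow> finite F \<and> F \<subseteq> free_group S \<and> [] \<in> F \<and> (\<forall>x w. x # w \<in> F \<longrightarrow> w \<in> F)"

text \<open>A path in the tree from \<open>x # w\<close> to the identity can leave the words ending in \<open>x # w\<close> only
  through the edge from \<open>x # w\<close> to \<open>w\<close>.\<close>
lemma grounded_suffix_closed:
  assumes F: "grounded S F"
  shows "suffix_closed S F"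
proof -
  have "w \<in> F" if xw: "x # w \<in> F" for x w
  proof -
    have red: "reduced g" if "g \<in> F" for g
      using F that by (auto simp: grounded_def free_group_def)
    have "(x # w, []) \<in> (cayley_edges_in S F)\<^sup>*"
      using F xw by (auto simp: grounded_def)
    moreover have "w \<in> F \<or> (\<exists>u. h = u @ x # w)" if "(x # w, h) \<in> (cayley_edges_in S F)\<^sup>*" for h
      using that
    proof (induction rule: rtrancl_induct)
      case (step h h')
      from step.hyps(2) obtain s b where h: "h \<in> F" "h' = fg_mult [(s, b)] h" "h' \<in> F"
        by (auto simp: cayley_edges_in_def)
      have h': "h' = red_cons (s, b) h" using h fg_mult_single[OF red] by simp
      from step.IH show ?case
      proof
        assume "\<exists>u. h = u @ x # w"
        then obtain u where u: "h = u @ x # w" ..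
        show ?thesis
          using red_cons_cases[OF red[OF h(1)], of s b]
        proof
          assume "h = (s, \<not> b) # red_cons (s, b) h"
          hence "h = (s, \<not> b) # h'" using h' by simp
          thus ?thesis using u h(3) by (cases u) auto
        next
          assume "red_cons (s, b) h = (s, b) # h"
          thus ?thesis using u h' by (intro disjI2 exI[of _ "(s, b) # u"]) simp
        qed
      qed blast
    qed auto
    ultimately show ?thesis by blast
  qed
  thus ?thesis using F by (auto simp: suffix_closed_def grounded_def)
qed

text \<open>A longest word is a leaf, and its removal leaves a subtree.\<close>

lemma suffix_closed_induct [consumes 1, case_names empty insert]:
  assumes "suffix_closed S F" "P {[]}"
    and "\<And>F x w. suffix_closed S F \<Longrightarrow> P F \<Longrightarrow> x # w \<notin> F \<Longrightarrow> w \<in> F \<Longrightarrow> x # w \<in> free_group S \<Longrightarrow> P (insert (x # w) F)"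
  shows "P F"
  using assms(1)
proof (induction "card F" arbitrary: F rule: less_induct)
  case less
  note F = less.prems
  have fin: "finite F" using F by (simp add: suffix_closed_def)
  show ?case
  proof (cases "F = {[]}")
    case False
    obtain g where g: "g \<in> F" "\<And>h. h \<in> F \<Longrightarrow> length h \<le> length g"
    proof -
      have "Max (length ` F) \<in> length ` F" using fin F by (intro Max_in) (auto simp: suffix_closed_def)
      thus ?thesis using that fin Max_ge[of "length ` F"] by (metis (no_types) finite_imageI imageE imageI)
    qed
    have "g \<noteq> []"
    proof
      assume "g = []"
      hence "F \<subseteq> {[]}" using g by auto
      thus False using False F by (auto simp: suffix_closed_def)
    qed
    then obtain x w where xw: "g = x # w" by (cases g) auto
    let ?F = "F - {g}"
    have sc: "suffix_closed S ?F"
      unfolding suffix_closed_def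
    proof (intro conjI allI impI)
      fix y v assume yv: "y # v \<in> ?F"
      hence "length (y # v) \<le> length g" using g(2) by blast
      hence "v \<noteq> g" by auto
      moreover have "v \<in> F" using F yv unfolding suffix_closed_def by blast
      ultimately show "v \<in> ?F" by simp
    qed (use F xw in \<open>auto simp: suffix_closed_def\<close>)
    have "P ?F" by (rule less.hyps[OF _ sc]) (rule card_Diff1_less[OF fin g(1)])
    moreover have "w \<in> F" using F g(1) xw unfolding suffix_closed_def by blast
    hence "w \<in> ?F" using xw by auto
    moreover have "x # w \<in> free_group S" using F g xw by (auto simp: suffix_closed_def)
    ultimately have "P (insert (x # w) ?F)" using assms(3)[OF sc, of x w] xw by simp
    thus ?thesis using g xw by (simp add: insert_absorb)
  qed (use assms(2) in simp)
qed

text \<open>The letter \<open>(s, True)\<close> is the inverse of \<open>s\<close>, so these are the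
  endpoints of the edges labelled \<open>s\<close>, oriented by left multiplication with
  \<open>s\<close>. The set is the intersection of \<open>F\<close> with its translate by
  \<open>s\<close>, the index set in \<open>hF\<close>.\<close>

definition edge_targets :: "'s set \<Rightarrow> 's word set \<Rightarrow> 's \<Rightarrow> 's word set" where
  "edge_targets S F s = {g \<in> F. red_cons (s, True) g \<in> F}"

lemma edge_targets_eq:
  assumes "suffix_closed S F"
  shows "F \<inter> (\<lambda>g. fg_mult [(s, False)] g) ` F = edge_targets S F s"
proof -
  have red: "reduced g" if "g \<in> F" for g
    using assms that by (auto simp: suffix_closed_def free_group_def)
  show ?thesis
  proof (intro set_eqI iffI)
    fix g assume "g \<in> F \<inter> (\<lambda>g. fg_mult [(s, False)] g) ` F"
    then obtain g' where "g \<in> F" "g' \<in> F" "g = red_cons (s, False) g'"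
      using fg_mult_single[OF red] by auto
    thus "g \<in> edge_targets S F s" using red_cons_inverse[OF red, of g' s True] by (simp add: edge_targets_def)
  next
    fix g assume "g \<in> edge_targets S F s"
    hence g: "g \<in> F" "red_cons (s, True) g \<in> F" by (auto simp: edge_targets_def)
    have "g = fg_mult [(s, False)] (red_cons (s, True) g)"
      using g fg_mult_single[OF red[OF g(2)]] red_cons_inverse[OF red[OF g(1)], of s False] by simp
    thus "g \<in> F \<inter> (\<lambda>g. fg_mult [(s, False)] g) ` F" using g by blast
  qed
qed

text \<open>The constraint on the edge between a nonempty \<open>g\<close> and its parent
  \<open>tl g\<close>. The generator carries the parent to \<open>g\<close> if the head is a
  generator and \<open>g\<close> to the parent if it is an inverse, so no adjoint appears.\<close>

definition tree_edge :: "nat \<Rightarrow> real \<Rightarrow> ('s \<Rightarrow> cmat) \<Rightarrow> ('s word \<times> nat \<Rightarrow> cvec) \<Rightarrow> 's word \<Rightarrow> nat \<Rightarrow> bool" where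
  "tree_edge n h X Y g i \<longleftrightarrow>
    (if snd (hd g) then cnorm n (\<lambda>l. mv n (X (fst (hd g))) (Y (g, i)) l - Y (tl g, i) l) \<le> h
     else cnorm n (\<lambda>l. mv n (X (fst (hd g))) (Y (tl g, i)) l - Y (g, i) l) \<le> h)"

text \<open>The same edges, enumerated by outer ends and by labels. The first form lets the tree
  grow leaf by leaf for fixed generators; the second splits the condition into one for each
  generator when the tuple is fixed.\<close>

lemma tree_edges_iff:
  assumes F: "suffix_closed S F"
  shows "(\<forall>g\<in>F - {[]}. \<forall>i<k. tree_edge n h X Y g i) \<longleftrightarrow>
    (\<forall>s\<in>S. \<forall>g\<in>edge_targets S F s. \<forall>i<k. cnorm n (\<lambda>l. mv n (X s) (Y (red_cons (s, True) g, i)) l - Y (g, i) l) \<le> h)"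
    (is "?L \<longleftrightarrow> ?R")
proof
  have red: "reduced g" if "g \<in> F" for g
    using F that by (auto simp: suffix_closed_def free_group_def)
  assume L: ?L
  show ?R
  proof (intro ballI allI impI)
    fix s g i assume s: "s \<in> S" "g \<in> edge_targets S F s" "i < k"
    hence g: "g \<in> F" "red_cons (s, True) g \<in> F" by (auto simp: edge_targets_def)
    from red_cons_cases[OF red[OF g(1)], of s True]
    show "cnorm n (\<lambda>l. mv n (X s) (Y (red_cons (s, True) g, i)) l - Y (g, i) l) \<le> h"
    proof
      assume 1: "g = (s, \<not> True) # red_cons (s, True) g"
      hence hd: "g \<noteq> []" "hd g = (s, False)" "tl g = red_cons (s, True) g" by (metis list.distinct(1) list.sel)+
      hence "tree_edge n h X Y g i" using L g s by blast
      thus ?thesis using hd by (simp add: tree_edge_def)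
    next
      assume 1: "red_cons (s, True) g = (s, True) # g"
      hence "tree_edge n h X Y ((s, True) # g) i" using L g s by auto
      thus ?thesis unfolding 1 by (simp add: tree_edge_def)
    qed
  qed
next
  assume R: ?R
  show ?L
  proof (intro ballI allI impI)
    fix g i assume g: "g \<in> F - {[]}" and i: "i < k"
    then obtain s b w where gw: "g = (s, b) # w" by (cases g) auto
    have w: "w \<in> F" and s: "s \<in> S" and red: "reduced g"
      using F g gw by (auto simp: suffix_closed_def free_group_def)
    show "tree_edge n h X Y g i"
    proof (cases b)
      case True
      have rc: "red_cons (s, True) w = g" using red_cons_reduced red gw True by metis
      hence "w \<in> edge_targets S F s" using w g by (auto simp: edge_targets_def)
      hence "cnorm n (\<lambda>l. mv n (X s) (Y (g, i)) l - Y (w, i) l) \<le> h" using R s i rc by metis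
      thus ?thesis using True by (simp add: tree_edge_def gw)
    next
      case False
      have rc: "red_cons (s, True) g = w" using gw False by simp
      hence "g \<in> edge_targets S F s" using w g by (auto simp: edge_targets_def)
      hence "cnorm n (\<lambda>l. mv n (X s) (Y (w, i)) l - Y (g, i) l) \<le> h" using R s i rc by metis
      thus ?thesis using False by (simp add: tree_edge_def gw)
    qed
  qed
qed

text \<open>A tree has one edge fewer than vertices. The bijection sends an edge to its outer end,
  which is the target if the head of the target is \<open>s\<close> and the source
  otherwise.\<close>

lemma card_edge_targets:
  assumes S: "finite S" and F: "suffix_closed S F"
  shows "(\<Sum>s\<in>S. card (edge_targets S F s)) = card F - 1"
proof -
  have fin: "finite F" using F by (simp add: suffix_closed_def)
  have red: "reduced g" if "g \<in> F" for g
    using F that by (auto simp: suffix_closed_def free_group_def)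
  have finE: "finite (edge_targets S F s)" for s using fin by (simp add: edge_targets_def)
  have "(\<Sum>s\<in>S. card (edge_targets S F s)) = (\<Sum>p\<in>Sigma S (edge_targets S F). 1)"
    using S finE by simp
  also have "\<dots> = (\<Sum>g\<in>F - {[]}. 1)"
  proof (rule sum.reindex_bij_witness[where j = "\<lambda>(s, g). if g \<noteq> [] \<and> hd g = (s, False) then g else (s, True) # g"
        and i = "\<lambda>g. (fst (hd g), if snd (hd g) then tl g else g)"], goal_cases)
    case (1 p)
    obtain s g where p: "p = (s, g)" by force
    have g: "g \<in> F" using 1 p by (auto simp: edge_targets_def)
    show ?case unfolding p by (auto dest: red_cons_cases)
  next
    case (2 p)
    obtain s g where p: "p = (s, g)" by force
    have g: "g \<in> F" "red_cons (s, True) g \<in> F" using 2 p by (auto simp: edge_targets_def)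
    have "(g \<noteq> [] \<and> hd g = (s, False)) \<or> red_cons (s, True) g = (s, True) # g"
      using red_cons_cases[OF red[OF g(1)], of s True] by (metis list.distinct(1) list.sel(1))
    thus ?case unfolding p using g by auto
  next
    case (3 g)
    then obtain s b w where gw: "g = (s, b) # w" by (cases g) auto
    have "reduced ((s, b) # w)" using red 3 gw by simp
    thus ?case unfolding gw
      by (cases w; cases b) (auto simp: reduced_Cons2)
  next
    case (4 g)
    then obtain s b w where gw: "g = (s, b) # w" by (cases g) auto
    have w: "w \<in> F" and s: "s \<in> S" and r: "reduced g"
      using F 4 gw by (auto simp: suffix_closed_def free_group_def)
    show ?case using w s 4 red_cons_reduced[of "(s, True)" w] r unfolding gw
      by (cases b) (auto simp: edge_targets_def)
  qed simp
  also have "\<dots> = card F - 1" using F by (simp add: suffix_closed_def)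
  finally show ?thesis .
qed

text \<open>The homomorphism to the integers that sends every generator to 1. It grows by one along
  each oriented edge, whatever the label.\<close>

definition height :: "'s word \<Rightarrow> int" where
  "height g = (\<Sum>x\<leftarrow>g. if snd x then -1 else 1)"

lemma height_red_cons: "height (red_cons (s, True) g) = height g - 1"
  by (cases g) (auto simp: height_def)

section \<open>Representations evaluated on words\<close>

lemma rep_unitary:
  assumes "\<forall>s\<in>S. X s \<in> unitary_set n" "fst ` set w \<subseteq> S"
  shows "rep n X w \<in> unitary_set n"
  using assms by (induction n X w rule: rep.induct) (auto intro!: unitary_ident unitary_mmul unitary_adj)

lemma rep_Cons: "rep n X (x # w) = mmul n (if snd x then adj (X (fst x)) else X (fst x)) (rep n X w)"
  by (cases x) simp

lemma letter_cancel:
  assumes "X s \<in> unitary_set n" "supp_in n n A"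
  shows "mmul n (if b then adj (X s) else X s) (mmul n (if \<not> b then adj (X s) else X s) A) = A"
  using assms by (auto simp: unitary_left unitary_right mmul_ident_left simp flip: mmul_assoc)

lemma red_cons_letters: "fst ` set (red_cons x w) \<subseteq> insert (fst x) (fst ` set w)"
  by (cases w) auto

lemma reduce_letters: "fst ` set (reduce w) \<subseteq> fst ` set w"
proof (induction w)
  case (Cons x w)
  thus ?case
    using order_trans[OF red_cons_letters[of x "reduce w"] Set.insert_mono[OF Cons]] by (simp add: reduce_Cons)
qed (simp add: reduce_def)

lemma rep_red_cons:
  assumes X: "\<forall>s\<in>S. X s \<in> unitary_set n" and w: "fst ` set w \<subseteq> S" "fst x \<in> S"
  shows "rep n X (red_cons x w) = rep n X (x # w)"
proof (cases w)
  case (Cons y ys)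
  obtain s b where x: "x = (s, b)" by force
  have "supp_in n n (rep n X ys)"
    by (rule unitary_supp[OF rep_unitary[OF X]]) (use w Cons in auto)
  thus ?thesis using Cons letter_cancel[of X s n "rep n X ys" b] X w x by (auto simp: rep_Cons)
qed simp

lemma rep_reduce:
  assumes X: "\<forall>s\<in>S. X s \<in> unitary_set n" and w: "fst ` set w \<subseteq> S"
  shows "rep n X (reduce w) = rep n X w"
  using w
proof (induction w)
  case (Cons x w)
  have "rep n X (reduce (x # w)) = rep n X (x # reduce w)"
    unfolding reduce_Cons by (rule rep_red_cons[OF X]) (use Cons.prems reduce_letters[of w] in auto)
  thus ?case using Cons by (simp add: rep_Cons)
qed (simp add: reduce_def)

lemma rep_append:
  assumes X: "\<forall>s\<in>S. X s \<in> unitary_set n" and v: "fst ` set v \<subseteq> S"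
  shows "rep n X (u @ v) = mmul n (rep n X u) (rep n X v)"
  by (induction u)
     (simp_all add: rep_Cons mmul_assoc mmul_ident_left unitary_supp[OF rep_unitary[OF X v]])

lemma fg_inv_letters: "fst ` set (fg_inv g) = fst ` set g"
  by (force simp: fg_inv_def)

lemma rep_fg_inv:
  assumes X: "\<forall>s\<in>S. X s \<in> unitary_set n" and g: "fst ` set g \<subseteq> S"
  shows "rep n X (fg_inv g) = adj (rep n X g)"
  using g
proof (induction g)
  case Nil
  show ?case by (simp add: fg_inv_def adj_ident)
next
  case (Cons x w)
  obtain s b where x: "x = (s, b)" by force
  have s: "s \<in> S" using Cons.prems x by simp
  have "rep n X (fg_inv (x # w)) = mmul n (rep n X (fg_inv w)) (rep n X [(s, \<not> b)])"
    unfolding x fg_inv_Cons by (rule rep_append[OF X]) (use s in auto)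
  also have "rep n X [(s, \<not> b)] = adj (if b then adj (X s) else X s)"
    using X s by (auto simp: mmul_ident_right unitary_supp supp_in_adj)
  finally show ?case using Cons x by (simp add: adj_mmul)
qed

text \<open>For unitary generators \<open>rep\<close> respects free reduction and turns inverses
  into adjoints. The identity rests on unitarity of the generators, which is why it is used almost
  everywhere rather than pointwise.\<close>

lemma Qpi_eq_gram:
  assumes X: "\<forall>s\<in>S. X s \<in> unitary_set n" and F: "F \<subseteq> free_group S"
    and gh: "g \<in> F" "h \<in> F" "i < k" "j < k"
  shows "Qpi n k V F X g h i j = cip n (mv n (rep n X g) (\<lambda>l. V l i)) (mv n (rep n X h) (\<lambda>l. V l j))"
proof -
  have l: "fst ` set g \<subseteq> S" "fst ` set h \<subseteq> S" using F gh by (auto simp: free_group_def)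
  have "rep n X (fg_mult (fg_inv g) h) = rep n X (fg_inv g @ h)"
    unfolding fg_mult_def by (rule rep_reduce[OF X]) (use l in \<open>auto simp: fg_inv_letters image_Un\<close>)
  also have "\<dots> = mmul n (adj (rep n X g)) (rep n X h)"
    by (simp add: rep_append[OF X l(2)] rep_fg_inv[OF X l(1)])
  finally have r: "rep n X (fg_mult (fg_inv g) h) = mmul n (adj (rep n X g)) (rep n X h)" .
  have "Qpi n k V F X g h i j = cip n (\<lambda>l. V l i) (mv n (rep n X (fg_mult (fg_inv g) h)) (\<lambda>l. V l j))"
    using gh by (simp add: Qpi_def cip_def mv_def sum_distrib_left mult.assoc)
  also have "\<dots> = cip n (mv n (rep n X g) (\<lambda>l. V l i)) (mv n (rep n X h) (\<lambda>l. V l j))"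
    unfolding r mv_mmul cip_mv_right[of n _ "adj (rep n X g)"] by simp
  finally show ?thesis .
qed

lemma rep_conj:
  assumes X: "\<forall>s\<in>S. X s \<in> unitary_set n" and W: "W \<in> unitary_set n" and w: "fst ` set w \<subseteq> S"
  shows "mmul n (rep n X w) W = mmul n W (rep n (\<lambda>s\<in>S. mmul n (adj W) (mmul n (X s) W)) w)"
  using w
proof (induction w)
  case Nil
  show ?case using W by (simp add: mmul_ident_left mmul_ident_right unitary_supp)
next
  case (Cons x w)
  let ?X = "\<lambda>s\<in>S. mmul n (adj W) (mmul n (X s) W)"
  obtain s b where x: "x = (s, b)" by force
  have s: "s \<in> S" using Cons.prems x by simp
  have ih: "mmul n (rep n X w) W = mmul n W (rep n ?X w)"
    using Cons.prems by (intro Cons.IH) auto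
  define L where "L = (if b then adj (X s) else X s)"
  have L: "supp_in n n L" using X s by (auto simp: L_def unitary_supp supp_in_adj)
  have L': "(if b then adj (?X s) else ?X s) = mmul n (adj W) (mmul n L W)"
    using s by (simp add: L_def adj_mmul mmul_assoc)
  have WL: "mmul n W (mmul n (adj W) (mmul n L W)) = mmul n L W"
    using L W by (simp add: unitary_right mmul_ident_left supp_in_mmul unitary_supp flip: mmul_assoc)
  have "mmul n (rep n X (x # w)) W = mmul n L (mmul n W (rep n ?X w))"
    by (simp only: x rep_Cons fst_conv snd_conv mmul_assoc ih L_def)
  also have "\<dots> = mmul n W (mmul n (mmul n (adj W) (mmul n L W)) (rep n ?X w))"
    by (metis WL mmul_assoc)
  finally show ?case by (simp only: x rep_Cons fst_conv snd_conv L')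
qed

section \<open>Double counting\<close>

lemma suffix_closed_letters: "suffix_closed S F \<Longrightarrow> g \<in> F \<Longrightarrow> fst ` set g \<subseteq> S"
  unfolding suffix_closed_def free_group_def by blast

lemma tvol_pair_sections:
  assumes \<Lambda>: "sigma_finite_measure \<Lambda>" and J: "finite J" and R: "R \<in> sets (tvol n J \<Otimes>\<^sub>M \<Lambda>)"
  shows "(\<integral>\<^sup>+X. emeasure (tvol n J) ((\<lambda>Y. (Y, X)) -` R) \<partial>\<Lambda>) = (\<integral>\<^sup>+Y. emeasure \<Lambda> (Pair Y -` R) \<partial>tvol n J)"
proof -
  interpret P: product_sigma_finite "\<lambda>_. cvol n" by (rule product_sigma_finite_cvol)
  interpret T: sigma_finite_measure "tvol n J" by (rule P.sigma_finite[OF J])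
  interpret L: sigma_finite_measure \<Lambda> by (rule \<Lambda>)
  interpret Q: pair_sigma_finite "tvol n J" \<Lambda> by standard
  show ?thesis using Q.emeasure_pair_measure_alt2[OF R] L.emeasure_pair_measure_alt[OF R] by simp
qed

lemma emeasure_tvol_union:
  assumes I: "finite I" "finite K" "I \<inter> K = {}" and A: "A \<in> sets (tvol n (I \<union> K))"
  shows "emeasure (tvol n (I \<union> K)) A
    = (\<integral>\<^sup>+Y. emeasure (tvol n K) {Z \<in> space (tvol n K). merge I K (Y, Z) \<in> A} \<partial>tvol n I)"
proof -
  interpret product_sigma_finite "\<lambda>_. cvol n" by (rule product_sigma_finite_cvol)
  have "emeasure (tvol n (I \<union> K)) A = (\<integral>\<^sup>+Y. indicator A Y \<partial>tvol n (I \<union> K))" using A by simp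
  also have "\<dots> = (\<integral>\<^sup>+Y. (\<integral>\<^sup>+Z. indicator A (merge I K (Y, Z)) \<partial>tvol n K) \<partial>tvol n I)"
    using A by (intro product_nn_integral_fold I) auto
  also have "\<dots> = (\<integral>\<^sup>+Y. emeasure (tvol n K) {Z \<in> space (tvol n K). merge I K (Y, Z) \<in> A} \<partial>tvol n I)"
  proof (rule nn_integral_cong)
    fix Y assume Y: "Y \<in> space (tvol n I)"
    have m: "(\<lambda>Z. merge I K (Y, Z)) \<in> measurable (tvol n K) (tvol n (I \<union> K))"
      using Y by (intro measurable_compose[OF measurable_Pair1' measurable_merge])
    have "{Z \<in> space (tvol n K). merge I K (Y, Z) \<in> A} \<in> sets (tvol n K)"
      using measurable_sets[OF m A] by (simp add: vimage_def Int_def conj_commute)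
    moreover have "(\<integral>\<^sup>+Z. indicator A (merge I K (Y, Z)) \<partial>tvol n K)
      = (\<integral>\<^sup>+Z. indicator {Z \<in> space (tvol n K). merge I K (Y, Z) \<in> A} Z \<partial>tvol n K)"
      by (intro nn_integral_cong) (auto simp: indicator_def)
    ultimately show "(\<integral>\<^sup>+Z. indicator A (merge I K (Y, Z)) \<partial>tvol n K)
      = emeasure (tvol n K) {Z \<in> space (tvol n K). merge I K (Y, Z) \<in> A}" by simp
  qed
  finally show ?thesis .
qed

definition orbit :: "nat \<Rightarrow> ('s \<Rightarrow> cmat) \<Rightarrow> (nat \<Rightarrow> cvec) \<Rightarrow> 's word \<times> nat \<Rightarrow> cvec" where
  "orbit n X V p = mv n (rep n X (fst p)) (V (snd p))"

definition near :: "nat \<Rightarrow> ('s word \<times> nat) set \<Rightarrow> ('s word \<times> nat \<Rightarrow> 's word \<times> nat \<Rightarrow> complex) \<Rightarrow> real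
    \<Rightarrow> ('s \<Rightarrow> cmat) \<Rightarrow> (nat \<Rightarrow> cvec) \<Rightarrow> bool" where
  "near n J q t X V \<longleftrightarrow> (\<forall>a\<in>J. \<forall>b\<in>J. cmod (cip n (orbit n X V a) (orbit n X V b) - q a b) < t)"

text \<open>The relation between generators and tuples that is counted in two ways.\<close>

definition edges :: "nat \<Rightarrow> nat \<Rightarrow> 's word set \<Rightarrow> real \<Rightarrow> ('s \<Rightarrow> cmat) \<Rightarrow> ('s word \<times> nat \<Rightarrow> cvec) \<Rightarrow> bool" where
  "edges n k F h X Y \<longleftrightarrow> (\<forall>g\<in>F - {[]}. \<forall>i<k. tree_edge n h X Y g i)"

text \<open>The generators are isometries, so going up the tree every letter adds at most one
  \<open>h\<close> to the error.\<close>

lemma edges_orbit: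
  assumes F: "suffix_closed S F" and X: "\<forall>s\<in>S. X s \<in> unitary_set n" and e: "edges n k F h X Y"
    and g: "g \<in> F" and i: "i < k" and h: "0 \<le> h"
  shows "cnorm n (\<lambda>l. Y (g, i) l - orbit n X (\<lambda>i. Y ([], i)) (g, i) l) \<le> real (length g) * h"
  using g
proof (induction g)
  case Nil
  have "cnorm n (\<lambda>l. Y ([], i) l - mv n (ident n) (Y ([], i)) l) = cnorm n (\<lambda>_. 0)"
    by (rule cnorm_cong) (simp add: mv_ident)
  thus ?case by (simp add: orbit_def cnorm_def L2_set_def)
next
  case (Cons x w)
  obtain s b where x: "x = (s, b)" by force
  have w: "w \<in> F" and s: "s \<in> S"
    using F Cons.prems x by (auto simp: suffix_closed_def free_group_def)
  define L where "L = (if b then adj (X s) else X s)"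
  have L: "L \<in> unitary_set n" using X s by (auto simp: L_def unitary_adj)
  have "tree_edge n h X Y (x # w) i" using e Cons.prems i by (auto simp: edges_def)
  hence 1: "cnorm n (\<lambda>l. Y (x # w, i) l - mv n L (Y (w, i)) l) \<le> h"
    using X s by (auto simp: x tree_edge_def L_def cnorm_minus_commute[of n "Y ((s, b) # w, i)"]
        cnorm_mv_adj_swap split: if_splits)
  have "cnorm n (\<lambda>l. mv n L (Y (w, i)) l - mv n L (orbit n X (\<lambda>i. Y ([], i)) (w, i)) l) \<le> real (length w) * h"
    unfolding cnorm_mv_diff_unitary[OF L] by (rule Cons.IH[OF w])
  moreover have "mv n L (orbit n X (\<lambda>i. Y ([], i)) (w, i)) = orbit n X (\<lambda>i. Y ([], i)) (x # w, i)"
    by (simp add: orbit_def x L_def mv_mmul)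
  ultimately show ?case
    using 1 cnorm_diff_triangle[of n "Y (x # w, i)" "orbit n X (\<lambda>i. Y ([], i)) (x # w, i)" "mv n L (Y (w, i))"]
    by (simp add: algebra_simps)
qed

context haar
begin

abbreviation randrep :: "'s set \<Rightarrow> ('s \<Rightarrow> cmat) measure" where
  "randrep S \<equiv> PiM S (\<lambda>_. \<mu>)"

lemma measurable_generator [measurable (raw)]:
  "s \<in> S \<Longrightarrow> (\<lambda>X. X s) \<in> measurable (randrep S) borel"
  by (rule measurable_component_singleton[of s S "\<lambda>_. \<mu>", unfolded measurable_cong_sets[OF refl sets_haar]])

lemma prob_space_randrep: "prob_space (randrep S)"
  by (intro prob_space_PiM prob_space_axioms)

lemma AE_randrep_unitary:
  assumes "finite S"
  shows "AE X in randrep S. \<forall>s\<in>S. X s \<in> unitary_set n"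
  using assms
  by (intro AE_finite_allI AE_PiM_component AE_unitary) (auto intro: prob_space_axioms)

lemma measurable_rep:
  assumes f: "\<And>s. s \<in> S \<Longrightarrow> (\<lambda>x. f x s) \<in> borel_measurable M" and w: "fst ` set w \<subseteq> S"
  shows "(\<lambda>x. rep n (f x) w) \<in> borel_measurable M"
  using w
proof (induction w)
  case (Cons x w)
  obtain s b where x: "x = (s, b)" by force
  have [measurable]: "(\<lambda>x. rep n (f x) w) \<in> borel_measurable M" "(\<lambda>x. f x s) \<in> borel_measurable M"
    using Cons x f by auto
  show ?case unfolding x by (cases b) simp_all
qed simp

text \<open>Grouping the edges by label turns the event into a product over the independent
  generators.\<close>

lemma emeasure_edges:
  assumes S: "finite S" and F: "suffix_closed S F"
  shows "emeasure (randrep S) {X \<in> space (randrep S). edges n k F h X Y}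
    = (\<Prod>s\<in>S. hprob (edge_targets S F s \<times> {..<k}) h (\<lambda>(g, i). Y (red_cons (s, True) g, i)) Y)"
proof -
  interpret P: product_sigma_finite "\<lambda>_. \<mu>" by standard
  let ?A = "\<lambda>s (g, i). Y (red_cons (s, True) g, i)"
  let ?S = "\<lambda>s. {U. \<forall>j\<in>edge_targets S F s \<times> {..<k}. cnorm n (\<lambda>l. mv n U (?A s j) l - Y j l) \<le> h}"
  have "{X \<in> space (randrep S). edges n k F h X Y} = PiE S ?S"
    unfolding edges_def tree_edges_iff[OF F]
    by (auto simp: space_PiM PiE_iff extensional_def)
  moreover have "finite (edge_targets S F s \<times> {..<k})" for s
    using F by (auto simp: suffix_closed_def edge_targets_def)
  hence "emeasure (randrep S) (PiE S ?S) = (\<Prod>s\<in>S. emeasure \<mu> (?S s))"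
    by (intro P.emeasure_PiM S) (simp only: sets_haar, rule hprob_sets)
  ultimately show ?thesis by (simp only: hprob_def)
qed

lemma measurable_tree_edge:
  assumes X: "\<And>s. s \<in> S \<Longrightarrow> (\<lambda>x. X x s) \<in> borel_measurable M"
    and Y: "\<And>g i. g \<in> F \<Longrightarrow> i < k \<Longrightarrow> (\<lambda>x. Y x (g, i)) \<in> borel_measurable M"
    and F: "suffix_closed S F" and g: "g \<in> F - {[]}" "i < k"
  shows "Measurable.pred M (\<lambda>x. tree_edge n h (X x) (Y x) g i)"
proof -
  obtain s b w where gw: "g = (s, b) # w" using g by (cases g) auto
  have w: "w \<in> F" and s: "s \<in> S"
    using F g gw by (auto simp: suffix_closed_def free_group_def)
  have [measurable]: "(\<lambda>x. X x s) \<in> borel_measurable M" "(\<lambda>x. Y x (g, i)) \<in> borel_measurable M"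
    "(\<lambda>x. Y x (w, i)) \<in> borel_measurable M"
    using X Y s w g by auto
  hence [measurable]: "(\<lambda>x. Y x ((s, b) # w, i)) \<in> borel_measurable M" by (simp add: gw)
  show ?thesis
  proof (cases b)
    case True
    show ?thesis unfolding tree_edge_def gw list.sel fst_conv snd_conv
      by (subst if_P[OF True]) measurable
  next
    case False
    show ?thesis unfolding tree_edge_def gw list.sel fst_conv snd_conv
      by (subst if_not_P[OF False]) measurable
  qed
qed

lemma measurable_edges:
  assumes X: "\<And>s. s \<in> S \<Longrightarrow> (\<lambda>x. X x s) \<in> borel_measurable M"
    and Y: "\<And>g i. g \<in> F \<Longrightarrow> i < k \<Longrightarrow> (\<lambda>x. Y x (g, i)) \<in> borel_measurable M"
    and F: "suffix_closed S F"
  shows "Measurable.pred M (\<lambda>x. edges n k F h (X x) (Y x))"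
proof -
  have "finite (F - {[]})" using F by (simp add: suffix_closed_def)
  moreover have "Measurable.pred M (\<lambda>x. tree_edge n h (X x) (Y x) g i)" if "g \<in> F - {[]}" "i \<in> {..<k}" for g i
    by (rule measurable_tree_edge[where X = X and Y = Y and S = S and F = F and k = k]) (use X Y F that in auto)
  moreover have "(\<forall>i<k. P i) \<longleftrightarrow> (\<forall>i\<in>{..<k}. P i)" for P by auto
  ultimately show ?thesis unfolding edges_def
    by (simp only:) (intro pred_intros_finite finite_lessThan)
qed

lemma measurable_near:
  assumes X: "\<And>s. s \<in> S \<Longrightarrow> (\<lambda>x. X x s) \<in> borel_measurable M"
    and V: "\<And>i. i < k \<Longrightarrow> (\<lambda>x. V x i) \<in> borel_measurable M"
    and F: "suffix_closed S F"
  shows "Measurable.pred M (\<lambda>x. near n (F \<times> {..<k}) q t (X x) (V x))"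
proof -
  have fin: "finite (F \<times> {..<k})" using F by (simp add: suffix_closed_def)
  have [measurable]: "(\<lambda>x. orbit n (X x) (V x) a) \<in> borel_measurable M" if "a \<in> F \<times> {..<k}" for a
  proof -
    have [measurable]: "(\<lambda>x. rep n (X x) (fst a)) \<in> borel_measurable M" "(\<lambda>x. V x (snd a)) \<in> borel_measurable M"
      using that V by (auto intro!: measurable_rep[OF X] suffix_closed_letters[OF F, THEN subsetD])
    show ?thesis unfolding orbit_def by measurable
  qed
  show ?thesis unfolding near_def using fin by measurable
qed

definition pnear :: "'s set \<Rightarrow> ('s word \<times> nat) set \<Rightarrow> ('s word \<times> nat \<Rightarrow> 's word \<times> nat \<Rightarrow> complex) \<Rightarrow> real
    \<Rightarrow> (nat \<Rightarrow> cvec) \<Rightarrow> ennreal" where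
  "pnear S J q t V = emeasure (randrep S) {X \<in> space (randrep S). near n J q t X V}"

lemma sets_near:
  assumes "suffix_closed S F"
  shows "{X \<in> space (randrep S). near n (F \<times> {..<k}) q t X V} \<in> sets (randrep S)"
  using measurable_near[of S "\<lambda>X. X" "randrep S" k "\<lambda>_. V" F q t] assms by (auto simp: pred_def)

lemma orbit_conj:
  assumes X: "\<forall>s\<in>S. X s \<in> unitary_set n" and W: "W \<in> unitary_set n" and g: "fst ` set g \<subseteq> S"
  shows "orbit n X (\<lambda>i. mv n W (V i)) (g, i) = mv n W (orbit n (\<lambda>s\<in>S. mmul n (adj W) (mmul n (X s) W)) V (g, i))"
  by (simp add: orbit_def rep_conj[OF X W g] flip: mv_mmul)

text \<open>Rotating the frame amounts to conjugating all generators, which preserves their law. The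
  two orbits differ by the rotation, which Gram matrices do not see.\<close>

lemma pnear_conj:
  assumes S: "finite S" and F: "suffix_closed S F" and W: "W \<in> unitary_set n"
  shows "pnear S (F \<times> {..<k}) q t (\<lambda>i. mv n W (V i)) = pnear S (F \<times> {..<k}) q t V"
proof -
  let ?J = "F \<times> {..<k}"
  let ?f = "\<lambda>X. mmul n (adj W) (mmul n X W)"
  let ?c = "compose S ?f"
  have d: "distr (randrep S) (randrep S) ?c = randrep S"
    using distr_PiM_finite_prob_space'[OF S, of "\<lambda>_. \<mu>" "\<lambda>_. \<mu>" ?f] conj_invariant[OF W] prob_space_axioms
    by simp
  have cm: "?c \<in> measurable (randrep S) (randrep S)"
    unfolding compose_def by (intro measurable_restrict) measurable
  have "pnear S ?J q t V = emeasure (distr (randrep S) (randrep S) ?c) {X \<in> space (randrep S). near n ?J q t X V}"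
    unfolding pnear_def d ..
  also have "\<dots> = emeasure (randrep S) {X \<in> space (randrep S). near n ?J q t (?c X) V}"
    using cm sets_near[OF F] measurable_space[OF cm]
    by (subst emeasure_distr) (auto intro!: arg_cong[of _ _ "emeasure (randrep S)"])
  also have "\<dots> = emeasure (randrep S) {X \<in> space (randrep S). near n ?J q t X (\<lambda>i. mv n W (V i))}"
  proof (rule emeasure_eq_AE)
    show "AE X in randrep S. (X \<in> {X \<in> space (randrep S). near n ?J q t (?c X) V}) \<longleftrightarrow>
       (X \<in> {X \<in> space (randrep S). near n ?J q t X (\<lambda>i. mv n W (V i))})"
      using AE_randrep_unitary[OF S]
    proof eventually_elim
      case (elim X)
      have "orbit n X (\<lambda>i. mv n W (V i)) a = mv n W (orbit n (?c X) V a)" if "a \<in> ?J" for a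
      proof -
        obtain g i where a: "a = (g, i)" by force
        have "fst ` set g \<subseteq> S" using that F a by (auto simp: suffix_closed_def free_group_def)
        from orbit_conj[OF elim W this] show ?thesis unfolding a compose_def by simp
      qed
      thus ?case by (auto simp: near_def cip_mv_unitary[OF W])
    qed
    have 1: "(\<lambda>X. ?c X s) \<in> borel_measurable (randrep S)" if "s \<in> S" for s
      using that unfolding compose_def by simp
    have "Measurable.pred (randrep S) (\<lambda>X. near n ?J q t (?c X) V)"
      by (rule measurable_near[OF 1 _ F]) auto
    thus "{X \<in> space (randrep S). near n ?J q t (?c X) V} \<in> sets (randrep S)" by (simp add: pred_def)
    show "{X \<in> space (randrep S). near n ?J q t X (\<lambda>i. mv n W (V i))} \<in> sets (randrep S)"
      by (rule sets_near[OF F])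
  qed
  finally show ?thesis by (simp add: pnear_def)
qed

text \<open>Allows the frame \<open>V\<close> to be exchanged for a nearby base tuple in the volume
  count, at the price of changing the tolerance from \<open>t\<close> to \<open>t'\<close>.\<close>

lemma pnear_perturb:
  assumes S: "finite S" and F: "suffix_closed S F" and W: "W \<in> unitary_set n"
    and V: "\<And>i. i < k \<Longrightarrow> cnorm n (V i) \<le> R" "\<And>i. i < k \<Longrightarrow> cnorm n (V' i) \<le> R"
      "\<And>i. i < k \<Longrightarrow> cnorm n (\<lambda>l. mv n W (V i) l - V' i l) \<le> e"
    and t: "t + 2 * R * e \<le> t'"
  shows "pnear S (F \<times> {..<k}) q t V \<le> pnear S (F \<times> {..<k}) q t' V'"
proof -
  let ?J = "F \<times> {..<k}"
  have "pnear S ?J q t V = pnear S ?J q t (\<lambda>i. mv n W (V i))" by (rule pnear_conj[OF S F W, symmetric])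
  also have "\<dots> \<le> pnear S ?J q t' V'"
    unfolding pnear_def
  proof (rule emeasure_mono_AE)
    show "AE X in randrep S. X \<in> {X \<in> space (randrep S). near n ?J q t X (\<lambda>i. mv n W (V i))} \<longrightarrow>
        X \<in> {X \<in> space (randrep S). near n ?J q t' X V'}"
      using AE_randrep_unitary[OF S]
    proof eventually_elim
      case (elim X)
      have ru: "rep n X (fst a) \<in> unitary_set n" if "a \<in> ?J" for a
        by (rule rep_unitary[OF elim suffix_closed_letters[OF F]]) (use that in auto)
      have no: "cnorm n (orbit n X (\<lambda>i. mv n W (V i)) a) \<le> R" "cnorm n (orbit n X V' a) \<le> R"
        "cnorm n (\<lambda>l. orbit n X V' a l - orbit n X (\<lambda>i. mv n W (V i)) a l) \<le> e" if "a \<in> ?J" for a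
        unfolding orbit_def cnorm_mv_unitary[OF ru[OF that]] cnorm_mv_diff_unitary[OF ru[OF that]] cnorm_mv_unitary[OF W]
        using V[of "snd a"] that by (auto simp: cnorm_minus_commute[of n "V' _"])
      have "near n ?J q t' X V'" if "near n ?J q t X (\<lambda>i. mv n W (V i))"
        unfolding near_def
      proof (intro ballI)
        fix a b assume ab: "a \<in> ?J" "b \<in> ?J"
        let ?u = "cip n (orbit n X V' a) (orbit n X V' b)"
        let ?v = "cip n (orbit n X (\<lambda>i. mv n W (V i)) a) (orbit n X (\<lambda>i. mv n W (V i)) b)"
        have "cmod (?u - ?v) \<le> 2 * R * e"
          by (rule cip_perturb) (use no ab in auto)
        moreover have "cmod (?v - q a b) < t" using that ab by (auto simp: near_def)
        ultimately show "cmod (?u - q a b) < t'"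
          using norm_triangle_ineq[of "?u - ?v" "?v - q a b"] t by simp
      qed
      thus ?case by auto
    qed
  qed (rule sets_near[OF F])
  finally show ?thesis .
qed

text \<open>The tree grows leaf by leaf. For fixed generators the \<open>k\<close> vectors at a new
  word range over balls centred at the images of the parent vectors, so the volume of the noisy
  orbits does not depend on the generators.\<close>

lemma tree_volume:
  assumes F: "suffix_closed S F" and X: "\<forall>s\<in>S. X s \<in> unitary_set n" and h: "0 < h"
    and A: "A \<in> sets (tvol n ({[]} \<times> {..<k}))"
  shows "emeasure (tvol n (F \<times> {..<k})) {Y \<in> space (tvol n (F \<times> {..<k})). restrict Y ({[]} \<times> {..<k}) \<in> A \<and> edges n k F h X Y}
    = ennreal ((h ^ (2 * n) * vball n) ^ (k * (card F - 1))) * emeasure (tvol n ({[]} \<times> {..<k})) A"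
  using F
proof (induction rule: suffix_closed_induct)
  case empty
  have "{Y \<in> space (tvol n ({[]} \<times> {..<k})). restrict Y ({[]} \<times> {..<k}) \<in> A \<and> edges n k {[]} h X Y} = A"
    using sets.sets_into_space[OF A] by (auto simp: edges_def space_PiM extensional_restrict PiE_iff subset_eq)
  thus ?case by (simp only: card.empty card.insert finite.emptyI empty_iff) simp
next
  case (insert F x w)
  note F = insert.hyps(1) and IH = insert.IH and g = insert.hyps(2) and w = insert.hyps(3)
  let ?g = "x # w"
  let ?I = "F \<times> {..<k}" and ?K = "{?g} \<times> {..<k}" and ?E = "{[]} \<times> {..<k}"
  let ?c = "h ^ (2 * n) * vball n"
  let ?B = "\<lambda>F. {Y \<in> space (tvol n (F \<times> {..<k})). restrict Y ?E \<in> A \<and> edges n k F h X Y}"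
  obtain s b where x: "x = (s, b)" by force
  have s: "s \<in> S" using insert.hyps(4) x by (auto simp: free_group_def)
  have sc: "suffix_closed S (insert ?g F)"
    using F w insert.hyps(4) by (auto simp: suffix_closed_def)
  have fin: "finite F" "[] \<in> F" using F by (auto simp: suffix_closed_def)
  have U: "insert ?g F \<times> {..<k} = ?I \<union> ?K" by auto
  have disj: "?I \<inter> ?K = {}" using g by auto
  have Bm: "?B G \<in> sets (tvol n (G \<times> {..<k}))" if G: "suffix_closed S G" for G
  proof -
    have 1: "Measurable.pred (tvol n (G \<times> {..<k})) (\<lambda>Y. edges n k G h X Y)"
      by (rule measurable_edges[OF _ _ G]) auto
    have "(\<lambda>Y. restrict Y ?E) \<in> measurable (tvol n (G \<times> {..<k})) (tvol n ?E)"
      by (rule measurable_restrict_subset) (use G in \<open>auto simp: suffix_closed_def\<close>)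
    from measurable_sets[OF this A] have "{Y \<in> space (tvol n (G \<times> {..<k})). restrict Y ?E \<in> A} \<in> sets (tvol n (G \<times> {..<k}))"
      by (simp add: vimage_def Int_def conj_commute)
    moreover have "?B G = {Y \<in> space (tvol n (G \<times> {..<k})). restrict Y ?E \<in> A} \<inter> {Y \<in> space (tvol n (G \<times> {..<k})). edges n k G h X Y}"
      by auto
    ultimately show ?thesis using 1 by (simp only: pred_def) (rule sets.Int)
  qed
  have "emeasure (tvol n (insert ?g F \<times> {..<k})) (?B (insert ?g F))
    = (\<integral>\<^sup>+Y. emeasure (tvol n ?K) {Z \<in> space (tvol n ?K). merge ?I ?K (Y, Z) \<in> ?B (insert ?g F)} \<partial>tvol n ?I)"
    using Bm[OF sc] fin disj unfolding U by (intro emeasure_tvol_union) auto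
  also have "\<dots> = (\<integral>\<^sup>+Y. ennreal (?c ^ k) * indicator (?B F) Y \<partial>tvol n ?I)"
  proof (rule nn_integral_cong)
    fix Y assume Y: "Y \<in> space (tvol n ?I)"
    define a where "a p = mv n (if b then adj (X s) else X s) (Y (w, snd p))" for p :: "'a word \<times> nat"
    have m1: "merge ?I ?K (Y, Z) (u, i) = Y (u, i)" if "u \<in> F" "i < k" for Z u i
      using that by (simp add: merge_def)
    have m2: "merge ?I ?K (Y, Z) (?g, i) = Z (?g, i)" if "i < k" for Z i
      using that g by (simp add: merge_def)
    have tl: "tl u \<in> F" if "u \<in> F - {[]}" for u
      using that F by (cases u) (auto simp: suffix_closed_def)
    have te1: "tree_edge n h X (merge ?I ?K (Y, Z)) u i = tree_edge n h X Y u i" if "u \<in> F - {[]}" "i < k" for Z u i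
      using that tl by (auto simp: tree_edge_def m1)
    have te2: "tree_edge n h X (merge ?I ?K (Y, Z)) ?g i \<longleftrightarrow> cnorm n (\<lambda>l. Z (?g, i) l - a (?g, i) l) \<le> h" if "i < k" for Z i
      unfolding tree_edge_def list.sel m1[OF w that] m2[OF that]
      using X s by (auto simp: x a_def cnorm_minus_commute[of n "Z _"] cnorm_mv_adj_swap)
    have r: "restrict (merge ?I ?K (Y, Z)) ?E = restrict Y ?E" for Z
      using fin by (auto simp: restrict_def m1 fun_eq_iff)
    have sp: "merge ?I ?K (Y, Z) \<in> space (tvol n (insert ?g F \<times> {..<k}))" for Z
      unfolding U by (auto simp: space_PiM merge_def extensional_def PiE_iff)
    have "edges n k (insert ?g F) h X (merge ?I ?K (Y, Z)) \<longleftrightarrow>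
        edges n k F h X Y \<and> (\<forall>p\<in>?K. cnorm n (\<lambda>l. Z p l - a p l) \<le> h)" for Z
      unfolding edges_def using te1 te2 g by (auto simp: insert_Diff_if)
    hence "{Z \<in> space (tvol n ?K). merge ?I ?K (Y, Z) \<in> ?B (insert ?g F)}
      = (if Y \<in> ?B F then {Z \<in> space (tvol n ?K). \<forall>p\<in>?K. cnorm n (\<lambda>l. Z p l - a p l) \<le> h} else {})"
      using Y r sp by auto
    thus "emeasure (tvol n ?K) {Z \<in> space (tvol n ?K). merge ?I ?K (Y, Z) \<in> ?B (insert ?g F)} = ennreal (?c ^ k) * indicator (?B F) Y"
      using emeasure_tvol_box[of ?K h a] h by (simp add: card_cartesian_product)
  qed
  also have "\<dots> = ennreal (?c ^ k) * emeasure (tvol n ?I) (?B F)"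
    using Bm[OF F] by (simp add: nn_integral_cmult_indicator)
  also have "\<dots> = ennreal (?c ^ k * ?c ^ (k * (card F - 1))) * emeasure (tvol n ?E) A"
    using h by (simp add: IH ennreal_mult' mult.assoc)
  also have "?c ^ k * ?c ^ (k * (card F - 1)) = ?c ^ (k * (card (insert ?g F) - 1))"
  proof -
    have "0 < card F" using fin by (auto simp: card_gt_0_iff)
    hence "k + k * (card F - 1) = k * card F" by (cases "card F") auto
    thus ?thesis using fin g by (simp flip: power_add)
  qed
  finally show ?case .
qed

end

lemma near_cong:
  assumes "\<And>i. i < k \<Longrightarrow> V i = V' i"
  shows "near n (F \<times> {..<k}) q t X V \<longleftrightarrow> near n (F \<times> {..<k}) q t X V'"
proof -
  have "orbit n X V a = orbit n X V' a" if "a \<in> F \<times> {..<k}" for a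
    using that assms by (auto simp: orbit_def)
  thus ?thesis by (auto simp: near_def)
qed

context haar
begin

text \<open>The probability is averaged over base tuples in \<open>B\<close>, because Lebesgue
  measure cannot see a single frame.\<close>

lemma near_average:
  assumes S: "finite S" and F: "suffix_closed S F" and B: "B \<in> sets (tvol n ({[]} \<times> {..<k}))"
  shows "(\<integral>\<^sup>+X. emeasure (tvol n ({[]} \<times> {..<k})) {Y \<in> B. near n (F \<times> {..<k}) q t X (\<lambda>i. Y ([], i))} \<partial>randrep S)
    = (\<integral>\<^sup>+Y. pnear S (F \<times> {..<k}) q t (\<lambda>i. Y ([], i)) * indicator B Y \<partial>tvol n ({[]} \<times> {..<k}))"
    "\<And>X. {Y \<in> B. near n (F \<times> {..<k}) q t X (\<lambda>i. Y ([], i))} \<in> sets (tvol n ({[]} \<times> {..<k}))"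
    "(\<lambda>X. emeasure (tvol n ({[]} \<times> {..<k})) {Y \<in> B. near n (F \<times> {..<k}) q t X (\<lambda>i. Y ([], i))}) \<in> borel_measurable (randrep S)"
proof -
  let ?E = "{[]} \<times> {..<k}" and ?J = "F \<times> {..<k}"
  let ?M = "tvol n ?E \<Otimes>\<^sub>M randrep S"
  interpret L: prob_space "randrep S" by (rule prob_space_randrep)
  interpret PP: product_sigma_finite "\<lambda>_. cvol n" by (rule product_sigma_finite_cvol)
  interpret T: sigma_finite_measure "tvol n ?E" by (rule PP.sigma_finite) simp
  interpret Q: pair_sigma_finite "tvol n ?E" "randrep S" by standard
  define R where "R = {p \<in> space ?M. fst p \<in> B \<and> near n ?J q t (snd p) (\<lambda>i. fst p ([], i))}"
  have 1: "(\<lambda>p. snd p s) \<in> borel_measurable ?M" if "s \<in> S" for s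
    using that by measurable
  have 2: "(\<lambda>p. fst p ([], i)) \<in> borel_measurable ?M" if "i < k" for i
  proof -
    have "([], i) \<in> ?E" using that by simp
    thus ?thesis by measurable
  qed
  have "Measurable.pred ?M (\<lambda>p. near n ?J q t (snd p) (\<lambda>i. fst p ([], i)))"
    by (rule measurable_near[where X = snd and V = "\<lambda>p i. fst p ([], i)" and S = S and k = k])
       (use 1 2 F in auto)
  moreover have "Measurable.pred ?M (\<lambda>p. fst p \<in> B)" using B by measurable
  ultimately have R: "R \<in> sets ?M" unfolding R_def by measurable
  have s1: "(\<lambda>Y. (Y, X)) -` R = {Y \<in> B. near n ?J q t X (\<lambda>i. Y ([], i))}" if "X \<in> space (randrep S)" for X
    using that sets.sets_into_space[OF B] by (auto simp: R_def space_pair_measure)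
  have s2: "emeasure (randrep S) (Pair Y -` R) = pnear S ?J q t (\<lambda>i. Y ([], i)) * indicator B Y"
    if "Y \<in> space (tvol n ?E)" for Y
  proof -
    have "Pair Y -` R = (if Y \<in> B then {X \<in> space (randrep S). near n ?J q t X (\<lambda>i. Y ([], i))} else {})"
      using that by (auto simp: R_def space_pair_measure)
    thus ?thesis by (simp add: pnear_def)
  qed
  show "(\<integral>\<^sup>+X. emeasure (tvol n ?E) {Y \<in> B. near n ?J q t X (\<lambda>i. Y ([], i))} \<partial>randrep S)
    = (\<integral>\<^sup>+Y. pnear S ?J q t (\<lambda>i. Y ([], i)) * indicator B Y \<partial>tvol n ?E)"
    using tvol_pair_sections[OF L.sigma_finite_measure_axioms _ R]
    by (simp add: s1 s2 cong: nn_integral_cong)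
  have "(\<lambda>X. emeasure (tvol n ?E) ((\<lambda>Y. (Y, X)) -` R)) \<in> borel_measurable (randrep S)"
    by (rule Q.measurable_emeasure_Pair2[OF R])
  thus "(\<lambda>X. emeasure (tvol n ?E) {Y \<in> B. near n ?J q t X (\<lambda>i. Y ([], i))}) \<in> borel_measurable (randrep S)"
    by (subst measurable_cong[OF arg_cong[OF s1, symmetric]])
  fix X :: "'a \<Rightarrow> cmat"
  have "Measurable.pred (tvol n ?E) (\<lambda>Y. near n ?J q t X (\<lambda>i. Y ([], i)))"
    by (rule measurable_near[where X = "\<lambda>_. X" and V = "\<lambda>Y i. Y ([], i)" and S = S and k = k]) (use F in auto)
  hence "B \<inter> {Y \<in> space (tvol n ?E). near n ?J q t X (\<lambda>i. Y ([], i))} \<in> sets (tvol n ?E)"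
    using B by (auto simp: pred_def)
  moreover have "B \<inter> {Y \<in> space (tvol n ?E). near n ?J q t X (\<lambda>i. Y ([], i))} = {Y \<in> B. near n ?J q t X (\<lambda>i. Y ([], i))}"
    using sets.sets_into_space[OF B] by auto
  ultimately show "{Y \<in> B. near n ?J q t X (\<lambda>i. Y ([], i))} \<in> sets (tvol n ?E)" by simp
qed

abbreviation edge_prob :: "'s set \<Rightarrow> 's word set \<Rightarrow> nat \<Rightarrow> real \<Rightarrow> ('s word \<times> nat \<Rightarrow> cvec) \<Rightarrow> ennreal" where
  "edge_prob S F k h Y \<equiv> \<Prod>s\<in>S. hprob (edge_targets S F s \<times> {..<k}) h (\<lambda>(g, i). Y (red_cons (s, True) g, i)) Y"

lemma edges_average:
  assumes S: "finite S" and F: "suffix_closed S F" and G: "G \<in> sets (tvol n (F \<times> {..<k}))"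
  shows "(\<integral>\<^sup>+X. emeasure (tvol n (F \<times> {..<k})) {Y \<in> G. edges n k F h X Y} \<partial>randrep S)
    = (\<integral>\<^sup>+Y. edge_prob S F k h Y * indicator G Y \<partial>tvol n (F \<times> {..<k}))"
    "\<And>X. {Y \<in> G. edges n k F h X Y} \<in> sets (tvol n (F \<times> {..<k}))"
proof -
  let ?J = "F \<times> {..<k}"
  let ?M = "tvol n ?J \<Otimes>\<^sub>M randrep S"
  have J: "finite ?J" using F by (simp add: suffix_closed_def)
  interpret L: prob_space "randrep S" by (rule prob_space_randrep)
  define R where "R = {p \<in> space ?M. fst p \<in> G \<and> edges n k F h (snd p) (fst p)}"
  have 1: "(\<lambda>p. snd p s) \<in> borel_measurable ?M" if "s \<in> S" for s
    using that by measurable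
  have 2: "(\<lambda>p. fst p (g, i)) \<in> borel_measurable ?M" if "g \<in> F" "i < k" for g i
  proof -
    have "(g, i) \<in> ?J" using that by simp
    thus ?thesis by measurable
  qed
  have "Measurable.pred ?M (\<lambda>p. edges n k F h (snd p) (fst p))"
    by (rule measurable_edges[where X = snd and Y = fst and S = S]) (use 1 2 F in auto)
  moreover have "Measurable.pred ?M (\<lambda>p. fst p \<in> G)" using G by measurable
  ultimately have R: "R \<in> sets ?M" unfolding R_def by measurable
  have s1: "(\<lambda>Y. (Y, X)) -` R = {Y \<in> G. edges n k F h X Y}" if "X \<in> space (randrep S)" for X
    using that sets.sets_into_space[OF G] by (auto simp: R_def space_pair_measure)
  have s2: "emeasure (randrep S) (Pair Y -` R) = edge_prob S F k h Y * indicator G Y"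
    if "Y \<in> space (tvol n ?J)" for Y
  proof -
    have "Pair Y -` R = (if Y \<in> G then {X \<in> space (randrep S). edges n k F h X Y} else {})"
      using that by (auto simp: R_def space_pair_measure)
    thus ?thesis using emeasure_edges[OF S F, of k h Y] by simp
  qed
  show "(\<integral>\<^sup>+X. emeasure (tvol n ?J) {Y \<in> G. edges n k F h X Y} \<partial>randrep S)
    = (\<integral>\<^sup>+Y. edge_prob S F k h Y * indicator G Y \<partial>tvol n ?J)"
    using tvol_pair_sections[OF L.sigma_finite_measure_axioms J R]
    by (simp add: s1 s2 cong: nn_integral_cong)
  fix X :: "'a \<Rightarrow> cmat"
  have "Measurable.pred (tvol n ?J) (\<lambda>Y. edges n k F h X Y)"
    by (rule measurable_edges[where X = "\<lambda>_. X" and Y = "\<lambda>Y. Y" and S = S]) (use F in auto)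
  hence "G \<inter> {Y \<in> space (tvol n ?J). edges n k F h X Y} \<in> sets (tvol n ?J)"
    using G by (auto simp: pred_def)
  moreover have "G \<inter> {Y \<in> space (tvol n ?J). edges n k F h X Y} = {Y \<in> G. edges n k F h X Y}"
    using sets.sets_into_space[OF G] by auto
  ultimately show "{Y \<in> G. edges n k F h X Y} \<in> sets (tvol n ?J)" by simp
qed

text \<open>Generators first, each good base tuple contributes the constant volume of
  \<open>tree_volume\<close>, which on average brings in the probability sought. Tuples first, all
  related tuples lie in \<open>G\<close> and each is related to generators with probability at most
  \<open>c\<close>.\<close>

lemma double_count_upper:
  assumes S: "finite S" and F: "suffix_closed S F" and h: "0 < h"
    and G: "G \<in> sets (tvol n (F \<times> {..<k}))" and B: "B \<in> sets (tvol n ({[]} \<times> {..<k}))"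
    and imp: "\<And>X Y. \<forall>s\<in>S. X s \<in> unitary_set n \<Longrightarrow> Y \<in> space (tvol n (F \<times> {..<k})) \<Longrightarrow>
      restrict Y ({[]} \<times> {..<k}) \<in> B \<Longrightarrow> edges n k F h X Y \<Longrightarrow>
      near n (F \<times> {..<k}) q t X (\<lambda>i. Y ([], i)) \<Longrightarrow> Y \<in> G"
    and cG: "\<And>Y. Y \<in> G \<Longrightarrow> edge_prob S F k h Y \<le> c"
    and pB: "\<And>Y. Y \<in> B \<Longrightarrow> p \<le> pnear S (F \<times> {..<k}) q t (\<lambda>i. Y ([], i))"
  shows "ennreal ((h ^ (2 * n) * vball n) ^ (k * (card F - 1))) * (p * emeasure (tvol n ({[]} \<times> {..<k})) B)
    \<le> c * emeasure (tvol n (F \<times> {..<k})) G"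
proof -
  let ?E = "{[]} \<times> {..<k}" and ?J = "F \<times> {..<k}"
  let ?C = "ennreal ((h ^ (2 * n) * vball n) ^ (k * (card F - 1)))"
  let ?A = "\<lambda>X. {Y \<in> B. near n ?J q t X (\<lambda>i. Y ([], i))}"
  have "p * emeasure (tvol n ?E) B = (\<integral>\<^sup>+Y. p * indicator B Y \<partial>tvol n ?E)"
    using B by (simp add: nn_integral_cmult_indicator)
  also have "\<dots> \<le> (\<integral>\<^sup>+Y. pnear S ?J q t (\<lambda>i. Y ([], i)) * indicator B Y \<partial>tvol n ?E)"
    by (rule nn_integral_mono) (use pB in \<open>auto simp: indicator_def\<close>)
  also have "\<dots> = (\<integral>\<^sup>+X. emeasure (tvol n ?E) (?A X) \<partial>randrep S)"
    by (rule near_average(1)[OF S F B, symmetric])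
  finally have "?C * (p * emeasure (tvol n ?E) B) \<le> ?C * (\<integral>\<^sup>+X. emeasure (tvol n ?E) (?A X) \<partial>randrep S)"
    by (intro mult_left_mono) auto
  also have "\<dots> = (\<integral>\<^sup>+X. ?C * emeasure (tvol n ?E) (?A X) \<partial>randrep S)"
    by (rule nn_integral_cmult[symmetric]) (rule near_average(3)[OF S F B])
  also have "\<dots> \<le> (\<integral>\<^sup>+X. emeasure (tvol n ?J) {Y \<in> G. edges n k F h X Y} \<partial>randrep S)"
  proof (rule nn_integral_mono_AE, rule AE_mp[OF AE_randrep_unitary[OF S]], rule AE_I2, rule impI)
    fix X :: "'a \<Rightarrow> cmat" assume X: "\<forall>s\<in>S. X s \<in> unitary_set n"
    have "?C * emeasure (tvol n ?E) (?A X)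
      = emeasure (tvol n ?J) {Y \<in> space (tvol n ?J). restrict Y ?E \<in> ?A X \<and> edges n k F h X Y}"
      by (rule tree_volume[OF F X h near_average(2)[OF S F B], symmetric])
    also have "\<dots> \<le> emeasure (tvol n ?J) {Y \<in> G. edges n k F h X Y}"
    proof (rule emeasure_mono)
      show "{Y \<in> space (tvol n ?J). restrict Y ?E \<in> ?A X \<and> edges n k F h X Y} \<subseteq> {Y \<in> G. edges n k F h X Y}"
      proof (intro subsetI CollectI conjI)
        fix Y assume Y: "Y \<in> {Y \<in> space (tvol n ?J). restrict Y ?E \<in> ?A X \<and> edges n k F h X Y}"
        have "near n ?J q t X (\<lambda>i. restrict Y ?E ([], i))" using Y by auto
        hence "near n ?J q t X (\<lambda>i. Y ([], i))"
          by (subst near_cong[where V' = "\<lambda>i. restrict Y ?E ([], i)"]) auto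
        thus "Y \<in> G" using Y by (intro imp[OF X]) auto
      qed auto
    qed (rule edges_average(2)[OF S F G])
    finally show "?C * emeasure (tvol n ?E) (?A X) \<le> emeasure (tvol n ?J) {Y \<in> G. edges n k F h X Y}" .
  qed
  also have "\<dots> = (\<integral>\<^sup>+Y. edge_prob S F k h Y * indicator G Y \<partial>tvol n ?J)"
    by (rule edges_average(1)[OF S F G])
  also have "\<dots> \<le> (\<integral>\<^sup>+Y. c * indicator G Y \<partial>tvol n ?J)"
    by (rule nn_integral_mono) (use cG in \<open>auto simp: indicator_def\<close>)
  also have "\<dots> = c * emeasure (tvol n ?J) G"
    using G by (simp add: nn_integral_cmult_indicator)
  finally show ?thesis .
qed

text \<open>The reverse count: here being an almost-orbit forces a tuple in \<open>G\<close> to have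
  its base in \<open>B\<close> and a good exact orbit, so the pairs over \<open>G\<close> are at
  most those counted by \<open>tree_volume\<close>.\<close>

lemma double_count_lower:
  assumes S: "finite S" and F: "suffix_closed S F" and h: "0 < h"
    and G: "G \<in> sets (tvol n (F \<times> {..<k}))" and B: "B \<in> sets (tvol n ({[]} \<times> {..<k}))"
    and imp: "\<And>X Y. \<forall>s\<in>S. X s \<in> unitary_set n \<Longrightarrow> Y \<in> G \<Longrightarrow> edges n k F h X Y \<Longrightarrow>
      restrict Y ({[]} \<times> {..<k}) \<in> B \<and> near n (F \<times> {..<k}) q t X (\<lambda>i. Y ([], i))"
    and cG: "\<And>Y. Y \<in> G \<Longrightarrow> c \<le> edge_prob S F k h Y"
    and pB: "\<And>Y. Y \<in> B \<Longrightarrow> pnear S (F \<times> {..<k}) q t (\<lambda>i. Y ([], i)) \<le> p"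
  shows "c * emeasure (tvol n (F \<times> {..<k})) G
    \<le> ennreal ((h ^ (2 * n) * vball n) ^ (k * (card F - 1))) * (p * emeasure (tvol n ({[]} \<times> {..<k})) B)"
proof -
  let ?E = "{[]} \<times> {..<k}" and ?J = "F \<times> {..<k}"
  let ?C = "ennreal ((h ^ (2 * n) * vball n) ^ (k * (card F - 1)))"
  let ?A = "\<lambda>X. {Y \<in> B. near n ?J q t X (\<lambda>i. Y ([], i))}"
  have "c * emeasure (tvol n ?J) G = (\<integral>\<^sup>+Y. c * indicator G Y \<partial>tvol n ?J)"
    using G by (simp add: nn_integral_cmult_indicator)
  also have "\<dots> \<le> (\<integral>\<^sup>+Y. edge_prob S F k h Y * indicator G Y \<partial>tvol n ?J)"
    by (rule nn_integral_mono) (use cG in \<open>auto simp: indicator_def\<close>)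
  also have "\<dots> = (\<integral>\<^sup>+X. emeasure (tvol n ?J) {Y \<in> G. edges n k F h X Y} \<partial>randrep S)"
    by (rule edges_average(1)[OF S F G, symmetric])
  also have "\<dots> \<le> (\<integral>\<^sup>+X. ?C * emeasure (tvol n ?E) (?A X) \<partial>randrep S)"
  proof (rule nn_integral_mono_AE, rule AE_mp[OF AE_randrep_unitary[OF S]], rule AE_I2, rule impI)
    fix X :: "'a \<Rightarrow> cmat" assume X: "\<forall>s\<in>S. X s \<in> unitary_set n"
    let ?T = "{Y \<in> space (tvol n ?J). restrict Y ?E \<in> ?A X \<and> edges n k F h X Y}"
    have "{Y \<in> G. edges n k F h X Y} \<subseteq> ?T"
    proof (intro subsetI CollectI)
      fix Y assume Y: "Y \<in> {Y \<in> G. edges n k F h X Y}"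
      have "near n ?J q t X (\<lambda>i. restrict Y ?E ([], i))"
        using imp[OF X, of Y] Y by (subst near_cong[where V' = "\<lambda>i. Y ([], i)"]) auto
      thus "Y \<in> space (tvol n ?J) \<and> restrict Y ?E \<in> ?A X \<and> edges n k F h X Y"
        using imp[OF X, of Y] Y sets.sets_into_space[OF G] by blast
    qed
    moreover have "?T \<in> sets (tvol n ?J)"
    proof -
      have "(\<lambda>Y. restrict Y ?E) \<in> measurable (tvol n ?J) (tvol n ?E)"
        by (rule measurable_restrict_subset) (use F in \<open>auto simp: suffix_closed_def\<close>)
      from measurable_sets[OF this near_average(2)[OF S F B]]
      have "{Y \<in> space (tvol n ?J). restrict Y ?E \<in> ?A X} \<in> sets (tvol n ?J)"
        by (simp add: vimage_def Int_def conj_commute)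
      from edges_average(2)[OF S F this] show ?thesis by (simp add: conj_assoc)
    qed
    ultimately have "emeasure (tvol n ?J) {Y \<in> G. edges n k F h X Y} \<le> emeasure (tvol n ?J) ?T"
      by (rule emeasure_mono)
    also have "\<dots> = ?C * emeasure (tvol n ?E) (?A X)"
      by (rule tree_volume[OF F X h near_average(2)[OF S F B]])
    finally show "emeasure (tvol n ?J) {Y \<in> G. edges n k F h X Y} \<le> ?C * emeasure (tvol n ?E) (?A X)" .
  qed
  also have "\<dots> = ?C * (\<integral>\<^sup>+X. emeasure (tvol n ?E) (?A X) \<partial>randrep S)"
    by (rule nn_integral_cmult) (rule near_average(3)[OF S F B])
  also have "\<dots> = ?C * (\<integral>\<^sup>+Y. pnear S ?J q t (\<lambda>i. Y ([], i)) * indicator B Y \<partial>tvol n ?E)"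
    by (simp only: near_average(1)[OF S F B])
  also have "\<dots> \<le> ?C * (\<integral>\<^sup>+Y. p * indicator B Y \<partial>tvol n ?E)"
    by (intro mult_left_mono nn_integral_mono) (use pB in \<open>auto simp: indicator_def\<close>)
  also have "\<dots> = ?C * (p * emeasure (tvol n ?E) B)"
    using B by (simp add: nn_integral_cmult_indicator)
  finally show ?thesis .
qed

end

section \<open>Uniformity over neighbourhoods of matrices\<close>

lemma finite_common_bound:
  assumes "finite S" "\<And>s. s \<in> S \<Longrightarrow> \<exists>d>0. P s d"
    and mono: "\<And>s d d'. s \<in> S \<Longrightarrow> P s d \<Longrightarrow> 0 < d' \<Longrightarrow> d' \<le> d \<Longrightarrow> P s d'"
  shows "\<exists>d>0::real. \<forall>s\<in>S. P s d"
proof -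
  obtain f where f: "\<And>s. s \<in> S \<Longrightarrow> 0 < f s \<and> P s (f s)" using assms(2) by metis
  define d where "d = Min (insert 1 (f ` S))"
  have d: "0 < d" unfolding d_def using assms(1) f by (subst Min_gr_iff) auto
  have "P s d" if "s \<in> S" for s
    by (rule mono[OF that conjunct2[OF f[OF that]] d]) (use that assms(1) in \<open>auto simp: d_def\<close>)
  thus ?thesis using d by blast
qed

text \<open>Rounding real and imaginary parts to a grid of mesh \<open>a / 2\<close> takes finitely
  many values on \<open>P\<close>, and one preimage of each is kept. The net lies inside
  \<open>P\<close>, so its members stay semidefinite in the application.\<close>

lemma finite_net:
  fixes P :: "('a \<Rightarrow> 'a \<Rightarrow> complex) set"
  assumes J: "finite J" and a: "0 < a" and K: "\<And>r i j. r \<in> P \<Longrightarrow> i \<in> J \<Longrightarrow> j \<in> J \<Longrightarrow> cmod (r i j) \<le> K"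
  shows "\<exists>N. finite N \<and> N \<subseteq> P \<and> (\<forall>r\<in>P. \<exists>r'\<in>N. \<forall>i\<in>J. \<forall>j\<in>J. cmod (r i j - r' i j) < a)"
proof -
  define b where "b = a / 2"
  have b: "0 < b" using a by (simp add: b_def)
  define \<phi> where "\<phi> r = (\<lambda>p\<in>J \<times> J. (\<lfloor>Re (r (fst p) (snd p)) / b\<rfloor>, \<lfloor>Im (r (fst p) (snd p)) / b\<rfloor>))" for r :: "'a \<Rightarrow> 'a \<Rightarrow> complex"
  let ?I = "{\<lfloor>- K / b\<rfloor>..\<lfloor>K / b\<rfloor>}"
  have fl: "\<lfloor>x / b\<rfloor> \<in> ?I" if "\<bar>x\<bar> \<le> K" for x
  proof -
    have "- K / b \<le> x / b" "x / b \<le> K / b" by (rule divide_right_mono, use that b in auto)+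
    thus ?thesis by (simp add: floor_mono)
  qed
  have "\<phi> ` P \<subseteq> PiE (J \<times> J) (\<lambda>_. ?I \<times> ?I)"
  proof (intro image_subsetI PiE_I)
    fix r p assume r: "r \<in> P" and p: "p \<in> J \<times> J"
    have "cmod (r (fst p) (snd p)) \<le> K" using K[OF r] p by auto
    hence "\<bar>Re (r (fst p) (snd p))\<bar> \<le> K" "\<bar>Im (r (fst p) (snd p))\<bar> \<le> K"
      using abs_Re_le_cmod[of "r (fst p) (snd p)"] abs_Im_le_cmod[of "r (fst p) (snd p)"] by linarith+
    thus "\<phi> r p \<in> ?I \<times> ?I" using p fl by (simp add: \<phi>_def)
  qed (simp add: \<phi>_def)
  moreover have "finite (PiE (J \<times> J) (\<lambda>_. ?I \<times> ?I))" using J by (intro finite_PiE) auto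
  ultimately have "finite (\<phi> ` P)" by (rule finite_subset)
  then obtain N where N: "N \<subseteq> P" "finite N" "\<phi> ` P = \<phi> ` N"
    using finite_subset_image[of "\<phi> ` P" \<phi> P] by auto
  have close: "\<bar>x - y\<bar> < b" if "\<lfloor>x / b\<rfloor> = \<lfloor>y / b\<rfloor>" for x y :: real
  proof -
    have "\<bar>x / b - y / b\<bar> < 1"
      using that floor_correct[of "x / b"] floor_correct[of "y / b"] by linarith
    hence "b * \<bar>x / b - y / b\<bar> < b * 1" using b by (intro mult_strict_left_mono)
    moreover have "b * \<bar>x / b - y / b\<bar> = \<bar>b * (x / b - y / b)\<bar>" using b by (simp add: abs_mult)
    moreover have "b * (x / b - y / b) = x - y" using b by (simp add: right_diff_distrib)
    ultimately show ?thesis by simp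
  qed
  have "\<exists>r'\<in>N. \<forall>i\<in>J. \<forall>j\<in>J. cmod (r i j - r' i j) < a" if rP: "r \<in> P" for r
  proof -
    obtain r' where r': "r' \<in> N" "\<phi> r = \<phi> r'" using rP N(3) by (metis imageE imageI)
    have "cmod (r i j - r' i j) < a" if "i \<in> J" "j \<in> J" for i j
    proof -
      have "\<phi> r (i, j) = \<phi> r' (i, j)" using r'(2) by simp
      hence "\<bar>Re (r i j) - Re (r' i j)\<bar> < b" "\<bar>Im (r i j) - Im (r' i j)\<bar> < b"
        using that by (auto simp: \<phi>_def intro: close)
      thus ?thesis using cmod_le[of "r i j - r' i j"] by (simp add: b_def)
    qed
    thus ?thesis using r'(1) by blast
  qed
  thus ?thesis using N by blast
qed

lemma gram_psd: "psd J (\<lambda>a b. cip n (Y a) (Y b))"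
  unfolding psd_def
proof
  fix x
  let ?y = "\<lambda>l. \<Sum>i\<in>J. x i * Y i l"
  show "Im (bform J (\<lambda>a b. cip n (Y a) (Y b)) x x) = 0 \<and> 0 \<le> Re (bform J (\<lambda>a b. cip n (Y a) (Y b)) x x)"
    unfolding cip_combination[symmetric] cip_self by simp
qed

text \<open>Counterexamples at distances \<open>1/(m+1)\<close> would form a sequence contradicting
  \<open>det_on_tendsto\<close>.\<close>

lemma det_on_perturb:
  assumes e: "0 < (e::real)"
  shows "\<exists>d>0. \<forall>r. (\<forall>i\<in>J. \<forall>j\<in>J. cmod (r i j - q i j) < d) \<longrightarrow> cmod (det_on J r - det_on J q) < e"
proof (rule ccontr)
  assume neg: "\<not> ?thesis"
  define Q where "Q m r \<longleftrightarrow> (\<forall>i\<in>J. \<forall>j\<in>J. cmod (r i j - q i j) < inverse (real (Suc m))) \<and>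
    e \<le> cmod (det_on J r - det_on J q)" for m r
  have "\<exists>r. Q m r" for m
  proof (rule ccontr)
    assume "\<nexists>r. Q m r"
    hence "\<forall>r. (\<forall>i\<in>J. \<forall>j\<in>J. cmod (r i j - q i j) < inverse (real (Suc m))) \<longrightarrow> cmod (det_on J r - det_on J q) < e"
      unfolding Q_def not_ex de_Morgan_conj not_le imp_conv_disj .
    hence "\<exists>d>0. \<forall>r. (\<forall>i\<in>J. \<forall>j\<in>J. cmod (r i j - q i j) < d) \<longrightarrow> cmod (det_on J r - det_on J q) < e"
      by (intro exI[of _ "inverse (real (Suc m))"] conjI) simp_all
    thus False using neg by (rule notE[rotated])
  qed
  hence "\<forall>m. \<exists>r. Q m r" by (rule allI)
  from choice[of Q, OF this] obtain r where rQ: "\<forall>m. Q m (r m)" by (rule exE)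
  hence r: "\<And>m i j. i \<in> J \<Longrightarrow> j \<in> J \<Longrightarrow> cmod (r m i j - q i j) < inverse (real (Suc m))"
    and far: "\<And>m. e \<le> cmod (det_on J (r m) - det_on J q)" unfolding Q_def by blast+
  have "(\<lambda>m. det_on J (r m)) \<longlonglongrightarrow> det_on J q"
  proof (rule det_on_tendsto)
    fix i j assume ij: "i \<in> J" "j \<in> J"
    have "(\<lambda>m. r m i j - q i j) \<longlonglongrightarrow> 0"
      by (rule Lim_null_comparison[OF _ LIMSEQ_inverse_real_of_nat])
         (use r[OF ij] in \<open>auto intro!: always_eventually less_imp_le\<close>)
    thus "(\<lambda>m. r m i j) \<longlonglongrightarrow> q i j" by (simp add: LIM_zero_iff)
  qed
  from tendstoD[OF this e] obtain m where "dist (det_on J (r m)) (det_on J q) < e"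
    by (auto simp: eventually_sequentially)
  moreover have "e \<le> cmod (det_on J (r m) - det_on J q)" by (rule far)
  ultimately show False by (simp add: dist_norm)
qed

lemma det_on_identity:
  assumes "finite J" "\<And>i j. i \<in> J \<Longrightarrow> j \<in> J \<Longrightarrow> q i j = (if i = j then 1 else 0)"
  shows "det_on J q = 1"
  using assms
proof (induction J rule: finite_induct)
  case (insert j J)
  have "det_on (insert j J) q = det_on J q * (q j j - (\<Sum>l\<in>J. q j l * 0))"
    by (rule det_on_schur[OF insert.hyps, where c = "\<lambda>_. 0"]) (use insert in auto)
  thus ?case using insert by simp
qed simp

lemma pd_identity:
  assumes "finite J" "\<And>i j. i \<in> J \<Longrightarrow> j \<in> J \<Longrightarrow> q i j = (if i = j then 1 else 0)"
  shows "psd J q" "pd J q"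
proof -
  have b: "bform J q x x = of_real (\<Sum>i\<in>J. (cmod (x i))\<^sup>2)" for x :: "_ \<Rightarrow> complex"
  proof -
    have "bform J q x x = (\<Sum>i\<in>J. \<Sum>j\<in>J. if i = j then cnj (x i) * x i else 0)"
      unfolding bform_def by (intro sum.cong refl) (auto simp: assms(2))
    also have "\<dots> = (\<Sum>i\<in>J. cnj (x i) * x i)" using assms(1) by simp
    also have "\<dots> = of_real (\<Sum>i\<in>J. (cmod (x i))\<^sup>2)"
      unfolding of_real_sum by (intro sum.cong refl) (simp only: complex_norm_square mult.commute)
    finally show ?thesis .
  qed
  show "psd J q" unfolding psd_def b by (simp add: sum_nonneg)
  show "pd J q" unfolding pd_def b
  proof (intro allI impI)
    fix x :: "_ \<Rightarrow> complex" assume "\<exists>i\<in>J. x i \<noteq> 0"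
    then obtain i where "i \<in> J" "x i \<noteq> 0" by blast
    hence "0 < (\<Sum>i\<in>J. (cmod (x i))\<^sup>2)" using assms(1) by (intro sum_pos2[of J i]) auto
    thus "0 < Re (complex_of_real (\<Sum>i\<in>J. (cmod (x i))\<^sup>2))" by simp
  qed
qed

section \<open>The exponential rate\<close>

lemma ennreal_divide_bound:
  assumes "P * G \<le> ennreal a" "ennreal b \<le> G" "0 < b" "0 \<le> a"
  shows "P \<le> ennreal (a / b)"
proof -
  have "P * ennreal b \<le> ennreal a"
    using mult_left_mono[OF assms(2), of P] assms(1) by (auto intro: order_trans)
  thus ?thesis using assms(3,4)
    by (cases P) (auto simp: ennreal_mult'[symmetric] ennreal_top_mult pos_le_divide_eq ennreal_mult[symmetric] top_unique)
qed

lemma prod_ennreal_le: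
  assumes "finite S" "\<And>s. s \<in> S \<Longrightarrow> f s \<le> ennreal (g s)" "\<And>s. s \<in> S \<Longrightarrow> 0 \<le> g s"
  shows "prod f S \<le> ennreal (prod g S)"
  using assms
proof (induction S rule: finite_induct)
  case (insert s S)
  have "f s * prod f S \<le> ennreal (g s) * ennreal (prod g S)"
    using insert by (intro mult_mono) auto
  thus ?case using insert by (simp add: ennreal_mult prod_nonneg)
qed simp

lemma prod_ennreal_ge:
  assumes "finite S" "\<And>s. s \<in> S \<Longrightarrow> ennreal (g s) \<le> f s" "\<And>s. s \<in> S \<Longrightarrow> 0 \<le> g s"
  shows "ennreal (prod g S) \<le> prod f S"
  using assms
proof (induction S rule: finite_induct)
  case (insert s S)
  have "ennreal (g s) * ennreal (prod g S) \<le> f s * prod f S"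
    using insert by (intro mult_mono) auto
  thus ?case using insert by (simp add: ennreal_mult prod_nonneg)
qed simp

lemma Ukn_cip:
  assumes "V \<in> Ukn k n" "i < k" "j < k"
  shows "cip n (\<lambda>l. V l i) (\<lambda>l. V l j) = (if i = j then 1 else 0)"
  using assms by (auto simp: Ukn_def cip_def)

lemma Ukn_cnorm:
  assumes "V \<in> Ukn k n" "i < k"
  shows "cnorm n (\<lambda>l. V l i) = 1"
proof -
  have "(cnorm n (\<lambda>l. V l i))\<^sup>2 = 1" unfolding Re_cip_self[symmetric] Ukn_cip[OF assms(1,2,2)] by simp
  thus ?thesis using cnorm_nonneg[of n "\<lambda>l. V l i"] by (simp add: power2_eq_1_iff)
qed

lemma gset_cnorm_le:
  assumes "Y \<in> gset n J q d" "j \<in> J" "cmod (q j j) + d \<le> R\<^sup>2" "0 \<le> R"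
  shows "cnorm n (Y j) \<le> R"
proof -
  have "cmod (cip n (Y j) (Y j) - q j j) < d" using assms(1,2) by (auto simp: gset_def)
  moreover have "cmod (cip n (Y j) (Y j)) = (cnorm n (Y j))\<^sup>2" unfolding cip_self norm_of_real by simp
  ultimately have "(cnorm n (Y j))\<^sup>2 \<le> R\<^sup>2"
    using norm_triangle_sub[of "cip n (Y j) (Y j)" "q j j"] assms(3) by linarith
  thus ?thesis using assms(4) by (rule power2_le_imp_le)
qed

lemma orbit_cnorm:
  assumes "suffix_closed S F" "\<forall>s\<in>S. X s \<in> unitary_set n" "fst a \<in> F"
  shows "cnorm n (orbit n X V a) = cnorm n (V (snd a))"
  unfolding orbit_def
  by (rule cnorm_mv_unitary[OF rep_unitary[OF assms(2) suffix_closed_letters[OF assms(1,3)]]])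

definition lengths :: "'s word set \<Rightarrow> real" where
  "lengths F = real (\<Sum>g\<in>F. length g)"

lemma length_le_lengths: "finite F \<Longrightarrow> g \<in> F \<Longrightarrow> real (length g) \<le> lengths F"
  unfolding lengths_def by (intro of_nat_mono member_le_sum) auto

lemma lengths_nonneg [simp]: "0 \<le> lengths F"
  by (simp add: lengths_def sum_nonneg)

text \<open>The constant 6 is \<open>2 * 3\<close> from \<open>cip_perturb\<close>: the base and
  hence the orbit have norms at most 2, the noisy vectors at most 3.\<close>

lemma edges_gram_close:
  assumes F: "suffix_closed S F" and X: "\<forall>s\<in>S. X s \<in> unitary_set n" and e: "edges n k F h X Y"
    and h: "0 \<le> h" "lengths F * h \<le> 1" and Y: "\<And>i. i < k \<Longrightarrow> cnorm n (Y ([], i)) \<le> 2"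
    and ab: "a \<in> F \<times> {..<k}" "b \<in> F \<times> {..<k}"
  shows "cmod (cip n (Y a) (Y b) - cip n (orbit n X (\<lambda>i. Y ([], i)) a) (orbit n X (\<lambda>i. Y ([], i)) b)) \<le> 6 * (lengths F * h)"
proof -
  have fin: "finite F" using F by (simp add: suffix_closed_def)
  have d: "cnorm n (\<lambda>l. Y p l - orbit n X (\<lambda>i. Y ([], i)) p l) \<le> lengths F * h" if "p \<in> F \<times> {..<k}" for p
  proof -
    obtain g i where p: "p = (g, i)" by force
    have "cnorm n (\<lambda>l. Y p l - orbit n X (\<lambda>i. Y ([], i)) p l) \<le> real (length g) * h"
      unfolding p by (rule edges_orbit[OF F X e]) (use that p h in auto)
    also have "\<dots> \<le> lengths F * h"
      using that p h by (intro mult_right_mono length_le_lengths[OF fin]) auto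
    finally show ?thesis .
  qed
  have o: "cnorm n (orbit n X (\<lambda>i. Y ([], i)) p) \<le> 2" if "p \<in> F \<times> {..<k}" for p
    using Y[of "snd p"] that orbit_cnorm[OF F X, where a = p] by auto
  have "cnorm n (Y b) \<le> 3"
    using cnorm_triangle_sub[of n "Y b" "orbit n X (\<lambda>i. Y ([], i)) b"] d[OF ab(2)] o[OF ab(2)] h by linarith
  hence "cmod (cip n (Y a) (Y b) - cip n (orbit n X (\<lambda>i. Y ([], i)) a) (orbit n X (\<lambda>i. Y ([], i)) b)) \<le> 2 * 3 * (lengths F * h)"
    using d[OF ab(1)] d[OF ab(2)] o[OF ab(1)] by (intro cip_perturb) auto
  thus ?thesis by simp
qed

lemma card_edge_index:
  assumes "finite S" "suffix_closed S F"
  shows "(\<Sum>s\<in>S. card (edge_targets S F s \<times> {..<k})) = k * (card F - 1)"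
  by (simp add: card_cartesian_product card_edge_targets[OF assms] mult.commute flip: sum_distrib_left)

text \<open>The conclusion of \<open>gram_alignment\<close> as a predicate monotone in
  \<open>d\<close>, so that finitely many index sets can share one \<open>d\<close>.\<close>

definition aligns :: "'a set \<Rightarrow> real \<Rightarrow> real \<Rightarrow> real \<Rightarrow> bool" where
  "aligns J R e d \<longleftrightarrow> (\<forall>n. \<forall>A B :: 'a \<Rightarrow> cvec. (\<forall>j\<in>J. cnorm n (A j) \<le> R \<and> cnorm n (B j) \<le> R) \<longrightarrow>
      (\<forall>i\<in>J. \<forall>j\<in>J. cmod (cip n (A i) (A j) - cip n (B i) (B j)) \<le> d) \<longrightarrow>
      (\<exists>W\<in>unitary_set n. \<forall>j\<in>J. cnorm n (\<lambda>l. mv n W (A j) l - B j l) \<le> e))"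

lemma alignsD:
  assumes "aligns J R e d" "\<And>j. j \<in> J \<Longrightarrow> cnorm n (A j) \<le> R" "\<And>j. j \<in> J \<Longrightarrow> cnorm n (B j) \<le> R"
    "\<And>i j. i \<in> J \<Longrightarrow> j \<in> J \<Longrightarrow> cmod (cip n (A i) (A j) - cip n (B i) (B j)) \<le> d"
  shows "\<exists>W\<in>unitary_set n. \<forall>j\<in>J. cnorm n (\<lambda>l. mv n W (A j) l - B j l) \<le> e"
  using assms unfolding aligns_def by blast

lemma aligns_mono:
  assumes "aligns J R e d" "d' \<le> d"
  shows "aligns J R e d'"
  unfolding aligns_def
proof (intro allI impI)
  fix n A B
  assume 1: "\<forall>j\<in>J. cnorm n (A j) \<le> R \<and> cnorm n (B j) \<le> R"
    and 2: "\<forall>i\<in>J. \<forall>j\<in>J. cmod (cip n (A i) (A j) - cip n (B i) (B j)) \<le> d'"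
  show "\<exists>W\<in>unitary_set n. \<forall>j\<in>J. cnorm n (\<lambda>l. mv n W (A j) l - B j l) \<le> e"
  proof (rule alignsD[OF assms(1)])
    fix i j assume "i \<in> J" "j \<in> J"
    hence "cmod (cip n (A i) (A j) - cip n (B i) (B j)) \<le> d'" using 2 by blast
    thus "cmod (cip n (A i) (A j) - cip n (B i) (B j)) \<le> d" using assms(2) by (rule order_trans)
  qed (use 1 in auto)
qed

lemma aligns_exists:
  assumes "finite J" "0 < e"
  shows "\<exists>d>0. aligns J R e d"
proof -
  from gram_alignment[OF assms, of R]
  obtain d where d: "0 < d" "\<forall>n. \<forall>A B :: 'a \<Rightarrow> cvec. (\<forall>j\<in>J. cnorm n (A j) \<le> R \<and> cnorm n (B j) \<le> R) \<and>
      (\<forall>i\<in>J. \<forall>j\<in>J. cmod (cip n (A i) (A j) - cip n (B i) (B j)) \<le> d) \<longrightarrow>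
      (\<exists>W\<in>reflgrp n. \<forall>j\<in>J. cnorm n (\<lambda>l. mv n W (A j) l - B j l) \<le> e)" by blast
  have "aligns J R e d"
    unfolding aligns_def
  proof (intro allI impI)
    fix n A B
    assume 1: "\<forall>j\<in>J. cnorm n (A j) \<le> R \<and> cnorm n (B j) \<le> R"
      and 2: "\<forall>i\<in>J. \<forall>j\<in>J. cmod (cip n (A i) (A j) - cip n (B i) (B j)) \<le> d"
    obtain W where "W \<in> reflgrp n" "\<forall>j\<in>J. cnorm n (\<lambda>l. mv n W (A j) l - B j l) \<le> e"
      using d(2)[THEN spec, THEN spec, THEN spec, THEN mp, OF conjI[OF 1 2]] by blast
    thus "\<exists>W\<in>unitary_set n. \<forall>j\<in>J. cnorm n (\<lambda>l. mv n W (A j) l - B j l) \<le> e"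
      using reflgrp_unitary by blast
  qed
  thus ?thesis using d(1) by blast
qed

lemma aligns_common:
  assumes "finite S" "\<And>s. s \<in> S \<Longrightarrow> finite (J s)" "0 < e"
  shows "\<exists>d>0. \<forall>s\<in>S. aligns (J s) R e d"
  by (rule finite_common_bound[OF assms(1)]) (use aligns_exists[OF assms(2,3)] aligns_mono in blast)+

section \<open>Upper bound for the probability of a neighbourhood\<close>

text \<open>After the ball volumes cancel, the determinant of \<open>q\<close> over the product of
  the edge determinants remains, to the power \<open>n\<close>. Definiteness is asked on the edge
  sets, whose determinants stand in the denominator; \<open>q\<close> itself may be singular, and
  then every \<open>c > 0\<close> is allowed.\<close>

lemma upper_rate:
  fixes S :: "'s set" and q :: "'s word \<times> nat \<Rightarrow> 's word \<times> nat \<Rightarrow> complex"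
  assumes S: "finite S" and F: "suffix_closed S F" and q: "psd (F \<times> {..<k}) q"
    and pds: "\<And>s. s \<in> S \<Longrightarrow> pd (edge_targets S F s \<times> {..<k}) q"
    and diag: "\<And>a. a \<in> F \<times> {..<k} \<Longrightarrow> q a a = 1"
    and base: "\<And>i j. i < k \<Longrightarrow> j < k \<Longrightarrow> q ([], i) ([], j) = (if i = j then 1 else 0)"
    and H: "\<And>n. is_haar n (H n)" and V: "\<And>n. n \<ge> k \<Longrightarrow> V n \<in> Ukn k n"
    and c: "Re (det_on (F \<times> {..<k}) q) / (\<Prod>s\<in>S. Re (det_on (edge_targets S F s \<times> {..<k}) q)) < c"
  shows "\<exists>t>0. \<forall>\<^sub>F n in sequentially. haar.pnear n (H n) S (F \<times> {..<k}) q t (\<lambda>i l. V n l i) \<le> ennreal (c ^ n)"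
proof -
  let ?J = "F \<times> {..<k}" and ?E = "{[] :: 's word} \<times> {..<k}"
  define K where "K s = edge_targets S F s \<times> {..<k}" for s
  define D where "D = Re (det_on ?J q)"
  define Ds where "Ds s = Re (det_on (K s) q)" for s
  define N where "N = k * (card F - 1)"
  have finF: "finite F" and eF: "[] \<in> F" using F by (auto simp: suffix_closed_def)
  have finJ: "finite ?J" using finF by simp
  have KJ: "K s \<subseteq> ?J" for s by (auto simp: K_def edge_targets_def)
  have finK: "finite (K s)" for s by (rule finite_subset[OF KJ finJ])
  have D0: "0 \<le> D" unfolding D_def by (rule det_on_nonneg[OF finJ q])
  have Ds0: "0 < Ds s" if "s \<in> S" for s
    unfolding Ds_def by (rule det_on_pos[OF finK psd_subset[OF q KJ finJ] pds[OF that, folded K_def]])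
  have sumN: "(\<Sum>s\<in>S. card (K s)) = N" unfolding K_def N_def by (rule card_edge_index[OF S F])
  have cardJ: "card ?J = N + k"
  proof -
    have "0 < card F" using finF eF by (auto simp: card_gt_0_iff)
    thus ?thesis by (cases "card F") (auto simp: N_def card_cartesian_product mult.commute)
  qed
  \<comment> \<open>The rate with its errors: \<open>D + x\<close> comes from the Gram volume,
    \<open>Ds s - x\<close> from edge determinants near \<open>q\<close>, and
    \<open>(1 + x) ^ (2 * N)\<close> from the ratio of the radii \<open>h + x * h\<close> and
    \<open>h\<close> over \<open>N\<close> edge vectors.\<close>
  define f where "f x = (D + x) * (1 + x) ^ (2 * N) / (\<Prod>s\<in>S. Ds s - x)" for x
  have "(f \<longlongrightarrow> (D + 0) * (1 + 0) ^ (2 * N) / (\<Prod>s\<in>S. Ds s - 0)) (at_right 0)"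
    unfolding f_def using Ds0 S by (intro tendsto_intros) (force simp: prod_zero_iff)
  hence "\<forall>\<^sub>F x in at_right 0. f x < c"
    by (rule order_tendstoD) (use c in \<open>simp add: D_def Ds_def K_def\<close>)
  moreover have "\<forall>\<^sub>F x in at_right 0. \<forall>s\<in>S. x < Ds s"
    using S Ds0 by (intro eventually_ball_finite ballI) (auto intro: eventually_at_right_less[THEN eventually_mono] eventually_at_rightI[of 0 "Ds _"])
  moreover have "\<forall>\<^sub>F x in at_right (0::real). 0 < x" by (rule eventually_at_right_less)
  ultimately have "\<forall>\<^sub>F x in at_right 0. f x < c \<and> (\<forall>s\<in>S. x < Ds s) \<and> 0 < x"
    by eventually_elim auto
  then obtain x where x: "f x < c" "\<And>s. s \<in> S \<Longrightarrow> x < Ds s" "0 < x"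
    by (metis (no_types, lifting) eventually_happens trivial_limit_at_right_real)
  obtain d0 where d0: "0 < d0" "\<And>n. emeasure (tvol n ?J) (gset n ?J q d0) \<le> ennreal ((D + x) ^ n * vball n ^ card ?J)"
    using gram_volume_upper[OF finJ q x(3)] by (auto simp: D_def)
  obtain \<rho> where \<rho>: "0 < \<rho>" "\<And>s r. s \<in> S \<Longrightarrow> (\<forall>i\<in>K s. \<forall>j\<in>K s. cmod (r i j - q i j) < \<rho>) \<Longrightarrow> Ds s - x < Re (det_on (K s) r)"
  proof -
    have "\<exists>d>0. \<forall>s\<in>S. \<forall>r. (\<forall>i\<in>K s. \<forall>j\<in>K s. cmod (r i j - q i j) < d) \<longrightarrow> cmod (det_on (K s) r - det_on (K s) q) < x"
    proof (rule finite_common_bound[OF S])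
      show "\<exists>d>0. \<forall>r. (\<forall>i\<in>K s. \<forall>j\<in>K s. cmod (r i j - q i j) < d) \<longrightarrow> cmod (det_on (K s) r - det_on (K s) q) < x" for s
        by (rule det_on_perturb[OF x(3)])
      fix s and d d' :: real
      assume 1: "\<forall>r. (\<forall>i\<in>K s. \<forall>j\<in>K s. cmod (r i j - q i j) < d) \<longrightarrow> cmod (det_on (K s) r - det_on (K s) q) < x"
        and "d' \<le> d"
      show "\<forall>r. (\<forall>i\<in>K s. \<forall>j\<in>K s. cmod (r i j - q i j) < d') \<longrightarrow> cmod (det_on (K s) r - det_on (K s) q) < x"
        using 1 \<open>d' \<le> d\<close> by (meson order_less_le_trans)
    qed
    then obtain d where d: "0 < d" "\<And>s r. s \<in> S \<Longrightarrow> (\<forall>i\<in>K s. \<forall>j\<in>K s. cmod (r i j - q i j) < d) \<Longrightarrow>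
        cmod (det_on (K s) r - det_on (K s) q) < x" by blast
    have "Ds s - x < Re (det_on (K s) r)" if "s \<in> S" "\<forall>i\<in>K s. \<forall>j\<in>K s. cmod (r i j - q i j) < d" for s r
      using d(2)[OF that] abs_Re_le_cmod[of "det_on (K s) r - det_on (K s) q"] by (simp add: Ds_def)
    thus ?thesis using that d(1) by blast
  qed
  define d1 where "d1 = min (min d0 \<rho>) 1"
  have d1: "0 < d1" "d1 \<le> d0" "d1 \<le> \<rho>" "d1 \<le> 1" using d0(1) \<rho>(1) by (auto simp: d1_def)
  define L where "L = lengths F + 1"
  have L1: "0 < L" using lengths_nonneg[of F] unfolding L_def by linarith
  \<comment> \<open>With 24 the Gram error \<open>6 * (lengths F * h)\<close> of an almost-orbit is
    at most \<open>d1 / 4\<close>, which added to \<open>t = d1 / 2\<close> stays below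
    \<open>d1\<close>.\<close>
  define h where "h = d1 / (24 * L)"
  have h0: "0 < h" using d1 L1 by (simp add: h_def)
  have hL: "lengths F * h \<le> d1 / 24"
  proof -
    have "lengths F * h \<le> L * h" using h0 by (intro mult_right_mono) (auto simp: L_def)
    also have "\<dots> = d1 / 24" using L1 by (simp add: h_def)
    finally show ?thesis .
  qed
  define t where "t = d1 / 2"
  have t: "0 < t" using d1 by (simp add: t_def)
  have xh: "0 < x * h" using x h0 by simp
  obtain a' where a': "0 < a'" "\<And>s. s \<in> S \<Longrightarrow> aligns (K s) 3 (x * h) a'"
    using aligns_common[where J = K and R = 3, OF S finK xh] by blast
  define a where "a = min a' 1"
  have a: "0 < a" "a \<le> a'" "a \<le> 1" using a' by (auto simp: a_def)
  \<comment> \<open>Edge probabilities must be bounded for all tuples with Gram matrix near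
    \<open>q\<close>, while \<open>gram_volume_lower\<close> gives a threshold for \<open>n\<close>
    one matrix at a time. A finite net in \<open>P s\<close> yields a common threshold.\<close>
  define P where "P s = {r. psd (K s) r \<and> (\<forall>i\<in>K s. \<forall>j\<in>K s. cmod (r i j - q i j) < d1)}" for s
  have "\<exists>Ns. finite Ns \<and> Ns \<subseteq> P s \<and> (\<forall>r\<in>P s. \<exists>r'\<in>Ns. \<forall>i\<in>K s. \<forall>j\<in>K s. cmod (r i j - r' i j) < a / 2)" for s
  proof (rule finite_net[OF finK])
    fix r i j assume r: "r \<in> P s" and ij: "i \<in> K s" "j \<in> K s"
    have "cmod (r i j - q i j) < d1" using r ij by (auto simp: P_def)
    moreover have "cmod (q i j) \<le> (\<Sum>p\<in>K s \<times> K s. cmod (q (fst p) (snd p)))"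
      using member_le_sum[of "(i, j)" "K s \<times> K s" "\<lambda>p. cmod (q (fst p) (snd p))"] ij finK by auto
    ultimately show "cmod (r i j) \<le> 1 + (\<Sum>p\<in>K s \<times> K s. cmod (q (fst p) (snd p)))"
      using norm_triangle_sub[of "r i j" "q i j"] d1(4) by linarith
  qed (use a in auto)
  then obtain Ns where Ns: "\<And>s. finite (Ns s)" "\<And>s. Ns s \<subseteq> P s"
    "\<And>s r. r \<in> P s \<Longrightarrow> \<exists>r'\<in>Ns s. \<forall>i\<in>K s. \<forall>j\<in>K s. cmod (r i j - r' i j) < a / 2"
    by metis
  have lowev: "\<forall>\<^sub>F n in sequentially. \<forall>s\<in>S. \<forall>r\<in>Ns s.
     ennreal ((1/2) ^ card (K s) * Re (det_on (K s) r) ^ n * vball n ^ card (K s)) \<le> emeasure (tvol n (K s)) (gset n (K s) r (a / 2))"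
  proof (intro eventually_ball_finite ballI S Ns(1))
    fix s r assume s: "s \<in> S" and r: "r \<in> Ns s"
    have rP: "psd (K s) r" "\<forall>i\<in>K s. \<forall>j\<in>K s. cmod (r i j - q i j) < d1" using r Ns(2) by (auto simp: P_def)
    have "\<forall>i\<in>K s. \<forall>j\<in>K s. cmod (r i j - q i j) < \<rho>" using rP(2) d1(3) by (meson order_less_le_trans)
    hence "0 < Re (det_on (K s) r)" using \<rho>(2)[OF s] x(2)[OF s] by fastforce
    hence "pd (K s) r" using pd_iff_det[OF finK rP(1)] by auto
    from gram_volume_lower[OF finK rP(1) this, of "a / 2"] a(1)
    show "\<forall>\<^sub>F n in sequentially. ennreal ((1/2) ^ card (K s) * Re (det_on (K s) r) ^ n * vball n ^ card (K s))
        \<le> emeasure (tvol n (K s)) (gset n (K s) r (a / 2))"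
      by (auto simp: eventually_sequentially)
  qed
  have finE: "finite ?E" by simp
  have baseE: "q i j = (if i = j then 1 else 0)" if "i \<in> ?E" "j \<in> ?E" for i j
    using that by (auto simp: base split: if_splits)
  obtain a0 where a0: "0 < a0" "aligns ?E 2 (t / 8) a0"
    using aligns_exists[OF finE, where e = "t / 8" and R = 2] t by auto
  define a1 where "a1 = min a0 1"
  have a1: "0 < a1" "a1 \<le> a0" "a1 \<le> 1" using a0 by (auto simp: a1_def)
  have baseev: "\<forall>\<^sub>F n in sequentially. ennreal ((1/2) ^ k * vball n ^ k) \<le> emeasure (tvol n ?E) (gset n ?E q a1)"
    using gram_volume_lower[OF finE pd_identity[OF finE baseE] a1(1)] det_on_identity[OF finE baseE]
    by (simp add: eventually_sequentially card_cartesian_product)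
  have fx0: "0 < f x"
    unfolding f_def using D0 x by (intro divide_pos_pos mult_pos_pos prod_pos) auto
  \<comment> \<open>The constant collects the halves lost in \<open>gram_volume_lower\<close>, over
    the edges and at the base; the gap between \<open>f x\<close> and \<open>c\<close> absorbs
    it.\<close>
  have limev: "\<forall>\<^sub>F n in sequentially. 2 ^ (N + k) * f x ^ n \<le> c ^ n"
  proof -
    have "(\<lambda>n. 2 ^ (N + k) * (f x / c) ^ n) \<longlonglongrightarrow> 2 ^ (N + k) * 0"
      using fx0 x(1) by (intro tendsto_mult tendsto_const LIMSEQ_realpow_zero) auto
    hence "\<forall>\<^sub>F n in sequentially. 2 ^ (N + k) * (f x / c) ^ n < 1" by (rule order_tendstoD) simp
    thus ?thesis
    proof eventually_elim
      case (elim n)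
      have "0 < c ^ n" using fx0 x(1) by simp
      thus ?case using elim by (simp add: power_divide divide_less_eq)
    qed
  qed
  have "\<forall>\<^sub>F n in sequentially. haar.pnear n (H n) S ?J q (t / 2) (\<lambda>i l. V n l i) \<le> ennreal (c ^ n)"
    using lowev baseev limev eventually_ge_at_top[of k]
  proof eventually_elim
    case (elim n)
    interpret haar n "H n" by standard (rule H)
    let ?G = "gset n ?J q d1" and ?B = "gset n ?E q a1"
    let ?p = "pnear S ?J q (t / 2) (\<lambda>i l. V n l i)"
    \<comment> \<open>The product of balls from \<open>hprob_upper\<close> divided by the Gram
      volume from \<open>gram_volume_lower\<close>; the powers of \<open>vball n\<close>
      cancel.\<close>
    define C where "C s = (((h + x * h) ^ (2 * n) * vball n) ^ card (K s)) / ((1/2) ^ card (K s) * (Ds s - x) ^ n * vball n ^ card (K s))" for s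
    have C0: "0 \<le> C s" if "s \<in> S" for s
      using x(2)[OF that] h0 x(3) by (auto simp: C_def)
    have dc: "ennreal ((h ^ (2 * n) * vball n) ^ (k * (card F - 1))) * (?p * emeasure (tvol n ?E) ?B)
      \<le> ennreal (prod C S) * emeasure (tvol n ?J) ?G"
    proof (rule double_count_upper[OF S F h0 sets_gset[OF finJ] sets_gset[OF finE]])
      fix X Y assume X: "\<forall>s\<in>S. X s \<in> unitary_set n" and Y: "Y \<in> space (tvol n ?J)" "restrict Y ?E \<in> ?B"
        and e: "edges n k F h X Y" and nr: "near n ?J q t X (\<lambda>i. Y ([], i))"
      have Y2: "cnorm n (Y ([], i)) \<le> 2" if "i < k" for i
        using gset_cnorm_le[OF Y(2), where j = "([], i)" and R = 2] that a1 base by auto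
      have hL1: "lengths F * h \<le> 1" using hL d1 by linarith
      show "Y \<in> ?G"
        unfolding gset_def
      proof (intro CollectI conjI ballI Y(1))
        fix u v assume uv: "u \<in> ?J" "v \<in> ?J"
        let ?o = "orbit n X (\<lambda>i. Y ([], i))"
        have "cmod (cip n (Y u) (Y v) - cip n (?o u) (?o v)) \<le> 6 * (lengths F * h)"
          by (rule edges_gram_close[OF F X e _ hL1 Y2 uv]) (use h0 in auto)
        also have "\<dots> \<le> d1 / 4" using hL by linarith
        finally have 1: "cmod (cip n (Y u) (Y v) - cip n (?o u) (?o v)) \<le> d1 / 4" .
        have 2: "cmod (cip n (?o u) (?o v) - q u v) < d1 / 2" using nr uv by (auto simp: near_def t_def)
        show "cmod (cip n (Y u) (Y v) - q u v) < d1"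
          using norm_triangle_ineq[of "cip n (Y u) (Y v) - cip n (?o u) (?o v)" "cip n (?o u) (?o v) - q u v"] 1 2 d1
          by simp
      qed
    next
      fix Y assume Y: "Y \<in> ?G"
      show "edge_prob S F k h Y \<le> ennreal (prod C S)"
      proof (rule prod_ennreal_le[OF S _ C0])
        fix s assume s: "s \<in> S"
        define r where "r = (\<lambda>i j. cip n (Y i) (Y j))"
        have YK: "cmod (r i j - q i j) < d1" if "i \<in> K s" "j \<in> K s" for i j
        proof -
          have "i \<in> ?J" "j \<in> ?J" using that KJ by blast+
          thus ?thesis using Y unfolding gset_def r_def by blast
        qed
        have "r \<in> P s" using YK gram_psd unfolding P_def r_def by blast
        \<comment> \<open>The net member \<open>r'\<close> stands in for the Gram matrix of the
          tuple. It is itself close to \<open>q\<close>, so its determinant still exceeds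
          \<open>Ds s - x\<close>.\<close>
        then obtain r' where r': "r' \<in> Ns s" "\<And>i j. i \<in> K s \<Longrightarrow> j \<in> K s \<Longrightarrow> cmod (r i j - r' i j) < a / 2"
          using Ns(3) by blast
        have r'q: "cmod (r' i j - q i j) < d1" if "i \<in> K s" "j \<in> K s" for i j
          using r'(1) Ns(2) that by (auto simp: P_def)
        have dr: "Ds s - x < Re (det_on (K s) r')"
          by (rule \<rho>(2)[OF s]) (intro ballI order_less_le_trans[OF r'q d1(3)])
        let ?A = "\<lambda>(g, i). Y (red_cons (s, True) g, i)"
        have "hprob (K s) h ?A Y * emeasure (tvol n (K s)) (gset n (K s) r' (a / 2))
            \<le> ennreal (((h + x * h) ^ (2 * n) * vball n) ^ card (K s))"
        proof (rule hprob_upper[OF finK h0 _ _ sets_gset[OF finK]])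
          fix B' assume B': "B' \<in> gset n (K s) r' (a / 2)"
          show "\<exists>W\<in>unitary_set n. \<forall>j\<in>K s. cnorm n (\<lambda>l. mv n W (Y j) l - B' j l) \<le> x * h"
          proof (rule alignsD[OF a'(2)[OF s]])
            fix i assume i: "i \<in> K s"
            have iJ: "i \<in> ?J" using i KJ by blast
            have qi: "q i i = 1" by (rule diag[OF iJ])
            show "cnorm n (Y i) \<le> 3"
              by (rule gset_cnorm_le[OF Y iJ]) (use qi d1 in simp_all)
            have "cmod (r' i i) \<le> 2"
              using r'q[OF i i] norm_triangle_sub[of "r' i i" "q i i"] qi d1 by simp
            thus "cnorm n (B' i) \<le> 3"
              by (intro gset_cnorm_le[OF B' i]) (use a in auto)
            fix j assume j: "j \<in> K s"
            have "cmod (cip n (B' i) (B' j) - r' i j) < a / 2" using B' i j by (auto simp: gset_def)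
            thus "cmod (cip n (Y i) (Y j) - cip n (B' i) (B' j)) \<le> a'"
              using r'(2)[OF i j] norm_triangle_ineq4[of "r i j - r' i j" "cip n (B' i) (B' j) - r' i j"] a
              by (simp add: r_def)
          qed
        qed (use xh in auto)
        moreover have "ennreal ((1/2) ^ card (K s) * (Ds s - x) ^ n * vball n ^ card (K s)) \<le> emeasure (tvol n (K s)) (gset n (K s) r' (a / 2))"
        proof -
          have "(1/2) ^ card (K s) * (Ds s - x) ^ n * vball n ^ card (K s) \<le> (1/2) ^ card (K s) * Re (det_on (K s) r') ^ n * vball n ^ card (K s)"
            using dr x(2)[OF s] by (intro mult_right_mono mult_left_mono power_mono) auto
          thus ?thesis using elim(1) s r'(1) by (meson ennreal_leI order_trans)
        qed
        ultimately show "hprob (edge_targets S F s \<times> {..<k}) h ?A Y \<le> ennreal (C s)"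
          unfolding C_def K_def[symmetric]
          by (rule ennreal_divide_bound) (use x(2)[OF s] x(3) h0 vball_pos[of n] in auto)
      qed
    next
      fix Y assume Y: "Y \<in> ?B"
      have V2: "cnorm n (\<lambda>l. V n l i) \<le> 2" if "i < k" for i using Ukn_cnorm[OF V[OF elim(4)] that] by simp
      have Y2: "cnorm n (Y ([], i)) \<le> 2" if "i < k" for i
        using gset_cnorm_le[OF Y, where j = "([], i)" and R = 2] that a1 base by auto
      \<comment> \<open>At the root \<open>q\<close> is the identity, which is also the Gram matrix
        of the frame; hence the frame is nearly a rotation of each base tuple.\<close>
      have "\<exists>W\<in>unitary_set n. \<forall>j\<in>?E. cnorm n (\<lambda>l. mv n W ((\<lambda>p l. V n l (snd p)) j) l - Y j l) \<le> t / 8"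
      proof (rule alignsD[OF a0(2)])
        fix i assume i: "i \<in> ?E"
        show "cnorm n (\<lambda>l. V n l (snd i)) \<le> 2" "cnorm n (Y i) \<le> 2" using i V2 Y2 by auto
        fix j assume j: "j \<in> ?E"
        have "cip n (\<lambda>l. V n l (snd i)) (\<lambda>l. V n l (snd j)) = q i j"
          using i j Ukn_cip[OF V[OF elim(4)]] base by auto
        moreover have "cmod (cip n (Y i) (Y j) - q i j) < a1" using Y i j by (auto simp: gset_def)
        ultimately show "cmod (cip n (\<lambda>l. V n l (snd i)) (\<lambda>l. V n l (snd j)) - cip n (Y i) (Y j)) \<le> a0"
          using a1 by (simp add: norm_minus_commute)
      qed
      then obtain W where W: "W \<in> unitary_set n" "\<And>i. i < k \<Longrightarrow> cnorm n (\<lambda>l. mv n W (\<lambda>l. V n l i) l - Y ([], i) l) \<le> t / 8"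
        by fastforce
      show "?p \<le> pnear S ?J q t (\<lambda>i. Y ([], i))"
        by (rule pnear_perturb[OF S F W(1), where R = 2 and e = "t / 8"]) (use V2 Y2 W(2) t in auto)
    qed
    interpret L: prob_space "randrep S" by (rule prob_space_randrep)
    define p where "p = measure (randrep S) {X \<in> space (randrep S). near n ?J q (t / 2) X (\<lambda>i l. V n l i)}"
    have p: "?p = ennreal p" "0 \<le> p" unfolding pnear_def p_def by (auto simp: L.emeasure_eq_measure)
    have v: "0 < vball n" by (rule vball_pos)
    have pc: "0 \<le> prod C S" by (rule prod_nonneg) (rule C0)
    have PC: "prod C S = 2 ^ N * ((h + x * h) ^ (2 * n)) ^ N / (\<Prod>s\<in>S. Ds s - x) ^ n"
    proof -
      let ?w = "2 * (h + x * h) ^ (2 * n)"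
      have Cs: "C s = ?w ^ card (K s) / (Ds s - x) ^ n" for s
        using v by (simp add: C_def power_mult_distrib power_divide field_simps)
      have "prod C S = (\<Prod>s\<in>S. ?w ^ card (K s)) / (\<Prod>s\<in>S. (Ds s - x) ^ n)"
        unfolding prod_dividef[symmetric] by (rule prod.cong[OF refl Cs])
      also have "\<dots> = ?w ^ N / (\<Prod>s\<in>S. Ds s - x) ^ n"
        by (simp only: power_sum[symmetric] sumN prod_power_distrib)
      finally show ?thesis by (simp only: power_mult_distrib)
    qed
    have "ennreal ((h ^ (2 * n) * vball n) ^ N) * (ennreal p * ennreal ((1/2) ^ k * vball n ^ k))
        \<le> ennreal ((h ^ (2 * n) * vball n) ^ N) * (?p * emeasure (tvol n ?E) ?B)"
      unfolding p(1) using elim(2) by (intro mult_left_mono) auto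
    also have "\<dots> \<le> ennreal (prod C S) * emeasure (tvol n ?J) ?G" using dc by (simp add: N_def)
    also have "\<dots> \<le> ennreal (prod C S) * ennreal ((D + x) ^ n * vball n ^ card ?J)"
    proof (intro mult_left_mono)
      have "emeasure (tvol n ?J) ?G \<le> emeasure (tvol n ?J) (gset n ?J q d0)"
        using d1(2) finJ by (intro emeasure_mono gset_mono sets_gset)
      thus "emeasure (tvol n ?J) ?G \<le> ennreal ((D + x) ^ n * vball n ^ card ?J)" using d0(2)[of n] by (rule order_trans)
    qed simp
    finally have "(h ^ (2 * n) * vball n) ^ N * (p * ((1/2) ^ k * vball n ^ k)) \<le> prod C S * ((D + x) ^ n * vball n ^ card ?J)"
      using p(2) h0 v D0 x(3) pc
      by (simp add: ennreal_mult'[symmetric] ennreal_mult[symmetric] ennreal_le_iff)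
    hence main: "(h ^ (2 * n)) ^ N * p * (1/2) ^ k * vball n ^ (N + k) \<le> prod C S * (D + x) ^ n * vball n ^ (N + k)"
      unfolding cardJ by (simp add: power_mult_distrib power_add mult_ac)
    hence "(h ^ (2 * n)) ^ N * p * (1/2) ^ k \<le> prod C S * (D + x) ^ n"
      using v by (simp add: mult_le_cancel_right)
    also have "prod C S * (D + x) ^ n = (h ^ (2 * n)) ^ N * (2 ^ N * f x ^ n)"
    proof -
      have hx: "h + x * h = h * (1 + x)" by (simp add: algebra_simps)
      have "((h + x * h) ^ (2 * n)) ^ N = (h ^ (2 * n)) ^ N * ((1 + x) ^ (2 * N)) ^ n"
        unfolding hx by (simp add: power_mult_distrib mult_ac flip: power_mult)
      thus ?thesis unfolding PC f_def by (simp add: power_divide power_mult_distrib mult_ac)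
    qed
    finally have "(h ^ (2 * n)) ^ N * (p * (1/2) ^ k) \<le> (h ^ (2 * n)) ^ N * (2 ^ N * f x ^ n)" by (simp add: mult_ac)
    hence "p * (1/2) ^ k \<le> 2 ^ N * f x ^ n" using h0 by (simp add: mult_le_cancel_left)
    hence "p \<le> 2 ^ (N + k) * f x ^ n" by (simp add: power_add field_simps power_divide)
    hence "p \<le> c ^ n" using elim(3) by linarith
    thus ?case unfolding p(1) by (rule ennreal_leI)
  qed
  thus ?thesis using t by (intro exI[of _ "t / 2"]) auto
qed

section \<open>Lower bound for the probability of a neighbourhood\<close>

lemma ennreal_divide_bound_ge:
  assumes "ennreal a \<le> P * G" "G \<le> ennreal b" "0 < b" "0 \<le> a"
  shows "ennreal (a / b) \<le> P"
proof -
  have "ennreal a \<le> P * ennreal b"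
    using mult_left_mono[OF assms(2), of P] assms(1) by (auto intro: order_trans)
  thus ?thesis using assms(3,4)
    by (cases P) (auto simp: ennreal_mult'[symmetric] pos_divide_le_eq ennreal_mult[symmetric])
qed

lemma bform_add_diag:
  assumes "finite J"
  shows "bform J (\<lambda>a b. q a b + (if a = b then complex_of_real (w a) else 0)) x x
    = bform J q x x + complex_of_real (\<Sum>a\<in>J. w a * (cmod (x a))\<^sup>2)"
proof -
  have "bform J (\<lambda>a b. q a b + (if a = b then complex_of_real (w a) else 0)) x x
      = (\<Sum>a\<in>J. \<Sum>b\<in>J. cnj (x a) * q a b * x b + (if a = b then complex_of_real (w a) * (cnj (x a) * x a) else 0))"
    unfolding bform_def by (intro sum.cong refl) (simp add: algebra_simps)
  also have "\<dots> = bform J q x x + (\<Sum>a\<in>J. complex_of_real (w a) * (cnj (x a) * x a))"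
    using assms by (simp add: bform_def sum.distrib)
  also have "(\<Sum>a\<in>J. complex_of_real (w a) * (cnj (x a) * x a)) = complex_of_real (\<Sum>a\<in>J. w a * (cmod (x a))\<^sup>2)"
    unfolding of_real_sum of_real_mult
    by (intro sum.cong refl arg_cong2[of _ _ _ _ "(*)"]) (simp only: complex_norm_square mult.commute)
  finally show ?thesis .
qed

lemma add_diag_psd_pd:
  assumes J: "finite J" and q: "psd J q" "pd J q" and w: "\<And>a. a \<in> J \<Longrightarrow> 0 \<le> w a"
  shows "psd J (\<lambda>a b. q a b + (if a = b then complex_of_real (w a) else 0))"
    "pd J (\<lambda>a b. q a b + (if a = b then complex_of_real (w a) else 0))"
proof -
  have s: "0 \<le> (\<Sum>a\<in>J. w a * (cmod (x a))\<^sup>2)" for x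
    using w by (intro sum_nonneg mult_nonneg_nonneg) auto
  show "psd J (\<lambda>a b. q a b + (if a = b then complex_of_real (w a) else 0))"
    unfolding psd_def bform_add_diag[OF J]
    using q(1) s by (simp add: psd_def add_nonneg_nonneg)
  show "pd J (\<lambda>a b. q a b + (if a = b then complex_of_real (w a) else 0))"
    unfolding pd_def bform_add_diag[OF J]
    using q(2) s by (simp add: pd_def add_pos_nonneg)
qed

lemma abs_height_le: "\<bar>real_of_int (height g)\<bar> \<le> real (length g)"
  by (induction g) (auto simp: height_def)

text \<open>For generic tuples the noise in \<open>edges\<close> is orthogonal to everything, so along an edge \<open>g \<rightarrow> s g\<close>
  the squared norm grows by \<open>h\<^sup>2\<close>.  We therefore target the Gram matrix \<open>q\<close> plus \<open>h\<^sup>2\<close> times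
  the height on the diagonal (the height is shifted to keep it nonnegative).\<close>
lemma lower_rate:
  fixes S :: "'s set" and q :: "'s word \<times> nat \<Rightarrow> 's word \<times> nat \<Rightarrow> complex"
  assumes S: "finite S" and F: "suffix_closed S F" and q: "psd (F \<times> {..<k}) q" "pd (F \<times> {..<k}) q"
    and diag: "\<And>a. a \<in> F \<times> {..<k} \<Longrightarrow> q a a = 1"
    and base: "\<And>i j. i < k \<Longrightarrow> j < k \<Longrightarrow> q ([], i) ([], j) = (if i = j then 1 else 0)"
    and toep: "\<And>s a b. s \<in> S \<Longrightarrow> a \<in> edge_targets S F s \<times> {..<k} \<Longrightarrow> b \<in> edge_targets S F s \<times> {..<k} \<Longrightarrow>
      q (red_cons (s, True) (fst a), snd a) (red_cons (s, True) (fst b), snd b) = q a b"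
    and H: "\<And>n. is_haar n (H n)" and V: "\<And>n. n \<ge> k \<Longrightarrow> V n \<in> Ukn k n"
    and c: "0 < c" "c < Re (det_on (F \<times> {..<k}) q) / (\<Prod>s\<in>S. Re (det_on (edge_targets S F s \<times> {..<k}) q))"
    and t: "0 < t"
  shows "\<forall>\<^sub>F n in sequentially. ennreal (c ^ n) \<le> haar.pnear n (H n) S (F \<times> {..<k}) q t (\<lambda>i l. V n l i)"
proof -
  let ?J = "F \<times> {..<k}" and ?E = "{[] :: 's word} \<times> {..<k}"
  define K where "K s = edge_targets S F s \<times> {..<k}" for s
  define N where "N = k * (card F - 1)"
  define M where "M = lengths F"
  have M0: "0 \<le> M" by (simp add: M_def)
  have finF: "finite F" and eF: "[] \<in> F" using F by (auto simp: suffix_closed_def)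
  have finJ: "finite ?J" using finF by simp
  have EJ: "?E \<subseteq> ?J" using eF by auto
  have KJ: "K s \<subseteq> ?J" for s by (auto simp: K_def edge_targets_def)
  have finK: "finite (K s)" for s by (rule finite_subset[OF KJ finJ])
  have red: "reduced g" if "g \<in> F" for g
    using F that by (auto simp: suffix_closed_def free_group_def)
  define src where "src s a = (red_cons (s, True) (fst a), snd a)" for s and a :: "'s word \<times> nat"
  have srcJ: "src s a \<in> ?J" if "a \<in> K s" for s a
    using that by (auto simp: src_def K_def edge_targets_def)
  have src_inj: "src s a = src s b \<longleftrightarrow> a = b" if "a \<in> K s" "b \<in> K s" for s a b
  proof
    assume e: "src s a = src s b"
    have "fst a \<in> F" "fst b \<in> F" using that by (auto simp: K_def edge_targets_def)
    hence "fst a = fst b" using red_cons_inverse[OF red, of _ s False] e unfolding src_def by (metis prod.inject)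
    thus "a = b" using e by (simp add: src_def prod_eq_iff)
  qed simp
  \<comment> \<open>\<open>M\<close> dominates every height on \<open>F\<close>, so the shift is
    nonnegative and \<open>qx\<close> stays positive definite. Along edges only differences of
    heights count and \<open>M\<close> drops out.\<close>
  define w where "w x a = x\<^sup>2 * (real_of_int (height (fst a)) + M)" for x :: real and a :: "'s word \<times> nat"
  have w0: "0 \<le> w x a" "w x a \<le> 2 * M * x\<^sup>2" if "a \<in> ?J" for x a
  proof -
    have "\<bar>real_of_int (height (fst a))\<bar> \<le> M"
      using abs_height_le[of "fst a"] length_le_lengths[OF finF, of "fst a"] that by (auto simp: M_def)
    hence "0 \<le> real_of_int (height (fst a)) + M" "real_of_int (height (fst a)) + M \<le> 2 * M" by linarith+
    thus "0 \<le> w x a" "w x a \<le> 2 * M * x\<^sup>2" unfolding w_def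
      by (simp, simp add: mult.commute[of "x\<^sup>2"] mult_right_mono)
  qed
  define qx where "qx x a b = q a b + (if a = b then complex_of_real (w x a) else 0)" for x a b
  have qx_eq: "qx x = (\<lambda>a b. q a b + (if a = b then complex_of_real (w x a) else 0))" for x
    by (intro ext) (rule qx_def)
  have qx: "psd ?J (qx x)" "pd ?J (qx x)" for x
    unfolding qx_eq by (rule add_diag_psd_pd[OF finJ q w0(1)], assumption)+
  have qxK: "psd (K s) (qx x)" "pd (K s) (qx x)" for s x
    using psd_subset[OF qx(1) KJ finJ] pd_subset[OF qx(2) KJ finJ] by blast+
  define Dx where "Dx x = Re (det_on ?J (qx x))" for x
  define Ex where "Ex s x = Re (det_on (K s) (qx x))" for s x
  have Dx0: "0 < Dx x" for x unfolding Dx_def by (rule det_on_pos[OF finJ qx])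
  have Ex0: "0 < Ex s x" for s x unfolding Ex_def by (rule det_on_pos[OF finK qxK])
  have sumN: "(\<Sum>s\<in>S. card (K s)) = N" unfolding K_def N_def by (rule card_edge_index[OF S F])
  have cardJ: "card ?J = N + k"
  proof -
    have "0 < card F" using finF eF by (auto simp: card_gt_0_iff)
    thus ?thesis by (cases "card F") (auto simp: N_def card_cartesian_product mult.commute)
  qed
  have qx_lim: "((\<lambda>x. qx x a b) \<longlongrightarrow> qx 0 a b) (at_right 0)" for a b
    unfolding qx_def w_def by (cases "a = b") (auto intro!: tendsto_eq_intros)
  have q0: "qx 0 = q" by (auto simp: qx_def w_def fun_eq_iff)
  \<comment> \<open>\<open>(1 + x) ^ (2 * N)\<close> is the loss from the radii
    \<open>x + x * x\<close> and \<open>x\<close>; \<open>(1 + x) ^ k\<close> bounds the volume of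
    base tuples, whose squared norms are at most \<open>1 + x\<close>.\<close>
  define f where "f x = Dx x / ((1 + x) ^ (2 * N) * (1 + x) ^ k * (\<Prod>s\<in>S. Ex s x + x))" for x
  have nz: "0 < (\<Prod>s\<in>S. Ex s 0 + 0)"
    by (intro prod_pos) (simp add: Ex0)
  have "(f \<longlongrightarrow> Dx 0 / ((1 + 0) ^ (2 * N) * (1 + 0) ^ k * (\<Prod>s\<in>S. Ex s 0 + 0))) (at_right 0)"
    unfolding f_def Dx_def Ex_def
    by (intro tendsto_intros det_on_tendsto qx_lim) (use nz in \<open>simp add: Ex_def\<close>)
  hence "\<forall>\<^sub>F x in at_right 0. c < f x"
    by (rule order_tendstoD) (use c in \<open>simp add: Dx_def Ex_def K_def q0\<close>)
  moreover
  have finE: "finite ?E" by simp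
  obtain a0 where a0: "0 < a0" "aligns ?E 2 (t / 8) a0"
    using aligns_exists[OF finE, where e = "t / 8" and R = 2] t by auto
  \<comment> \<open>The bounds on \<open>x\<close> serve, in turn, to have \<open>x < 1\<close>, to
    keep the total Gram error \<open>(14 * M + 1) * x\<close> below \<open>t / 2\<close>, to keep
    almost-orbits within distance 1 of orbits, and to align base tuples with the frame.\<close>
  define b where "b = min (min 1 (t / 2 / (14 * M + 1))) (min (1 / (2 * M + 1)) a0)"
  have b0: "0 < b" using a0 t M0 by (simp add: b_def)
  have "\<forall>\<^sub>F x in at_right 0. x < b"
    using b0 by (auto simp: eventually_at_right_field)
  moreover have "\<forall>\<^sub>F x in at_right (0::real). 0 < x" by (rule eventually_at_right_less)
  ultimately have "\<forall>\<^sub>F x in at_right 0. c < f x \<and> x < b \<and> 0 < x"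
    by eventually_elim auto
  then obtain x where x: "c < f x" "x < b" "0 < x"
    by (metis (no_types, lifting) eventually_happens trivial_limit_at_right_real)
  have x1: "x < 1" "x < a0" using x(2) by (auto simp: b_def)
  have x2: "(14 * M + 1) * x < t / 2"
  proof -
    have "x < t / 2 / (14 * M + 1)" using x(2) by (simp add: b_def)
    moreover have "0 < 14 * M + 1" using M0 by simp
    ultimately have "x * (14 * M + 1) < t / 2" by (simp only: pos_less_divide_eq)
    thus ?thesis by (simp only: mult.commute)
  qed
  have x3: "2 * M * x + x < 1"
  proof -
    have "x < 1 / (2 * M + 1)" using x(2) by (simp add: b_def)
    moreover have "0 < 2 * M + 1" using M0 by simp
    ultimately have "x * (2 * M + 1) < 1" by (simp only: pos_less_divide_eq)
    thus ?thesis by (simp add: algebra_simps)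
  qed
  have xx: "x * x < x" using x(3) x1(1) by (simp add: mult_less_cancel_left1)
  have Mx: "2 * M * x\<^sup>2 \<le> 2 * M * x" "2 * M * x\<^sup>2 < x"
  proof -
    show "2 * M * x\<^sup>2 \<le> 2 * M * x" using M0 xx by (intro mult_left_mono) (auto simp: power2_eq_square)
    have "(2 * M * x) * x < 1 * x" using x3 x(3) by (intro mult_strict_right_mono) auto
    thus "2 * M * x\<^sup>2 < x" by (simp add: power2_eq_square mult.assoc)
  qed
  have Mx2: "M * x\<^sup>2 < x / 2" using Mx(2) by simp
  obtain ds where ds: "0 < ds" "\<And>s n. s \<in> S \<Longrightarrow> emeasure (tvol n (K s)) (gset n (K s) (qx x) ds) \<le> ennreal ((Ex s x + x) ^ n * vball n ^ card (K s))"
  proof -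
    have "\<exists>d>0. \<forall>s\<in>S. \<forall>n. emeasure (tvol n (K s)) (gset n (K s) (qx x) d) \<le> ennreal ((Ex s x + x) ^ n * vball n ^ card (K s))"
    proof (rule finite_common_bound[OF S])
      show "\<exists>d>0. \<forall>n. emeasure (tvol n (K s)) (gset n (K s) (qx x) d) \<le> ennreal ((Ex s x + x) ^ n * vball n ^ card (K s))" for s
        unfolding Ex_def by (rule gram_volume_upper[OF finK qxK(1) x(3)])
      fix s and d d' :: real
      assume 1: "\<forall>n. emeasure (tvol n (K s)) (gset n (K s) (qx x) d) \<le> ennreal ((Ex s x + x) ^ n * vball n ^ card (K s))"
        and d': "d' \<le> d"
      show "\<forall>n. emeasure (tvol n (K s)) (gset n (K s) (qx x) d') \<le> ennreal ((Ex s x + x) ^ n * vball n ^ card (K s))"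
        by (intro allI order_trans[OF emeasure_mono[OF gset_mono[OF d'] sets_gset[OF finK]] 1[rule_format]])
    qed
    thus ?thesis using that by blast
  qed
  have xx0: "0 < x * x" using x by simp
  obtain a' where a': "0 < a'" "\<And>s. s \<in> S \<Longrightarrow> aligns (K s) 3 (x * x) a'"
    using aligns_common[where J = K and R = 3, OF S finK xx0] by blast
  define d' where "d' = min ds (min (a' / 2) 1)"
  have d': "0 < d'" "d' \<le> ds" "d' \<le> a' / 2" "d' \<le> 1" using ds a' by (auto simp: d'_def)
  define d where "d = min (d' / 2) (x / 2)"
  have d: "0 < d" "d \<le> d' / 2" "d \<le> x / 2" using d' x by (auto simp: d_def)
  have noisy: "\<forall>\<^sub>F n in sequentially. \<forall>s\<in>S. \<forall>A. (\<forall>j\<in>K s. cnorm n (A j) \<le> 3) \<longrightarrow>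
    ennreal ((1/2 * (x ^ (2 * n) * vball n)) ^ card (K s)) \<le>
    emeasure (tvol n (K s)) {B \<in> space (tvol n (K s)). (\<forall>j\<in>K s. cnorm n (\<lambda>l. B j l - A j l) \<le> x) \<and>
      (\<forall>i\<in>K s. \<forall>j\<in>K s. cmod (cip n (B i) (B j) - (cip n (A i) (A j) + (if i = j then of_real (x\<^sup>2) else 0))) < d' / 2)}"
    using noisy_gram_volume[OF finK x(3), where d = "d' / 2" and R = 3] d'(1)
    by (intro eventually_ball_finite ballI S) (auto simp: eventually_sequentially)
  have volG: "\<forall>\<^sub>F n in sequentially. ennreal ((1/2) ^ card ?J * Dx x ^ n * vball n ^ card ?J) \<le> emeasure (tvol n ?J) (gset n ?J (qx x) d)"
    using gram_volume_lower[OF finJ qx d(1)] by (auto simp: eventually_sequentially Dx_def)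
  have fx0: "0 < f x" using c(1) x(1) by linarith
  have limev: "\<forall>\<^sub>F n in sequentially. c ^ n \<le> (1/2) ^ (2 * N + k) * f x ^ n"
  proof -
    have "(\<lambda>n. 2 ^ (2 * N + k) * (c / f x) ^ n) \<longlonglongrightarrow> 2 ^ (2 * N + k) * 0"
      using fx0 x(1) c(1) by (intro tendsto_mult tendsto_const LIMSEQ_realpow_zero) auto
    hence "\<forall>\<^sub>F n in sequentially. 2 ^ (2 * N + k) * (c / f x) ^ n < 1" by (rule order_tendstoD) simp
    thus ?thesis
    proof eventually_elim
      case (elim n)
      have "0 < f x ^ n" using fx0 by simp
      hence "2 ^ (2 * N + k) * c ^ n \<le> f x ^ n" using elim by (simp add: power_divide divide_less_eq)
      thus ?case by (simp add: power_one_over field_simps)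
    qed
  qed
  show ?thesis
    using noisy volG limev eventually_ge_at_top[of k]
  proof eventually_elim
    case (elim n)
    interpret haar n "H n" by standard (rule H)
    let ?G = "gset n ?J (qx x) d" and ?B = "gset n ?E q x"
    let ?p = "pnear S ?J q t (\<lambda>i l. V n l i)"
    define C where "C s = ((1/2 * (x ^ (2 * n) * vball n)) ^ card (K s)) / ((Ex s x + x) ^ n * vball n ^ card (K s))" for s
    have v: "0 < vball n" by (rule vball_pos)
    have C0: "0 \<le> C s" for s using x(3) Ex0[of s x] v by (auto simp: C_def)
    \<comment> \<open>The tolerance along edges is the noise radius \<open>x\<close> plus the
      alignment error \<open>x * x\<close>; being of lower order, the latter lets the ratio of the
      radii tend to 1.\<close>
    have h': "0 < x + x * x" using x(3) xx0 by linarith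
    have hL: "lengths F * (x + x * x) \<le> 2 * M * x"
    proof -
      have "M * (x + x * x) \<le> M * (2 * x)" using M0 xx by (intro mult_left_mono) auto
      thus ?thesis by (simp add: M_def)
    qed
    have qxq: "cmod (qx x u v - q u v) \<le> 2 * M * x\<^sup>2" if "u \<in> ?J" for u v
    proof (cases "u = v")
      case True
      have "qx x u v - q u v = complex_of_real (w x u)" using True by (simp add: qx_def)
      thus ?thesis using w0[OF that, of x] by simp
    qed (use M0 in \<open>simp add: qx_def\<close>)
    have qxE: "cmod (qx x u v - q u v) \<le> M * x\<^sup>2" if "u \<in> ?E" for u v
    proof (cases "u = v")
      case True
      have "qx x u v - q u v = complex_of_real (x\<^sup>2 * M)" using True that by (auto simp: qx_def w_def height_def)
      thus ?thesis using M0 by (simp only: norm_of_real) (simp add: mult.commute)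
    qed (use M0 in \<open>simp add: qx_def\<close>)
    have GY: "cmod (cip n (Y u) (Y v) - qx x u v) < d" if "Y \<in> ?G" "u \<in> ?J" "v \<in> ?J" for Y u v
      using that unfolding gset_def by blast
    have GB: "restrict Y ?E \<in> ?B" if Y: "Y \<in> ?G" for Y
    proof -
      have "cmod (cip n (restrict Y ?E u) (restrict Y ?E v) - q u v) < x" if uv: "u \<in> ?E" "v \<in> ?E" for u v
      proof -
        have "u \<in> ?J" "v \<in> ?J" using uv EJ by blast+
        from GY[OF Y this] qxE[OF uv(1), of v]
        have "cmod (cip n (Y u) (Y v) - q u v) < x"
          using norm_triangle_ineq[of "cip n (Y u) (Y v) - qx x u v" "qx x u v - q u v"] d(3) Mx2 by simp
        thus ?thesis using uv by simp
      qed
      thus ?thesis unfolding gset_def by (auto simp: space_PiM)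
    qed
    have GN: "cnorm n (Y u) \<le> 3" if Y: "Y \<in> ?G" and u: "u \<in> ?J" for Y u
    proof (rule gset_cnorm_le[OF Y u])
      have "cmod (qx x u u) \<le> 1 + x"
        using qxq[OF u, of u] norm_triangle_sub[of "qx x u u" "q u u"] diag[OF u] Mx(2) by simp
      thus "cmod (qx x u u) + d \<le> 3\<^sup>2" using d(3) x1(1) by simp
    qed simp
    have B2: "cnorm n (Y ([], i)) \<le> 2" if "Y \<in> ?B" "i < k" for Y i
      using gset_cnorm_le[OF that(1), where j = "([], i)" and R = 2] that(2) x1(1) base by auto
    have dc: "ennreal (prod C S) * emeasure (tvol n ?J) ?G
      \<le> ennreal (((x + x * x) ^ (2 * n) * vball n) ^ (k * (card F - 1))) * (?p * emeasure (tvol n ?E) ?B)"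
    proof (rule double_count_lower[where t = "t / 2" and q = q, OF S F h' sets_gset[OF finJ] sets_gset[OF finE]])
      fix X Y assume X: "\<forall>s\<in>S. X s \<in> unitary_set n" and Y: "Y \<in> ?G"
        and e: "edges n k F (x + x * x) X Y"
      have Y2: "cnorm n (Y ([], i)) \<le> 2" if "i < k" for i
        using B2[OF GB[OF Y] that] that by simp
      have hL1: "lengths F * (x + x * x) \<le> 1" using hL x3 x(3) by linarith
      have "near n ?J q (t / 2) X (\<lambda>i. Y ([], i))"
        unfolding near_def
      proof (intro ballI)
        fix u v assume uv: "u \<in> ?J" "v \<in> ?J"
        let ?o = "orbit n X (\<lambda>i. Y ([], i))"
        have "cmod (cip n (Y u) (Y v) - cip n (?o u) (?o v)) \<le> 6 * (lengths F * (x + x * x))"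
          by (rule edges_gram_close[OF F X e _ hL1 Y2 uv]) (use h' in auto)
        hence 1: "cmod (cip n (?o u) (?o v) - cip n (Y u) (Y v)) \<le> 12 * M * x"
          using hL by (simp add: norm_minus_commute)
        have 2: "cmod (cip n (Y u) (Y v) - q u v) < x / 2 + 2 * M * x"
          using GY[OF Y uv] qxq[OF uv(1), of v] Mx(1) d(3)
            norm_triangle_ineq[of "cip n (Y u) (Y v) - qx x u v" "qx x u v - q u v"] by simp
        have "12 * M * x + (x / 2 + 2 * M * x) \<le> (14 * M + 1) * x" using x(3) by (simp add: algebra_simps)
        thus "cmod (cip n (?o u) (?o v) - q u v) < t / 2"
          using norm_triangle_ineq[of "cip n (?o u) (?o v) - cip n (Y u) (Y v)" "cip n (Y u) (Y v) - q u v"] 1 2 x2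
          by simp
      qed
      thus "restrict Y ?E \<in> ?B \<and> near n ?J q (t / 2) X (\<lambda>i. Y ([], i))" using GB[OF Y] by simp
    next
      fix Y assume Y: "Y \<in> ?G"
      show "ennreal (prod C S) \<le> edge_prob S F k (x + x * x) Y"
      proof (rule prod_ennreal_ge[OF S _ C0])
        fix s assume s: "s \<in> S"
        let ?A = "\<lambda>(g, i). Y (red_cons (s, True) g, i)"
        have A: "?A = (\<lambda>a. Y (src s a))" by (auto simp: src_def fun_eq_iff)
        let ?G' = "gset n (K s) (qx x) d'"
        have "ennreal ((1/2 * (x ^ (2 * n) * vball n)) ^ card (K s))
          \<le> hprob (K s) (x + x * x) ?A Y * emeasure (tvol n (K s)) ?G'"
        proof (rule hprob_lower[OF finK sets_gset[OF finK]])
          fix B' assume B': "B' \<in> ?G'"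
          show "\<exists>W\<in>unitary_set n. \<forall>j\<in>K s. cnorm n (\<lambda>l. mv n W (B' j) l - Y j l) \<le> x * x"
          proof (rule alignsD[OF a'(2)[OF s]])
            fix i assume i: "i \<in> K s"
            have iJ: "i \<in> ?J" using i KJ by blast
            show "cnorm n (Y i) \<le> 3" by (rule GN[OF Y iJ])
            show "cnorm n (B' i) \<le> 3"
            proof (rule gset_cnorm_le[OF B' i])
              have "cmod (qx x i i) \<le> 1 + x"
                using qxq[OF iJ, of i] norm_triangle_sub[of "qx x i i" "q i i"] diag[OF iJ] Mx(2) by simp
              thus "cmod (qx x i i) + d' \<le> 3\<^sup>2" using d'(4) x1(1) by simp
            qed simp
            fix j assume j: "j \<in> K s"
            have jJ: "j \<in> ?J" using j KJ by blast
            have "cmod (cip n (B' i) (B' j) - qx x i j) < d'" using B' i j by (auto simp: gset_def)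
            thus "cmod (cip n (B' i) (B' j) - cip n (Y i) (Y j)) \<le> a'"
              using GY[OF Y iJ jJ] d(2) d'(1,3)
                norm_triangle_ineq4[of "cip n (B' i) (B' j) - qx x i j" "cip n (Y i) (Y j) - qx x i j"] by simp
          qed
        next
          fix U assume U: "U \<in> unitary_set n"
          let ?UA = "\<lambda>j. mv n U (?A j)"
          let ?T = "{B \<in> space (tvol n (K s)). (\<forall>j\<in>K s. cnorm n (\<lambda>l. B j l - ?UA j l) \<le> x) \<and>
            (\<forall>i\<in>K s. \<forall>j\<in>K s. cmod (cip n (B i) (B j) - (cip n (?UA i) (?UA j) + (if i = j then of_real (x\<^sup>2) else 0))) < d' / 2)}"
          have "\<forall>j\<in>K s. cnorm n (?UA j) \<le> 3"
            unfolding cnorm_mv_unitary[OF U] unfolding A using GN[OF Y srcJ] by blast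
          hence "ennreal ((1/2 * (x ^ (2 * n) * vball n)) ^ card (K s)) \<le> emeasure (tvol n (K s)) ?T"
            by (rule elim(1)[THEN bspec, OF s, THEN spec[of _ ?UA], THEN mp])
          also have "\<dots> \<le> emeasure (tvol n (K s)) {B \<in> ?G'. \<forall>j\<in>K s. cnorm n (\<lambda>l. B j l - mv n U (?A j) l) \<le> x}"
          proof (rule emeasure_mono)
            show "?T \<subseteq> {B \<in> ?G'. \<forall>j\<in>K s. cnorm n (\<lambda>l. B j l - mv n U (?A j) l) \<le> x}"
            proof (intro subsetI CollectI conjI)
              fix B assume B: "B \<in> ?T"
              show "\<forall>j\<in>K s. cnorm n (\<lambda>l. B j l - mv n U (?A j) l) \<le> x" using B by blast
              show "B \<in> ?G'"
                unfolding gset_def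
              proof (intro CollectI conjI ballI)
                show "B \<in> space (tvol n (K s))" using B by blast
                fix i j assume ij: "i \<in> K s" "j \<in> K s"
                let ?z = "if i = j then complex_of_real (x\<^sup>2) else 0"
                have "cmod (cip n (B i) (B j) - (cip n (?UA i) (?UA j) + ?z)) < d' / 2" using B ij by blast
                hence 1: "cmod (cip n (B i) (B j) - (cip n (Y (src s i)) (Y (src s j)) + ?z)) < d' / 2"
                  unfolding cip_mv_unitary[OF U] unfolding A .
                have 2: "cmod (cip n (Y (src s i)) (Y (src s j)) - qx x (src s i) (src s j)) < d"
                  by (rule GY[OF Y srcJ[OF ij(1)] srcJ[OF ij(2)]])
                have "q (src s i) (src s j) = q i j"
                  unfolding src_def using toep[OF s] ij unfolding K_def by blast
                \<comment> \<open>The \<open>x\<^sup>2\<close> contributed by the noise is exactly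
                  the gain in height from source to target, so noisy images of the sources have the
                  Gram matrix required of the targets.\<close>
                moreover have "w x (src s i) + x\<^sup>2 = w x i"
                  by (simp add: w_def src_def height_red_cons algebra_simps)
                hence "complex_of_real (w x (src s i)) + complex_of_real (x\<^sup>2) = complex_of_real (w x i)"
                  by (simp only: of_real_add[symmetric])
                ultimately have 3: "qx x (src s i) (src s j) + ?z = qx x i j"
                  unfolding qx_def src_inj[OF ij] by (cases "i = j") (auto simp: add.assoc)
                have "cip n (B i) (B j) - qx x i j = (cip n (B i) (B j) - (cip n (Y (src s i)) (Y (src s j)) + ?z))
                  + (cip n (Y (src s i)) (Y (src s j)) - qx x (src s i) (src s j))"
                  unfolding 3[symmetric] by simp
                also have "cmod \<dots> < d'"
                  using 1 2 d(2) by (intro order_le_less_trans[OF norm_triangle_ineq]) linarith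
                finally show "cmod (cip n (B i) (B j) - qx x i j) < d'" .
              qed
            qed
            have "{B \<in> space (tvol n (K s)). \<forall>j\<in>K s. cnorm n (\<lambda>l. B j l - mv n U (?A j) l) \<le> x} \<in> sets (tvol n (K s))"
              using finK by measurable
            from sets.Int[OF sets_gset[OF finK] this]
            show "{B \<in> ?G'. \<forall>j\<in>K s. cnorm n (\<lambda>l. B j l - mv n U (?A j) l) \<le> x} \<in> sets (tvol n (K s))"
              by (rule back_subst[where P = "\<lambda>A. A \<in> sets (tvol n (K s))"]) (auto simp: gset_def)
          qed
          finally show "ennreal ((1/2 * (x ^ (2 * n) * vball n)) ^ card (K s))
            \<le> emeasure (tvol n (K s)) {B \<in> ?G'. \<forall>j\<in>K s. cnorm n (\<lambda>l. B j l - mv n U (?A j) l) \<le> x}" .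
        qed
        moreover have "emeasure (tvol n (K s)) ?G' \<le> ennreal ((Ex s x + x) ^ n * vball n ^ card (K s))"
          by (rule order_trans[OF emeasure_mono[OF gset_mono[OF d'(2)] sets_gset[OF finK]] ds(2)[OF s]])
        ultimately show "ennreal (C s) \<le> hprob (edge_targets S F s \<times> {..<k}) (x + x * x) ?A Y"
          unfolding C_def K_def[symmetric]
          by (rule ennreal_divide_bound_ge) (use Ex0[of s x] x(3) v in auto)
      qed
    next
      fix Y assume Y: "Y \<in> ?B"
      have V2: "cnorm n (\<lambda>l. V n l i) \<le> 2" if "i < k" for i using Ukn_cnorm[OF V[OF elim(4)] that] by simp
      have "\<exists>W\<in>unitary_set n. \<forall>j\<in>?E. cnorm n (\<lambda>l. mv n W (Y j) l - (\<lambda>p l. V n l (snd p)) j l) \<le> t / 8"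
      proof (rule alignsD[OF a0(2)])
        fix i assume i: "i \<in> ?E"
        show "cnorm n (\<lambda>l. V n l (snd i)) \<le> 2" "cnorm n (Y i) \<le> 2" using i V2 B2[OF Y] by auto
        fix j assume j: "j \<in> ?E"
        have "cip n (\<lambda>l. V n l (snd i)) (\<lambda>l. V n l (snd j)) = q i j"
          using i j Ukn_cip[OF V[OF elim(4)]] base by auto
        moreover have "cmod (cip n (Y i) (Y j) - q i j) < x" using Y i j by (auto simp: gset_def)
        ultimately show "cmod (cip n (Y i) (Y j) - cip n (\<lambda>l. V n l (snd i)) (\<lambda>l. V n l (snd j))) \<le> a0"
          using x1 by simp
      qed
      then obtain W where W: "W \<in> unitary_set n" "\<And>i. i < k \<Longrightarrow> cnorm n (\<lambda>l. mv n W (Y ([], i)) l - V n l i) \<le> t / 8"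
        by fastforce
      show "pnear S ?J q (t / 2) (\<lambda>i. Y ([], i)) \<le> ?p"
        by (rule pnear_perturb[OF S F W(1), where R = 2 and e = "t / 8"]) (use V2 B2[OF Y] W(2) t in auto)
    qed
    interpret L: prob_space "randrep S" by (rule prob_space_randrep)
    define p where "p = measure (randrep S) {X \<in> space (randrep S). near n ?J q t X (\<lambda>i l. V n l i)}"
    have p: "?p = ennreal p" "0 \<le> p" unfolding pnear_def p_def by (auto simp: L.emeasure_eq_measure)
    have PC: "prod C S = (1/2) ^ N * (x ^ (2 * n)) ^ N / (\<Prod>s\<in>S. Ex s x + x) ^ n"
    proof -
      let ?w = "1/2 * x ^ (2 * n)"
      have Cs: "C s = ?w ^ card (K s) / (Ex s x + x) ^ n" for s
        using v by (simp add: C_def power_mult_distrib power_divide field_simps)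
      have "prod C S = (\<Prod>s\<in>S. ?w ^ card (K s)) / (\<Prod>s\<in>S. (Ex s x + x) ^ n)"
        unfolding prod_dividef[symmetric] by (rule prod.cong[OF refl Cs])
      also have "\<dots> = ?w ^ N / (\<Prod>s\<in>S. Ex s x + x) ^ n"
        by (simp only: power_sum[symmetric] sumN prod_power_distrib)
      finally show ?thesis by (simp only: power_mult_distrib)
    qed
    have pc: "0 \<le> prod C S" by (rule prod_nonneg) (rule C0)
    \<comment> \<open>The Gram matrix at the base is near the identity, of determinant 1, so
      bounding the norms alone already gives the right volume up to powers of
      \<open>1 + x\<close>.\<close>
    have volB: "emeasure (tvol n ?E) ?B \<le> ennreal (((1 + x) ^ n * vball n) ^ k)"
    proof -
      let ?T = "{Y \<in> space (tvol n ?E). \<forall>j\<in>?E. cnorm n (\<lambda>l. Y j l - (\<lambda>_ _. 0) j l) \<le> sqrt (1 + x)}"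
      have "?B \<subseteq> ?T"
      proof (intro subsetI CollectI conjI ballI)
        fix Y j assume Y: "Y \<in> ?B" and j: "j \<in> ?E"
        have "cnorm n (Y j) \<le> sqrt (1 + x)"
          by (rule gset_cnorm_le[OF Y j]) (use j base x(3) in auto)
        thus "cnorm n (\<lambda>l. Y j l - (\<lambda>_ _. 0) j l) \<le> sqrt (1 + x)" by simp
      qed (auto simp: gset_def)
      moreover have "?T \<in> sets (tvol n ?E)" by measurable
      ultimately have "emeasure (tvol n ?E) ?B \<le> emeasure (tvol n ?E) ?T" by (rule emeasure_mono)
      also have "\<dots> = ennreal ((sqrt (1 + x) ^ (2 * n) * vball n) ^ card ?E)"
        by (rule emeasure_tvol_box) (use x(3) in auto)
      also have "sqrt (1 + x) ^ (2 * n) = (1 + x) ^ n" using x(3) by (simp add: power_mult)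
      finally show ?thesis by (simp add: card_cartesian_product)
    qed
    have "ennreal (prod C S) * ennreal ((1/2) ^ card ?J * Dx x ^ n * vball n ^ card ?J)
        \<le> ennreal (prod C S) * emeasure (tvol n ?J) ?G"
      using elim(2) by (intro mult_left_mono) auto
    also have "\<dots> \<le> ennreal (((x + x * x) ^ (2 * n) * vball n) ^ N) * (?p * emeasure (tvol n ?E) ?B)"
      using dc by (simp add: N_def)
    also have "\<dots> \<le> ennreal (((x + x * x) ^ (2 * n) * vball n) ^ N) * (ennreal p * ennreal (((1 + x) ^ n * vball n) ^ k))"
      unfolding p(1) using volB by (intro mult_left_mono) auto
    finally have "prod C S * ((1/2) ^ card ?J * Dx x ^ n * vball n ^ card ?J)
        \<le> ((x + x * x) ^ (2 * n) * vball n) ^ N * (p * ((1 + x) ^ n * vball n) ^ k)"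
      using p(2) x(3) v pc Dx0[of x]
      by (simp add: ennreal_mult'[symmetric] ennreal_mult[symmetric] ennreal_le_iff)
    hence "prod C S * (1/2) ^ (N + k) * Dx x ^ n * vball n ^ (N + k)
        \<le> ((x + x * x) ^ (2 * n)) ^ N * p * ((1 + x) ^ n) ^ k * vball n ^ (N + k)"
      unfolding cardJ by (simp add: power_mult_distrib power_add mult_ac)
    hence main: "prod C S * (1/2) ^ (N + k) * Dx x ^ n \<le> ((x + x * x) ^ (2 * n)) ^ N * p * ((1 + x) ^ n) ^ k"
      using v by (simp add: mult_le_cancel_right)
    define Z where "Z = (\<Prod>s\<in>S. Ex s x + x)"
    have Z: "0 < Z" unfolding Z_def using Ex0[of _ x] x(3) by (intro prod_pos) (auto intro: add_pos_pos)
    define Q where "Q = (1 + x) ^ (2 * N) * (1 + x) ^ k"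
    have Q: "0 < Q" unfolding Q_def using x(3) by (intro mult_pos_pos zero_less_power) auto
    have rhs: "((x + x * x) ^ (2 * n)) ^ N * p * ((1 + x) ^ n) ^ k = (x ^ (2 * n)) ^ N * (p * Q ^ n)"
    proof -
      have hx: "x + x * x = x * (1 + x)" by (simp add: algebra_simps)
      have "((x + x * x) ^ (2 * n)) ^ N = (x ^ (2 * n)) ^ N * ((1 + x) ^ (2 * N)) ^ n"
        unfolding hx by (simp add: power_mult_distrib mult_ac flip: power_mult)
      moreover have "((1 + x) ^ n) ^ k = ((1 + x) ^ k) ^ n" by (simp add: mult.commute flip: power_mult)
      ultimately show ?thesis unfolding Q_def power_mult_distrib by (simp only: mult_ac)
    qed
    have "(x ^ (2 * n)) ^ N * ((1/2) ^ (2 * N + k) * Dx x ^ n / Z ^ n) = prod C S * (1/2) ^ (N + k) * Dx x ^ n"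
      unfolding PC Z_def[symmetric] by (simp add: power_add mult_2)
    also have "\<dots> \<le> (x ^ (2 * n)) ^ N * (p * Q ^ n)" using main unfolding rhs .
    finally have "(1/2) ^ (2 * N + k) * Dx x ^ n / Z ^ n \<le> p * Q ^ n"
      by (rule mult_left_le_imp_le) (use x(3) in simp)
    hence "(1/2) ^ (2 * N + k) * Dx x ^ n / Z ^ n / Q ^ n \<le> p"
      by (subst pos_divide_le_eq) (use Q in auto)
    moreover have "(1/2) ^ (2 * N + k) * Dx x ^ n / Z ^ n / Q ^ n = (1/2) ^ (2 * N + k) * f x ^ n"
      unfolding f_def Z_def[symmetric] Q_def[symmetric] by (simp add: power_divide power_mult_distrib mult.commute)
    ultimately have "c ^ n \<le> p" using elim(3) by linarith
    thus ?case unfolding p(1) by (rule ennreal_leI)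
  qed
qed

section \<open>Zero sets\<close>

lemma tendsto_fun_iff:
  fixes f :: "'m \<Rightarrow> 'i \<Rightarrow> 'b::topological_space"
  shows "(f \<longlongrightarrow> l) G \<longleftrightarrow> (\<forall>i. ((\<lambda>m. f m i) \<longlongrightarrow> l i) G)"
  using limitin_componentwise[of "\<lambda>_. euclidean" UNIV f l G]
  by (simp add: euclidean_product_topology limitin_canonical_iff)

section \<open>Analytic functions along one-parameter rotations\<close>

text \<open>The class is closed under sums and products and contains the conjugates that adjoints
  bring in: on the real line the conjugate of \<open>cis t\<close> is \<open>cis (- t)\<close>,
  again the restriction of an entire function.\<close>

definition entire_on_reals :: "(real \<Rightarrow> complex) \<Rightarrow> bool" where
  "entire_on_reals \<phi> \<longleftrightarrow> (\<exists>g. g holomorphic_on UNIV \<and> (\<forall>t. \<phi> t = g (of_real t)))"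

lemma entire_const: "entire_on_reals (\<lambda>_. c)"
  unfolding entire_on_reals_def by (intro exI[of _ "\<lambda>_. c"]) auto

lemma entire_add:
  assumes "entire_on_reals f" "entire_on_reals g"
  shows "entire_on_reals (\<lambda>t. f t + g t)"
proof -
  from assms obtain F G where "F holomorphic_on UNIV" "\<forall>t. f t = F (of_real t)"
    "G holomorphic_on UNIV" "\<forall>t. g t = G (of_real t)" unfolding entire_on_reals_def by blast
  thus ?thesis unfolding entire_on_reals_def
    by (intro exI[of _ "\<lambda>z. F z + G z"]) (auto intro: holomorphic_intros)
qed

lemma entire_mult:
  assumes "entire_on_reals f" "entire_on_reals g"
  shows "entire_on_reals (\<lambda>t. f t * g t)"
proof -
  from assms obtain F G where "F holomorphic_on UNIV" "\<forall>t. f t = F (of_real t)"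
    "G holomorphic_on UNIV" "\<forall>t. g t = G (of_real t)" unfolding entire_on_reals_def by blast
  thus ?thesis unfolding entire_on_reals_def
    by (intro exI[of _ "\<lambda>z. F z * G z"]) (auto intro: holomorphic_intros)
qed

lemma entire_sum: "(\<And>i. i \<in> A \<Longrightarrow> entire_on_reals (f i)) \<Longrightarrow> entire_on_reals (\<lambda>t. \<Sum>i\<in>A. f i t)"
  by (induction A rule: infinite_finite_induct) (auto intro: entire_const entire_add)

lemma entire_prod: "(\<And>i. i \<in> A \<Longrightarrow> entire_on_reals (f i)) \<Longrightarrow> entire_on_reals (\<lambda>t. \<Prod>i\<in>A. f i t)"
  by (induction A rule: infinite_finite_induct) (auto intro: entire_const entire_mult)

lemma entire_cis: "entire_on_reals (\<lambda>t. cis t)" "entire_on_reals (\<lambda>t. cis (- t))"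
proof -
  have "(\<lambda>z. exp (\<i> * z)) holomorphic_on UNIV" "(\<lambda>z. exp (\<i> * (- z))) holomorphic_on UNIV"
    by (intro holomorphic_intros)+
  moreover have "cis t = exp (\<i> * of_real t)" "cis (- t) = exp (\<i> * (- of_real t))" for t
    by (simp_all add: cis_conv_exp)
  ultimately show "entire_on_reals (\<lambda>t. cis t)" "entire_on_reals (\<lambda>t. cis (- t))"
    unfolding entire_on_reals_def by blast+
qed

text \<open>Zeros at infinitely many of the angles \<open>1/(m+1)\<close> accumulate at 0, so the
  identity theorem applies.\<close>

lemma entire_frequently_zero:
  assumes f: "entire_on_reals f" and inf: "infinite {m::nat. f (inverse (real (Suc m))) = 0}"
  shows "f t = 0"
proof -
  obtain g where g: "g holomorphic_on UNIV" "\<And>t. f t = g (of_real t)"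
    using f unfolding entire_on_reals_def by blast
  define U where "U = (\<lambda>m. complex_of_real (inverse (real (Suc m)))) ` {m. f (inverse (real (Suc m))) = 0}"
  have lim: "0 islimpt U"
    unfolding islimpt_approachable
  proof (intro allI impI)
    fix e :: real assume "0 < e"
    then obtain M where M: "inverse (real (Suc M)) < e" using reals_Archimedean by blast
    obtain m where m: "M \<le> m" "f (inverse (real (Suc m))) = 0"
      using inf unfolding infinite_nat_iff_unbounded_le by blast
    have "inverse (real (Suc m)) \<le> inverse (real (Suc M))" using m(1) by (intro le_imp_inverse_le) auto
    hence lt: "inverse (real (Suc m)) < e" using M by linarith
    have "complex_of_real (inverse (real (Suc m))) \<in> U" using m(2) by (auto simp: U_def)
    moreover have "complex_of_real (inverse (real (Suc m))) \<noteq> 0"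
      by (simp only: of_real_eq_0_iff) simp
    moreover have "dist (complex_of_real (inverse (real (Suc m)))) 0 < e"
      using lt by (simp only: dist_norm diff_0_right norm_of_real) simp
    ultimately show "\<exists>x'\<in>U. x' \<noteq> 0 \<and> dist x' 0 < e" by blast
  qed
  have zero: "\<And>z. z \<in> U \<Longrightarrow> g z = 0" using g(2) by (auto simp: U_def)
  have "g (of_real t) = 0"
    by (rule analytic_continuation[OF g(1) open_UNIV connected_UNIV subset_UNIV UNIV_I lim zero UNIV_I])
  thus ?thesis using g(2) by simp
qed

text \<open>Alignment of the standard basis with its image under \<open>U\<close>: the Gram matrices
  agree exactly, so the error can be made arbitrarily small.\<close>

lemma reflgrp_dense:
  assumes U: "U \<in> unitary_set n"
  shows "U \<in> closure (reflgrp n)"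
proof -
  define e where "e j = (\<lambda>l. if l = j then 1 else 0 :: complex)" for j :: nat
  have Ue: "mv n W (e j) i = W i j" if "j < n" for W i j
  proof -
    have "mv n W (e j) i = (\<Sum>l<n. if l = j then W i l else 0)"
      unfolding mv_def e_def by (intro sum.cong) auto
    thus ?thesis using that by simp
  qed
  define R where "R = (\<Sum>j<n. cnorm n (e j))"
  have R: "cnorm n (e j) \<le> R" if "j < n" for j
    unfolding R_def using that by (intro member_le_sum) auto
  have "\<exists>W\<in>reflgrp n. \<forall>i j. cmod (W i j - U i j) \<le> inverse (real (Suc m))" for m
  proof -
    have "0 < inverse (real (Suc m))" by simp
    from gram_alignment[of "{..<n}", OF finite_lessThan this, of R]
    obtain d where d: "0 < d" "\<forall>n'. \<forall>A B :: nat \<Rightarrow> cvec. (\<forall>j\<in>{..<n}. cnorm n' (A j) \<le> R \<and> cnorm n' (B j) \<le> R) \<and>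
      (\<forall>i\<in>{..<n}. \<forall>j\<in>{..<n}. cmod (cip n' (A i) (A j) - cip n' (B i) (B j)) \<le> d) \<longrightarrow>
      (\<exists>W\<in>reflgrp n'. \<forall>j\<in>{..<n}. cnorm n' (\<lambda>l. mv n' W (A j) l - B j l) \<le> inverse (real (Suc m)))" by blast
    have "\<exists>W\<in>reflgrp n. \<forall>j\<in>{..<n}. cnorm n (\<lambda>l. mv n W (e j) l - mv n U (e j) l) \<le> inverse (real (Suc m))"
      by (rule d(2)[THEN spec[of _ n], THEN spec[of _ e], THEN spec[of _ "\<lambda>j. mv n U (e j)"], THEN mp])
         (use d(1) R in \<open>auto simp: cnorm_mv_unitary[OF U] cip_mv_unitary[OF U]\<close>)
    then obtain W where W: "W \<in> reflgrp n"
      "\<And>j. j < n \<Longrightarrow> cnorm n (\<lambda>l. mv n W (e j) l - mv n U (e j) l) \<le> inverse (real (Suc m))" by auto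
    have "cmod (W i j - U i j) \<le> inverse (real (Suc m))" for i j
    proof (cases "i < n \<and> j < n")
      case True
      have "cmod (mv n W (e j) i - mv n U (e j) i) \<le> cnorm n (\<lambda>l. mv n W (e j) l - mv n U (e j) l)"
        unfolding cnorm_def by (rule member_le_L2_set) (use True in auto)
      thus ?thesis using W(2)[of j] True by (simp add: Ue)
    next
      case False
      hence "W i j = 0" "U i j = 0"
        using unitary_supp[OF U] unitary_supp[OF reflgrp_unitary[OF W(1)]] unfolding supp_in_def by blast+
      thus ?thesis by simp
    qed
    thus ?thesis using W(1) by blast
  qed
  then obtain W where W: "\<And>m. W m \<in> reflgrp n" "\<And>m i j. cmod (W m i j - U i j) \<le> inverse (real (Suc m))"
    by metis
  have "(\<lambda>m. W m i j) \<longlonglongrightarrow> U i j" for i j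
  proof -
    have "(\<lambda>m. W m i j - U i j) \<longlonglongrightarrow> 0"
      by (rule Lim_null_comparison[OF _ LIMSEQ_inverse_real_of_nat]) (use W(2) in auto)
    thus ?thesis by (simp add: LIM_zero_iff)
  qed
  hence "W \<longlonglongrightarrow> U" by (simp add: tendsto_fun_iff)
  thus ?thesis using W(1) unfolding closure_sequential by blast
qed

text \<open>Countability matters because every matrix of the dense set will bring its own null
  set.\<close>

lemma countable_dense_subset:
  fixes A :: "'a::second_countable_topology set"
  obtains T where "countable T" "T \<subseteq> A" "A \<subseteq> closure T"
proof -
  obtain B :: "'a set set" where B: "countable B" "topological_basis B" using ex_countable_basis by blast
  define T where "T = (\<lambda>b. SOME x. x \<in> b \<inter> A) ` {b \<in> B. b \<inter> A \<noteq> {}}"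
  have pick: "(SOME x. x \<in> b \<inter> A) \<in> b \<inter> A" if "b \<inter> A \<noteq> {}" for b
    using that by (simp only: some_in_eq not_False_eq_True)
  have "countable T" using B(1) by (auto simp: T_def)
  moreover have "T \<subseteq> A" using pick by (auto simp: T_def)
  moreover have "x \<in> closure T" if x: "x \<in> A" for x
  proof (rule ccontr)
    assume "x \<notin> closure T"
    hence "open (- closure T)" "x \<in> - closure T" by auto
    then obtain b where b: "b \<in> B" "x \<in> b" "b \<subseteq> - closure T"
      using topological_basisE[OF B(2)] by metis
    hence "(SOME x. x \<in> b \<inter> A) \<in> T" using x by (auto simp: T_def)
    moreover have "(SOME x. x \<in> b \<inter> A) \<in> b" using pick[of b] x b(2) by blast
    ultimately show False using b(3) closure_subset by blast
  qed
  ultimately show ?thesis using that by blast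
qed

context haar
begin

section \<open>Almost sure nonvanishing under left translations of the generators\<close>

definition act :: "'s set \<Rightarrow> ('s \<Rightarrow> cmat) \<Rightarrow> ('s \<Rightarrow> cmat) \<Rightarrow> 's \<Rightarrow> cmat" where
  "act S D X = (\<lambda>s\<in>S. mmul n (D s) (X s))"

lemma measurable_act: "act S D \<in> measurable (randrep S) (randrep S)"
  unfolding act_def by (intro measurable_restrict) measurable

lemma act_preserves:
  assumes S: "finite S" and D: "\<And>s. s \<in> S \<Longrightarrow> D s \<in> unitary_set n"
  shows "distr (randrep S) (randrep S) (act S D) = randrep S"
proof -
  interpret P: product_sigma_finite "\<lambda>_. \<mu>" by standard
  show ?thesis
  proof (rule P.PiM_eqI[OF S])
    fix A :: "'a \<Rightarrow> cmat set" assume A: "\<And>s. s \<in> S \<Longrightarrow> A s \<in> sets \<mu>"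
    have m: "{Z. mmul n (D s) Z \<in> A s} \<in> sets \<mu>" if "s \<in> S" for s
      using measurable_sets[of "\<lambda>Z. mmul n (D s) Z" borel borel "A s"] A[OF that] by (simp add: vimage_def)
    have eq: "act S D -` PiE S A \<inter> space (randrep S) = PiE S (\<lambda>s. {Z. mmul n (D s) Z \<in> A s})"
      by (auto simp: act_def space_PiM PiE_iff)
    have "emeasure (distr (randrep S) (randrep S) (act S D)) (PiE S A) = emeasure (randrep S) (PiE S (\<lambda>s. {Z. mmul n (D s) Z \<in> A s}))"
      using A S by (subst emeasure_distr[OF measurable_act]) (auto simp: eq intro!: sets_PiM_I_finite)
    also have "\<dots> = (\<Prod>s\<in>S. emeasure \<mu> {Z. mmul n (D s) Z \<in> A s})"
      by (rule P.emeasure_PiM[OF S m])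
    also have "\<dots> = (\<Prod>s\<in>S. emeasure \<mu> (A s))"
      using D A by (intro prod.cong refl emeasure_left) auto
    finally show "emeasure (distr (randrep S) (randrep S) (act S D)) (PiE S A) = (\<Prod>s\<in>S. emeasure \<mu> (A s))" .
  qed simp
qed

lemma AE_act:
  assumes S: "finite S" and D: "\<And>s. s \<in> S \<Longrightarrow> D s \<in> unitary_set n"
    and P: "AE X in randrep S. P X"
  shows "AE X in randrep S. P (act S D X)"
proof -
  have "AE X in distr (randrep S) (randrep S) (act S D). P X" using P by (simp only: act_preserves[OF S D])
  thus ?thesis by (rule AE_distrD[OF measurable_act])
qed

definition one_at :: "'s \<Rightarrow> cmat \<Rightarrow> 's \<Rightarrow> cmat" where
  "one_at s A = (\<lambda>s'. if s' = s then A else ident n)"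

text \<open>If \<open>f X = 0\<close> but \<open>f\<close> does not vanish after rotating one generator, then the rotation orbit of \<open>X\<close>
  meets the zero set only in isolated points; a set of positive measure of such \<open>X\<close> would by
  invariance contain points with infinitely many zeros at the angles \<open>1/(m+1)\<close>.\<close>
lemma AE_zero_rotate:
  fixes f :: "('s \<Rightarrow> cmat) \<Rightarrow> complex"
  assumes S: "finite S" and s: "s \<in> S" and v: "cnorm n v = 1"
    and fm: "f \<in> borel_measurable (randrep S)"
    and ent: "\<And>X. X \<in> PiE S (\<lambda>_. unitary_set n) \<Longrightarrow> entire_on_reals (\<lambda>t. f (act S (one_at s (creflect n v (cis t))) X))"
  shows "AE X in randrep S. f (act S (one_at s (creflect n v (cis t0))) X) \<noteq> 0 \<longrightarrow> f X \<noteq> 0"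
proof -
  let ?R = "\<lambda>t. act S (one_at s (creflect n v (cis t)))"
  have Ru: "one_at s (creflect n v (cis t)) s' \<in> unitary_set n" for t s'
    using unitary_creflect[OF v] unitary_ident by (simp add: one_at_def)
  interpret L: prob_space "randrep S" by (rule prob_space_randrep)
  define N where "N = {X \<in> space (randrep S). f X = 0 \<and> f (?R t0 X) \<noteq> 0}"
  have fR: "(\<lambda>X. f (?R t X)) \<in> borel_measurable (randrep S)" for t
    by (rule measurable_compose[OF measurable_act fm])
  have N: "N \<in> sets (randrep S)"
    unfolding N_def using fm fR[of t0] by measurable
  define Nm where "Nm m = ?R (inverse (real (Suc m))) -` N \<inter> space (randrep S)" for m
  have Nm: "Nm m \<in> sets (randrep S)" for m
    unfolding Nm_def by (rule measurable_sets[OF measurable_act N])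
  have mNm: "measure (randrep S) (Nm m) = measure (randrep S) N" for m
  proof -
    have "measure (distr (randrep S) (randrep S) (?R (inverse (real (Suc m))))) N = measure (randrep S) (Nm m)"
      unfolding Nm_def by (rule measure_distr[OF measurable_act N])
    thus ?thesis using act_preserves[OF S Ru] by simp
  qed
  \<comment> \<open>The intersection of all \<open>T M\<close> consists of the points that meet
    \<open>N\<close> at infinitely many of the angles. By invariance each \<open>Nm m\<close> has
    the measure of \<open>N\<close>, and so this intersection has at least that measure.\<close>
  define T where "T M = (\<Union>m\<in>{M..}. Nm m)" for M :: nat
  have T: "T M \<in> sets (randrep S)" for M using Nm by (auto simp: T_def)
  have "decseq T" by (force simp: T_def decseq_def)
  hence lim: "(\<lambda>M. measure (randrep S) (T M)) \<longlonglongrightarrow> measure (randrep S) (\<Inter>M. T M)"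
    using T by (intro L.finite_Lim_measure_decseq) auto
  have "measure (randrep S) N \<le> measure (randrep S) (T M)" for M
    unfolding mNm[of M, symmetric] using T Nm by (intro L.finite_measure_mono) (auto simp: T_def)
  hence le: "measure (randrep S) N \<le> measure (randrep S) (\<Inter>M. T M)"
    by (intro LIMSEQ_le_const[OF lim]) auto
  have "AE X in randrep S. X \<notin> (\<Inter>M. T M)"
    using AE_randrep_unitary[OF S] AE_space
  proof eventually_elim
    case (elim X)
    have X: "X \<in> PiE S (\<lambda>_. unitary_set n)" using elim by (auto simp: space_PiM PiE_iff)
    have comp: "?R t0 (?R t X) = ?R (t0 + t) X" for t
      by (auto simp: act_def one_at_def fun_eq_iff cis_mult creflect_mmul[OF v] mmul_assoc[symmetric]
          mmul_ident_left[OF supp_in_ident])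
    show "X \<notin> (\<Inter>M. T M)"
    proof
      assume XT: "X \<in> (\<Inter>M. T M)"
      have "infinite {m::nat. f (?R (inverse (real (Suc m))) X) = 0}"
        unfolding infinite_nat_iff_unbounded_le
      proof
        fix M
        have "X \<in> T M" using XT by blast
        thus "\<exists>m\<ge>M. m \<in> {m. f (?R (inverse (real (Suc m))) X) = 0}" by (auto simp: T_def Nm_def N_def)
      qed
      hence 0: "f (?R t X) = 0" for t by (rule entire_frequently_zero[OF ent[OF X]])
      have "X \<in> T 0" using XT by blast
      then obtain m where "f (?R t0 (?R (inverse (real (Suc m))) X)) \<noteq> 0" by (auto simp: T_def Nm_def N_def)
      thus False using 0 comp by simp
    qed
  qed
  hence "measure (randrep S) (\<Inter>M. T M) = 0"
    using T by (subst L.prob_eq_0) auto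
  hence "measure (randrep S) N = 0" using le measure_nonneg[of "randrep S" N] by linarith
  hence "AE X in randrep S. X \<notin> N" using N by (subst L.prob_eq_0[symmetric]) auto
  thus ?thesis using AE_space by eventually_elim (auto simp: N_def)
qed

text \<open>The translation by \<open>D\<close> is decomposed into single rotations, generator by
  generator and reflection by reflection. \<open>AE_zero_rotate\<close> handles each of them,
  transported by \<open>AE_act\<close> along the translation by the remaining factors.\<close>

lemma AE_zero_reflgrp:
  fixes f :: "('s \<Rightarrow> cmat) \<Rightarrow> complex"
  assumes S: "finite S" and fm: "f \<in> borel_measurable (randrep S)"
    and ent: "\<And>X s v. X \<in> PiE S (\<lambda>_. unitary_set n) \<Longrightarrow> s \<in> S \<Longrightarrow> cnorm n v = 1 \<Longrightarrow>
      entire_on_reals (\<lambda>t. f (act S (one_at s (creflect n v (cis t))) X))"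
    and D: "\<And>s. s \<in> S \<Longrightarrow> D s \<in> reflgrp n"
  shows "AE X in randrep S. f (act S D X) \<noteq> 0 \<longrightarrow> f X \<noteq> 0"
proof -
  have "AE X in randrep S. f (act S (\<lambda>s. if s \<in> I then D s else ident n) X) \<noteq> 0 \<longrightarrow> f X \<noteq> 0"
    if "finite I" "I \<subseteq> S" for I
    using that
  proof (induction I rule: finite_induct)
    case empty
    show ?case using AE_randrep_unitary[OF S] AE_space
    proof eventually_elim
      case (elim X)
      have "act S (\<lambda>s. if s \<in> {} then D s else ident n) X = X"
        using elim by (auto simp: act_def fun_eq_iff space_PiM PiE_iff extensional_def mmul_ident_left unitary_supp)
      thus ?case by simp
    qed
  next
    case (insert s I)
    have s: "s \<in> S" using insert.prems by simp
    have "AE X in randrep S. f (act S (\<lambda>s'. if s' = s then W else if s' \<in> I then D s' else ident n) X) \<noteq> 0 \<longrightarrow> f X \<noteq> 0"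
      if "W \<in> reflgrp n" for W
      using that
    proof (induction rule: reflgrp.induct)
      case ident
      have "(\<lambda>s'. if s' = s then ident n else if s' \<in> I then D s' else ident n) = (\<lambda>s'. if s' \<in> I then D s' else ident n)"
        using insert.hyps by auto
      thus ?case using insert by simp
    next
      case (step W v t)
      define D' where "D' = (\<lambda>s'. if s' = s then W else if s' \<in> I then D s' else ident n)"
      have D'u: "D' s' \<in> unitary_set n" if "s' \<in> S" for s'
        using that reflgrp_unitary[OF step.hyps(1)] reflgrp_unitary[OF D] unitary_ident by (auto simp: D'_def)
      let ?R = "act S (one_at s (creflect n v (cis t)))"
      have "AE X in randrep S. f (?R X) \<noteq> 0 \<longrightarrow> f X \<noteq> 0"
        by (rule AE_zero_rotate[OF S s step.hyps(2) fm]) (rule ent[OF _ s step.hyps(2)])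
      from AE_act[OF S D'u this]
      have "AE X in randrep S. f (?R (act S D' X)) \<noteq> 0 \<longrightarrow> f (act S D' X) \<noteq> 0" .
      moreover have "AE X in randrep S. f (act S D' X) \<noteq> 0 \<longrightarrow> f X \<noteq> 0"
        using step.IH by (simp add: D'_def)
      ultimately show ?case
        using AE_randrep_unitary[OF S]
      proof eventually_elim
        case (elim X)
        have "act S (\<lambda>s'. if s' = s then mmul n (creflect n v (cis t)) W else if s' \<in> I then D s' else ident n) X = ?R (act S D' X)"
          using D'u elim(3)
          by (auto simp: act_def one_at_def D'_def fun_eq_iff mmul_assoc mmul_ident_left supp_in_mmul unitary_supp
              supp_in_ident reflgrp_unitary[OF D])
        thus ?case using elim(1,2) by simp
      qed
    qed
    from this[OF D[OF s]] show ?case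
      by (rule back_subst[where P = "\<lambda>E. AE X in randrep S. f (act S E X) \<noteq> 0 \<longrightarrow> f X \<noteq> 0"]) auto
  qed
  from this[OF S subset_refl] show ?thesis
    by (rule AE_mp) (auto simp: act_def cong: restrict_cong)
qed

text \<open>Almost every \<open>X\<close> can be moved close to the good point \<open>W\<close> by a
  member of a countable dense family, where \<open>f\<close> is nonzero by continuity at
  \<open>W\<close>. Outside one null set for the whole family, \<open>f\<close> was then nonzero at
  \<open>X\<close> already.\<close>

lemma AE_nonzero:
  fixes f :: "('s \<Rightarrow> cmat) \<Rightarrow> complex"
  assumes S: "finite S" and fm: "f \<in> borel_measurable (randrep S)"
    and ent: "\<And>X s v. X \<in> PiE S (\<lambda>_. unitary_set n) \<Longrightarrow> s \<in> S \<Longrightarrow> cnorm n v = 1 \<Longrightarrow>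
      entire_on_reals (\<lambda>t. f (act S (one_at s (creflect n v (cis t))) X))"
    and cont: "\<And>Z. (\<And>s i j. s \<in> S \<Longrightarrow> (\<lambda>m. Z m s i j) \<longlonglongrightarrow> W s i j) \<Longrightarrow> (\<lambda>m. f (Z m)) \<longlonglongrightarrow> f W"
    and W: "\<And>s. s \<in> S \<Longrightarrow> W s \<in> unitary_set n" "f W \<noteq> 0"
  shows "AE X in randrep S. f X \<noteq> 0"
proof -
  obtain T where T: "countable T" "T \<subseteq> reflgrp n" "reflgrp n \<subseteq> closure T"
    by (rule countable_dense_subset)
  have "countable (PiE S (\<lambda>_. T))" using S T(1) by (intro countable_PiE) auto
  moreover have "AE X in randrep S. f (act S D X) \<noteq> 0 \<longrightarrow> f X \<noteq> 0" if "D \<in> PiE S (\<lambda>_. T)" for D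
    using that T(2) by (intro AE_zero_reflgrp[OF S fm ent]) (auto simp: PiE_iff)
  ultimately have "AE X in randrep S. \<forall>D\<in>PiE S (\<lambda>_. T). f (act S D X) \<noteq> 0 \<longrightarrow> f X \<noteq> 0"
    by (subst AE_ball_countable) auto
  thus ?thesis using AE_randrep_unitary[OF S]
  proof eventually_elim
    case (elim X)
    \<comment> \<open>The matrix that carries \<open>X s\<close> to \<open>W s\<close> by left
      multiplication is approximated from the dense set.\<close>
    have "\<exists>E. (\<forall>m. E m \<in> T) \<and> (\<lambda>m. E m) \<longlonglongrightarrow> mmul n (W s) (adj (X s))" if "s \<in> S" for s
    proof -
      have "mmul n (W s) (adj (X s)) \<in> closure (reflgrp n)"
        using that W(1) elim(2) by (intro reflgrp_dense unitary_mmul unitary_adj) auto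
      also have "closure (reflgrp n) \<subseteq> closure T" using T(3) by (simp add: closure_minimal)
      finally show ?thesis unfolding closure_sequential .
    qed
    then obtain E where E: "\<And>s m. s \<in> S \<Longrightarrow> E s m \<in> T"
      "\<And>s. s \<in> S \<Longrightarrow> (\<lambda>m. E s m) \<longlonglongrightarrow> mmul n (W s) (adj (X s))" by metis
    define D where "D m = (\<lambda>s\<in>S. E s m)" for m
    have D: "D m \<in> PiE S (\<lambda>_. T)" for m using E(1) by (auto simp: D_def)
    have "(\<lambda>m. f (act S (D m) X)) \<longlonglongrightarrow> f W"
    proof (rule cont)
      fix s i j assume s: "s \<in> S"
      have "(\<lambda>m. E s m i l) \<longlonglongrightarrow> mmul n (W s) (adj (X s)) i l" for l
        using E(2)[OF s] by (simp add: tendsto_fun_iff)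
      hence "(\<lambda>m. mmul n (E s m) (X s) i j) \<longlonglongrightarrow> mmul n (mmul n (W s) (adj (X s))) (X s) i j"
        unfolding mmul_def[of n "E s _"] mmul_def[of n "mmul n (W s) (adj (X s))"] by (intro tendsto_intros)
      moreover have "mmul n (mmul n (W s) (adj (X s))) (X s) = W s"
        using s W(1) elim(2) by (simp add: mmul_assoc unitary_left mmul_ident_right unitary_supp)
      ultimately show "(\<lambda>m. act S (D m) X s i j) \<longlonglongrightarrow> W s i j"
        using s by (simp add: act_def D_def)
    qed
    hence "\<forall>\<^sub>F m in sequentially. f (act S (D m) X) \<noteq> 0"
      using W(2) by (rule tendsto_imp_eventually_ne)
    then obtain m where "f (act S (D m) X) \<noteq> 0" by (auto simp: eventually_sequentially)
    thus ?case using elim(1) D by blast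
  qed
qed

end

section \<open>Block matrices\<close>

definition pmat :: "'s bmat \<Rightarrow> 's word \<times> nat \<Rightarrow> 's word \<times> nat \<Rightarrow> complex" where
  "pmat q a b = q (fst a) (fst b) (snd a) (snd b)"

lemma bdet_pmat: "bdet k E q = det_on (E \<times> {..<k}) (pmat q)"
proof -
  have "(\<lambda>(g, i) (h, j). q g h i j) = pmat q" by (auto simp: pmat_def fun_eq_iff)
  thus ?thesis by (simp add: bdet_def lessThan_atLeast0)
qed

lemma psd_block_iff: "psd_block k F q \<longleftrightarrow> psd (F \<times> {..<k}) (pmat q)"
proof -
  have e: "(\<Sum>g\<in>F. \<Sum>h\<in>F. \<Sum>i<k. \<Sum>j<k. cnj (x g i) * q g h i j * x h j)
      = bform (F \<times> {..<k}) (pmat q) (\<lambda>(g, i). x g i) (\<lambda>(g, i). x g i)" for x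
  proof -
    have "bform (F \<times> {..<k}) (pmat q) (\<lambda>(g, i). x g i) (\<lambda>(g, i). x g i)
        = (\<Sum>g\<in>F. \<Sum>i<k. \<Sum>h\<in>F. \<Sum>j<k. cnj (x g i) * q g h i j * x h j)"
    proof -
      have "(\<Sum>a\<in>F \<times> {..<k}. f a) = (\<Sum>g\<in>F. \<Sum>i<k. f (g, i))" for f :: "'a word \<times> nat \<Rightarrow> complex"
        unfolding sum.cartesian_product by (intro sum.cong) auto
      thus ?thesis by (simp add: bform_def pmat_def)
    qed
    also have "\<dots> = (\<Sum>g\<in>F. \<Sum>h\<in>F. \<Sum>i<k. \<Sum>j<k. cnj (x g i) * q g h i j * x h j)"
      by (intro sum.cong refl sum.swap)
    finally show ?thesis ..
  qed
  show ?thesis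
  proof
    assume P: "psd_block k F q"
    show "psd (F \<times> {..<k}) (pmat q)"
      unfolding psd_def
    proof
      fix x :: "'a word \<times> nat \<Rightarrow> complex"
      have "(\<lambda>(g, i). (\<lambda>g i. x (g, i)) g i) = x" by auto
      thus "Im (bform (F \<times> {..<k}) (pmat q) x x) = 0 \<and> 0 \<le> Re (bform (F \<times> {..<k}) (pmat q) x x)"
        using P[unfolded psd_block_def e Let_def, rule_format, of "\<lambda>g i. x (g, i)"] by simp
    qed
  next
    assume "psd (F \<times> {..<k}) (pmat q)"
    thus "psd_block k F q" unfolding psd_block_def e Let_def psd_def by blast
  qed
qed

lemma Su_toeplitz:
  assumes F: "suffix_closed S F" and q: "q \<in> Su k F"
    and ab: "a \<in> edge_targets S F s \<times> {..<k}" "b \<in> edge_targets S F s \<times> {..<k}"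
  shows "pmat q (red_cons (s, True) (fst a), snd a) (red_cons (s, True) (fst b), snd b) = pmat q a b"
proof -
  have in_F: "fst a \<in> F" "fst b \<in> F" "red_cons (s, True) (fst a) \<in> F" "red_cons (s, True) (fst b) \<in> F"
    using ab by (auto simp: edge_targets_def)
  have "reduced (fst a)" "reduced (fst b)" using F in_F by (auto simp: suffix_closed_def free_group_def)
  note tr = left_translation_invariant[OF this, of s True]
  have "q (red_cons (s, True) (fst a)) (red_cons (s, True) (fst b)) = q (fst a) (fst b)"
  proof -
    have "\<forall>g1\<in>F. \<forall>h1\<in>F. \<forall>g2\<in>F. \<forall>h2\<in>F.
        fg_mult (fg_inv g1) h1 = fg_mult (fg_inv g2) h2 \<longrightarrow> q g1 h1 = q g2 h2"
      using q unfolding Su_def by (elim CollectE conjE)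
    from this[rule_format, OF in_F(3,4,1,2) tr] show ?thesis .
  qed
  thus ?thesis by (simp add: pmat_def)
qed

lemma Su_zero:
  assumes "q \<in> Su k F" "\<not> (g \<in> F \<and> h \<in> F \<and> i < k \<and> j < k)"
  shows "q g h i j = 0"
proof -
  have "\<forall>g h i j. \<not> (g \<in> F \<and> h \<in> F \<and> i < k \<and> j < k) \<longrightarrow> q g h i j = 0"
    using assms(1) unfolding Su_def by (elim CollectE conjE)
  thus ?thesis using assms(2) by blast
qed

lemma Su_diag: "q \<in> Su k F \<Longrightarrow> g \<in> F \<Longrightarrow> i < k \<Longrightarrow> j < k \<Longrightarrow> pmat q (g, i) (g, j) = (if i = j then 1 else 0)"
proof -
  assume q: "q \<in> Su k F" and "g \<in> F" "i < k" "j < k"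
  moreover have "\<forall>g\<in>F. \<forall>i<k. \<forall>j<k. q g g i j = (if i = j then 1 else 0)"
    using q unfolding Su_def by (elim CollectE conjE)
  ultimately show "pmat q (g, i) (g, j) = (if i = j then 1 else 0)" by (simp add: pmat_def)
qed

text \<open>Descending to a minimal singular subtree: removing a longest word leaves a nonsingular matrix,
  of which all the matrices indexed by the sets \<open>F \<inter> sF\<close> are (translates of) submatrices.\<close>
lemma minimal_singular_subtree:
  fixes q :: "'s word \<times> nat \<Rightarrow> 's word \<times> nat \<Rightarrow> complex"
  assumes F: "suffix_closed S F" and np: "\<not> pd (F \<times> {..<k}) q"
    and toep: "\<And>s a b. s \<in> S \<Longrightarrow> a \<in> edge_targets S F s \<times> {..<k} \<Longrightarrow> b \<in> edge_targets S F s \<times> {..<k} \<Longrightarrow>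
      q (red_cons (s, True) (fst a), snd a) (red_cons (s, True) (fst b), snd b) = q a b"
    and base: "\<And>i j. i < k \<Longrightarrow> j < k \<Longrightarrow> q ([], i) ([], j) = (if i = j then 1 else 0)"
  obtains G where "suffix_closed S G" "G \<subseteq> F" "\<not> pd (G \<times> {..<k}) q"
    "\<And>s. s \<in> S \<Longrightarrow> pd (edge_targets S G s \<times> {..<k}) q"
proof -
  let ?P = "\<lambda>G. suffix_closed S G \<and> G \<subseteq> F \<and> \<not> pd (G \<times> {..<k}) q"
  obtain G where G: "?P G" and min: "\<And>G'. ?P G' \<Longrightarrow> card G \<le> card G'"
    using ex_has_least_nat[of ?P F card] F np by auto
  have sc: "suffix_closed S G" and GF: "G \<subseteq> F" using G by auto
  have fin: "finite G" and eG: "[] \<in> G" using sc by (auto simp: suffix_closed_def)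
  have red: "reduced g" if "g \<in> G" for g
    using sc that by (auto simp: suffix_closed_def free_group_def)
  obtain g where g: "g \<in> G" "\<And>h. h \<in> G \<Longrightarrow> length h \<le> length g"
  proof -
    have "Max (length ` G) \<in> length ` G" using fin eG by (intro Max_in) auto
    thus ?thesis using that fin Max_ge[of "length ` G"] by (metis (no_types) finite_imageI imageE imageI)
  qed
  have gne: "g \<noteq> []"
  proof
    assume "g = []"
    hence "G = {[]}" using g eG by auto
    moreover have "pd ({[]} \<times> {..<k}) q" by (rule pd_identity(2)) (auto simp: base split: if_splits)
    ultimately show False using G by simp
  qed
  let ?G = "G - {g}"
  have sc': "suffix_closed S ?G"
    unfolding suffix_closed_def
  proof (intro conjI allI impI)
    fix y v assume yv: "y # v \<in> ?G"
    hence "length (y # v) \<le> length g" using g(2) by blast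
    hence "v \<noteq> g" by auto
    moreover have "v \<in> G" using sc yv unfolding suffix_closed_def by blast
    ultimately show "v \<in> ?G" by simp
  qed (use sc gne in \<open>auto simp: suffix_closed_def\<close>)
  have pd': "pd (?G \<times> {..<k}) q"
  proof (rule ccontr)
    assume "\<not> pd (?G \<times> {..<k}) q"
    hence "card G \<le> card ?G" using sc' GF by (intro min) auto
    thus False using card_Diff1_less[OF fin g(1)] by simp
  qed
  have fin': "finite (?G \<times> {..<k})" using fin by simp
  have "pd (edge_targets S G s \<times> {..<k}) q" if s: "s \<in> S" for s
  \<comment> \<open>If \<open>g\<close> is not a target, the edge set avoids it. If it is, the
    sources avoid it, because \<open>g\<close> has maximal length and starts with \<open>s\<close>,
    and they carry the same submatrix by the Toeplitz condition.\<close>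
  proof (cases "g \<in> edge_targets S G s")
    case False
    thus ?thesis by (intro pd_subset[OF pd' _ fin']) (auto simp: edge_targets_def)
  next
    case True
    let ?src = "\<lambda>a :: 's word \<times> nat. (red_cons (s, True) (fst a), snd a)"
    have g0: "g = (s, False) # red_cons (s, True) g"
    proof -
      have "red_cons (s, True) g \<noteq> (s, True) # g"
        using True g(2)[of "red_cons (s, True) g"] by (auto simp: edge_targets_def)
      thus ?thesis using red_cons_cases[OF red[OF g(1)], of s True] by simp
    qed
    have ne: "red_cons (s, True) h \<noteq> g" if "h \<in> G" for h
      using red_cons_cases[OF red[OF that], of s True]
    proof
      assume h: "h = (s, \<not> True) # red_cons (s, True) h"
      show ?thesis
      proof
        assume "red_cons (s, True) h = g"
        hence "length h = Suc (length g)" using h by (metis length_Cons)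
        thus False using g(2)[OF that] by simp
      qed
    next
      assume "red_cons (s, True) h = (s, True) # h"
      thus ?thesis using g0 by (metis list.inject prod.inject)
    qed
    have inj: "inj_on ?src (edge_targets S G s \<times> {..<k})"
    proof (rule inj_onI)
      fix a b assume ab: "a \<in> edge_targets S G s \<times> {..<k}" "b \<in> edge_targets S G s \<times> {..<k}" and e: "?src a = ?src b"
      have "fst a \<in> G" "fst b \<in> G" using ab by (auto simp: edge_targets_def)
      hence "fst a = fst b" using red_cons_inverse[OF red, of _ s False] e by (metis prod.inject)
      thus "a = b" using e by (simp add: prod_eq_iff)
    qed
    have "pd (edge_targets S G s \<times> {..<k}) (\<lambda>a b. q (?src a) (?src b))"
    proof (rule pd_reindex[OF pd' inj _ fin'], rule image_subsetI)
      fix a assume "a \<in> edge_targets S G s \<times> {..<k}"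
      hence "fst a \<in> G" "red_cons (s, True) (fst a) \<in> G" "snd a < k" by (auto simp: edge_targets_def)
      thus "?src a \<in> ?G \<times> {..<k}" using ne[of "fst a"] by simp
    qed
    moreover have "edge_targets S G s \<subseteq> edge_targets S F s" using GF by (auto simp: edge_targets_def)
    hence "q (?src a) (?src b) = q a b" if "a \<in> edge_targets S G s \<times> {..<k}" "b \<in> edge_targets S G s \<times> {..<k}" for a b
      by (intro toep[OF s]) (use that in auto)
    ultimately show ?thesis using pd_cong[of "edge_targets S G s \<times> {..<k}" "\<lambda>a b. q (?src a) (?src b)" q] by blast
  qed
  thus ?thesis using that[of G] G by blast
qed

section \<open>Topology of the set of block matrices\<close>

lemma entry_continuous: "continuous_on UNIV (\<lambda>Q :: 's bmat. Q g h i j)"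
  by (rule continuous_on_product_then_coordinatewise[OF continuous_on_product_then_coordinatewise[OF continuous_on_product_then_coordinatewise[OF
        continuous_on_product_then_coordinatewise[OF continuous_on_id]]]])

text \<open>A conjunction of closed conditions on entries. Closedness makes relatively open subsets
  Borel, as \<open>Qpi_event_sets\<close> requires.\<close>

lemma closed_Su:
  shows "closed (Su k F)"
proof -
  have P: "psd_block k F Q \<longleftrightarrow> (\<forall>x. Im (\<Sum>g\<in>F. \<Sum>h\<in>F. \<Sum>i<k. \<Sum>j<k. cnj (x g i) * Q g h i j * x h j) = 0 \<and>
     0 \<le> Re (\<Sum>g\<in>F. \<Sum>h\<in>F. \<Sum>i<k. \<Sum>j<k. cnj (x g i) * Q g h i j * x h j))" for Q
    unfolding psd_block_def Let_def by blast
  have T: "Q g1 h1 = Q g2 h2 \<longleftrightarrow> (\<forall>i j. Q g1 h1 i j = Q g2 h2 i j)" for Q :: "'a bmat" and g1 h1 g2 h2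
    by (auto simp: fun_eq_iff)
  show ?thesis
    unfolding Su_def P T Ball_def
    by (intro closed_Collect_conj closed_Collect_all closed_Collect_imp closed_Collect_eq closed_Collect_le
        open_Collect_const continuous_intros entry_continuous)
qed

text \<open>Entries outside \<open>F\<close> vanish on \<open>Su k F\<close>, so finitely many
  entries govern convergence there. Hence a sequence of counterexamples suffices even if there are
  uncountably many words.\<close>

lemma neighbourhood_entries:
  fixes q :: "'s bmat"
  assumes T: "open T" "q \<in> T" and q: "q \<in> Su k F"
  shows "\<exists>t>0. \<forall>Q\<in>Su k F. (\<forall>g\<in>F. \<forall>h\<in>F. \<forall>i<k. \<forall>j<k. cmod (Q g h i j - q g h i j) < t) \<longrightarrow> Q \<in> T"
proof (rule ccontr)
  assume neg: "\<not> ?thesis"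
  have "\<exists>Q. Q \<in> Su k F \<and> (\<forall>g\<in>F. \<forall>h\<in>F. \<forall>i<k. \<forall>j<k. cmod (Q g h i j - q g h i j) < inverse (real (Suc m))) \<and> Q \<notin> T" for m
  proof -
    have "0 < inverse (real (Suc m))" by simp
    thus ?thesis using neg by blast
  qed
  then obtain Q where Q: "\<And>m. Q m \<in> Su k F" "\<And>m. Q m \<notin> T"
    "\<And>m g h i j. g \<in> F \<Longrightarrow> h \<in> F \<Longrightarrow> i < k \<Longrightarrow> j < k \<Longrightarrow> cmod (Q m g h i j - q g h i j) < inverse (real (Suc m))" by metis
  have le: "cmod (Q m g h i j - q g h i j) \<le> inverse (real (Suc m))" for m g h i j
  proof (cases "g \<in> F \<and> h \<in> F \<and> i < k \<and> j < k")
    case True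
    thus ?thesis using Q(3)[of g h i j m] by simp
  next
    case False
    thus ?thesis using Su_zero[OF Q(1) False] Su_zero[OF q False] by simp
  qed
  have "(\<lambda>m. Q m g h i j) \<longlonglongrightarrow> q g h i j" for g h i j
  proof -
    have "(\<lambda>m. Q m g h i j - q g h i j) \<longlonglongrightarrow> 0"
      by (rule Lim_null_comparison[OF _ LIMSEQ_inverse_real_of_nat]) (use le in auto)
    thus ?thesis by (simp add: LIM_zero_iff)
  qed
  hence "Q \<longlonglongrightarrow> q" by (simp add: tendsto_fun_iff)
  hence "\<forall>\<^sub>F m in sequentially. Q m \<in> T" using T by (rule topological_tendstoD)
  thus False using Q(2) by (auto simp: eventually_sequentially)
qed

context haar
begin

section \<open>The random Gram matrix: membership, measurability, analyticity\<close>

lemma pmat_Qpi: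
  assumes F: "suffix_closed S F" and X: "\<forall>s\<in>S. X s \<in> unitary_set n" and ab: "a \<in> F \<times> {..<k}" "b \<in> F \<times> {..<k}"
  shows "pmat (Qpi n k V F X) a b = cip n (orbit n X (\<lambda>i l. V l i) a) (orbit n X (\<lambda>i l. V l i) b)"
proof -
  have "F \<subseteq> free_group S" using F by (simp add: suffix_closed_def)
  from Qpi_eq_gram[OF X this] ab show ?thesis by (auto simp: pmat_def orbit_def)
qed

lemma Qpi_in_Su:
  assumes F: "suffix_closed S F" and X: "\<forall>s\<in>S. X s \<in> unitary_set n" and V: "V \<in> Ukn k n"
  shows "Qpi n k V F X \<in> Su k F"
  unfolding Su_def
proof (intro CollectI conjI allI impI ballI)
  show "psd_block k F (Qpi n k V F X)"
    unfolding psd_block_iff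
    using gram_psd[of "F \<times> {..<k}" n "orbit n X (\<lambda>i l. V l i)"] pmat_Qpi[OF F X]
    by (subst psd_cong[of _ _ "\<lambda>a b. cip n (orbit n X (\<lambda>i l. V l i) a) (orbit n X (\<lambda>i l. V l i) b)"]) auto
next
  fix g i j assume g: "g \<in> F" and i: "i < k" and j: "j < k"
  have ru: "rep n X g \<in> unitary_set n" by (rule rep_unitary[OF X suffix_closed_letters[OF F g]])
  have "Qpi n k V F X g g i j = pmat (Qpi n k V F X) (g, i) (g, j)" by (simp add: pmat_def)
  also have "\<dots> = cip n (\<lambda>l. V l i) (\<lambda>l. V l j)"
    using g i j by (subst pmat_Qpi[OF F X]) (auto simp: orbit_def cip_mv_unitary[OF ru])
  finally show "Qpi n k V F X g g i j = (if i = j then 1 else 0)" using Ukn_cip[OF V i j] by simp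
qed (auto simp: Qpi_def fun_eq_iff)

lemma near_Qpi:
  assumes F: "suffix_closed S F" and X: "\<forall>s\<in>S. X s \<in> unitary_set n"
  shows "near n (F \<times> {..<k}) (pmat q) t X (\<lambda>i l. V l i) \<longleftrightarrow>
    (\<forall>g\<in>F. \<forall>h\<in>F. \<forall>i<k. \<forall>j<k. cmod (Qpi n k V F X g h i j - q g h i j) < t)"
proof -
  have "near n (F \<times> {..<k}) (pmat q) t X (\<lambda>i l. V l i) \<longleftrightarrow>
    (\<forall>a\<in>F \<times> {..<k}. \<forall>b\<in>F \<times> {..<k}. cmod (pmat (Qpi n k V F X) a b - pmat q a b) < t)"
    unfolding near_def using pmat_Qpi[OF F X, of _ k _ V] by (intro ball_cong refl) simp
  thus ?thesis by (auto simp: pmat_def)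
qed

lemma measurable_Qpi_entry:
  assumes F: "suffix_closed S F"
  shows "(\<lambda>X. Qpi n k V F X g h i j) \<in> borel_measurable (randrep S)"
proof (cases "g \<in> F \<and> h \<in> F \<and> i < k \<and> j < k")
  case True
  let ?w = "fg_mult (fg_inv g) h"
  have "fst ` set ?w \<subseteq> S"
  proof -
    have "fst ` set ?w \<subseteq> fst ` set (fg_inv g @ h)" unfolding fg_mult_def by (rule reduce_letters)
    thus ?thesis using suffix_closed_letters[OF F] True by (auto simp: image_Un fg_inv_letters)
  qed
  hence "(\<lambda>X. rep n X ?w) \<in> borel_measurable (randrep S)"
    by (intro measurable_rep) auto
  hence "(\<lambda>X. rep n X ?w a b) \<in> borel_measurable (randrep S)" for a b
    by (rule measurable_entry[OF measurable_entry])
  hence "(\<lambda>X. cnj (V a i) * rep n X ?w a b * V b j) \<in> borel_measurable (randrep S)" for a b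
    by (rule borel_measurable_times[OF borel_measurable_times[OF borel_measurable_const] borel_measurable_const])
  hence "(\<lambda>X. \<Sum>a<n. \<Sum>b<n. cnj (V a i) * rep n X ?w a b * V b j) \<in> borel_measurable (randrep S)"
    by (rule borel_measurable_sum[OF borel_measurable_sum])
  thus ?thesis using True unfolding Qpi_def by (simp only: if_True simp_thms)
qed (auto simp: Qpi_def)

text \<open>The letters may form an uncountable type, where measurability of all coordinates does
  not give Borel measurability into \<open>'s bmat\<close>. The event is therefore pulled back
  through a copy indexed by natural numbers: \<open>\<Psi>\<close> is continuous, and
  \<open>A\<close> is measurable coordinate by coordinate.\<close>

lemma Qpi_event_sets:
  assumes F: "suffix_closed S F" and W: "openin (top_of_set (Su k F)) W"
  shows "{X \<in> space (randrep S). Qpi n k V F X \<in> W} \<in> sets (randrep S)"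
proof -
  have "finite F" using F by (simp add: suffix_closed_def)
  then obtain e :: "'a word \<Rightarrow> nat" where e: "inj_on e F" using finite_imp_inj_to_nat_seg by blast
  define d where "d = the_inv_into F e"
  have d: "d (e g) = g" if "g \<in> F" for g using e that by (simp add: d_def the_inv_into_f_f)
  define \<Psi> :: "(nat \<Rightarrow> nat \<Rightarrow> nat \<Rightarrow> nat \<Rightarrow> complex) \<Rightarrow> 'a bmat" where
    "\<Psi> A = (\<lambda>g h i j. if g \<in> F \<and> h \<in> F \<and> i < k \<and> j < k then A (e g) (e h) i j else 0)" for A
  have cont: "continuous_on UNIV \<Psi>"
  proof (rule continuous_on_coordinatewise_then_product, rule continuous_on_coordinatewise_then_product,
      rule continuous_on_coordinatewise_then_product, rule continuous_on_coordinatewise_then_product)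
    fix g h i j
    have "continuous_on UNIV (\<lambda>A :: nat \<Rightarrow> nat \<Rightarrow> nat \<Rightarrow> nat \<Rightarrow> complex. A (e g) (e h) i j)"
      by (rule continuous_on_product_then_coordinatewise[OF continuous_on_product_then_coordinatewise[OF continuous_on_product_then_coordinatewise[OF
        continuous_on_product_then_coordinatewise[OF continuous_on_id]]]])
    thus "continuous_on UNIV (\<lambda>A. \<Psi> A g h i j)"
      unfolding \<Psi>_def by (cases "g \<in> F \<and> h \<in> F \<and> i < k \<and> j < k") (simp_all only: if_True if_False continuous_on_const simp_thms)
  qed
  define A where "A X = (\<lambda>a b i j. Qpi n k V F X (d a) (d b) i j)" for X
  have Ae: "(\<lambda>X. A X a b i j) \<in> borel_measurable (randrep S)" for a b i j
    unfolding A_def by (rule measurable_Qpi_entry[OF F])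
  have A: "A \<in> borel_measurable (randrep S)"
    by (rule measurable_coordinatewise_then_product, rule measurable_coordinatewise_then_product,
        rule measurable_coordinatewise_then_product, rule measurable_coordinatewise_then_product, rule Ae)
  have \<Psi>A: "\<Psi> (A X) = Qpi n k V F X" for X
    by (auto simp: \<Psi>_def A_def d Qpi_def fun_eq_iff)
  obtain T where T: "open T" "W = Su k F \<inter> T" using W by (auto simp: openin_open)
  have c: "closed (\<Psi> -` Su k F)"
    by (rule cont[unfolded continuous_on_closed_vimage[OF closed_UNIV] Int_UNIV_right, rule_format, OF closed_Su])
  have o: "open (\<Psi> -` T)"
    by (rule cont[unfolded continuous_on_open_vimage[OF open_UNIV] Int_UNIV_right, rule_format, OF T(1)])
  have "\<Psi> -` W \<in> sets borel"
    unfolding T(2) vimage_Int by (rule sets.Int[OF borel_closed[OF c] borel_open[OF o]])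
  from measurable_sets[OF A this] have "A -` (\<Psi> -` W) \<inter> space (randrep S) \<in> sets (randrep S)" .
  also have "A -` (\<Psi> -` W) \<inter> space (randrep S) = {X \<in> space (randrep S). Qpi n k V F X \<in> W}"
  proof (rule set_eqI)
    fix X
    show "X \<in> A -` (\<Psi> -` W) \<inter> space (randrep S) \<longleftrightarrow> X \<in> {X \<in> space (randrep S). Qpi n k V F X \<in> W}"
      unfolding Int_iff vimage_eq mem_Collect_eq \<Psi>A by (rule conj_commute)
  qed
  finally show ?thesis .
qed

lemma measurable_bdet_Qpi:
  assumes "suffix_closed S F"
  shows "(\<lambda>X. bdet k F (Qpi n k V F X)) \<in> borel_measurable (randrep S)"
proof -
  have "(\<lambda>X. pmat (Qpi n k V F X) a b) \<in> borel_measurable (randrep S)" for a b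
    unfolding pmat_def by (rule measurable_Qpi_entry[OF assms])
  hence "(\<lambda>X. c * (\<Prod>a\<in>J. pmat (Qpi n k V F X) a (p a))) \<in> borel_measurable (randrep S)"
    for c :: complex and p :: "'a word \<times> nat \<Rightarrow> 'a word \<times> nat" and J
    by (rule borel_measurable_times[OF borel_measurable_const borel_measurable_prod])
  thus ?thesis
    unfolding bdet_pmat det_on_def by (rule borel_measurable_sum)
qed

text \<open>Conjugated entries are assumed analytic as well, since inverse letters enter through
  adjoints.\<close>

lemma entire_rep:
  assumes Z: "\<And>s i j. s \<in> S \<Longrightarrow> entire_on_reals (\<lambda>t. Z t s i j)" "\<And>s i j. s \<in> S \<Longrightarrow> entire_on_reals (\<lambda>t. cnj (Z t s i j))"
    and w: "fst ` set w \<subseteq> S"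
  shows "entire_on_reals (\<lambda>t. rep n (Z t) w i j)"
  using w
proof (induction w arbitrary: i)
  case Nil
  show ?case by (simp add: entire_const)
next
  case (Cons x w)
  obtain s b where x: "x = (s, b)" by force
  have s: "s \<in> S" using Cons.prems x by simp
  have 1: "entire_on_reals (\<lambda>t. (if b then adj (Z t s) else Z t s) i l)" for l
    using Z[OF s] by (cases b) (simp_all add: adj_def)
  have 2: "entire_on_reals (\<lambda>t. rep n (Z t) w l j)" for l
    using Cons by auto
  show ?case unfolding x rep.simps mmul_def by (intro entire_sum entire_mult 1 2)
qed

lemma entire_bdet_Qpi:
  assumes F: "suffix_closed S F"
  shows "entire_on_reals (\<lambda>t. bdet k F (Qpi n k V F (act S (one_at s (creflect n v (cis t))) X)))"
proof -
  let ?Z = "\<lambda>t. act S (one_at s (creflect n v (cis t))) X"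
  have c1: "entire_on_reals (\<lambda>t. creflect n v (cis t) i j)" for i j
  proof -
    have "entire_on_reals (\<lambda>t. (if i = j then 1 else 0) + (cis t + - 1) * (v i * cnj (v j)))"
      by (intro entire_add entire_mult entire_const entire_cis)
    thus ?thesis by (cases "i < n \<and> j < n") (auto simp: creflect_def entire_const mult.assoc)
  qed
  have c2: "entire_on_reals (\<lambda>t. cnj (creflect n v (cis t) i j))" for i j
  proof -
    have "entire_on_reals (\<lambda>t. (if i = j then 1 else 0) + (cis (- t) + - 1) * (cnj (v i) * v j))"
      by (intro entire_add entire_mult entire_const entire_cis)
    moreover have "cnj (creflect n v (cis t) i j) = (if i = j then 1 else 0) + (cis (- t) + - 1) * (cnj (v i) * v j)"
      if "i < n" "j < n" for t
      using that by (simp add: creflect_def cis_cnj mult.assoc)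
    ultimately show ?thesis by (cases "i < n \<and> j < n") (auto simp: creflect_def entire_const)
  qed
  have Z1: "entire_on_reals (\<lambda>t. ?Z t s' i j)" if "s' \<in> S" for s' i j
  proof (cases "s' = s")
    case True
    show ?thesis using that True
      by (simp add: act_def one_at_def mmul_def) (intro entire_sum entire_mult c1 entire_const)
  qed (use that in \<open>simp add: act_def one_at_def entire_const\<close>)
  have Z2: "entire_on_reals (\<lambda>t. cnj (?Z t s' i j))" if "s' \<in> S" for s' i j
  proof (cases "s' = s")
    case True
    show ?thesis using that True
      by (simp add: act_def one_at_def mmul_def) (intro entire_sum entire_mult c2 entire_const)
  qed (use that in \<open>simp add: act_def one_at_def entire_const\<close>)
  have "entire_on_reals (\<lambda>t. Qpi n k V F (?Z t) g h i j)" for g h i j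
  proof (cases "g \<in> F \<and> h \<in> F \<and> i < k \<and> j < k")
    case True
    have "fst ` set (fg_mult (fg_inv g) h) \<subseteq> fst ` set (fg_inv g @ h)" unfolding fg_mult_def by (rule reduce_letters)
    also have "\<dots> \<subseteq> S" using suffix_closed_letters[OF F] True by (auto simp: image_Un fg_inv_letters)
    finally have "entire_on_reals (\<lambda>t. rep n (?Z t) (fg_mult (fg_inv g) h) a b)" for a b
      by (intro entire_rep[OF Z1 Z2])
    hence "entire_on_reals (\<lambda>t. \<Sum>a<n. \<Sum>b<n. cnj (V a i) * rep n (?Z t) (fg_mult (fg_inv g) h) a b * V b j)"
      by (intro entire_sum entire_mult entire_const)
    thus ?thesis using True by (simp add: Qpi_def)
  qed (auto simp: Qpi_def entire_const)
  thus ?thesis unfolding bdet_pmat det_on_def pmat_def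
    by (intro entire_sum entire_mult entire_const entire_prod)
qed

lemma bdet_Qpi_tendsto:
  assumes F: "suffix_closed S F" and Z: "\<And>s i j. s \<in> S \<Longrightarrow> (\<lambda>m. Z m s i j) \<longlonglongrightarrow> W s i j"
  shows "(\<lambda>m. bdet k F (Qpi n k V F (Z m))) \<longlonglongrightarrow> bdet k F (Qpi n k V F W)"
proof -
  have r: "(\<lambda>m. rep n (Z m) w i j) \<longlonglongrightarrow> rep n W w i j" if "fst ` set w \<subseteq> S" for w i j
    using that
  proof (induction w arbitrary: i)
    case (Cons x w)
    obtain s b where x: "x = (s, b)" by force
    have s: "s \<in> S" using Cons.prems x by simp
    have 1: "(\<lambda>m. (if b then adj (Z m s) else Z m s) i l) \<longlonglongrightarrow> (if b then adj (W s) else W s) i l" for l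
      using Z[OF s] by (cases b) (auto simp: adj_def intro: tendsto_cnj)
    have 2: "(\<lambda>m. rep n (Z m) w l j) \<longlonglongrightarrow> rep n W w l j" for l
      using Cons by auto
    show ?case unfolding x rep.simps mmul_def by (intro tendsto_sum tendsto_mult 1 2)
  qed simp
  have "(\<lambda>m. Qpi n k V F (Z m) g h i j) \<longlonglongrightarrow> Qpi n k V F W g h i j" for g h i j
  proof (cases "g \<in> F \<and> h \<in> F \<and> i < k \<and> j < k")
    case True
    have "fst ` set (fg_mult (fg_inv g) h) \<subseteq> fst ` set (fg_inv g @ h)" unfolding fg_mult_def by (rule reduce_letters)
    also have "\<dots> \<subseteq> S" using suffix_closed_letters[OF F] True by (auto simp: image_Un fg_inv_letters)
    finally have "(\<lambda>m. \<Sum>a<n. \<Sum>b<n. cnj (V a i) * rep n (Z m) (fg_mult (fg_inv g) h) a b * V b j)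
      \<longlonglongrightarrow> (\<Sum>a<n. \<Sum>b<n. cnj (V a i) * rep n W (fg_mult (fg_inv g) h) a b * V b j)"
      by (intro tendsto_sum tendsto_mult tendsto_const r)
    thus ?thesis using True by (simp add: Qpi_def)
  qed (auto simp: Qpi_def)
  thus ?thesis unfolding bdet_pmat by (intro det_on_tendsto) (simp add: pmat_def)
qed

text \<open>Positive probability serves to find one point with nonsingular Gram matrix; analyticity
  spreads nonvanishing to almost every point.\<close>

lemma AE_nonsingular:
  assumes S: "finite S" and F: "suffix_closed S F"
    and pos: "0 < pnear S (F \<times> {..<k}) (\<lambda>a b. if a = b then 1 else 0) t (\<lambda>i l. V l i)"
    and t: "\<And>r. (\<forall>i\<in>F \<times> {..<k}. \<forall>j\<in>F \<times> {..<k}. cmod (r i j - (if i = j then 1 else 0)) < t) \<Longrightarrow> det_on (F \<times> {..<k}) r \<noteq> 0"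
  shows "AE X in randrep S. bdet k F (Qpi n k V F X) \<noteq> 0"
proof -
  let ?J = "F \<times> {..<k}"
  let ?near = "\<lambda>X. near n ?J (\<lambda>a b. if a = b then 1 else 0) t X (\<lambda>i l. V l i)"
  have "\<exists>X. (\<forall>s\<in>S. X s \<in> unitary_set n) \<and> ?near X"
  proof (rule ccontr)
    assume no: "\<not> ?thesis"
    have "AE X in randrep S. \<not> ?near X"
      using AE_randrep_unitary[OF S] by eventually_elim (use no in auto)
    hence "emeasure (randrep S) {X \<in> space (randrep S). ?near X} = 0"
      using AE_iff_measurable[OF sets_near[OF F], where P = "\<lambda>X. \<not> ?near X"] by simp
    thus False using pos by (simp add: pnear_def)
  qed
  then obtain W where W: "\<forall>s\<in>S. W s \<in> unitary_set n" "?near W" by blast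
  have "bdet k F (Qpi n k V F W) \<noteq> 0"
    unfolding bdet_pmat
    by (rule t) (use W(2) pmat_Qpi[OF F W(1), of _ k _ V] in \<open>auto simp: near_def\<close>)
  thus ?thesis
    using W(1) by (intro AE_nonzero[OF S measurable_bdet_Qpi[OF F] entire_bdet_Qpi[OF F] bdet_Qpi_tendsto[OF F], where W = W]) auto
qed

end

section \<open>Large deviations of the Gram matrix\<close>

context haar
begin

lemma pnear_le_event:
  assumes S: "finite S" and F: "suffix_closed S F" and V: "V \<in> Ukn k n"
    and W: "openin (top_of_set (Su k F)) W"
    and sub: "\<And>Q. Q \<in> Su k F \<Longrightarrow> \<forall>g\<in>F. \<forall>h\<in>F. \<forall>i<k. \<forall>j<k. cmod (Q g h i j - q g h i j) < t \<Longrightarrow> Q \<in> W"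
  shows "pnear S (F \<times> {..<k}) (pmat q) t (\<lambda>i l. V l i) \<le>
    ennreal (measure (rand_rep S \<mu>) {X \<in> space (rand_rep S \<mu>). Qpi n k V F X \<in> W})"
proof -
  interpret P: prob_space "randrep S" by (rule prob_space_randrep)
  have "AE X in randrep S. X \<in> {X \<in> space (randrep S). near n (F \<times> {..<k}) (pmat q) t X (\<lambda>i l. V l i)} \<longrightarrow>
      X \<in> {X \<in> space (randrep S). Qpi n k V F X \<in> W}"
    using AE_randrep_unitary[OF S]
  proof eventually_elim
    case (elim X)
    show ?case
      unfolding mem_Collect_eq near_Qpi[OF F elim]
      using sub[OF Qpi_in_Su[OF F elim V]] by iprover
  qed
  from emeasure_mono_AE[OF this Qpi_event_sets[OF F W]]
  show ?thesis by (simp only: pnear_def rand_rep_def P.emeasure_eq_measure)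
qed

text \<open>Passing to the subtree \<open>G\<close> only enlarges the event. This is how the
  probability is bounded when \<open>q\<close> is singular.\<close>

lemma event_le_pnear:
  assumes S: "finite S" and F: "suffix_closed S F" and G: "suffix_closed S G" "G \<subseteq> F"
    and sub: "\<And>Q. Q \<in> W \<Longrightarrow> \<forall>g\<in>F. \<forall>h\<in>F. \<forall>i<k. \<forall>j<k. cmod (Q g h i j - q g h i j) < t"
  shows "ennreal (measure (rand_rep S \<mu>) {X \<in> space (rand_rep S \<mu>). Qpi n k V F X \<in> W})
    \<le> pnear S (G \<times> {..<k}) (pmat q) t (\<lambda>i l. V l i)"
proof -
  interpret P: prob_space "randrep S" by (rule prob_space_randrep)
  have e: "Qpi n k V G X g h i j = Qpi n k V F X g h i j" if "g \<in> G" "h \<in> G" "i < k" "j < k" for X g h i j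
  proof -
    have "g \<in> F" "h \<in> F" using that G by auto
    thus ?thesis using that unfolding Qpi_def by (simp only: if_True simp_thms)
  qed
  have "AE X in randrep S. X \<in> {X \<in> space (randrep S). Qpi n k V F X \<in> W} \<longrightarrow>
      X \<in> {X \<in> space (randrep S). near n (G \<times> {..<k}) (pmat q) t X (\<lambda>i l. V l i)}"
    using AE_randrep_unitary[OF S]
  proof eventually_elim
    case (elim X)
    have "\<forall>g\<in>G. \<forall>h\<in>G. \<forall>i<k. \<forall>j<k. cmod (Qpi n k V G X g h i j - q g h i j) < t" if "Qpi n k V F X \<in> W"
    proof (intro ballI allI impI)
      fix g h i j assume *: "g \<in> G" "h \<in> G" "i < k" "j < k"
      have "cmod (Qpi n k V F X g h i j - q g h i j) < t"
        using * G(2) by (intro sub[OF that, rule_format]) auto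
      thus "cmod (Qpi n k V G X g h i j - q g h i j) < t" by (simp only: e[OF *])
    qed
    thus ?case
      unfolding mem_Collect_eq near_Qpi[OF G(1) elim] by iprover
  qed
  from emeasure_mono_AE[OF this sets_near[OF G(1)]]
  show ?thesis by (simp only: pnear_def rand_rep_def P.emeasure_eq_measure)
qed

end

section \<open>From exponential bounds to logarithmic rates\<close>

text \<open>The error term is the actual deficit \<open>h * real n - ln (m n)\<close>, cut off at 0.
  The bounds for all \<open>c\<close> below \<open>exp h\<close> say that it is at most
  \<open>\<epsilon> * n\<close> eventually, for each positive \<open>\<epsilon>\<close>.\<close>

lemma elog_lower_rate:
  assumes "\<And>c. 0 < c \<Longrightarrow> c < exp h \<Longrightarrow> \<forall>\<^sub>F n in sequentially. ennreal (c ^ n) \<le> ennreal (m n)"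
    and m: "\<And>n. 0 \<le> m n"
  shows "\<exists>r. r \<in> o(\<lambda>n. real n) \<and> (\<forall>\<^sub>F n in sequentially. ereal h * ereal (real n) - ereal (r n) \<le> elog (m n))"
proof -
  define r where "r n = max 0 (h * real n - ln (m n))" for n
  have ev: "\<forall>\<^sub>F n in sequentially. 0 < m n \<and> (h - \<epsilon>) * real n \<le> ln (m n)" if "0 < \<epsilon>" for \<epsilon>
  proof -
    have "\<forall>\<^sub>F n in sequentially. ennreal (exp (h - \<epsilon>) ^ n) \<le> ennreal (m n)"
      by (rule assms(1)) (use that in auto)
    thus ?thesis
    proof eventually_elim
      case (elim n)
      hence le: "exp ((h - \<epsilon>) * real n) \<le> m n" using m[of n]
        by (simp add: exp_of_nat2_mult[symmetric] exp_of_nat_mult[symmetric] mult.commute)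
      hence "0 < m n" by (rule less_le_trans[OF exp_gt_zero])
      thus ?case using le by (simp add: ln_ge_iff)
    qed
  qed
  have "r \<in> o(\<lambda>n. real n)"
  proof (rule landau_o.smallI)
    fix \<epsilon> :: real assume "0 < \<epsilon>"
    from ev[OF this] show "\<forall>\<^sub>F n in sequentially. norm (r n) \<le> \<epsilon> * norm (real n)"
    proof eventually_elim
      case (elim n)
      thus ?case using \<open>0 < \<epsilon>\<close> by (simp add: r_def algebra_simps)
    qed
  qed
  moreover have "\<forall>\<^sub>F n in sequentially. ereal h * ereal (real n) - ereal (r n) \<le> elog (m n)"
    using ev[OF zero_less_one]
  proof eventually_elim
    case (elim n)
    have "h * real n - r n \<le> ln (m n)" by (simp add: r_def)
    thus ?case using elim by (simp add: elog_def)
  qed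
  ultimately show ?thesis by blast
qed

lemma elog_upper_rate:
  assumes "ennreal m \<le> ennreal (exp a ^ n)"
  shows "elog m \<le> ereal (a * real n)"
proof (cases "0 < m")
  case True
  hence "m \<le> exp (a * real n)"
    using assms by (simp add: exp_of_nat_mult[symmetric] mult.commute ennreal_le_iff)
  hence "ln m \<le> a * real n" using True by (metis ln_exp ln_le_cancel_iff exp_gt_zero)
  thus ?thesis using True by (simp add: elog_def)
qed (simp add: elog_def)

lemma openin_entrywise_ball:
  fixes q :: "'s bmat"
  assumes "finite F" "q \<in> Su k F" "0 < t"
  defines "W \<equiv> {Q \<in> Su k F. \<forall>g\<in>F. \<forall>h\<in>F. \<forall>i<k. \<forall>j<k. cmod (Q g h i j - q g h i j) < t}"
  shows "openin (top_of_set (Su k F)) W" "q \<in> W"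
proof -
  let ?T = "\<Inter>(g, h, i, j)\<in>F \<times> F \<times> {..<k} \<times> {..<k}. {Q :: 's bmat. cmod (Q g h i j - q g h i j) < t}"
  have "open ?T"
  proof (intro open_INT ballI)
    fix x assume "x \<in> F \<times> F \<times> {..<k} \<times> {..<k}"
    have "open {Q :: 's bmat. cmod (Q g h i j - q g h i j) < t}" for g h i j
      by (intro open_Collect_less continuous_intros entry_continuous)
    thus "open (case x of (g, h, i, j) \<Rightarrow> {Q :: 's bmat. cmod (Q g h i j - q g h i j) < t})"
      by (simp only: split: prod.split) iprover
  qed (use assms in simp)
  moreover have "W = Su k F \<inter> ?T"
    unfolding W_def by (intro set_eqI) (simp only: Int_iff mem_Collect_eq INT_iff split_paired_Ball_Sigma prod.case Ball_def lessThan_iff mem_Sigma_iff split_paired_All, blast)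
  ultimately show "openin (top_of_set (Su k F)) W" by (simp only: openin_open_Int)
  show "q \<in> W" using assms by (simp add: W_def)
qed

theorem theoremB:
  fixes S :: "'s set" and k :: nat and V :: "nat \<Rightarrow> cmat"
    and H :: "nat \<Rightarrow> cmat measure" and F :: "'s word set" and q :: "'s bmat"
  assumes "finite S" and "0 < k"
    and "\<forall>n\<ge>k. V n \<in> Ukn k n"
    and "\<forall>n. is_haar n (H n)"
    and "grounded S F"
    and "q \<in> Su k F"
  shows "(\<forall>\<^sub>F n in sequentially.
            AE X in rand_rep S (H n). bdet k F (Qpi n k (V n) F X) \<noteq> 0)
    \<and> (\<forall>W. openin (top_of_set (Su k F)) W \<and> q \<in> W \<longrightarrow>
         (\<exists>r. r \<in> o(\<lambda>n. real n) \<and>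
            (\<forall>\<^sub>F n in sequentially.
               elog (measure (rand_rep S (H n)) {X \<in> space (rand_rep S (H n)). Qpi n k (V n) F X \<in> W})
                 \<ge> hF S k F q * ereal (real n) - ereal (r n))))
    \<and> (\<forall>a::real. ereal a > hF S k F q \<longrightarrow>
         (\<exists>W. openin (top_of_set (Su k F)) W \<and> q \<in> W \<and>
            (\<exists>r. r \<in> o(\<lambda>n. real n) \<and>
              (\<forall>\<^sub>F n in sequentially.
                 elog (measure (rand_rep S (H n)) {X \<in> space (rand_rep S (H n)). Qpi n k (V n) F X \<in> W})
                   \<le> ereal (a * real n + r n)))))"
    (is "?A \<and> ?B \<and> ?C")
proof -
  note S = assms(1) and q = assms(6)
  have V: "V n \<in> Ukn k n" if "k \<le> n" for n using assms(3) that by blast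
  have H: "is_haar n (H n)" for n using assms(4) by blast
  have haar: "haar n (H n)" for n by (rule haar.intro[OF H])
  have F: "suffix_closed S F" by (rule grounded_suffix_closed[OF assms(5)])
  have fin: "finite F" and eF: "[] \<in> F" using F by (simp_all add: suffix_closed_def)
  let ?J = "F \<times> {..<k}" and ?K = "\<lambda>s. edge_targets S F s \<times> {..<k}"
  let ?q = "pmat q" and ?id = "\<lambda>a b :: 's word \<times> nat. if a = b then 1 else 0 :: complex"
  let ?m = "\<lambda>W n. measure (rand_rep S (H n)) {X \<in> space (rand_rep S (H n)). Qpi n k (V n) F X \<in> W}"
  have finJ: "finite ?J" using fin by simp
  have KJ: "?K s \<subseteq> ?J" for s by (auto simp: edge_targets_def)
  have finK: "finite (?K s)" for s by (rule finite_subset[OF KJ finJ])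
  have psdJ: "psd ?J ?q"
  proof -
    have "psd_block k F q" using q unfolding Su_def by (elim CollectE conjE)
    thus ?thesis by (simp only: psd_block_iff)
  qed
  have diag: "?q a a = 1" if "a \<in> ?J" for a
    using Su_diag[OF q, of "fst a" "snd a" "snd a"] that by (simp add: mem_Times_iff)
  have base: "?q ([], i) ([], j) = (if i = j then 1 else 0)" if "i < k" "j < k" for i j
    by (rule Su_diag[OF q eF that])
  note toep = Su_toeplitz[OF F q]

  have a: ?A
  proof -
    have 1: "det_on J ?id = 1" "psd J ?id" "pd J ?id" if "finite J" for J
      using that by (auto intro!: det_on_identity pd_identity)
    obtain t where t: "0 < t" "\<And>r. (\<forall>i\<in>?J. \<forall>j\<in>?J. cmod (r i j - ?id i j) < t) \<Longrightarrow> cmod (det_on ?J r - det_on ?J ?id) < 1"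
      using det_on_perturb[OF zero_less_one, of ?J ?id] by blast
    have ns: "det_on ?J r \<noteq> 0" if "\<forall>i\<in>?J. \<forall>j\<in>?J. cmod (r i j - ?id i j) < t" for r
      using t(2)[OF that] unfolding 1(1)[OF finJ] by auto
    have inj: "?id (red_cons (s, True) (fst a), snd a) (red_cons (s, True) (fst b), snd b) = ?id a b"
      if ab: "a \<in> ?K s" "b \<in> ?K s" for s a b
    proof -
      have "reduced (fst a)" "reduced (fst b)"
        using F ab by (auto simp: suffix_closed_def free_group_def edge_targets_def)
      hence "red_cons (s, True) (fst a) = red_cons (s, True) (fst b) \<longleftrightarrow> fst a = fst b"
        using red_cons_inverse[of _ s False] by (metis (full_types))
      thus ?thesis by (simp add: prod_eq_iff)
    qed
    \<comment> \<open>Orthonormal orbits realize the identity matrix, for which all determinants are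
      1. The rate is therefore 1, and any \<open>c < 1\<close> gives positive probability of a
      nonsingular neighbourhood.\<close>
    have "\<forall>\<^sub>F n in sequentially. ennreal ((1/2) ^ n) \<le> haar.pnear n (H n) S ?J ?id t (\<lambda>i l. V n l i)"
    proof (rule lower_rate[OF S F 1(2,3)[OF finJ] _ _ _ H V])
      show "1 / 2 < Re (det_on ?J ?id) / (\<Prod>s\<in>S. Re (det_on (?K s) ?id))"
        unfolding 1(1)[OF finJ] 1(1)[OF finK] by simp
    qed (use inj t(1) in simp_all)
    thus ?A
    proof eventually_elim
      case (elim n)
      interpret haar n "H n" by (rule haar)
      have "0 < ennreal ((1/2) ^ n)" by (simp add: ennreal_zero_less_divide)
      hence "0 < pnear S ?J ?id t (\<lambda>i l. V n l i)" using elim by (rule less_le_trans)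
      from AE_nonsingular[OF S F this ns] show ?case by (simp only: rand_rep_def)
    qed
  qed

  define D where "D = Re (det_on ?J ?q)"
  define P where "P = (\<Prod>s\<in>S. Re (det_on (?K s) ?q))"
  define h where "h = ln D - (\<Sum>s\<in>S. ln (Re (det_on (?K s) ?q)))"
  have hF: "hF S k F q = (if pd ?J ?q then ereal h else - \<infinity>)"
    unfolding hF_def bdet_pmat edge_targets_eq[OF F] pd_iff_det[OF finJ psdJ] h_def D_def by simp
  have exp_h: "exp h = D / P" if "pd ?J ?q"
  proof -
    have Ds: "0 < Re (det_on (?K s) ?q)" for s
      by (rule det_on_pos[OF finK psd_subset[OF psdJ KJ finJ] pd_subset[OF that KJ finJ]])
    have "0 < D" unfolding D_def by (rule det_on_pos[OF finJ psdJ that])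
    thus ?thesis using Ds S by (simp add: h_def P_def exp_diff exp_sum)
  qed

  have b: ?B
  proof (intro allI impI, elim conjE)
    fix W assume W: "openin (top_of_set (Su k F)) W" and qW: "q \<in> W"
    show "\<exists>r. r \<in> o(\<lambda>n. real n) \<and>
      (\<forall>\<^sub>F n in sequentially. hF S k F q * ereal (real n) - ereal (r n) \<le> elog (?m W n))"
    proof (cases "pd ?J ?q")
      case False
      \<comment> \<open>In \<open>ereal\<close> the product of -\<infinity> and 0 is 0, hence the
        restriction to positive \<open>n\<close>.\<close>
      have "\<forall>\<^sub>F n in sequentially. hF S k F q * ereal (real n) - ereal 0 \<le> elog (?m W n)"
        using eventually_gt_at_top[of 0] by eventually_elim (use False in \<open>simp add: hF\<close>)
      thus ?thesis by (intro exI[of _ "\<lambda>_. 0"]) simp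
    next
      case True
      obtain T where T: "open T" "W = Su k F \<inter> T" using W unfolding openin_open by blast
      have "q \<in> T" using qW T by blast
      from neighbourhood_entries[OF T(1) this q] obtain t where t: "0 < t"
        "\<And>Q. Q \<in> Su k F \<Longrightarrow> \<forall>g\<in>F. \<forall>h\<in>F. \<forall>i<k. \<forall>j<k. cmod (Q g h i j - q g h i j) < t \<Longrightarrow> Q \<in> T" by blast
      have "\<forall>\<^sub>F n in sequentially. ennreal (c ^ n) \<le> ennreal (?m W n)" if c: "0 < c" "c < exp h" for c
      proof -
        have "\<forall>\<^sub>F n in sequentially. ennreal (c ^ n) \<le> haar.pnear n (H n) S ?J ?q t (\<lambda>i l. V n l i)"
          by (rule lower_rate[OF S F psdJ True diag base toep H V c(1) c(2)[unfolded exp_h[OF True] D_def P_def] t(1)])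
        thus ?thesis using eventually_ge_at_top[of k]
        proof eventually_elim
          case (elim n)
          have "haar.pnear n (H n) S ?J ?q t (\<lambda>i l. V n l i) \<le> ennreal (?m W n)"
            by (rule haar.pnear_le_event[OF haar S F V[OF elim(2)] W]) (use t(2) T(2) in blast)
          with elim(1) show ?case by (rule order_trans)
        qed
      qed
      from elog_lower_rate[OF this measure_nonneg] show ?thesis unfolding hF using True by (simp only: if_True)
    qed
  qed

  have c: ?C
  proof (intro allI impI)
    fix a :: real assume a: "hF S k F q < ereal a"
    \<comment> \<open>For nonsingular \<open>q\<close> this is \<open>F\<close> itself. Otherwise a
      minimal singular subtree has determinant 0 and positive edge determinants, so the quotient is
      0 and lies below \<open>exp a\<close> for every \<open>a\<close>.\<close>
    obtain G where G: "suffix_closed S G" "G \<subseteq> F" and pdG: "\<And>s. s \<in> S \<Longrightarrow> pd (edge_targets S G s \<times> {..<k}) ?q"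
      and rate: "Re (det_on (G \<times> {..<k}) ?q) / (\<Prod>s\<in>S. Re (det_on (edge_targets S G s \<times> {..<k}) ?q)) < exp a"
    proof (cases "pd ?J ?q")
      case True
      have "h < a" using a True by (simp add: hF)
      hence "D / P < exp a" by (simp add: exp_h[OF True, symmetric])
      thus ?thesis using that[OF F subset_refl pd_subset[OF True KJ finJ]] by (simp only: D_def P_def)
    next
      case False
      obtain G where G: "suffix_closed S G" "G \<subseteq> F" "\<not> pd (G \<times> {..<k}) ?q"
        "\<And>s. s \<in> S \<Longrightarrow> pd (edge_targets S G s \<times> {..<k}) ?q"
        using minimal_singular_subtree[OF F False toep base] by blast
      have GJ: "G \<times> {..<k} \<subseteq> ?J" using G(2) by auto
      have "det_on (G \<times> {..<k}) ?q = 0"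
        using G(3) pd_iff_det[OF finite_subset[OF GJ finJ] psd_subset[OF psdJ GJ finJ]] by blast
      thus ?thesis by (intro that[OF G(1,2,4)]) simp_all
    qed
    have GJ: "G \<times> {..<k} \<subseteq> ?J" using G(2) by auto
    from upper_rate[OF S G(1) psd_subset[OF psdJ GJ finJ] pdG diag[OF subsetD[OF GJ]] base H V rate]
    obtain t where t: "0 < t" "\<forall>\<^sub>F n in sequentially. haar.pnear n (H n) S (G \<times> {..<k}) ?q t (\<lambda>i l. V n l i) \<le> ennreal (exp a ^ n)"
      by blast
    let ?W = "{Q \<in> Su k F. \<forall>g\<in>F. \<forall>h\<in>F. \<forall>i<k. \<forall>j<k. cmod (Q g h i j - q g h i j) < t}"
    from t(2) have "\<forall>\<^sub>F n in sequentially. elog (?m ?W n) \<le> ereal (a * real n + 0)"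
    proof eventually_elim
      case (elim n)
      have "ennreal (?m ?W n) \<le> haar.pnear n (H n) S (G \<times> {..<k}) ?q t (\<lambda>i l. V n l i)"
        by (rule haar.event_le_pnear[OF haar S F G]) blast
      from elog_upper_rate[OF order_trans[OF this elim]] show ?case by simp
    qed
    \<comment> \<open>The strict inequality between the rate and \<open>a\<close> has absorbed all
      subexponential factors, so the error term is 0.\<close>
    hence "\<exists>r. r \<in> o(\<lambda>n. real n) \<and> (\<forall>\<^sub>F n in sequentially. elog (?m ?W n) \<le> ereal (a * real n + r n))"
      by (intro exI[of _ "\<lambda>_. 0"]) simp
    with openin_entrywise_ball[OF fin q t(1)]
    show "\<exists>W. openin (top_of_set (Su k F)) W \<and> q \<in> W \<and> (\<exists>r. r \<in> o(\<lambda>n. real n) \<and>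
        (\<forall>\<^sub>F n in sequentially. elog (?m W n) \<le> ereal (a * real n + r n)))"
      by (intro exI[of _ ?W] conjI)
  qed

  from a b c show ?thesis by (intro conjI)
qed

end
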